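(* Let $P\in\mathbb{C}[u,u^{-1};\mathbf{v}]$, $N\in\mathbb{N}$, $s>0$ and $\tau\in\mathbb{D}(s,s)$. For each $\beta\in\{1,2,4\}$, the boosted Segal-Bargmann transform of the trace polynomial $P_N^{(\beta)}$ on $K_N^{(\beta)}$ is the trace polynomial on $K_{N,\mathbb{C}}^{(\beta)}$ given by $$\mathbf{B}_{s,\tau}^{K_N^{(\beta)}}P_N^{(\beta)}=[e^{\frac{\tau}{2}\mathcal{D}_N^{(\beta)}}P]_N^{(\beta)}.$$
   Context: Groups. $K_N^{(1)}=SO(N,\mathbb{R})$, $K_N^{(2)}=SU(N)$, $K_N^{(4)}=Sp(N)=\{A\in M_{2N}(\mathbb{C}): A^{\intercal}\Omega A=\Omega,\ A^*A=I_{2N}\}$, where $\Omega=\mathrm{diag}(\Omega_0,\dots,\Omega_0)$ ($N$ blocks), $\Omega_0=\begin{pmatrix}0&1\\-1&0\end{pmatrix}$. Complexifications $K_{N,\mathbb{C}}^{(\beta)}$: $SO(N,\mathbb{C})$, $SL(N,\mathbb{C})$, $Sp(N,\mathbb{C})=\{A\in M_{2N}(\mathbb{C}):A^{\intercal}\Omega A=\Omega\}$. Inner products on the Lie algebras: $\langle X,Y\rangle_{\mathfrak{so}(N,\mathbb{R})}=\frac N2\mathrm{Tr}(XY^* )$, $\langle X,Y\rangle_{\mathfrak{su}(N)}=N\,\mathrm{Tr}(XY^* )$, $\langle X,Y\rangle_{\mathfrak{sp}(N)}=N\,\mathrm{Tr}(XY^* )$. For $K$ one of these compact groups, $(\widetilde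 Xf)(k)=\frac{d}{dt}f(ke^{tX})|_{t=0}$ and $\Delta_K=\sum_X\widetilde X^2$ over an orthonormal basis of the Lie algebra. Segal-Bargmann transform. $\mathbb{D}(s,s)=\{\tau\in\mathbb{C}:|\tau-s|<s\}$. The heat kernel $\rho_s^K\in C^\infty(K,(0,\infty))$, $s>0$, is determined by $(e^{\frac s2\Delta_K}f)(x)=\int_Kf(xk)\rho_s^K(k)\,dk$ for $f\in L^2(K)$ ($dk$ Haar measure). It has a unique analytic continuation to a holomorphic function $\rho_{\mathbb{C}}^K:\{\tau:\mathrm{Re}\,\tau>0\}\times K_{\mathbb{C}}\to\mathbb{C}$ with $\rho^K_{\mathbb{C}}(s,x)=\rho_s^K(x)$ for $s>0$, $x\in K$. For $f\in L^2(K,\rho_s^K)$ and $z\in K_{\mathbb{C}}$, $(B_{s,\tau}^Kf)(z)=\int_K\rho_{\mathbb{C}}^K(\tau,zk^{-1})f(k)\,dk$. The boosted transform $\mathbf{B}_{s,\tau}^K$ on matrix-valued functions is $B_{s,\tau}^K$ applied entrywise. Trace polynomials. $\mathbb{C}[u,u^{-1};\mathbf{v}]$ is the algebra of polynomials in commuting variables $u,u^{-1},v_{\pm1},v_{\pm2},\dots$ (with $uu^{-1}=1$); convention $v_0=1$. Let $\mathrm{tr}=\frac1N\mathrm{Tr}$ on $M_N(\mathbb{C})$, $\widetilde{\mathrm{tr}}=\frac1{2N}\mathrm{Tr}$ on $M_{2N}(\mathbb{C})$. For $A\in K_N^{(\beta)}$ or $K_{N,\mathbb{C}}^{(\beta)}$,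 $P_N^{(\beta)}(A)=[P]_N^{(\beta)}(A)$ is obtained from $P$ by substituting $u=A$ and, for $k\neq0$, $v_k=\mathrm{tr}(A^k)$ if $\beta\in\{1,2\}$, $v_k=\widetilde{\mathrm{tr}}(A^k)$ if $\beta=4$. Operators. $\mathcal{R}^+(\sum_{k\in\mathbb{Z}}u^kq_k(\mathbf{v}))=\sum_{k\ge0}u^kq_k(\mathbf{v})$, $\mathcal{R}^-(\sum_{k\in\mathbb{Z}}u^kq_k(\mathbf{v}))=\sum_{k\le-1}u^kq_k(\mathbf{v})$, $\mathcal{M}_{u^k}P=u^kP$. Define $$\mathcal{N}=\sum_{|k|\ge1}|k|v_k\frac{\partial}{\partial v_k}+u\frac{\partial}{\partial u}(\mathcal{R}^+-\mathcal{R}^-),$$ $$\mathcal{Y}_1=\sum_{k=1}^\infty v_ku\mathcal{R}^+\frac{\partial}{\partial u}\mathcal{M}_{u^{-k}}\mathcal{R}^+-\sum_{k=-\infty}^{-1}v_ku\mathcal{R}^-\frac{\partial}{\partial u}\mathcal{M}_{u^{-k}}\mathcal{R}^-,$$ $$\mathcal{Y}_2=\sum_{k=2}^\infty\Big(\sum_{j=1}^{k-1}jv_jv_{k-j}\Big)\frac{\partial}{\partial v_k}-\sum_{k=-\infty}^{-2}\Big(\sum_{j=k+1}^{-1}jv_jv_{k-j}\Big)\frac{\partial}{\partial v_k},$$ $$\mathcal{Z}_1=\sum_{k=2}^\infty\Big(\sum_{j=1}^{k-1}(k-j)v_{k-2j}\Big)\frac{\partial}{\partial v_k}-\sum_{k=-\infty}^{-2}\Big(\sum_{j=k+1}^{-1}(k-j)v_{k-2j}\Big)\frac{\partial}{\partial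 v_k},$$ $$\mathcal{Z}_2=\sum_{k=1}^\infty u^{-k+1}\mathcal{R}^+\frac{\partial}{\partial u}\mathcal{M}_{u^{-k}}\mathcal{R}^+-\sum_{k=-\infty}^{-1}u^{-k+1}\mathcal{R}^-\frac{\partial}{\partial u}\mathcal{M}_{u^{-k}}\mathcal{R}^-,$$ $$\mathcal{K}_1=\mathcal{K}_1^+-\mathcal{K}_1^-,\quad \mathcal{K}_1^{+}=\sum_{|k|\ge1}ku^{-k+1}\frac{\partial^2}{\partial v_k\partial u},\quad \mathcal{K}_1^{-}=\sum_{|k|\ge1}ku^{k+1}\frac{\partial^2}{\partial v_k\partial u},$$ $$\mathcal{K}_2=\mathcal{K}_2^+-\mathcal{K}_2^-,\quad \mathcal{K}_2^{+}=\sum_{|j|,|k|\ge1}jkv_{k-j}\frac{\partial^2}{\partial v_j\partial v_k},\quad \mathcal{K}_2^{-}=\sum_{|j|,|k|\ge1}jkv_{k+j}\frac{\partial^2}{\partial v_j\partial v_k},$$ $$\mathcal{J}=2\sum_{|k|\ge1}kuv_k\frac{\partial^2}{\partial u\partial v_k}+\sum_{|j|,|k|\ge1}jkv_jv_k\frac{\partial^2}{\partial v_j\partial v_k}+\sum_{|k|\ge1}k^2v_k\frac{\partial}{\partial v_k}+u^2\frac{\partial^2}{\partial u^2}+u\frac{\partial}{\partial u}.$$ Set $\mathcal{L}_0=-\mathcal{N}-2\mathcal{Y}_1-2\mathcal{Y}_2$; $\mathcal{L}_1^{(1)}=\mathcal{N}+2\mathcal{Z}_1+2\mathcal{Z}_2$,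 $\mathcal{L}_2^{(1)}=2\mathcal{K}_1+\mathcal{K}_2$; $\mathcal{L}_1^{(2)}=0$, $\mathcal{L}_2^{(2)}=-2\mathcal{K}_1^--\mathcal{K}_2^-+\mathcal{J}$; $\mathcal{L}_1^{(4)}=-\frac12\mathcal{L}_1^{(1)}$, $\mathcal{L}_2^{(4)}=\frac14\mathcal{L}_2^{(1)}$; and $\mathcal{D}_N^{(\beta)}=\mathcal{L}_0+\frac1N\mathcal{L}_1^{(\beta)}+\frac1{N^2}\mathcal{L}_2^{(\beta)}$. The exponential $e^{\frac\tau2\mathcal{D}_N^{(\beta)}}$ is defined by its power series on the finite-dimensional invariant subspaces of bounded trace degree (the trace degree of $u^{k_0}\prod_jv_j^{k_j}$ being $|k_0|+\sum_j|j|k_j$). *)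

theory Defs
  imports "HOL-Analysis.Analysis" "HOL-Library.Poly_Mapping" "HOL-Library.Groups_Big_Fun"
begin

section \<open>Trace polynomials\<close>

text \<open>
  The monomial with index \<open>(a, e)\<close> is the product of \<open>u\<close> to the power \<open>a\<close> and of all
  \<open>v\<^sub>k\<close> to the power \<open>e k\<close>.  The index type of the \<open>v\<close>-variables is \<open>int\<close>; there is no variable
  \<open>v\<^sub>0\<close>, so the algebra of the paper is the carrier \<open>trace_polys\<close> below, and \<open>v 0\<close> denotes \<open>1\<close>.
\<close>

type_synonym monomial = "int \<times> (int \<Rightarrow>\<^sub>0 nat)"
type_synonym trace_poly = "monomial \<Rightarrow>\<^sub>0 complex"

definition trace_polys :: "trace_poly set" where
  "trace_polys = {P. \<forall>(a, e) \<in> Poly_Mapping.keys P. Poly_Mapping.lookup e 0 = 0}"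

definition const :: "complex \<Rightarrow> trace_poly" where
  "const c = Poly_Mapping.single (0, 0) c"

definition u_pow :: "int \<Rightarrow> trace_poly" where
  "u_pow a = Poly_Mapping.single (a, 0) 1"

definition v :: "int \<Rightarrow> trace_poly" where
  "v k = (if k = 0 then 1 else Poly_Mapping.single (0, Poly_Mapping.single k 1) 1)"

definition linear_ext :: "(monomial \<Rightarrow> trace_poly) \<Rightarrow> trace_poly \<Rightarrow> trace_poly" where
  "linear_ext \<phi> P = (\<Sum>m\<in>Poly_Mapping.keys P. const (Poly_Mapping.lookup P m) * \<phi> m)"

definition D_u :: "trace_poly \<Rightarrow> trace_poly" where
  "D_u = linear_ext (\<lambda>(a, e). Poly_Mapping.single (a - 1, e) (of_int a))"

definition D_v :: "int \<Rightarrow> trace_poly \<Rightarrow> trace_poly" where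
  "D_v k = linear_ext (\<lambda>(a, e).
     Poly_Mapping.single (a, e - Poly_Mapping.single k 1) (of_nat (Poly_Mapping.lookup e k)))"

definition R_plus :: "trace_poly \<Rightarrow> trace_poly" where
  "R_plus = linear_ext (\<lambda>(a, e). if a \<ge> 0 then Poly_Mapping.single (a, e) 1 else 0)"

definition R_minus :: "trace_poly \<Rightarrow> trace_poly" where
  "R_minus = linear_ext (\<lambda>(a, e). if a \<le> -1 then Poly_Mapping.single (a, e) 1 else 0)"

section \<open>The differential operators\<close>

text \<open>
  All sums over infinite ranges of \<open>k\<close> (and \<open>j\<close>) are written with \<open>Sum_any\<close>: applied to a fixed
  \<open>P\<close>, only finitely many terms are nonzero.
\<close>

definition N_op :: "trace_poly \<Rightarrow> trace_poly" where
  "N_op P = Sum_any (\<lambda>k. of_int \<bar>k\<bar> * v k * D_v k P when \<bar>k\<bar> \<ge> 1)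
            + u_pow 1 * D_u (R_plus P - R_minus P)"

definition Y1_op :: "trace_poly \<Rightarrow> trace_poly" where
  "Y1_op P =
     Sum_any (\<lambda>k. v k * u_pow 1 * R_plus (D_u (u_pow (- k) * R_plus P)) when k \<ge> 1)
     - Sum_any (\<lambda>k. v k * u_pow 1 * R_minus (D_u (u_pow (- k) * R_minus P)) when k \<le> -1)"

definition Y2_op :: "trace_poly \<Rightarrow> trace_poly" where
  "Y2_op P =
     Sum_any (\<lambda>k. (\<Sum>j = 1..k - 1. of_int j * v j * v (k - j)) * D_v k P when k \<ge> 2)
     - Sum_any (\<lambda>k. (\<Sum>j = k + 1..-1. of_int j * v j * v (k - j)) * D_v k P when k \<le> -2)"

definition Z1_op :: "trace_poly \<Rightarrow> trace_poly" where
  "Z1_op P =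
     Sum_any (\<lambda>k. (\<Sum>j = 1..k - 1. of_int (k - j) * v (k - 2 * j)) * D_v k P when k \<ge> 2)
     - Sum_any (\<lambda>k. (\<Sum>j = k + 1..-1. of_int (k - j) * v (k - 2 * j)) * D_v k P when k \<le> -2)"

definition Z2_op :: "trace_poly \<Rightarrow> trace_poly" where
  "Z2_op P =
     Sum_any (\<lambda>k. u_pow (- k + 1) * R_plus (D_u (u_pow (- k) * R_plus P)) when k \<ge> 1)
     - Sum_any (\<lambda>k. u_pow (- k + 1) * R_minus (D_u (u_pow (- k) * R_minus P)) when k \<le> -1)"

definition K1_plus :: "trace_poly \<Rightarrow> trace_poly" where
  "K1_plus P = Sum_any (\<lambda>k. of_int k * u_pow (- k + 1) * D_v k (D_u P) when \<bar>k\<bar> \<ge> 1)"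

definition K1_minus :: "trace_poly \<Rightarrow> trace_poly" where
  "K1_minus P = Sum_any (\<lambda>k. of_int k * u_pow (k + 1) * D_v k (D_u P) when \<bar>k\<bar> \<ge> 1)"

definition K1_op :: "trace_poly \<Rightarrow> trace_poly" where
  "K1_op P = K1_plus P - K1_minus P"

definition K2_plus :: "trace_poly \<Rightarrow> trace_poly" where
  "K2_plus P = Sum_any (\<lambda>(j, k). of_int (j * k) * v (k - j) * D_v j (D_v k P)
                                when \<bar>j\<bar> \<ge> 1 \<and> \<bar>k\<bar> \<ge> 1)"

definition K2_minus :: "trace_poly \<Rightarrow> trace_poly" where
  "K2_minus P = Sum_any (\<lambda>(j, k). of_int (j * k) * v (k + j) * D_v j (D_v k P)
                                 when \<bar>j\<bar> \<ge> 1 \<and> \<bar>k\<bar> \<ge> 1)"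

definition K2_op :: "trace_poly \<Rightarrow> trace_poly" where
  "K2_op P = K2_plus P - K2_minus P"

definition J_op :: "trace_poly \<Rightarrow> trace_poly" where
  "J_op P =
     2 * Sum_any (\<lambda>k. of_int k * u_pow 1 * v k * D_u (D_v k P) when \<bar>k\<bar> \<ge> 1)
     + Sum_any (\<lambda>(j, k). of_int (j * k) * v j * v k * D_v j (D_v k P)
                         when \<bar>j\<bar> \<ge> 1 \<and> \<bar>k\<bar> \<ge> 1)
     + Sum_any (\<lambda>k. of_int (k\<^sup>2) * v k * D_v k P when \<bar>k\<bar> \<ge> 1)
     + u_pow 2 * D_u (D_u P) + u_pow 1 * D_u P"

definition L0_op :: "trace_poly \<Rightarrow> trace_poly" where
  "L0_op P = - N_op P - 2 * Y1_op P - 2 * Y2_op P"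

text \<open>Only \<open>\<beta> = 1, 2, 4\<close> are meaningful; other values of \<open>\<beta>\<close> are treated like \<open>4\<close>.\<close>

definition L1_op :: "nat \<Rightarrow> trace_poly \<Rightarrow> trace_poly" where
  "L1_op \<beta> P =
     (if \<beta> = 1 then N_op P + 2 * Z1_op P + 2 * Z2_op P
      else if \<beta> = 2 then 0
      else const (- (1 / 2)) * (N_op P + 2 * Z1_op P + 2 * Z2_op P))"

definition L2_op :: "nat \<Rightarrow> trace_poly \<Rightarrow> trace_poly" where
  "L2_op \<beta> P =
     (if \<beta> = 1 then 2 * K1_op P + K2_op P
      else if \<beta> = 2 then - 2 * K1_minus P - K2_minus P + J_op P
      else const (1 / 4) * (2 * K1_op P + K2_op P))"

definition D_op :: "nat \<Rightarrow> nat \<Rightarrow> trace_poly \<Rightarrow> trace_poly" where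
  "D_op \<beta> N P = L0_op P + const (1 / of_nat N) * L1_op \<beta> P
                + const (1 / (of_nat N)\<^sup>2) * L2_op \<beta> P"

text \<open>
  The exponential \<open>e\<^sup>c\<^sup>D P\<close>.  For an operator \<open>D\<close> that does not increase the trace degree, all
  iterates of \<open>D\<close> on \<open>P\<close> lie in one finite-dimensional space spanned by monomials, so that
  convergence of the power series there is convergence of each coefficient, and only finitely many
  coefficients of the limit are nonzero (as \<open>Abs_poly_mapping\<close> requires).
\<close>

definition exp_op :: "complex \<Rightarrow> (trace_poly \<Rightarrow> trace_poly) \<Rightarrow> trace_poly \<Rightarrow> trace_poly" where
  "exp_op c D P =
     Abs_poly_mapping (\<lambda>m. suminf (\<lambda>n. c ^ n / fact n * Poly_Mapping.lookup ((D ^^ n) P) m))"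

section \<open>Matrices and matrix groups\<close>

type_synonym 'm cmat = "complex ^ 'm ^ 'm"

definition cscale :: "complex \<Rightarrow> 'm::finite cmat \<Rightarrow> 'm cmat" where
  "cscale c A = (\<chi> i j. c * A $ i $ j)"

definition conj_transpose :: "'m::finite cmat \<Rightarrow> 'm cmat" where
  "conj_transpose A = (\<chi> i j. cnj (A $ j $ i))"

primrec mat_pow :: "'m::finite cmat \<Rightarrow> nat \<Rightarrow> 'm cmat" where
  "mat_pow A 0 = mat 1"
| "mat_pow A (Suc n) = A ** mat_pow A n"

definition mat_powi :: "'m::finite cmat \<Rightarrow> int \<Rightarrow> 'm cmat" where
  "mat_powi A k = (if k \<ge> 0 then mat_pow A (nat k) else mat_pow (matrix_inv A) (nat (- k)))"

definition mat_exp :: "'m::finite cmat \<Rightarrow> 'm cmat" where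
  "mat_exp X = suminf (\<lambda>n. (1 / fact n) *\<^sub>R mat_pow X n)"

text \<open>The trace normalized by the size of the matrix, i.e. \<open>Tr/N\<close> for size \<open>N\<close> and \<open>Tr/(2N)\<close> for
  size \<open>2N\<close>.\<close>

definition ntrace :: "'m::finite cmat \<Rightarrow> complex" where
  "ntrace A = trace A / of_nat CARD('m)"

definition trace_eval :: "trace_poly \<Rightarrow> 'm::finite cmat \<Rightarrow> 'm cmat" where
  "trace_eval P A =
     (\<Sum>(a, e)\<in>Poly_Mapping.keys P.
        cscale (Poly_Mapping.lookup P (a, e)
                * (\<Prod>k\<in>Poly_Mapping.keys e. ntrace (mat_powi A k) ^ Poly_Mapping.lookup e k))
          (mat_powi A a))"

text \<open>The real group \<open>SO(N,\<real>)\<close> is realized inside the complex matrices.\<close>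

definition SO_real :: "'n::finite cmat set" where
  "SO_real = {A. (\<forall>i j. A $ i $ j \<in> \<real>) \<and> transpose A ** A = mat 1 \<and> det A = 1}"

definition SO_complex :: "'n::finite cmat set" where
  "SO_complex = {A. transpose A ** A = mat 1 \<and> det A = 1}"

definition SU :: "'n::finite cmat set" where
  "SU = {A. conj_transpose A ** A = mat 1 \<and> det A = 1}"

definition SL :: "'n::finite cmat set" where
  "SL = {A. det A = 1}"

text \<open>
  Matrices of size \<open>2N\<close> are indexed by \<open>'n \<times> bool\<close>: the first component is the number of the
  \<open>2 \<times> 2\<close> block, the second the position inside the block (\<open>False\<close> first, \<open>True\<close> second).
\<close>

definition Omega :: "('n::finite \<times> bool) cmat" where
  "Omega = (\<chi> p q. if fst p \<noteq> fst q then 0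
                    else if \<not> snd p \<and> snd q then 1
                    else if snd p \<and> \<not> snd q then - 1
                    else 0)"

definition Sp_complex :: "('n::finite \<times> bool) cmat set" where
  "Sp_complex = {A. transpose A ** Omega ** A = Omega}"

definition Sp_compact :: "('n::finite \<times> bool) cmat set" where
  "Sp_compact = {A. transpose A ** Omega ** A = Omega \<and> conj_transpose A ** A = mat 1}"

section \<open>Calculus on a compact matrix group\<close>

definition lie_algebra :: "'m::finite cmat set \<Rightarrow> 'm cmat set" where
  "lie_algebra K = {X. \<forall>t::real. mat_exp (t *\<^sub>R X) \<in> K}"

text \<open>The inner product \<open>c Tr(X Y\<^sup>*)\<close>; it is real on the Lie algebras considered here.\<close>

definition lie_inner :: "real \<Rightarrow> 'm::finite cmat \<Rightarrow> 'm cmat \<Rightarrow> complex" where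
  "lie_inner c X Y = of_real c * trace (X ** conj_transpose Y)"

definition orthonormal_lie_basis :: "real \<Rightarrow> 'm::finite cmat set \<Rightarrow> 'm cmat set \<Rightarrow> bool" where
  "orthonormal_lie_basis c K B \<longleftrightarrow>
     finite B \<and> B \<subseteq> lie_algebra K \<and> span B = lie_algebra K \<and>
     (\<forall>X\<in>B. \<forall>Y\<in>B. lie_inner c X Y = (if X = Y then 1 else 0))"

definition lie_deriv ::
  "'m::finite cmat \<Rightarrow> ('m cmat \<Rightarrow> 'b::real_normed_vector) \<Rightarrow> 'm cmat \<Rightarrow> 'b" where
  "lie_deriv X f k = vector_derivative (\<lambda>t::real. f (k ** mat_exp (t *\<^sub>R X))) (at 0)"

text \<open>The sum does not depend on the choice of the orthonormal basis.\<close>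

definition laplacian ::
  "real \<Rightarrow> 'm::finite cmat set \<Rightarrow> ('m cmat \<Rightarrow> 'b::real_normed_vector) \<Rightarrow> 'm cmat \<Rightarrow> 'b" where
  "laplacian c K f k =
     (\<Sum>X\<in>(SOME B. orthonormal_lie_basis c K B). lie_deriv X (lie_deriv X f) k)"

text \<open>
  The left-invariant vector fields form a global frame of the tangent bundle of \<open>K\<close>, so a function
  on \<open>K\<close> is \<open>C\<^sup>n\<close> iff its iterated derivatives along them up to order \<open>n\<close> exist and are continuous.
\<close>

primrec Cn_on ::
  "nat \<Rightarrow> 'm::finite cmat set \<Rightarrow> ('m cmat \<Rightarrow> 'b::real_normed_vector) \<Rightarrow> bool" where
  "Cn_on 0 K f \<longleftrightarrow> continuous_on K f"
| "Cn_on (Suc n) K f \<longleftrightarrow>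
     continuous_on K f \<and>
     (\<forall>X\<in>lie_algebra K.
        (\<forall>k\<in>K. (\<lambda>t::real. f (k ** mat_exp (t *\<^sub>R X))) differentiable (at 0)) \<and>
        Cn_on n K (lie_deriv X f))"

definition smooth_on_group ::
  "'m::finite cmat set \<Rightarrow> ('m cmat \<Rightarrow> 'b::real_normed_vector) \<Rightarrow> bool" where
  "smooth_on_group K f \<longleftrightarrow> (\<forall>n. Cn_on n K f)"

text \<open>Normalized Haar measure; on a compact group it is bi-invariant.\<close>

definition haar_measure :: "'m::finite cmat set \<Rightarrow> 'm cmat measure \<Rightarrow> bool" where
  "haar_measure K \<mu> \<longleftrightarrow>
     space \<mu> = K \<and> sets \<mu> = sets (restrict_space borel K) \<and> emeasure \<mu> K = 1 \<and>
     (\<forall>g\<in>K. distr \<mu> \<mu> (\<lambda>k. g ** k) = \<mu> \<and> distr \<mu> \<mu> (\<lambda>k. k ** g) = \<mu>)"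

section \<open>Heat kernel and Segal-Bargmann transform\<close>

definition L2 :: "'a measure \<Rightarrow> ('a \<Rightarrow> real) \<Rightarrow> ('a \<Rightarrow> complex) \<Rightarrow> bool" where
  "L2 \<mu> w f \<longleftrightarrow> f \<in> borel_measurable \<mu> \<and> integrable \<mu> (\<lambda>k. (norm (f k))\<^sup>2 * w k)"

definition laplace_eigenfunction ::
  "real \<Rightarrow> 'm::finite cmat set \<Rightarrow> real \<Rightarrow> ('m cmat \<Rightarrow> complex) \<Rightarrow> bool" where
  "laplace_eigenfunction c K \<nu> \<phi> \<longleftrightarrow>
     smooth_on_group K \<phi> \<and> (\<forall>k\<in>K. laplacian c K \<phi> k = of_real \<nu> * \<phi> k)"

text \<open>
  \<open>g = e\<^bsup>(s/2)\<Delta>\<^esup> f\<close> in \<open>L\<^sup>2(K)\<close>, by the functional calculus of the self-adjoint operator \<open>\<Delta>\<close>.  As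
  \<open>K\<close> is compact, \<open>L\<^sup>2(K)\<close> is the Hilbert sum of the eigenspaces of \<open>\<Delta>\<close>, whose elements are smooth
  and whose eigenvalues are real, and the exponential multiplies the spectral component for the
  eigenvalue \<open>\<nu>\<close> by \<open>exp (s \<nu> / 2)\<close>.  This determines \<open>g\<close> almost everywhere.
\<close>

definition heat_operator_graph ::
  "real \<Rightarrow> 'm::finite cmat set \<Rightarrow> 'm cmat measure \<Rightarrow> real \<Rightarrow>
    ('m cmat \<Rightarrow> complex) \<Rightarrow> ('m cmat \<Rightarrow> complex) \<Rightarrow> bool" where
  "heat_operator_graph c K \<mu> s f g \<longleftrightarrow>
     L2 \<mu> (\<lambda>_. 1) f \<and> L2 \<mu> (\<lambda>_. 1) g \<and>
     (\<forall>\<nu> \<phi>. laplace_eigenfunction c K \<nu> \<phi> \<longrightarrow>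
        (LINT k|\<mu>. g k * cnj (\<phi> k)) = of_real (exp (s * \<nu> / 2)) * (LINT k|\<mu>. f k * cnj (\<phi> k)))"

definition heat_kernel ::
  "real \<Rightarrow> 'm::finite cmat set \<Rightarrow> 'm cmat measure \<Rightarrow> (real \<Rightarrow> 'm cmat \<Rightarrow> real) \<Rightarrow> bool" where
  "heat_kernel c K \<mu> \<rho> \<longleftrightarrow>
     (\<forall>s>0. smooth_on_group K (\<rho> s) \<and> (\<forall>k\<in>K. \<rho> s k > 0) \<and>
        (\<forall>f. L2 \<mu> (\<lambda>_. 1) f \<longrightarrow>
           heat_operator_graph c K \<mu> s f (\<lambda>x. LINT k|\<mu>. f (x ** k) * of_real (\<rho> s k))))"

text \<open>
  Holomorphy of \<open>F\<close> on a complex submanifold \<open>S\<close> of \<open>\<complex> \<times> M\<^sub>m(\<complex>)\<close>: locally \<open>F\<close> is the restriction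
  of a function with complex-linear derivatives on an open set of the ambient space.
\<close>

definition holomorphic_on_submanifold ::
  "(complex \<times> 'm::finite cmat) set \<Rightarrow> (complex \<times> 'm cmat \<Rightarrow> complex) \<Rightarrow> bool" where
  "holomorphic_on_submanifold S F \<longleftrightarrow>
     (\<forall>p\<in>S. \<exists>U G. open U \<and> p \<in> U \<and> (\<forall>q\<in>U \<inter> S. G q = F q) \<and>
        (\<forall>q\<in>U. \<exists>G'. (G has_derivative G') (at q) \<and>
                     (\<forall>t Z. G' (\<i> * t, cscale \<i> Z) = \<i> * G' (t, Z))))"

definition heat_kernel_continuation ::
  "'m::finite cmat set \<Rightarrow> 'm cmat set \<Rightarrow> (real \<Rightarrow> 'm cmat \<Rightarrow> real) \<Rightarrow>
    (complex \<Rightarrow> 'm cmat \<Rightarrow> complex) \<Rightarrow> bool" where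
  "heat_kernel_continuation K KC \<rho> \<rho>C \<longleftrightarrow>
     holomorphic_on_submanifold ({\<tau>. Re \<tau> > 0} \<times> KC) (\<lambda>(\<tau>, z). \<rho>C \<tau> z) \<and>
     (\<forall>s>0. \<forall>x\<in>K. \<rho>C (of_real s) x = of_real (\<rho> s x))"

text \<open>The transform is left undefined for \<open>f\<close> outside its domain \<open>L\<^sup>2(K, \<rho>\<^sub>s)\<close>.\<close>

definition segal_bargmann ::
  "'m::finite cmat measure \<Rightarrow> (real \<Rightarrow> 'm cmat \<Rightarrow> real) \<Rightarrow> (complex \<Rightarrow> 'm cmat \<Rightarrow> complex) \<Rightarrow>
    real \<Rightarrow> complex \<Rightarrow> ('m cmat \<Rightarrow> complex) \<Rightarrow> 'm cmat \<Rightarrow> complex" where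
  "segal_bargmann \<mu> \<rho> \<rho>C s \<tau> f z =
     (if L2 \<mu> (\<rho> s) f then (LINT k|\<mu>. \<rho>C \<tau> (z ** matrix_inv k) * f k) else undefined)"

definition boosted_segal_bargmann ::
  "'m::finite cmat measure \<Rightarrow> (real \<Rightarrow> 'm cmat \<Rightarrow> real) \<Rightarrow> (complex \<Rightarrow> 'm cmat \<Rightarrow> complex) \<Rightarrow>
    real \<Rightarrow> complex \<Rightarrow> ('m cmat \<Rightarrow> 'm cmat) \<Rightarrow> 'm cmat \<Rightarrow> 'm cmat" where
  "boosted_segal_bargmann \<mu> \<rho> \<rho>C s \<tau> F z =
     (\<chi> i j. segal_bargmann \<mu> \<rho> \<rho>C s \<tau> (\<lambda>k. F k $ i $ j) z)"

end

theory Submission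
  imports Defs "HOL-Complex_Analysis.Complex_Analysis" "HOL-Computational_Algebra.Fundamental_Theorem_Algebra"
begin

no_notation fps_nth (infixl \<open>$\<close> 75)

text \<open>
  On trace polynomials the Laplacian is intertwined with a differential operator on the formal
  algebra: expanding the second derivatives of \<open>A\<^sup>k\<close> and of its trace, only the Casimir sums
  \<open>\<Sum>X A X\<close> and \<open>\<Sum>tr(A X) X\<close> occur, and both are again combinations of powers of \<open>A\<close>.
  The operator preserves the trace degree filtration and is symmetric for the semidefinite form
  given by integration over \<open>K\<close>, so it splits a trace polynomial, modulo polynomials vanishing on
  \<open>K\<close>, into eigenfunctions of the Laplacian. On an eigenfunction, convolution with the heat kernel
  is multiplication by \<open>exp (s \<nu> / 2)\<close>, which gives the formula for real \<open>\<tau>\<close> and arguments in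
  \<open>K\<close>. Both sides are holomorphic in \<open>\<tau>\<close>; to reach an element of the complexification, write it
  as \<open>k H\<^sup>1\<^sup>/\<^sup>2\<close> with \<open>k \<in> K\<close> and \<open>H\<close> positive definite and continue in \<open>w\<close> along
  \<open>k H\<^sup>w\<close>, which lies in \<open>K\<close> for imaginary \<open>w\<close>.
\<close>

section \<open>Matrix algebra\<close>

text \<open>One abstract computation serves all three series because transposition (orthogonal case)
  and the adjoint for \<open>Omega\<close> (symplectic case) send a power of a group element to its
  inverse power. Both Casimir sums for \<open>A^k\<close> are therefore combinations of
  \<open>1\<close>, \<open>A^k\<close> and \<open>A^(-k)\<close>, and only four real numbers
  \<open>al\<close>, \<open>cp\<close>, \<open>cm\<close>, \<open>g\<close> depend on the series.
  The obstacle throughout is that evaluation on \<open>K\<close> is not injective: different trace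
  polynomials may give the same function. The formal operator thus contains choices which the
  Laplacian does not see, and eigenvalue equations hold only between functions on \<open>K\<close>.
  For this reason spectral theory is done modulo null vectors, iterates of the operator are compared
  through the Laplacian, and in the continuation to the complexification the comparison is with the
  one trace polynomial given by the exponential, not with a sum of eigenfunctions. The spectral
  theorem for the semidefinite form is used a second time, for left multiplication by a Hermitian
  matrix, to construct the powers of \<open>H\<close>.\<close>

lemma cscale_nth [simp]: "cscale c A $ i $ j = c * A $ i $ j"
  by (simp add: cscale_def)

lemma conj_transpose_nth [simp]: "conj_transpose A $ i $ j = cnj (A $ j $ i)"
  by (simp add: conj_transpose_def)

lemma matrix_mult_nth: "(A ** B) $ i $ j = (\<Sum>k\<in>UNIV. A $ i $ k * B $ k $ j)"
  by (simp add: matrix_matrix_mult_def)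

lemma mat_1_nth: "(mat 1 :: 'm::finite cmat) $ i $ j = (if i = j then 1 else 0)"
  by (simp add: mat_def)

lemma cscale_mult_left [simp]: "cscale c A ** B = cscale c (A ** B)"
  by (simp add: vec_eq_iff matrix_mult_nth sum_distrib_left mult.assoc)

lemma cscale_mult_right [simp]: "A ** cscale c B = cscale c (A ** B)"
  by (simp add: vec_eq_iff matrix_mult_nth sum_distrib_left algebra_simps)

lemma cscale_cscale [simp]: "cscale a (cscale b A) = cscale (a * b) A"
  by (simp add: vec_eq_iff mult.assoc)

lemma cscale_0 [simp]: "cscale 0 A = 0" "cscale c 0 = 0"
  by (simp_all add: vec_eq_iff)

lemma cscale_1 [simp]: "cscale 1 A = A"
  by (simp add: vec_eq_iff)

lemma cscale_add_right: "cscale c (A + B) = cscale c A + cscale c B"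
  by (simp add: vec_eq_iff algebra_simps)

lemma cscale_diff_right: "cscale c (A - B) = cscale c A - cscale c B"
  by (simp add: vec_eq_iff algebra_simps)

lemma cscale_add_left: "cscale (a + b) A = cscale a A + cscale b A"
  by (simp add: vec_eq_iff algebra_simps)

lemma cscale_diff_left: "cscale (a - b) A = cscale a A - cscale b A"
  by (simp add: vec_eq_iff algebra_simps)

lemma cscale_minus_left: "cscale (- a) A = - cscale a A"
  by (simp add: vec_eq_iff algebra_simps)

lemma cscale_minus_right: "cscale a (- A) = - cscale a A"
  by (simp add: vec_eq_iff algebra_simps)

lemma cscale_of_real: "cscale (of_real r) A = r *\<^sub>R A"
  by (simp add: vec_eq_iff scaleR_conv_of_real[symmetric])

lemma cscale_sum_right: "cscale c (sum f S) = (\<Sum>i\<in>S. cscale c (f i))"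
  by (simp add: vec_eq_iff sum_distrib_left)

lemma cscale_sum_left: "cscale (sum f S) A = (\<Sum>i\<in>S. cscale (f i) A)"
  by (simp add: vec_eq_iff sum_distrib_right)

lemma matrix_add_rdistrib2: "(A + B) ** C = A ** C + B ** (C :: 'm::finite cmat)"
  by (simp add: vec_eq_iff matrix_mult_nth distrib_right sum.distrib)

lemma matrix_mult_sum_left:
  fixes A :: "'m::finite cmat"
  shows "sum f S ** A = (\<Sum>i\<in>S. f i ** A)"
  by (induction S rule: infinite_finite_induct) (simp_all add: matrix_add_rdistrib2)

lemma matrix_mult_sum_right:
  fixes A :: "'m::finite cmat"
  shows "A ** sum f S = (\<Sum>i\<in>S. A ** f i)"
  by (induction S rule: infinite_finite_induct) (simp_all add: matrix_add_ldistrib)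

lemma matrix_mult_scaleR [simp]:
  fixes A B :: "'m::finite cmat"
  shows "(r *\<^sub>R A) ** B = r *\<^sub>R (A ** B)" "A ** (r *\<^sub>R B) = r *\<^sub>R (A ** B)"
  by (simp_all add: cscale_of_real[symmetric])

lemma matrix_mult_minus [simp]:
  fixes A B :: "'m::finite cmat"
  shows "(- A) ** B = - (A ** B)" "A ** (- B) = - (A ** B)"
  by (simp_all add: vec_eq_iff matrix_mult_nth sum_negf)

lemma matrix_mult_diff:
  fixes A B :: "'m::finite cmat"
  shows "(A - B) ** C = A ** C - B ** C" "C ** (A - B) = C ** A - C ** B"
  by (simp_all add: vec_eq_iff matrix_mult_nth sum_subtractf algebra_simps)

lemma bounded_bilinear_matrix_mult:
  "bounded_bilinear ((**) :: 'm::finite cmat \<Rightarrow> 'm cmat \<Rightarrow> 'm cmat)"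
proof -
  have "bilinear ((**) :: 'm::finite cmat \<Rightarrow> 'm cmat \<Rightarrow> 'm cmat)"
    unfolding bilinear_def
    by (auto intro!: linearI simp: matrix_add_ldistrib matrix_add_rdistrib2)
  then show ?thesis
    by (simp add: bilinear_conv_bounded_bilinear)
qed

lemma conj_transpose_simps [simp]:
  fixes A :: "'m::finite cmat"
  shows "conj_transpose (A ** B) = conj_transpose B ** conj_transpose A"
    and "conj_transpose (conj_transpose A) = A"
    and "conj_transpose (mat 1 :: 'm cmat) = mat 1"
    and "conj_transpose (cscale c A) = cscale (cnj c) (conj_transpose A)"
    and "conj_transpose 0 = (0 :: 'm cmat)"
    and "conj_transpose (- A) = - conj_transpose A"
    and "conj_transpose (r *\<^sub>R A) = r *\<^sub>R conj_transpose A"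
  by (simp_all add: vec_eq_iff matrix_mult_nth mat_1_nth mult.commute)

lemma conj_transpose_add: "conj_transpose (A + B) = conj_transpose A + conj_transpose B"
  by (simp add: vec_eq_iff)

lemma conj_transpose_diff: "conj_transpose (A - B) = conj_transpose A - conj_transpose B"
  by (simp add: vec_eq_iff)

lemma conj_transpose_sum: "conj_transpose (sum f S) = (\<Sum>i\<in>S. conj_transpose (f i))"
  by (simp add: vec_eq_iff)

lemma bounded_linear_conj_transpose:
  "bounded_linear (conj_transpose :: 'm::finite cmat \<Rightarrow> 'm cmat)"
  by (intro linear_conv_bounded_linear[THEN iffD1] linearI) (simp_all add: conj_transpose_add)

lemma trace_cscale: "trace (cscale c A) = c * trace A"
  by (simp add: trace_def sum_distrib_left)

lemma trace_sum: "trace (sum f S :: 'm::finite cmat) = (\<Sum>i\<in>S. trace (f i))"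
  unfolding trace_def sum_component by (rule sum.swap)

lemma trace_minus: "trace (- A :: 'm::finite cmat) = - trace A"
  by (simp add: trace_def sum_negf)

lemma trace_conj_transpose: "trace (conj_transpose A) = cnj (trace A)"
  by (simp add: trace_def)

lemma bounded_linear_trace: "bounded_linear (trace :: 'm::finite cmat \<Rightarrow> complex)"
  by (intro linear_conv_bounded_linear[THEN iffD1] linearI)
     (simp_all add: trace_add trace_cscale cscale_of_real[symmetric] scaleR_conv_of_real)

lemma bounded_linear_ntrace: "bounded_linear (ntrace :: 'm::finite cmat \<Rightarrow> complex)"
  unfolding ntrace_def
  by (rule bounded_linear_compose[OF bounded_linear_divide bounded_linear_trace])

lemma ntrace_simps:
  fixes A B :: "'m::finite cmat"
  shows "ntrace (A + B) = ntrace A + ntrace B"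
    and "ntrace (A - B) = ntrace A - ntrace B"
    and "ntrace (- A) = - ntrace A"
    and "ntrace (cscale c A) = c * ntrace A"
    and "ntrace (sum f S :: 'm cmat) = (\<Sum>i\<in>S. ntrace (f i))"
    and "ntrace (mat 1 :: 'm cmat) = 1"
    and "ntrace (conj_transpose A) = cnj (ntrace A)"
    and "ntrace (0 :: 'm cmat) = 0"
  by (simp_all add: ntrace_def trace_add trace_sub trace_minus trace_cscale trace_sum trace_I
      trace_conj_transpose add_divide_distrib diff_divide_distrib sum_divide_distrib trace_0[unfolded mat_0])

lemma ntrace_mult_commute: "ntrace (A ** B) = ntrace (B ** (A :: 'm::finite cmat))"
  unfolding ntrace_def by (subst trace_mul_sym) (rule refl)

lemma bounded_bilinear_cscale:
  "bounded_bilinear (cscale :: complex \<Rightarrow> 'm::finite cmat \<Rightarrow> 'm cmat)"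
proof -
  have "bilinear (cscale :: complex \<Rightarrow> 'm::finite cmat \<Rightarrow> 'm cmat)"
    unfolding bilinear_def
    by (auto intro!: linearI simp: cscale_add_left cscale_add_right cscale_of_real[symmetric] scaleR_conv_of_real mult.commute)
  then show ?thesis
    by (simp add: bilinear_conv_bounded_bilinear)
qed

section \<open>Inverses and integer powers of matrices\<close>

lemma invertible_inv [simp]:
  fixes A :: "'m::finite cmat"
  assumes "invertible A"
  shows "A ** matrix_inv A = mat 1" "matrix_inv A ** A = mat 1"
  using someI_ex[OF assms[unfolded invertible_def]] by (simp_all add: matrix_inv_def)

text \<open>\<open>matrix_inv\<close> is a choice, so a known inverse has to be identified with it.
  A one-sided inverse suffices because the matrices are square.\<close>

lemma matrix_inv_eqI:
  fixes A B :: "'m::finite cmat"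
  assumes "A ** B = mat 1"
  shows "matrix_inv A = B"
proof -
  have "B ** A = mat 1"
    using assms by (simp add: matrix_left_right_inverse)
  then have "matrix_inv A ** A = mat 1"
    using assms by (intro invertible_inv) (auto simp: invertible_def)
  then have "matrix_inv A ** (A ** B) = B"
    by (simp add: matrix_mul_assoc)
  then show ?thesis
    by (simp add: assms)
qed

lemma matrix_inv_unitary:
  fixes A :: "'m::finite cmat"
  assumes "conj_transpose A ** A = mat 1"
  shows "matrix_inv A = conj_transpose A"
  using assms by (intro matrix_inv_eqI) (simp add: matrix_left_right_inverse)

lemma mat_pow_Suc2: "mat_pow A (Suc n) = mat_pow A n ** A"
  by (induction n) (simp_all add: matrix_mul_assoc)

lemma mat_pow_add: "mat_pow A (m + n) = mat_pow A m ** mat_pow A n"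
  by (induction m) (simp_all add: matrix_mul_assoc)

lemma mat_pow_mat_1 [simp]: "mat_pow (mat 1) n = mat 1"
  by (induction n) simp_all

lemma mat_pow_conj_transpose: "conj_transpose (mat_pow A n) = mat_pow (conj_transpose A) n"
proof (induction n)
  case (Suc n)
  then show ?case by (simp add: mat_pow_Suc2[symmetric])
qed simp

lemma mat_pow_cscale: "mat_pow (cscale c A) n = cscale (c ^ n) (mat_pow A n)"
  by (induction n) (simp_all add: mult.commute)

lemma mat_powi_0 [simp]: "mat_powi A 0 = mat 1"
  by (simp add: mat_powi_def)

lemma mat_powi_1 [simp]: "mat_powi A 1 = A"
  by (simp add: mat_powi_def)

lemma mat_powi_nat [simp]: "mat_powi A (int n) = mat_pow A n"
  by (simp add: mat_powi_def)

lemma mat_powi_uminus_nat: "mat_powi A (- int n) = mat_pow (matrix_inv A) n"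
  proof (cases n)
  case (Suc k)
  then have "nat (int n) = n" "\<not> 0 \<le> - int n" by simp_all
  then show ?thesis by (simp add: mat_powi_def)
qed simp

lemma mat_powi_Suc:
  assumes "invertible A"
  shows "mat_powi A (k + 1) = A ** mat_powi A k"
proof (cases "k \<ge> 0")
  case True
  then show ?thesis by (simp add: mat_powi_def nat_add_distrib)
next
  case False
  then have "0 \<le> - 1 - k" by simp
  then obtain n where "- 1 - k = int n" by (rule nonneg_int_cases)
  then have n: "k = - 1 - int n" by simp
  have "mat_powi A k = matrix_inv A ** mat_pow (matrix_inv A) n"
    using mat_powi_uminus_nat[of A "Suc n"] by (simp add: n algebra_simps)
  moreover have "mat_powi A (k + 1) = mat_pow (matrix_inv A) n"
    using mat_powi_uminus_nat[of A n] by (simp add: n)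
  ultimately show ?thesis
    using assms by (simp add: matrix_mul_assoc)
qed

lemma mat_powi_add:
  assumes "invertible A"
  shows "mat_powi A (j + k) = mat_powi A j ** mat_powi A k"
proof (induction j rule: int_induct[where k = 0])
  case base
  then show ?case by simp
next
  case (step1 i)
  then show ?case
    using mat_powi_Suc[OF assms, of "i + k"] mat_powi_Suc[OF assms, of i]
    by (simp add: algebra_simps matrix_mul_assoc)
next
  case (step2 i)
  have "A ** mat_powi A (i - 1 + k) = A ** (mat_powi A (i - 1) ** mat_powi A k)"
    using step2 mat_powi_Suc[OF assms, of "i - 1 + k"] mat_powi_Suc[OF assms, of "i - 1"]
    by (simp add: algebra_simps matrix_mul_assoc)
  then show ?case
    using assms by (metis invertible_inv(2) matrix_mul_assoc matrix_mul_lid)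
qed

text \<open>For unitary \<open>A\<close> the inverse is the adjoint. Statements about negative
  exponents can then be deduced from the positive case by applying \<open>conj_transpose\<close>,
  without differentiating an inverse.\<close>

lemma mat_powi_minus:
  assumes "conj_transpose A ** A = mat 1"
  shows "mat_powi A (- k) = conj_transpose (mat_powi A k)"
proof (cases "k \<ge> 0")
  case True
  then show ?thesis
    using mat_powi_uminus_nat[of A "nat k"]
    by (simp add: mat_pow_conj_transpose matrix_inv_unitary[OF assms] mat_powi_def)
next
  case False
  then show ?thesis
    by (simp add: mat_pow_conj_transpose matrix_inv_unitary[OF assms] mat_powi_def)
qed

section \<open>The matrix exponential\<close>

lemma has_vector_derivative_vecI:
  fixes f :: "real \<Rightarrow> ('a::real_normed_vector) ^ 'n::finite"
  assumes "\<And>i. ((\<lambda>t. f t $ i) has_vector_derivative f' $ i) (at t)"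
  shows "(f has_vector_derivative f') (at t)"
  using assms unfolding has_vector_derivative_def has_derivative_def
  by (auto intro!: vec_tendstoI bounded_linear_scaleR_left)

lemma has_vector_derivative_vec_nth:
  fixes f :: "real \<Rightarrow> ('a::real_normed_vector) ^ 'n::finite"
  assumes "(f has_vector_derivative f') F"
  shows "((\<lambda>t. f t $ i) has_vector_derivative f' $ i) F"
  by (rule bounded_linear.has_vector_derivative[OF bounded_linear_vec_nth assms])

text \<open>\<open>b\<close> dominates every absolute row sum of \<open>X\<close>, the factor by
  which one more multiplication can enlarge an entry.\<close>

lemma norm_mat_pow_nth_le:
  fixes X :: "'m::finite cmat"
  defines "b \<equiv> 1 + (\<Sum>i\<in>UNIV. \<Sum>j\<in>UNIV. norm (X $ i $ j))"
  shows "norm (mat_pow X n $ i $ j) \<le> b ^ n"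
proof (induction n arbitrary: i)
  case 0
  show ?case by (simp add: mat_1_nth)
next
  case (Suc n)
  have b: "b \<ge> 0" unfolding b_def by (intro add_nonneg_nonneg sum_nonneg) auto
  have "norm (mat_pow X (Suc n) $ i $ j) \<le> (\<Sum>k\<in>UNIV. norm (X $ i $ k) * norm (mat_pow X n $ k $ j))"
    by (simp add: matrix_mult_nth norm_mult[symmetric] norm_sum)
  also have "\<dots> \<le> (\<Sum>k\<in>UNIV. norm (X $ i $ k) * b ^ n)"
    by (intro sum_mono mult_left_mono Suc) simp
  also have "\<dots> = (\<Sum>k\<in>UNIV. norm (X $ i $ k)) * b ^ n"
    by (simp add: sum_distrib_right)
  also have "\<dots> \<le> b * b ^ n"
  proof (intro mult_right_mono)
    have "(\<Sum>k\<in>UNIV. norm (X $ i $ k)) \<le> (\<Sum>i\<in>UNIV. \<Sum>j\<in>UNIV. norm (X $ i $ j))"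
      by (rule member_le_sum) (auto intro: sum_nonneg)
    then show "(\<Sum>k\<in>UNIV. norm (X $ i $ k)) \<le> b" by (simp add: b_def)
  qed (use b in simp)
  finally show ?case by simp
qed

lemma summable_mat_pow_nth:
  fixes X :: "'m::finite cmat"
  shows "summable (\<lambda>n. mat_pow X n $ i $ j / fact n * w ^ n)"
proof (rule summable_comparison_test)
  define b where "b = 1 + (\<Sum>i\<in>UNIV. \<Sum>j\<in>UNIV. norm (X $ i $ j))"
  show "summable (\<lambda>n. inverse (fact n) * (b * norm w) ^ n)"
    using summable_exp[of "b * norm w"] by simp
  have "norm (mat_pow X n $ i $ j / fact n * w ^ n) \<le> inverse (fact n) * (b * norm w) ^ n" for n
  proof -
    have "norm (mat_pow X n $ i $ j / fact n * w ^ n)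
        = inverse (fact n) * (norm (mat_pow X n $ i $ j) * norm w ^ n)"
      by (simp add: norm_mult norm_divide norm_power field_simps)
    also have "\<dots> \<le> inverse (fact n) * (b ^ n * norm w ^ n)"
      using norm_mat_pow_nth_le[of X n i j]
      by (intro mult_left_mono mult_right_mono) (simp_all add: b_def)
    finally show ?thesis by (simp add: power_mult_distrib)
  qed
  then show "\<exists>N. \<forall>n\<ge>N. norm (mat_pow X n $ i $ j / fact n * w ^ n) \<le> inverse (fact n) * (b * norm w) ^ n"
    by blast
qed

lemma mat_pow_sums_mat_exp:
  fixes X :: "'m::finite cmat"
  shows "(\<lambda>n. (1 / fact n) *\<^sub>R mat_pow X n) sums mat_exp X"
proof -
  have "(\<lambda>n. (1 / fact n) *\<^sub>R mat_pow X n) sums (\<chi> i j. suminf (\<lambda>n. mat_pow X n $ i $ j / fact n))"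
    unfolding sums_def
  proof (intro vec_tendstoI)
    fix i j
    have "(\<lambda>n. mat_pow X n $ i $ j / fact n) sums (suminf (\<lambda>n. mat_pow X n $ i $ j / fact n))"
      using summable_mat_pow_nth[of X i j 1] by (intro summable_sums) simp
    moreover have "(1 / fact n) *\<^sub>R z = z / fact n" for n and z :: complex
      by (simp add: scaleR_conv_of_real)
    ultimately show "(\<lambda>n. sum (\<lambda>n. (1 / fact n) *\<^sub>R mat_pow X n) {..<n} $ i $ j)
        \<longlonglongrightarrow> (\<chi> i j. suminf (\<lambda>n. mat_pow X n $ i $ j / fact n)) $ i $ j"
      by (simp add: sums_def sum_component)
  qed
  then show ?thesis
    by (auto simp: mat_exp_def sums_iff)
qed

lemma mat_exp_nth:
  fixes X :: "'m::finite cmat"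
  shows "mat_exp (t *\<^sub>R X) $ i $ j = (suminf (\<lambda>n. mat_pow X n $ i $ j / fact n * of_real t ^ n))"
proof -
  have "(\<lambda>n. ((1 / fact n) *\<^sub>R mat_pow (t *\<^sub>R X) n) $ i $ j) sums (mat_exp (t *\<^sub>R X) $ i $ j)"
    by (intro bounded_linear.sums[OF bounded_linear_vec_nth] mat_pow_sums_mat_exp)
  then show ?thesis
    by (simp add: sums_iff cscale_of_real[symmetric] mat_pow_cscale del: of_real_power)
       (simp add: scaleR_conv_of_real mult.commute)
qed

lemma mat_exp_0 [simp]: "mat_exp 0 = mat 1"
proof -
  have "(\<lambda>n. (1 / fact n) *\<^sub>R mat_pow (0 :: 'a cmat) n) sums (\<Sum>n\<in>{0}. (1 / fact n) *\<^sub>R mat_pow (0 :: 'a cmat) n)"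
  proof (rule sums_finite)
    fix n :: nat assume "n \<notin> {0}"
    then obtain m where "n = Suc m" by (cases n) auto
    then show "(1 / fact n) *\<^sub>R mat_pow (0 :: 'a cmat) n = 0"
      by (simp add: vec_eq_iff matrix_mult_nth)
  qed simp
  then show ?thesis
    using mat_pow_sums_mat_exp[of "0 :: 'a cmat"] by (simp add: sums_iff)
qed

lemma mat_exp_commute: "X ** mat_exp X = mat_exp X ** (X :: 'm::finite cmat)"
proof -
  have "(\<lambda>n. X ** ((1 / fact n) *\<^sub>R mat_pow X n)) sums (X ** mat_exp X)"
    by (intro bounded_linear.sums[OF bounded_bilinear.bounded_linear_right[OF bounded_bilinear_matrix_mult]]
        mat_pow_sums_mat_exp)
  moreover have "(\<lambda>n. ((1 / fact n) *\<^sub>R mat_pow X n) ** X) sums (mat_exp X ** X)"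
    by (intro bounded_linear.sums[OF bounded_bilinear.bounded_linear_left[OF bounded_bilinear_matrix_mult]]
        mat_pow_sums_mat_exp)
  moreover have "X ** mat_pow X n = mat_pow X n ** X" for n
    by (metis mat_pow.simps(2) mat_pow_Suc2)
  ultimately show ?thesis
    by (simp add: sums_iff)
qed

lemma mat_exp_commute_scaleR: "X ** mat_exp (t *\<^sub>R X) = mat_exp (t *\<^sub>R X) ** (X :: 'm::finite cmat)"
proof (cases "t = 0")
  case False
  have "t *\<^sub>R (X ** mat_exp (t *\<^sub>R X)) = t *\<^sub>R (mat_exp (t *\<^sub>R X) ** X)"
    using mat_exp_commute[of "t *\<^sub>R X"] by simp
  then show ?thesis using False by simp
qed simp

text \<open>Every entry is an everywhere convergent power series in \<open>t\<close>, so it may be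
  differentiated termwise; the shifted coefficients belong to \<open>X\<close> times the exponential
  because \<open>mat_pow X (Suc n)\<close> has \<open>X\<close> as first factor.\<close>

lemma mat_exp_has_vector_derivative:
  fixes X :: "'m::finite cmat"
  shows "((\<lambda>t. mat_exp (t *\<^sub>R X)) has_vector_derivative X ** mat_exp (t *\<^sub>R X)) (at t)"
proof (intro has_vector_derivative_vecI)
  fix i j
  let ?c = "\<lambda>i j n. mat_pow X n $ i $ j / fact n"
  have "((\<lambda>w. suminf (\<lambda>n. ?c i j n * w ^ n)) has_field_derivative (suminf (\<lambda>n. diffs (?c i j) n * of_real t ^ n))) (at (of_real t))"
    by (rule termdiffs_strong_converges_everywhere) (rule summable_mat_pow_nth)
  then have "((\<lambda>t. suminf (\<lambda>n. ?c i j n * of_real t ^ n)) has_vector_derivative (suminf (\<lambda>n. diffs (?c i j) n * of_real t ^ n))) (at t)"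
    by (rule has_vector_derivative_real_field)
  moreover have "(suminf (\<lambda>n. diffs (?c i j) n * of_real t ^ n)) = (X ** mat_exp (t *\<^sub>R X)) $ i $ j"
  proof -
    have "diffs (?c i j) n * of_real t ^ n = (\<Sum>k\<in>UNIV. X $ i $ k * (?c k j n * of_real t ^ n))" for n
    proof -
      have "diffs (?c i j) n = mat_pow X (Suc n) $ i $ j / fact n"
        unfolding diffs_def by (simp add: field_simps del: of_nat_Suc)
      then show ?thesis
        by (simp add: matrix_mult_nth sum_divide_distrib sum_distrib_left mult_ac)
    qed
    then have "(suminf (\<lambda>n. diffs (?c i j) n * of_real t ^ n)) = (suminf (\<lambda>n. \<Sum>k\<in>UNIV. X $ i $ k * (?c k j n * of_real t ^ n)))"
      by simp
    also have "\<dots> = (\<Sum>k\<in>UNIV. suminf (\<lambda>n. X $ i $ k * (?c k j n * of_real t ^ n)))"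
      by (intro suminf_sum summable_mult summable_mat_pow_nth)
    also have "\<dots> = (\<Sum>k\<in>UNIV. X $ i $ k * (suminf (\<lambda>n. ?c k j n * of_real t ^ n)))"
      by (intro sum.cong refl suminf_mult summable_mat_pow_nth)
    finally show ?thesis by (simp add: matrix_mult_nth mat_exp_nth)
  qed
  ultimately show "((\<lambda>t. mat_exp (t *\<^sub>R X) $ i $ j) has_vector_derivative (X ** mat_exp (t *\<^sub>R X)) $ i $ j) (at t)"
    by (simp add: mat_exp_nth)
qed

lemmas has_vector_derivative_matrix_mult =
  bounded_bilinear.has_vector_derivative[OF bounded_bilinear_matrix_mult]

lemma mat_exp_shift_has_vector_derivative:
  fixes X :: "'m::finite cmat"
  shows "((\<lambda>t. mat_exp ((a * t + b) *\<^sub>R X)) has_vector_derivative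
    (a *\<^sub>R (mat_exp ((a * t + b) *\<^sub>R X) ** X))) (at t)"
proof -
  have "((\<lambda>t. a * t + b) has_vector_derivative a) (at t)"
    by (auto intro!: derivative_eq_intros simp: has_real_derivative_iff_has_vector_derivative[symmetric])
  from vector_diff_chain_at[OF this mat_exp_has_vector_derivative]
  show ?thesis by (simp add: o_def mat_exp_commute_scaleR)
qed

lemma vector_derivative_zero_constant:
  fixes f :: "real \<Rightarrow> 'a::real_normed_vector"
  assumes "\<And>t. (f has_vector_derivative 0) (at t)"
  shows "f s = f t"
  using has_vector_derivative_zero_constant[of UNIV f] assms by (metis UNIV_I convex_UNIV)

text \<open>The product of the exponentials at \<open>r + b\<close> and at \<open>- r\<close> has
  derivative zero in \<open>r\<close>, as \<open>X\<close> commutes with both factors, so it keeps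
  its value at \<open>r = 0\<close>.\<close>

lemma mat_exp_add:
  fixes X :: "'m::finite cmat"
  shows "mat_exp ((s + t) *\<^sub>R X) = mat_exp (s *\<^sub>R X) ** mat_exp (t *\<^sub>R X)"
proof -
  let ?E = "\<lambda>t. mat_exp (t *\<^sub>R X)"
  have const: "?E (r + b) ** ?E (- r) = ?E b" for r b
  proof -
    have "((\<lambda>r. ?E (1 * r + b) ** ?E (- 1 * r + 0)) has_vector_derivative 0) (at r)" for r
      by (rule has_vector_derivative_eq_rhs[OF has_vector_derivative_matrix_mult[OF
        mat_exp_shift_has_vector_derivative mat_exp_shift_has_vector_derivative]])
        (use mat_exp_commute_scaleR[of X "- r"] in \<open>simp add: matrix_mul_assoc[symmetric]\<close>)
    from vector_derivative_zero_constant[OF this, of r 0] show ?thesis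
      by simp
  qed
  have "?E (t + s) ** ?E (- t) ** ?E t = ?E s ** ?E t"
    by (simp only: const)
  moreover have "?E (- t) ** ?E t = mat 1"
    using const[of "- t" 0] by simp
  ultimately show ?thesis
    by (metis add.commute matrix_mul_assoc matrix_mul_rid)
qed

section \<open>One-parameter groups that preserve a form or the determinant\<close>

lemma transpose_simps:
  fixes A B :: "'m::finite cmat"
  shows "transpose (A + B) = transpose A + transpose B"
    and "transpose (A - B) = transpose A - transpose B"
    and "transpose (- A) = - transpose A"
    and "transpose (cscale c A) = cscale c (transpose A)"
    and "transpose (r *\<^sub>R A) = r *\<^sub>R transpose A"
    and "transpose (conj_transpose A) = conj_transpose (transpose A)"
  by (simp_all add: vec_eq_iff transpose_def)

lemma bounded_linear_transpose:
  "bounded_linear (transpose :: 'm::finite cmat \<Rightarrow> 'm cmat)"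
  by (intro linear_conv_bounded_linear[THEN iffD1] linearI) (simp_all add: transpose_simps)

text \<open>The derivative of the transformed form is \<open>\<phi> X ** J + J ** X\<close> between
  two exponential factors: at \<open>t = 0\<close> this gives necessity, and for all
  \<open>t\<close> it gives sufficiency. Real linearity of \<open>\<phi>\<close> is the right
  generality, since it covers both transposition and conjugate transposition.\<close>

lemma mat_exp_preserves_form_iff:
  fixes X J :: "'m::finite cmat"
  assumes lin: "bounded_linear \<phi>" and anti: "\<And>A B. \<phi> (A ** B) = \<phi> B ** (\<phi> A :: 'm cmat)" and one: "\<phi> (mat 1) = mat 1"
  shows "(\<forall>t. \<phi> (mat_exp (t *\<^sub>R X)) ** J ** mat_exp (t *\<^sub>R X) = J) \<longleftrightarrow> \<phi> X ** J + J ** X = 0"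
proof -
  let ?E = "\<lambda>t. mat_exp (t *\<^sub>R X)" and ?F = "\<lambda>t. \<phi> (mat_exp (t *\<^sub>R X)) ** J ** mat_exp (t *\<^sub>R X)"
  have E: "(?E has_vector_derivative ?E t ** X) (at t)" for t
    using mat_exp_has_vector_derivative[of X t] by (simp add: mat_exp_commute_scaleR)
  have E': "(?E has_vector_derivative X ** ?E t) (at t)" for t
    by (rule mat_exp_has_vector_derivative)
  have J: "((\<lambda>t. J) has_vector_derivative 0) (at t)" for t :: real
    by (rule has_vector_derivative_const)
  have z: "0 ** A = 0" "A ** 0 = 0" for A :: "'m cmat"
    by (simp_all add: vec_eq_iff matrix_mult_nth)
  have der: "(?F has_vector_derivative \<phi> (?E t) ** (\<phi> X ** J + J ** X) ** ?E t) (at t)" for t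
    by (rule has_vector_derivative_eq_rhs[OF has_vector_derivative_matrix_mult[OF has_vector_derivative_matrix_mult[OF
      bounded_linear.has_vector_derivative[OF lin E'] J] E']])
      (simp add: anti z matrix_add_ldistrib matrix_add_rdistrib2 matrix_mul_assoc add.commute)
  show ?thesis
  proof
    assume "\<forall>t. ?F t = J"
    then have "?F = (\<lambda>t. J)" by auto
    then have "((\<lambda>t. J) has_vector_derivative \<phi> (?E 0) ** (\<phi> X ** J + J ** X) ** ?E 0) (at 0)"
      using der[of 0] by simp
    from vector_derivative_unique_at[OF this J] show "\<phi> X ** J + J ** X = 0"
      by (simp add: one)
  next
    assume eq: "\<phi> X ** J + J ** X = 0"
    have "?F t = ?F 0" for t
      by (rule vector_derivative_zero_constant) (use der in \<open>simp add: eq z\<close>)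
    then show "\<forall>t. ?F t = J" by (simp add: one)
  qed
qed

text \<open>A permutation cannot move exactly one point. Hence differentiating the determinant at
  the identity matrix leaves only the identity permutation, and the derivative is the trace.\<close>

lemma prod_mat_1_remove:
  fixes p :: "'m::finite \<Rightarrow> 'm"
  assumes "p permutes UNIV"
  shows "(\<Prod>j\<in>UNIV - {i}. (mat 1 :: 'm cmat) $ j $ p j) = (if p = id then 1 else 0)"
proof (cases "p = id")
  case True
  then show ?thesis by (simp add: mat_1_nth)
next
  case False
  then obtain a where a: "p a \<noteq> a" by (auto simp: fun_eq_iff)
  have "p (p a) \<noteq> p a" using a assms by (metis permutes_inj injD)
  then obtain b where "b \<noteq> i" "p b \<noteq> b" using a by metis
  then show ?thesis using False by (auto simp: mat_1_nth intro!: prod_zero)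
qed

lemma det_has_vector_derivative:
  fixes f :: "real \<Rightarrow> 'm::finite cmat"
  assumes f: "(f has_vector_derivative X) (at t)" and "f t = mat 1"
  shows "((\<lambda>t. det (f t)) has_vector_derivative trace X) (at t)"
proof -
  have 1: "((\<lambda>s. f s $ i $ j) has_vector_derivative X $ i $ j) (at t)" for i j
    by (intro has_vector_derivative_vec_nth f)
  have prod: "((\<lambda>s. \<Prod>i\<in>UNIV. f s $ i $ p i) has_vector_derivative
      (\<Sum>i\<in>UNIV. X $ i $ p i * (\<Prod>j\<in>UNIV - {i}. f t $ j $ p j))) (at t)" for p
    using has_derivative_prod[of UNIV "\<lambda>i s. f s $ i $ p i" "\<lambda>i h. h *\<^sub>R (X $ i $ p i)" t UNIV] 1
    unfolding has_vector_derivative_def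
    by (simp add: scaleR_sum_right)
  have "((\<lambda>s. det (f s)) has_vector_derivative (\<Sum>p | p permutes (UNIV::'m set). of_int (sign p) *
      (\<Sum>i\<in>UNIV. X $ i $ p i * (\<Prod>j\<in>UNIV - {i}. f t $ j $ p j)))) (at t)"
    unfolding det_def
    by (intro has_vector_derivative_sum has_vector_derivative_mult_right prod)
  moreover have "(\<Sum>p | p permutes (UNIV::'m set). of_int (sign p) *
      (\<Sum>i\<in>UNIV. X $ i $ p i * (\<Prod>j\<in>UNIV - {i}. f t $ j $ p j))) =
      (\<Sum>p | p permutes (UNIV::'m set). if p = id then trace X else 0)"
    by (intro sum.cong) (auto simp: assms(2) prod_mat_1_remove trace_def)
  ultimately show ?thesis
    by (simp add: permutes_id finite_permutations)
qed

text \<open>Multiplicativity of the determinant moves the derivative at any \<open>t\<close> to the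
  one at \<open>0\<close>, where it is the trace.\<close>

lemma det_mat_exp_eq_1_iff:
  fixes X :: "'m::finite cmat"
  shows "(\<forall>t. det (mat_exp (t *\<^sub>R X)) = 1) \<longleftrightarrow> trace X = 0"
proof -
  let ?E = "\<lambda>t. mat_exp (t *\<^sub>R X)"
  have 0: "((\<lambda>h. det (?E h)) has_vector_derivative trace X) (at 0)"
    using mat_exp_has_vector_derivative[of X 0] by (intro det_has_vector_derivative) simp_all
  show ?thesis
  proof
    assume "\<forall>t. det (?E t) = 1"
    then have "((\<lambda>h. 1) has_vector_derivative trace X) (at (0::real))"
      using 0 by simp
    from vector_derivative_unique_at[OF this has_vector_derivative_const] show "trace X = 0" .
  next
    assume tr: "trace X = 0"
    have "((\<lambda>h. det (?E h)) has_vector_derivative 0) (at t)" for t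
    proof -
      have "((\<lambda>h. det (?E h)) \<circ> (\<lambda>h. h - t) has_vector_derivative 1 *\<^sub>R 0) (at t)"
        by (rule vector_diff_chain_at) (use 0 tr in \<open>auto intro!: derivative_eq_intros simp: has_vector_derivative_def\<close>)
      then have "((\<lambda>h. det (?E t) * det (?E (h - t))) has_vector_derivative det (?E t) * 0) (at t)"
        by (intro has_vector_derivative_mult_right) (simp add: o_def)
      moreover have "det (?E t) * det (?E (h - t)) = det (?E h)" for h
        using mat_exp_add[of t "h - t" X] by (simp add: det_mul)
      ultimately show ?thesis by simp
    qed
    from vector_derivative_zero_constant[OF this, of _ 0] show "\<forall>t. det (?E t) = 1"
      by simp
  qed
qed

section \<open>Lie algebras and Casimir tensors\<close>

lemma zero_matrix_mult [simp]:
  fixes A :: "'m::finite cmat"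
  shows "0 ** A = 0" "A ** 0 = 0"
  by (simp_all add: vec_eq_iff matrix_mult_nth)

lemma bounded_linear_conj_transpose_mat_exp_iff:
  fixes X :: "'m::finite cmat"
  shows "(\<forall>t. conj_transpose (mat_exp (t *\<^sub>R X)) ** mat_exp (t *\<^sub>R X) = mat 1) \<longleftrightarrow> conj_transpose X = - X"
  using mat_exp_preserves_form_iff[OF bounded_linear_conj_transpose, where J = "mat 1" and X = X]
  by (simp add: eq_neg_iff_add_eq_0)

lemma lie_algebra_skew:
  assumes "\<And>A. A \<in> K \<Longrightarrow> conj_transpose A ** A = mat 1" and "X \<in> lie_algebra K"
  shows "conj_transpose X = - X"
  using assms bounded_linear_conj_transpose_mat_exp_iff[of X] by (auto simp: lie_algebra_def)

lemma transpose_conj_transpose_eq_iff: "transpose A = conj_transpose A \<longleftrightarrow> (\<forall>i j. A $ i $ j \<in> \<real>)"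
  by (auto simp: vec_eq_iff transpose_def Reals_cnj_iff eq_commute)

text \<open>If \<open>transpose A\<close> is the inverse of \<open>A\<close>, then real entries mean
  that the adjoint is the inverse as well. Reality thus becomes invariance of a second form, to
  which \<open>mat_exp_preserves_form_iff\<close> applies.\<close>

lemma SO_real_altdef: "SO_real = {A. transpose A ** A = mat 1 \<and> conj_transpose A ** A = mat 1 \<and> det A = 1}"
proof -
  have "(\<forall>i j. A $ i $ j \<in> \<real>) \<longleftrightarrow> conj_transpose A ** A = mat 1" if "transpose A ** A = mat 1" for A :: "'m::finite cmat"
  proof
    assume "\<forall>i j. A $ i $ j \<in> \<real>"
    then show "conj_transpose A ** A = mat 1"
      using that transpose_conj_transpose_eq_iff[of A] by simp
  next
    assume "conj_transpose A ** A = mat 1"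
    then have "conj_transpose A ** (A ** transpose A) = transpose A"
      by (simp add: matrix_mul_assoc)
    moreover have "A ** transpose A = mat 1"
      using that by (simp add: matrix_left_right_inverse)
    ultimately show "\<forall>i j. A $ i $ j \<in> \<real>"
      using transpose_conj_transpose_eq_iff[of A] by simp
  qed
  then show ?thesis
    unfolding SO_real_def by blast
qed

lemma lie_algebra_SO_real:
  "lie_algebra SO_real = {X. transpose X = - X \<and> conj_transpose X = - X}"
proof -
  \<comment> \<open>The exponential is the square of the one at \<open>t / 2\<close>, whose
    determinant is \<open>1\<close> or \<open>-1\<close> by orthogonality.\<close>
  have det: "det (mat_exp (t *\<^sub>R X)) = 1" if "\<forall>t. transpose (mat_exp (t *\<^sub>R X)) ** mat_exp (t *\<^sub>R X) = mat 1"
    for X :: "'n::finite cmat" and t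
  proof -
    have "det (mat_exp (t *\<^sub>R X)) = det (mat_exp ((t/2) *\<^sub>R X)) * det (mat_exp ((t/2) *\<^sub>R X))"
      using mat_exp_add[of "t/2" "t/2" X] by (simp add: det_mul)
    also have "\<dots> = det (transpose (mat_exp ((t/2) *\<^sub>R X)) ** mat_exp ((t/2) *\<^sub>R X))"
      by (simp add: det_mul det_transpose)
    finally show ?thesis using that by simp
  qed
  have "(\<forall>t. transpose (mat_exp (t *\<^sub>R X)) ** mat_exp (t *\<^sub>R X) = mat 1) \<longleftrightarrow> transpose X = - X" for X :: "'n::finite cmat"
    using mat_exp_preserves_form_iff[OF bounded_linear_transpose, where J = "mat 1" and X = X]
    by (simp add: eq_neg_iff_add_eq_0 matrix_transpose_mul transpose_mat)
  then have "X \<in> lie_algebra SO_real \<longleftrightarrow> transpose X = - X \<and> conj_transpose X = - X" for X :: "'n::finite cmat"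
    using det[of X] bounded_linear_conj_transpose_mat_exp_iff[of X]
    unfolding lie_algebra_def SO_real_altdef mem_Collect_eq by blast
  then show ?thesis by blast
qed

lemma lie_algebra_SU: "lie_algebra SU = {X. conj_transpose X = - X \<and> trace X = 0}"
  using det_mat_exp_eq_1_iff bounded_linear_conj_transpose_mat_exp_iff
  unfolding lie_algebra_def SU_def by blast

lemma lie_algebra_Sp_compact:
  "lie_algebra Sp_compact = {X. transpose X ** Omega + Omega ** X = 0 \<and> conj_transpose X = - X}"
proof -
  have "(\<forall>t. transpose (mat_exp (t *\<^sub>R X)) ** Omega ** mat_exp (t *\<^sub>R X) = Omega) \<longleftrightarrow> transpose X ** Omega + Omega ** X = 0"
    for X :: "('n::finite \<times> bool) cmat"
    using mat_exp_preserves_form_iff[OF bounded_linear_transpose, where J = Omega and X = X]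
    by (simp add: matrix_transpose_mul transpose_mat)
  then show ?thesis
    using bounded_linear_conj_transpose_mat_exp_iff
    unfolding lie_algebra_def Sp_compact_def by blast
qed

section \<open>The trace form on skew-Hermitian matrices\<close>

lemma trace_mult_conj_transpose: "trace (X ** conj_transpose X) = of_real ((norm X)\<^sup>2)"
proof -
  have "trace (X ** conj_transpose X) = (\<Sum>i\<in>UNIV. \<Sum>j\<in>UNIV. of_real ((norm (X $ i $ j))\<^sup>2))"
    by (simp add: trace_def matrix_mult_nth complex_norm_square del: of_real_power)
  then show ?thesis
    by (simp add: norm_vec_def L2_set_def sum_nonneg)
qed

lemma Re_trace_mult_conj_transpose: "Re (trace (X ** conj_transpose Y)) = X \<bullet> Y"
  by (simp add: trace_def matrix_mult_nth inner_vec_def inner_complex_def)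

lemma trace_skew_real:
  fixes X Y :: "'m::finite cmat"
  assumes "conj_transpose X = - X" "conj_transpose Y = - Y"
  shows "trace (X ** conj_transpose Y) = of_real (X \<bullet> Y)"
proof -
  have "cnj (trace (X ** conj_transpose Y)) = trace (Y ** conj_transpose X)"
    by (simp add: trace_conj_transpose[symmetric])
  also have "\<dots> = trace (conj_transpose X ** Y)"
    by (rule trace_mul_sym)
  also have "\<dots> = trace (X ** conj_transpose Y)"
    by (simp add: assms)
  finally have "Im (trace (X ** conj_transpose Y)) = 0"
    by (simp add: complex_eq_iff)
  then show ?thesis
    using Re_trace_mult_conj_transpose[of X Y] by (simp add: complex_eq_iff)
qed

text \<open>On skew-Hermitian matrices the trace form is \<open>c\<close> times the real Euclidean
  inner product (\<open>trace_skew_real\<close>), so a Euclidean orthonormal basis scaled by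
  \<open>1 / sqrt c\<close> is orthonormal in the required sense. This shows that the choice made in
  \<open>laplacian\<close> meets its specification.\<close>

lemma orthonormal_lie_basis_exists:
  fixes K :: "'m::finite cmat set"
  assumes sub: "subspace (lie_algebra K)" and c: "c > 0"
    and skew: "\<And>X. X \<in> lie_algebra K \<Longrightarrow> conj_transpose X = - X"
  shows "orthonormal_lie_basis c K (SOME B. orthonormal_lie_basis c K B)"
proof (rule someI_ex)
  obtain B where B: "B \<subseteq> lie_algebra K" "pairwise orthogonal B" "\<And>x. x \<in> B \<Longrightarrow> norm x = 1"
    "independent B" "span B = lie_algebra K"
    using orthonormal_basis_subspace[OF sub] by metis
  have fin: "finite B" using B(4) independent_bound by blast
  define s where "s = 1 / sqrt c"
  have s: "s \<noteq> 0" "c * s * s = 1" using c by (auto simp: s_def field_simps)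
  have sub': "(*\<^sub>R) s ` B \<subseteq> lie_algebra K"
    using B(1) sub by (auto intro: subspace_scale)
  have "orthonormal_lie_basis c K ((*\<^sub>R) s ` B)"
    unfolding orthonormal_lie_basis_def
  proof (intro conjI ballI)
    have "span ((*\<^sub>R) s ` B) = span B"
      using span_image_scale[of B "\<lambda>_. s"] fin s by simp
    then show "span ((*\<^sub>R) s ` B) = lie_algebra K" using B by simp
    fix X Y assume "X \<in> (*\<^sub>R) s ` B" "Y \<in> (*\<^sub>R) s ` B"
    then obtain x y where xy: "x \<in> B" "y \<in> B" "X = s *\<^sub>R x" "Y = s *\<^sub>R y" by auto
    have "trace (X ** conj_transpose Y) = of_real (X \<bullet> Y)"
      using xy sub' by (intro trace_skew_real skew) auto
    then have "lie_inner c X Y = of_real (c * s * s * (x \<bullet> y))"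
      using xy by (simp add: lie_inner_def)
    also have "x \<bullet> y = (if x = y then 1 else 0)"
      using xy B(2,3) by (auto simp: pairwise_def orthogonal_def power2_norm_eq_inner[symmetric])
    finally show "lie_inner c X Y = (if X = Y then 1 else 0)"
      using xy s by auto
  qed (use fin sub' in auto)
  then show "\<exists>B. orthonormal_lie_basis c K B" by blast
qed

text \<open>The sum is \<open>- 1 / c\<close> times the orthogonal projection of \<open>P + \<i> Q + R\<close> to the complexified
  Lie algebra, whence its independence of the basis.\<close>

lemma casimir_projection:
  fixes K :: "'m::finite cmat set"
  assumes B: "orthonormal_lie_basis c K B" and c: "c > 0"
    and skew: "\<And>X. X \<in> lie_algebra K \<Longrightarrow> conj_transpose X = - X"
    and PQ: "P \<in> lie_algebra K" "Q \<in> lie_algebra K"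
    and R: "\<And>X. X \<in> lie_algebra K \<Longrightarrow> trace (R ** X) = 0"
  shows "(\<Sum>X\<in>B. cscale (trace ((P + cscale \<i> Q + R) ** X)) X) = cscale (- 1 / of_real c) (P + cscale \<i> Q)"
proof -
  have fin: "finite B" and BL: "B \<subseteq> lie_algebra K" and span: "span B = lie_algebra K"
    and on: "\<And>X Y. X \<in> B \<Longrightarrow> Y \<in> B \<Longrightarrow> lie_inner c X Y = (if X = Y then 1 else 0)"
    using B by (auto simp: orthonormal_lie_basis_def)
  have key: "(\<Sum>X\<in>B. cscale (trace (P ** X)) X) = cscale (- 1 / of_real c) P" if P: "P \<in> lie_algebra K" for P
  proof -
    obtain u where u: "P = (\<Sum>X\<in>B. u X *\<^sub>R X)"
      using P span_finite[OF fin] span by auto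
    \<comment> \<open>Skewness gives \<open>trace (X ** Y)\<close> the sign opposite to the inner
      product; this is the source of the minus sign in every Casimir formula.\<close>
    have coeff: "trace (P ** Y) = - of_real (u Y) / of_real c" if Y: "Y \<in> B" for Y
    proof -
      have "trace (X ** Y) = (if X = Y then - 1 / of_real c else 0)" if "X \<in> B" for X
      proof -
        have "of_real c * - trace (X ** Y) = (if X = Y then 1 else 0)"
          using on[OF that Y] skew[of Y] BL Y by (simp add: lie_inner_def trace_minus subset_iff)
        then show ?thesis using c by (auto simp: field_simps minus_equation_iff split: if_splits)
      qed
      then have "(\<Sum>X\<in>B. of_real (u X) * trace (X ** Y)) = (\<Sum>X\<in>B. if X = Y then - of_real (u Y) / of_real c else 0)"
        by (intro sum.cong) auto
      then show ?thesis
        using Y fin by (simp add: u matrix_mult_sum_left trace_sum cscale_of_real[symmetric] trace_cscale)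
    qed
    then show ?thesis
      by (subst (2) u) (simp add: cscale_sum_right cscale_of_real[symmetric] coeff)
  qed
  have "trace ((P + cscale \<i> Q + R) ** X) = trace (P ** X) + \<i> * trace (Q ** X)" if "X \<in> B" for X
    using R[of X] BL that by (auto simp: matrix_add_rdistrib2 trace_add trace_cscale)
  then have "(\<Sum>X\<in>B. cscale (trace ((P + cscale \<i> Q + R) ** X)) X)
      = (\<Sum>X\<in>B. cscale (trace (P ** X)) X) + cscale \<i> (\<Sum>X\<in>B. cscale (trace (Q ** X)) X)"
    by (simp add: cscale_add_left sum.distrib cscale_sum_right)
  then show ?thesis
    by (simp add: key PQ cscale_add_right mult.commute)
qed

section \<open>Casimir tensors of the three Lie algebras\<close>

definition mat_unit :: "'m::finite \<Rightarrow> 'm \<Rightarrow> 'm cmat" where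
  "mat_unit a b = (\<chi> i j. if i = a \<and> j = b then 1 else 0)"

lemma trace_mat_unit: "trace (mat_unit b a ** X) = X $ a $ b"
proof -
  have "trace (mat_unit b a ** X) = (\<Sum>i\<in>UNIV. \<Sum>k\<in>UNIV. if k = a then if i = b then X $ k $ i else 0 else 0)"
    unfolding trace_def matrix_mult_nth mat_unit_def by (intro sum.cong) auto
  then show ?thesis by simp
qed

text \<open>Pairing with \<open>mat_unit b a\<close> reads off the entry \<open>X $ a $ b\<close>,
  so the values of \<open>T\<close> at matrix units are the Casimir tensor, the sum of all
  \<open>X $ a $ b * X $ e $ d\<close>; the sandwich is a contraction of this tensor.\<close>

lemma casimir_sandwich:
  fixes B :: "'m::finite cmat set"
  assumes "\<And>M. (\<Sum>X\<in>B. cscale (trace (M ** X)) X) = T M"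
  shows "(\<Sum>X\<in>B. X ** M ** X) $ a $ d = (\<Sum>b\<in>UNIV. \<Sum>e\<in>UNIV. M $ b $ e * T (mat_unit b a) $ e $ d)"
proof -
  have "(\<Sum>X\<in>B. X ** M ** X) $ a $ d = (\<Sum>X\<in>B. \<Sum>e\<in>UNIV. \<Sum>b\<in>UNIV. M $ b $ e * (X $ a $ b * X $ e $ d))"
    by (simp add: matrix_mult_nth sum_distrib_left sum_distrib_right mult_ac)
  also have "\<dots> = (\<Sum>b\<in>UNIV. \<Sum>e\<in>UNIV. \<Sum>X\<in>B. M $ b $ e * (X $ a $ b * X $ e $ d))"
    by (subst sum.swap, subst (2) sum.swap, subst sum.swap) (rule refl)
  also have "\<dots> = (\<Sum>b\<in>UNIV. \<Sum>e\<in>UNIV. M $ b $ e * T (mat_unit b a) $ e $ d)"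
    by (simp add: assms[symmetric] trace_mat_unit sum_distrib_left)
  finally show ?thesis .
qed

lemma trace_transpose: "trace (transpose A) = trace A"
  by (simp add: trace_def transpose_def)

lemma trace_mult_eq_0I:
  fixes R X :: "'m::finite cmat"
  assumes "trace (R ** X) = trace (- (X ** R))"
  shows "trace (R ** X) = 0"
  using assms trace_mul_sym[of X R] by (simp add: trace_minus)

lemma skew_hermitian_parts:
  fixes A :: "'m::finite cmat"
  defines "P \<equiv> cscale (1/2) (A - conj_transpose A)" and "Q \<equiv> cscale (1 / (2 * \<i>)) (A + conj_transpose A)"
  shows "A = P + cscale \<i> Q" "conj_transpose P = - P" "conj_transpose Q = - Q"
  by (simp_all add: vec_eq_iff P_def Q_def field_simps)

text \<open>The skew part of \<open>M\<close> is split into two elements of the real Lie algebra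
  (\<open>skew_hermitian_parts\<close>). The symmetric part \<open>R\<close> is trace-orthogonal to
  the Lie algebra, since transposition turns \<open>R ** X\<close> into \<open>- (X ** R)\<close>.
  The factor \<open>2\<close> in \<open>1 / c\<close> cancels the \<open>1 / 2\<close> of the skew
  part.\<close>

lemma SO_casimir:
  assumes B: "orthonormal_lie_basis (real CARD('n) / 2) (SO_real :: 'n::finite cmat set) B"
  shows "(\<Sum>X\<in>B. cscale (trace (M ** X)) X) = cscale (- 1 / of_nat CARD('n)) (M - transpose M)"
proof -
  define A where "A = cscale (1/2) (M - transpose M)"
  define P where "P = cscale (1/2) (A - conj_transpose A)"
  define Q where "Q = cscale (1 / (2 * \<i>)) (A + conj_transpose A)"
  define R where "R = cscale (1/2) (M + transpose M)"
  have "transpose A = - A"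
    by (simp add: A_def transpose_simps cscale_minus_right[symmetric])
  then have "P \<in> lie_algebra SO_real" "Q \<in> lie_algebra SO_real"
    using skew_hermitian_parts[of A] by (simp_all add: lie_algebra_SO_real P_def Q_def transpose_simps cscale_minus_right[symmetric])
  moreover have "trace (R ** X) = 0" if "X \<in> lie_algebra SO_real" for X
  proof (rule trace_mult_eq_0I)
    have "transpose R = R" by (simp add: R_def transpose_simps add.commute)
    then show "trace (R ** X) = trace (- (X ** R))"
      using that by (subst trace_transpose[symmetric]) (simp add: matrix_transpose_mul lie_algebra_SO_real)
  qed
  ultimately have "(\<Sum>X\<in>B. cscale (trace ((P + cscale \<i> Q + R) ** X)) X) =
      cscale (- 1 / of_real (real CARD('n) / 2)) (P + cscale \<i> Q)"
    using B by (intro casimir_projection) (auto simp: lie_algebra_SO_real)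
  moreover have "P + cscale \<i> Q = A"
    unfolding P_def Q_def by (rule skew_hermitian_parts(1)[symmetric])
  moreover have "A + R = M"
    by (simp add: A_def R_def vec_eq_iff field_simps)
  ultimately show ?thesis
    by (simp add: A_def)
qed

text \<open>The complexified Lie algebra consists of all trace-free matrices, so exactly the scalar
  part of \<open>M\<close> is projected away.\<close>

lemma SU_casimir:
  assumes B: "orthonormal_lie_basis (real CARD('n)) (SU :: 'n::finite cmat set) B"
  shows "(\<Sum>X\<in>B. cscale (trace (M ** X)) X) = cscale (- 1 / of_nat CARD('n)) (M - cscale (ntrace M) (mat 1))"
proof -
  define R :: "'n cmat" where "R = cscale (ntrace M) (mat 1)"
  define A where "A = M - R"
  define P where "P = cscale (1/2) (A - conj_transpose A)"
  define Q where "Q = cscale (1 / (2 * \<i>)) (A + conj_transpose A)"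
  have "trace A = 0"
    by (simp add: A_def R_def trace_sub trace_cscale trace_I ntrace_def)
  then have "P \<in> lie_algebra SU" "Q \<in> lie_algebra SU"
    using skew_hermitian_parts[of A]
    by (simp_all add: lie_algebra_SU P_def Q_def trace_cscale trace_sub trace_add trace_conj_transpose)
  moreover have "trace (R ** X) = 0" if "X \<in> lie_algebra SU" for X
    using that by (simp add: R_def trace_cscale lie_algebra_SU)
  ultimately have "(\<Sum>X\<in>B. cscale (trace ((P + cscale \<i> Q + R) ** X)) X) =
      cscale (- 1 / of_real (real CARD('n))) (P + cscale \<i> Q)"
    using B by (intro casimir_projection) (auto simp: lie_algebra_SU)
  moreover have "P + cscale \<i> Q = A"
    unfolding P_def Q_def by (rule skew_hermitian_parts(1)[symmetric])
  ultimately show ?thesis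
    by (simp add: A_def R_def)
qed

lemma Omega_simps:
  "transpose Omega = - (Omega :: ('n::finite \<times> bool) cmat)"
  "conj_transpose Omega = - (Omega :: ('n \<times> bool) cmat)"
  "Omega ** Omega = - (mat 1 :: ('n \<times> bool) cmat)"
proof -
  show "transpose Omega = - (Omega :: ('n::finite \<times> bool) cmat)"
    by (auto simp: vec_eq_iff transpose_def Omega_def)
  show "conj_transpose Omega = - (Omega :: ('n \<times> bool) cmat)"
    by (auto simp: vec_eq_iff Omega_def)
  \<comment> \<open>A row of \<open>Omega\<close> meets only the two indices of its own
    block.\<close>
  have "(\<Sum>k\<in>UNIV. Omega $ p $ k * Omega $ k $ q) = (\<Sum>k\<in>{(fst p, True), (fst p, False)}. Omega $ p $ k * Omega $ k $ q)"
    for p q :: "'n \<times> bool"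
    by (rule sum.mono_neutral_right) (auto simp: Omega_def prod_eq_iff)
  then show "Omega ** Omega = - (mat 1 :: ('n \<times> bool) cmat)"
    by (auto simp: vec_eq_iff matrix_mult_nth mat_1_nth Omega_def)
qed

text \<open>As \<open>Omega\<close> has inverse \<open>- Omega\<close>, this is the adjoint with
  respect to the bilinear form \<open>Omega\<close>. It takes over the role of transposition:
  \<open>Sp_complex\<close> becomes the set of matrices whose adjoint is their inverse, and the Lie
  algebra condition becomes \<open>symplectic_adjoint X = - X\<close>.\<close>

definition symplectic_adjoint :: "('n::finite \<times> bool) cmat \<Rightarrow> ('n \<times> bool) cmat" where
  "symplectic_adjoint M = - (Omega ** transpose M ** Omega)"

lemma symplectic_adjoint_simps:
  fixes M M' :: "('n::finite \<times> bool) cmat"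
  shows "symplectic_adjoint (M + M') = symplectic_adjoint M + symplectic_adjoint M'"
    and "symplectic_adjoint (M - M') = symplectic_adjoint M - symplectic_adjoint M'"
    and "symplectic_adjoint (cscale z M) = cscale z (symplectic_adjoint M)"
    and "symplectic_adjoint (- M) = - symplectic_adjoint M"
    and "symplectic_adjoint (M ** M') = symplectic_adjoint M' ** symplectic_adjoint M"
    and "symplectic_adjoint (symplectic_adjoint M) = M"
    and "symplectic_adjoint (conj_transpose M) = conj_transpose (symplectic_adjoint M)"
    and "trace (symplectic_adjoint M) = trace M"
proof -
  have OO1: "Omega ** (Omega ** A) = - A" for A :: "('n::finite \<times> bool) cmat"
    by (simp add: matrix_mul_assoc Omega_simps)
  have OO2: "A ** Omega ** Omega = - A" for A :: "('n::finite \<times> bool) cmat"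
    by (metis Omega_simps(3) matrix_mul_assoc matrix_mul_rid matrix_mult_minus(2))
  note OO = OO1 OO2
  show "symplectic_adjoint (M + M') = symplectic_adjoint M + symplectic_adjoint M'"
    "symplectic_adjoint (M - M') = symplectic_adjoint M - symplectic_adjoint M'"
    "symplectic_adjoint (cscale z M) = cscale z (symplectic_adjoint M)"
    "symplectic_adjoint (- M) = - symplectic_adjoint M"
    by (simp_all add: symplectic_adjoint_def transpose_simps matrix_add_ldistrib matrix_add_rdistrib2 matrix_mult_diff
        cscale_minus_right)
  show "symplectic_adjoint (M ** M') = symplectic_adjoint M' ** symplectic_adjoint M"
    by (simp add: symplectic_adjoint_def matrix_transpose_mul matrix_mul_assoc OO)
  show "symplectic_adjoint (symplectic_adjoint M) = M"
    by (simp add: symplectic_adjoint_def matrix_transpose_mul transpose_simps Omega_simps matrix_mul_assoc OO)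
  show "symplectic_adjoint (conj_transpose M) = conj_transpose (symplectic_adjoint M)"
    by (simp add: symplectic_adjoint_def transpose_simps Omega_simps matrix_mul_assoc)
  have "trace (Omega ** (transpose M ** Omega)) = trace (transpose M ** Omega ** Omega)"
    by (rule trace_mul_sym)
  then show "trace (symplectic_adjoint M) = trace M"
    by (simp add: symplectic_adjoint_def trace_minus matrix_mul_assoc OO trace_transpose)
qed

lemma symplectic_adjoint_eq_iff: "symplectic_adjoint X = - X \<longleftrightarrow> transpose X ** Omega + Omega ** X = 0"
proof -
  have OO: "Omega ** (Omega ** A) = - A" for A :: "('n::finite \<times> bool) cmat"
    by (simp add: matrix_mul_assoc Omega_simps)
  have "transpose X ** Omega + Omega ** X = 0 \<longleftrightarrow> Omega ** (transpose X ** Omega + Omega ** X) = 0"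
  proof
    assume "Omega ** (transpose X ** Omega + Omega ** X) = 0"
    then have "Omega ** (Omega ** (transpose X ** Omega + Omega ** X)) = 0"
      by (simp only: zero_matrix_mult)
    then show "transpose X ** Omega + Omega ** X = 0"
      by (simp only: OO neg_equal_0_iff_equal)
  qed simp
  also have "\<dots> \<longleftrightarrow> symplectic_adjoint X = - X"
    unfolding symplectic_adjoint_def matrix_add_ldistrib OO by (simp add: matrix_mul_assoc)
  finally show ?thesis by simp
qed

lemma Sp_casimir:
  assumes B: "orthonormal_lie_basis (real CARD('n)) (Sp_compact :: ('n::finite \<times> bool) cmat set) B"
  shows "(\<Sum>X\<in>B. cscale (trace (M ** X)) X) = cscale (- 1 / (2 * of_nat CARD('n))) (M - symplectic_adjoint M)"
proof -
  define A where "A = cscale (1/2) (M - symplectic_adjoint M)"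
  define P where "P = cscale (1/2) (A - conj_transpose A)"
  define Q where "Q = cscale (1 / (2 * \<i>)) (A + conj_transpose A)"
  define R where "R = cscale (1/2) (M + symplectic_adjoint M)"
  have L: "lie_algebra Sp_compact = {X :: ('n::finite \<times> bool) cmat. symplectic_adjoint X = - X \<and> conj_transpose X = - X}"
    by (simp add: lie_algebra_Sp_compact symplectic_adjoint_eq_iff)
  have "symplectic_adjoint A = - A"
    by (simp add: A_def symplectic_adjoint_simps cscale_minus_right[symmetric])
  then have "P \<in> lie_algebra Sp_compact" "Q \<in> lie_algebra Sp_compact"
    using skew_hermitian_parts[of A]
    by (simp_all add: L P_def Q_def symplectic_adjoint_simps cscale_minus_right[symmetric])
  moreover have "trace (R ** X) = 0" if "X \<in> lie_algebra Sp_compact" for X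
  proof (rule trace_mult_eq_0I)
    have "symplectic_adjoint R = R" by (simp add: R_def symplectic_adjoint_simps add.commute)
    then show "trace (R ** X) = trace (- (X ** R))"
      using that by (subst symplectic_adjoint_simps(8)[symmetric]) (simp add: L symplectic_adjoint_simps(1-7))
  qed
  ultimately have "(\<Sum>X\<in>B. cscale (trace ((P + cscale \<i> Q + R) ** X)) X) =
      cscale (- 1 / of_real (real CARD('n))) (P + cscale \<i> Q)"
    using B by (intro casimir_projection) (auto simp: L)
  moreover have "P + cscale \<i> Q = A"
    unfolding P_def Q_def by (rule skew_hermitian_parts(1)[symmetric])
  moreover have "A + R = M"
    by (simp add: A_def R_def vec_eq_iff field_simps)
  ultimately show ?thesis
    by (simp add: A_def mult.commute)
qed

section \<open>Sandwich sums over an orthonormal basis\<close>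

lemma sum_mat_unit:
  fixes M :: "'m::finite cmat"
  shows "(\<Sum>b\<in>UNIV. \<Sum>e\<in>UNIV. M $ b $ e * mat_unit b a $ e $ d) = trace M * mat 1 $ a $ d"
    and "(\<Sum>b\<in>UNIV. \<Sum>e\<in>UNIV. M $ b $ e * mat_unit b a $ d $ e) = M $ d $ a"
    and "(\<Sum>b\<in>UNIV. \<Sum>e\<in>UNIV. M $ b $ e * (trace (mat_unit b a) * mat 1 $ e $ d)) = M $ a $ d"
proof -
  have "(\<Sum>b\<in>UNIV. \<Sum>e\<in>UNIV. M $ b $ e * mat_unit b a $ e $ d) = (\<Sum>b\<in>UNIV. \<Sum>e\<in>UNIV. if e = b then M $ b $ e * mat 1 $ a $ d else 0)"
    by (intro sum.cong) (auto simp: mat_unit_def mat_1_nth)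
  then show "(\<Sum>b\<in>UNIV. \<Sum>e\<in>UNIV. M $ b $ e * mat_unit b a $ e $ d) = trace M * mat 1 $ a $ d"
    by (simp add: trace_def sum_distrib_right)
  have "(\<Sum>b\<in>UNIV. \<Sum>e\<in>UNIV. M $ b $ e * mat_unit b a $ d $ e) = (\<Sum>b\<in>UNIV. \<Sum>e\<in>UNIV. if e = a then if b = d then M $ b $ e else 0 else 0)"
    by (intro sum.cong) (auto simp: mat_unit_def)
  then show "(\<Sum>b\<in>UNIV. \<Sum>e\<in>UNIV. M $ b $ e * mat_unit b a $ d $ e) = M $ d $ a"
    by simp
  have tr: "trace (mat_unit b a) = (if b = a then 1 else 0 :: complex)" for b
    using trace_mat_unit[of b a "mat 1"] by (simp add: mat_1_nth eq_commute)
  have "(\<Sum>b\<in>UNIV. \<Sum>e\<in>UNIV. M $ b $ e * (trace (mat_unit b a) * mat 1 $ e $ d)) = (\<Sum>b\<in>UNIV. \<Sum>e\<in>UNIV. if e = d then if b = a then M $ b $ e else 0 else 0)"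
    by (intro sum.cong) (auto simp: tr mat_1_nth)
  then show "(\<Sum>b\<in>UNIV. \<Sum>e\<in>UNIV. M $ b $ e * (trace (mat_unit b a) * mat 1 $ e $ d)) = M $ a $ d"
    by simp
qed

lemma matrix_eqI: "(\<And>a b. A $ a $ b = B $ a $ b) \<Longrightarrow> A = (B :: 'm::finite cmat)"
  by (simp add: vec_eq_iff)

lemma SO_sandwich:
  assumes B: "orthonormal_lie_basis (real CARD('n) / 2) (SO_real :: 'n::finite cmat set) B"
  shows "(\<Sum>X\<in>B. X ** M ** X) = cscale (- ntrace M) (mat 1) + cscale (1 / of_nat CARD('n)) (transpose M)"
proof (rule matrix_eqI)
  fix a d
  have "(\<Sum>X\<in>B. X ** M ** X) $ a $ d = (- 1 / of_nat CARD('n)) *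
      ((\<Sum>b\<in>UNIV. \<Sum>e\<in>UNIV. M $ b $ e * mat_unit b a $ e $ d) - (\<Sum>b\<in>UNIV. \<Sum>e\<in>UNIV. M $ b $ e * mat_unit b a $ d $ e))"
    unfolding casimir_sandwich[OF SO_casimir[OF B]]
    by (simp add: transpose_def sum_subtractf sum_distrib_left sum_divide_distrib[symmetric] algebra_simps diff_divide_distrib sum_negf)
  then show "(\<Sum>X\<in>B. X ** M ** X) $ a $ d = (cscale (- ntrace M) (mat 1) + cscale (1 / of_nat CARD('n)) (transpose M)) $ a $ d"
    unfolding sum_mat_unit by (simp add: transpose_def ntrace_def field_simps)
qed

text \<open>The term in \<open>M\<close> comes from the trace removed in \<open>SU_casimir\<close>:
  one factor \<open>1 / N\<close> is the Casimir constant, the other the normalization of the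
  trace.\<close>

lemma SU_sandwich:
  assumes B: "orthonormal_lie_basis (real CARD('n)) (SU :: 'n::finite cmat set) B"
  shows "(\<Sum>X\<in>B. X ** M ** X) = cscale (- ntrace M) (mat 1) + cscale (1 / (of_nat CARD('n))\<^sup>2) M"
proof (rule matrix_eqI)
  fix a d
  have "(\<Sum>X\<in>B. X ** M ** X) $ a $ d = (- 1 / of_nat CARD('n)) *
      ((\<Sum>b\<in>UNIV. \<Sum>e\<in>UNIV. M $ b $ e * mat_unit b a $ e $ d)
       - (\<Sum>b\<in>UNIV. \<Sum>e\<in>UNIV. M $ b $ e * (trace (mat_unit b a) * mat 1 $ e $ d)) / of_nat CARD('n))"
    unfolding casimir_sandwich[OF SU_casimir[OF B]]
    by (simp add: ntrace_def sum_subtractf sum_distrib_left sum_divide_distrib[symmetric] algebra_simps diff_divide_distrib sum_negf)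
  then show "(\<Sum>X\<in>B. X ** M ** X) $ a $ d = (cscale (- ntrace M) (mat 1) + cscale (1 / (of_nat CARD('n))\<^sup>2) M) $ a $ d"
    unfolding sum_mat_unit by (simp add: ntrace_def field_simps power2_eq_square)
qed

lemma symplectic_adjoint_nth:
  "symplectic_adjoint M $ a $ d = (\<Sum>b\<in>UNIV. \<Sum>e\<in>UNIV. M $ b $ e * (Omega $ e $ a * Omega $ b $ d))"
proof -
  have "Omega $ a $ e = - (Omega $ e $ a)" for e
    by (auto simp: Omega_def)
  then show ?thesis
    by (simp add: symplectic_adjoint_def matrix_mult_nth transpose_def sum_distrib_right sum_distrib_left sum_negf mult_ac)
qed

text \<open>Contracting the adjoints of matrix units produces the adjoint of \<open>M\<close> with a
  minus sign, because \<open>Omega\<close> is antisymmetric, while transposition in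
  \<open>SO_sandwich\<close> keeps the sign. This is the origin of the opposite signs of
  \<open>al\<close> in the orthogonal and the symplectic case.\<close>

lemma Sp_sandwich:
  assumes B: "orthonormal_lie_basis (real CARD('n)) (Sp_compact :: ('n::finite \<times> bool) cmat set) B"
  shows "(\<Sum>X\<in>B. X ** M ** X) = cscale (- ntrace M) (mat 1) + cscale (- 1 / (2 * of_nat CARD('n))) (symplectic_adjoint M)"
proof (rule matrix_eqI)
  fix a d :: "'n \<times> bool"
  have unit: "symplectic_adjoint (mat_unit b a) $ e $ d = - (Omega $ e $ a * Omega $ b $ d)" for b e :: "'n \<times> bool"
  proof -
    have "symplectic_adjoint (mat_unit b a) $ e $ d = (\<Sum>p\<in>UNIV. \<Sum>q\<in>UNIV. if q = a then if p = b then Omega $ q $ e * Omega $ p $ d else 0 else 0)"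
      unfolding symplectic_adjoint_nth by (intro sum.cong) (auto simp: mat_unit_def)
    moreover have "Omega $ a $ e = - (Omega $ e $ a)"
      by (auto simp: Omega_def)
    ultimately show ?thesis by simp
  qed
  have "(\<Sum>X\<in>B. X ** M ** X) $ a $ d = (- 1 / (2 * of_nat CARD('n))) *
      ((\<Sum>b\<in>UNIV. \<Sum>e\<in>UNIV. M $ b $ e * mat_unit b a $ e $ d) + symplectic_adjoint M $ a $ d)"
    unfolding casimir_sandwich[OF Sp_casimir[OF B]] symplectic_adjoint_nth
    by (simp add: unit sum.distrib sum_subtractf sum_distrib_left sum_divide_distrib[symmetric] algebra_simps add_divide_distrib sum_negf)
  then show "(\<Sum>X\<in>B. X ** M ** X) $ a $ d = (cscale (- ntrace M) (mat 1) + cscale (- 1 / (2 * of_nat CARD('n))) (symplectic_adjoint M)) $ a $ d"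
    unfolding sum_mat_unit by (simp add: ntrace_def field_simps)
qed

section \<open>Linear operators on trace polynomials\<close>

abbreviation lookup where "lookup \<equiv> Poly_Mapping.lookup"
abbreviation keys where "keys \<equiv> Poly_Mapping.keys"
abbreviation single where "single \<equiv> Poly_Mapping.single"

definition tmono :: "monomial \<Rightarrow> trace_poly" where
  "tmono m = single m 1"

definition linear_op :: "(trace_poly \<Rightarrow> trace_poly) \<Rightarrow> bool" where
  "linear_op L \<longleftrightarrow> (\<forall>P Q. L (P + Q) = L P + L Q) \<and> (\<forall>c P. L (const c * P) = const c * L P)"

lemma const_simps:
  "const 0 = 0" "const 1 = 1" "const (a + b) = const a + const b" "const (a - b) = const a - const b"
  "const (- a) = - const a" "const a * const b = const (a * b)"
  by (simp_all add: const_def single_add single_diff single_uminus mult_single zero_prod_def[symmetric])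

lemma of_int_const: "of_int j = const (of_int j)" "numeral n = const (numeral n)"
  by (simp_all add: const_def zero_prod_def[symmetric])

lemma const_mult_single: "const c * single m x = single m (c * x)"
  by (simp add: const_def mult_single zero_prod_def[symmetric])

lemma lookup_const_mult: "lookup (const c * P) m = c * lookup P m"
proof -
  have "const c * P = Poly_Mapping.map ((*) c) P"
    by (simp add: mult_map_scale_conv_mult const_def zero_prod_def)
  then show ?thesis
    by (simp add: Poly_Mapping.map.rep_eq when_def)
qed

lemma sum_keys_superset:
  assumes "finite S" "keys P \<subseteq> S" "\<And>m. f 0 m = 0"
  shows "(\<Sum>m\<in>keys P. f (lookup P m) m) = (\<Sum>m\<in>S. f (lookup P m) m)"
  using assms by (intro sum.mono_neutral_left) (auto simp: in_keys_iff)

lemma linear_ext_superset: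
  "finite S \<Longrightarrow> keys P \<subseteq> S \<Longrightarrow> linear_ext \<phi> P = (\<Sum>m\<in>S. const (lookup P m) * \<phi> m)"
  unfolding linear_ext_def by (rule sum_keys_superset) (simp_all add: const_simps)

lemma linear_op_linear_ext: "linear_op (linear_ext \<phi>)"
  unfolding linear_op_def
proof (intro conjI allI)
  fix P Q :: trace_poly
  let ?S = "keys P \<union> keys Q"
  show "linear_ext \<phi> (P + Q) = linear_ext \<phi> P + linear_ext \<phi> Q"
    using keys_add[of P Q]
    by (simp add: linear_ext_superset[of ?S] lookup_add const_simps distrib_right sum.distrib)
next
  fix c and P :: trace_poly
  have "keys (const c * P) \<subseteq> keys P"
    by (auto simp: in_keys_iff lookup_const_mult)
  then show "linear_ext \<phi> (const c * P) = const c * linear_ext \<phi> P"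
    by (simp add: linear_ext_superset[of "keys P"] lookup_const_mult const_simps[symmetric] sum_distrib_left mult.assoc)
qed

lemma linear_ext_single: "linear_ext \<phi> (single m c) = const c * \<phi> m"
  using linear_ext_superset[of "{m}" "single m c" \<phi>] by (simp add: keys_single)

lemma linear_ext_mono [simp]: "linear_ext \<phi> (tmono m) = \<phi> m"
  by (simp add: tmono_def linear_ext_single const_simps)

lemma poly_mono_expansion: "P = (\<Sum>m\<in>keys P. const (lookup P m) * tmono m)"
  by (rule poly_mapping_eqI)
    (auto simp: lookup_sum const_mult_single tmono_def lookup_single when_def in_keys_iff sum.delta)

lemma linear_op_add: "linear_op L \<Longrightarrow> L (P + Q) = L P + L Q"
  and linear_op_const: "linear_op L \<Longrightarrow> L (const c * P) = const c * L P"
  by (simp_all add: linear_op_def)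

lemma linear_op_0: "linear_op L \<Longrightarrow> L 0 = 0"
  using linear_op_const[of L 0 0] by (simp add: const_simps)

lemma linear_op_sum: "linear_op L \<Longrightarrow> L (sum f S) = (\<Sum>i\<in>S. L (f i))"
  by (induction S rule: infinite_finite_induct) (simp_all add: linear_op_0 linear_op_add)

lemma linear_op_uminus: "linear_op L \<Longrightarrow> L (- P) = - L P"
  using linear_op_const[of L "-1" P] by (simp add: const_simps)

lemma linear_op_diff: "linear_op L \<Longrightarrow> L (P - Q) = L P - L Q"
  using linear_op_add[of L P "- Q"] by (simp add: linear_op_uminus)

lemma linear_op_expansion:
  assumes "linear_op L"
  shows "L P = (\<Sum>m\<in>keys P. const (lookup P m) * L (tmono m))"
  by (subst poly_mono_expansion) (simp add: linear_op_sum linear_op_const assms)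

lemma linear_op_eqI:
  assumes "linear_op L" "linear_op L'" "\<And>m. L (tmono m) = L' (tmono m)"
  shows "L P = L' P"
  unfolding linear_op_expansion[OF assms(1), of P] linear_op_expansion[OF assms(2), of P] by (simp add: assms(3))

named_theorems linear_op_intros

lemma linear_op_id [linear_op_intros]: "linear_op (\<lambda>P. P)"
  by (simp add: linear_op_def)

lemma linear_op_zero [linear_op_intros]: "linear_op (\<lambda>P. 0)"
  by (simp add: linear_op_def)

lemma linear_op_times [linear_op_intros]: "linear_op L \<Longrightarrow> linear_op (\<lambda>P. R * L P)"
  by (auto simp: linear_op_def algebra_simps)

lemma linear_op_plus [linear_op_intros]: "linear_op L \<Longrightarrow> linear_op L' \<Longrightarrow> linear_op (\<lambda>P. L P + L' P)"
  by (auto simp: linear_op_def algebra_simps)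

lemma linear_op_minus [linear_op_intros]: "linear_op L \<Longrightarrow> linear_op L' \<Longrightarrow> linear_op (\<lambda>P. L P - L' P)"
  by (auto simp: linear_op_def algebra_simps)

lemma linear_op_neg [linear_op_intros]: "linear_op L \<Longrightarrow> linear_op (\<lambda>P. - L P)"
  by (auto simp: linear_op_def algebra_simps)

lemma linear_op_compose: "linear_op L \<Longrightarrow> linear_op L' \<Longrightarrow> linear_op (\<lambda>P. L (L' P))"
  by (auto simp: linear_op_def)

lemma linear_op_when [linear_op_intros]: "linear_op L \<Longrightarrow> linear_op (\<lambda>P. L P when b)"
  by (auto simp: linear_op_def when_def)

lemma linear_op_Sum_any:
  assumes "\<And>k. linear_op (L k)" "\<And>P. finite {k. L k P \<noteq> 0}"
  shows "linear_op (\<lambda>P. Sum_any (\<lambda>k. L k P))"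
  unfolding linear_op_def
proof (intro conjI allI)
  fix P Q :: trace_poly and c
  show "Sum_any (\<lambda>k. L k (P + Q)) = Sum_any (\<lambda>k. L k P) + Sum_any (\<lambda>k. L k Q)"
    using Sum_any.distrib[OF assms(2)[of P] assms(2)[of Q]] by (simp add: linear_op_add[OF assms(1)])
  show "Sum_any (\<lambda>k. L k (const c * P)) = const c * Sum_any (\<lambda>k. L k P)"
    using Sum_any_right_distrib[OF assms(2)[of P], of "const c"] by (simp add: linear_op_const[OF assms(1)])
qed

section \<open>The elementary operators on monomials and their commutation rules\<close>

lemma linear_op_basic:
  "linear_op D_u" "linear_op (D_v k)" "linear_op R_plus" "linear_op R_minus"
  by (simp_all add: D_u_def D_v_def R_plus_def R_minus_def linear_op_linear_ext)

lemmas [linear_op_intros] = linear_op_basic[THEN linear_op_compose]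

lemma D_u_mono: "D_u (tmono (a, e)) = const (of_int a) * tmono (a - 1, e)"
  unfolding D_u_def linear_ext_mono by (simp add: tmono_def const_mult_single)

lemma D_v_mono: "D_v k (tmono (a, e)) = const (of_nat (lookup e k)) * tmono (a, e - single k 1)"
  unfolding D_v_def linear_ext_mono by (simp add: tmono_def const_mult_single)

lemma R_plus_mono: "R_plus (tmono (a, e)) = (if a \<ge> 0 then tmono (a, e) else 0)"
  by (simp add: R_plus_def) (simp add: tmono_def)

lemma R_minus_mono: "R_minus (tmono (a, e)) = (if a \<le> -1 then tmono (a, e) else 0)"
  by (simp add: R_minus_def) (simp add: tmono_def)

lemma mono_mult: "tmono m * tmono m' = tmono (m + m')"
  by (simp add: tmono_def mult_single)

lemma u_pow_mono: "u_pow a = tmono (a, 0)"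
  by (simp add: u_pow_def tmono_def)

lemma v_mono: "k \<noteq> 0 \<Longrightarrow> v k = tmono (0, single k 1)"
  by (simp add: v_def tmono_def)

lemma u_pow_mult_mono: "u_pow b * tmono (a, e) = tmono (b + a, e)"
  by (simp add: u_pow_mono mono_mult)

lemma u_pow_0: "u_pow 0 = 1"
  by (simp add: u_pow_def zero_prod_def[symmetric])

lemma u_pow_add: "u_pow a * u_pow b = u_pow (a + b)"
  by (simp add: u_pow_mono mono_mult)

lemma v_mult_mono: "k \<noteq> 0 \<Longrightarrow> v k * tmono (a, e) = tmono (a, single k 1 + e)"
  by (simp add: v_mono mono_mult)

lemma v_0 [simp]: "v 0 = 1"
  by (simp add: v_def)

lemma D_v_v_mult:
  assumes "k \<noteq> 0"
  shows "D_v j (v k * P) = v k * D_v j P + (P when j = k)"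
proof (rule linear_op_eqI[where P = P and L = "\<lambda>P. D_v j (v k * P)"])
  fix m :: monomial
  obtain a e where m: "m = (a, e)" by (cases m)
  show "D_v j (v k * tmono m) = v k * D_v j (tmono m) + (tmono m when j = k)"
  \<comment> \<open>Exponents are natural numbers with truncated subtraction: subtracting
    \<open>single j 1\<close> commutes with adding \<open>single k 1\<close> if \<open>v j\<close>
    occurs in the monomial; otherwise the coefficient of its derivative vanishes.\<close>
  proof (cases "lookup e j = 0")
    case True
    then show ?thesis
      by (auto simp: m v_mult_mono[OF assms] D_v_mono lookup_add lookup_single const_simps when_def)
  next
    case False
    then have "single k 1 + e - single j 1 = single k 1 + (e - single j 1)"
      by (intro poly_mapping_eqI) (auto simp: lookup_add lookup_minus lookup_single when_def)
    then show ?thesis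
      by (auto simp: m v_mult_mono[OF assms] D_v_mono lookup_add lookup_single const_simps when_def
          mult.left_commute[of "v k"] algebra_simps)
  qed
qed (auto intro!: linear_op_intros)

lemma v_mult_commutes:
  assumes "k \<noteq> 0"
  shows "D_u (v k * P) = v k * D_u P" "R_plus (v k * P) = v k * R_plus P" "R_minus (v k * P) = v k * R_minus P"
proof -
  show "D_u (v k * P) = v k * D_u P"
  proof (rule linear_op_eqI[where P = P and L = "\<lambda>P. D_u (v k * P)"])
    fix m :: monomial
    show "D_u (v k * tmono m) = v k * D_u (tmono m)"
      by (cases m) (simp add: v_mult_mono[OF assms] D_u_mono mult.left_commute[of "v k"])
  qed (auto intro!: linear_op_intros)
  show "R_plus (v k * P) = v k * R_plus P"
  proof (rule linear_op_eqI[where P = P and L = "\<lambda>P. R_plus (v k * P)"])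
    fix m :: monomial
    show "R_plus (v k * tmono m) = v k * R_plus (tmono m)"
      by (cases m) (simp add: v_mult_mono[OF assms] R_plus_mono)
  qed (auto intro!: linear_op_intros)
  show "R_minus (v k * P) = v k * R_minus P"
  proof (rule linear_op_eqI[where P = P and L = "\<lambda>P. R_minus (v k * P)"])
    fix m :: monomial
    show "R_minus (v k * tmono m) = v k * R_minus (tmono m)"
      by (cases m) (simp add: v_mult_mono[OF assms] R_minus_mono)
  qed (auto intro!: linear_op_intros)
qed

lemma D_u_D_v: "D_u (D_v k P) = D_v k (D_u P)"
proof (rule linear_op_eqI[where P = P and L = "\<lambda>P. D_u (D_v k P)"])
  fix m :: monomial
  show "D_u (D_v k (tmono m)) = D_v k (D_u (tmono m))"
    by (cases m) (simp add: D_v_mono D_u_mono linear_op_const[OF linear_op_basic(1)] linear_op_const[OF linear_op_basic(2)]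
        mult.left_commute)
qed (auto intro!: linear_op_intros)

lemma D_v_D_v: "D_v j (D_v k P) = D_v k (D_v j P)"
proof (cases "j = k")
  case False
  show ?thesis
  proof (rule linear_op_eqI[where P = P and L = "\<lambda>P. D_v j (D_v k P)"])
    fix m :: monomial
    have "e - single k 1 - single j 1 = e - single j 1 - single k (1::nat)" for e
      by (intro poly_mapping_eqI) (simp add: lookup_minus)
    then show "D_v j (D_v k (tmono m)) = D_v k (D_v j (tmono m))"
      using False by (cases m) (simp add: D_v_mono linear_op_const[OF linear_op_basic(2)]
          mult.left_commute lookup_minus lookup_single when_def)
  qed (auto intro!: linear_op_intros)
qed simp

text \<open>Only variables occurring in \<open>P\<close> have a nonzero derivative. This turns the
  infinite sums of \<open>v\<close>-derivatives into finite ones.\<close>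

lemma finite_D_v: "finite {k. D_v k P \<noteq> 0}"
proof (rule finite_subset)
  show "{k. D_v k P \<noteq> 0} \<subseteq> (\<Union>m\<in>keys P. keys (snd m))"
  proof
    fix k assume "k \<in> {k. D_v k P \<noteq> 0}"
    then have "(\<Sum>m\<in>keys P. const (lookup P m) * D_v k (tmono m)) \<noteq> 0"
      using linear_op_expansion[OF linear_op_basic(2), of k P] by simp
    then obtain m where m: "m \<in> keys P" "D_v k (tmono m) \<noteq> 0"
      by (metis (mono_tags, lifting) mult_zero_right sum.neutral)
    then have "lookup (snd m) k \<noteq> 0"
      by (cases m, cases "lookup (snd m) k = 0") (simp_all add: D_v_mono const_simps)
    then show "k \<in> (\<Union>m\<in>keys P. keys (snd m))"
      using m by (auto simp: in_keys_iff)
  qed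
qed auto

text \<open>Normal form for the \<open>v\<close>-derivative parts, with \<open>p\<close> restricting
  the index range. The operators in question differ only in their coefficients, so one product rule
  each for \<open>vop\<close> and \<open>vop2\<close> serves them all.\<close>

definition vop :: "(int \<Rightarrow> trace_poly) \<Rightarrow> (int \<Rightarrow> bool) \<Rightarrow> trace_poly \<Rightarrow> trace_poly" where
  "vop c p P = Sum_any (\<lambda>k. c k * D_v k P when p k)"

definition vop2 :: "(int \<Rightarrow> int \<Rightarrow> trace_poly) \<Rightarrow> (int \<Rightarrow> bool) \<Rightarrow> trace_poly \<Rightarrow> trace_poly" where
  "vop2 c p P = Sum_any (\<lambda>(j, k). c j k * D_v j (D_v k P) when p j \<and> p k)"

lemma vop_finite: "finite {k. (c k * D_v k P when p k) \<noteq> 0}"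
  by (rule finite_subset[OF _ finite_D_v[of P]]) auto

lemma vop_superset:
  assumes "finite S" "{k. D_v k P \<noteq> 0} \<subseteq> S"
  shows "vop c p P = (\<Sum>k\<in>S. c k * D_v k P when p k)"
  unfolding vop_def by (rule Sum_any.expand_superset) (use assms in auto)

lemma linear_op_vop [linear_op_intros]: "linear_op L \<Longrightarrow> linear_op (\<lambda>P. vop c p (L P))"
proof (rule linear_op_compose[of "vop c p"])
  show "linear_op (vop c p)"
    unfolding vop_def by (intro linear_op_Sum_any linear_op_intros vop_finite)
qed

lemma D_v_D_v_nonzero: "D_v j (D_v k P) \<noteq> 0 \<Longrightarrow> D_v j P \<noteq> 0 \<and> D_v k P \<noteq> 0"
  by (metis D_v_D_v linear_op_0 linear_op_basic(2))

lemma vop2_support: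
  "{jk. (case jk of (j, k) \<Rightarrow> c j k * D_v j (D_v k P) when p j \<and> p k) \<noteq> 0} \<subseteq> {k. D_v k P \<noteq> 0} \<times> {k. D_v k P \<noteq> 0}"
proof
  fix jk assume *: "jk \<in> {jk. (case jk of (j, k) \<Rightarrow> c j k * D_v j (D_v k P) when p j \<and> p k) \<noteq> 0}"
  obtain j k where jk: "jk = (j, k)" by (cases jk)
  have "(c j k * D_v j (D_v k P) when p j \<and> p k) \<noteq> 0" using * by (simp add: jk)
  then have "D_v j (D_v k P) \<noteq> 0" by (metis mult_zero_right zero_when)
  from D_v_D_v_nonzero[OF this] show "jk \<in> {k. D_v k P \<noteq> 0} \<times> {k. D_v k P \<noteq> 0}"
    by (simp add: jk)
qed

lemma vop2_superset:
  assumes "finite S" "{k. D_v k P \<noteq> 0} \<subseteq> S"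
  shows "vop2 c p P = (\<Sum>j\<in>S. \<Sum>k\<in>S. c j k * D_v j (D_v k P) when p j \<and> p k)"
proof -
  have "vop2 c p P = (\<Sum>(j, k)\<in>S \<times> S. c j k * D_v j (D_v k P) when p j \<and> p k)"
    unfolding vop2_def
  proof (rule Sum_any.expand_superset)
    show "{a. (case a of (j, k) \<Rightarrow> c j k * D_v j (D_v k P) when p j \<and> p k) \<noteq> 0} \<subseteq> S \<times> S"
      by (rule subset_trans[OF vop2_support]) (use assms(2) in blast)
  qed (use assms in auto)
  then show ?thesis by (simp add: sum.cartesian_product)
qed

lemma linear_op_vop2 [linear_op_intros]: "linear_op L \<Longrightarrow> linear_op (\<lambda>P. vop2 c p (L P))"
proof (rule linear_op_compose[of "vop2 c p"])
  have "finite {jk. (case jk of (j, k) \<Rightarrow> c j k * D_v j (D_v k P) when p j \<and> p k) \<noteq> 0}" for P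
    by (rule finite_subset[OF vop2_support finite_cartesian_product[OF finite_D_v finite_D_v]])
  then show "linear_op (vop2 c p)"
    unfolding vop2_def by (intro linear_op_Sum_any) (auto split: prod.split intro!: linear_op_intros)
qed

lemma vop_v_mult:
  assumes "k \<noteq> 0"
  shows "vop c p (v k * P) = v k * vop c p P + (c k * P when p k)"
proof -
  let ?S = "insert k {j. D_v j P \<noteq> 0}"
  have S: "finite ?S" using finite_D_v by simp
  have sub: "{j. D_v j (v k * P) \<noteq> 0} \<subseteq> ?S"
    by (auto simp: D_v_v_mult[OF assms] when_def)
  have "vop c p (v k * P) = (\<Sum>j\<in>?S. v k * (c j * D_v j P when p j) + (if j = k then c k * P when p k else 0))"
    unfolding vop_superset[OF S sub]
    by (intro sum.cong) (auto simp: D_v_v_mult[OF assms] when_def distrib_left mult.left_commute add_ac)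
  also have "\<dots> = v k * (\<Sum>j\<in>?S. c j * D_v j P when p j) + (c k * P when p k)"
    using S by (simp only: sum.distrib sum_distrib_left[symmetric] sum.delta) simp
  finally show ?thesis
    using vop_superset[OF S, of P c p] by (simp add: subset_insertI)
qed

text \<open>The second-order product rule leaves two first-order operators, one for each of the two
  derivatives that may fall on \<open>v k\<close>; they are kept apart since \<open>c\<close> need
  not be symmetric.\<close>

lemma vop2_v_mult:
  assumes "k \<noteq> 0" "p k"
  shows "vop2 c p (v k * P) = v k * vop2 c p P + vop (\<lambda>j. c j k) p P + vop (\<lambda>j. c k j) p P"
proof -
  let ?S = "insert k {j. D_v j P \<noteq> 0}"
  have S: "finite ?S" using finite_D_v by simp
  have sub: "{j. D_v j (v k * P) \<noteq> 0} \<subseteq> ?S"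
    by (auto simp: D_v_v_mult[OF assms(1)] when_def)
  have sub': "{j. D_v j P \<noteq> 0} \<subseteq> ?S" by auto
  have D2: "D_v i (D_v j (v k * P)) = v k * D_v i (D_v j P) + (D_v j P when i = k) + (D_v i P when j = k)" for i j
    by (simp add: D_v_v_mult[OF assms(1)] linear_op_add[OF linear_op_basic(2)] linear_op_0[OF linear_op_basic(2)] when_def distrib_left mult.left_commute add_ac)
  have "vop2 c p (v k * P) = (\<Sum>i\<in>?S. \<Sum>j\<in>?S. v k * (c i j * D_v i (D_v j P) when p i \<and> p j)
      + (if i = k then c k j * D_v j P when p j else 0) + (if j = k then c i k * D_v i P when p i else 0))"
    unfolding vop2_superset[OF S sub]
    by (intro sum.cong) (use assms(2) in \<open>auto simp: D2 when_def distrib_left mult.left_commute add_ac\<close>)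
  also have "\<dots> = v k * (\<Sum>i\<in>?S. \<Sum>j\<in>?S. c i j * D_v i (D_v j P) when p i \<and> p j)
      + (\<Sum>j\<in>?S. c k j * D_v j P when p j) + (\<Sum>i\<in>?S. c i k * D_v i P when p i)"
  proof -
    have "(\<Sum>i\<in>?S. \<Sum>j\<in>?S. if i = k then c k j * D_v j P when p j else 0) = (\<Sum>j\<in>?S. c k j * D_v j P when p j)"
      by (subst sum.swap) (use S in \<open>simp only: sum.delta insertI1 if_True\<close>)
    moreover have "(\<Sum>i\<in>?S. \<Sum>j\<in>?S. if j = k then c i k * D_v i P when p i else 0) = (\<Sum>i\<in>?S. c i k * D_v i P when p i)"
      using S by (simp only: sum.delta insertI1 if_True)
    ultimately show ?thesis
      by (simp only: sum.distrib sum_distrib_left)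
  qed
  finally show ?thesis
    using vop_superset[OF S sub', of "\<lambda>j. c j k" p] vop_superset[OF S sub', of "\<lambda>j. c k j" p] vop2_superset[OF S sub', of c p]
    by (simp add: add_ac)
qed

lemma vop_u_pow: "vop c p (u_pow a) = 0" "vop2 c2 p (u_pow a) = 0"
proof -
  have "D_v k (u_pow a) = 0" for k by (simp add: u_pow_mono D_v_mono const_simps)
  then show "vop c p (u_pow a) = 0" "vop2 c2 p (u_pow a) = 0"
    using vop_superset[of "{}"] vop2_superset[of "{}"] by simp_all
qed

definition E_plus :: "int \<Rightarrow> trace_poly \<Rightarrow> trace_poly" where
  "E_plus k P = R_plus (D_u (u_pow (- k) * R_plus P))"

definition E_minus :: "int \<Rightarrow> trace_poly \<Rightarrow> trace_poly" where
  "E_minus k P = R_minus (D_u (u_pow (- k) * R_minus P))"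

lemma E_plus_mono:
  assumes "k \<ge> 1"
  shows "E_plus k (tmono (a, e)) = (if k < a then const (of_int (a - k)) * tmono (a - k - 1, e) else 0)"
  using assms
  by (auto simp: E_plus_def R_plus_mono u_pow_mult_mono D_u_mono linear_op_const[OF linear_op_basic(3)] linear_op_0[OF linear_op_basic(3)]
      linear_op_0[OF linear_op_basic(1)] algebra_simps)

lemma E_minus_mono:
  assumes "k \<le> -1"
  shows "E_minus k (tmono (a, e)) = (if a < k then const (of_int (a - k)) * tmono (a - k - 1, e) else 0)"
proof (cases "a \<le> -1")
  case True
  have "E_minus k (tmono (a, e)) = const (of_int (a - k)) * R_minus (tmono (a - k - 1, e))"
    using True by (simp add: E_minus_def R_minus_mono u_pow_mult_mono D_u_mono linear_op_const[OF linear_op_basic(4)] del: of_int_diff)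
  \<comment> \<open>For \<open>a = k\<close> the exponent is \<open>- 1\<close> and survives
    \<open>R_minus\<close>, but its coefficient \<open>a - k\<close> is \<open>0\<close>; hence the
    strict inequality.\<close>
  then show ?thesis
    by (cases "a = k") (auto simp: R_minus_mono const_simps(1) simp del: of_int_diff)
next
  case False
  then show ?thesis
    using assms by (auto simp: E_minus_def R_minus_mono linear_op_0[OF linear_op_basic(4)] linear_op_0[OF linear_op_basic(1)])
qed

lemma linear_op_E: "linear_op (E_plus k)" "linear_op (E_minus k)"
  unfolding E_plus_def E_minus_def by (intro linear_op_intros)+

lemma E_v_mult: "j \<noteq> 0 \<Longrightarrow> E_plus k (v j * P) = v j * E_plus k P" "j \<noteq> 0 \<Longrightarrow> E_minus k (v j * P) = v j * E_minus k P"
  by (simp_all add: E_plus_def E_minus_def v_mult_commutes mult.left_commute[of _ "v j"])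

lemma finite_E_plus: "finite {k. (c k * E_plus k P when k \<ge> 1) \<noteq> 0}"
proof (rule finite_subset)
  show "{k. (c k * E_plus k P when k \<ge> 1) \<noteq> 0} \<subseteq> (\<Union>m\<in>keys P. {1..fst m})"
  proof
    fix k assume "k \<in> {k. (c k * E_plus k P when k \<ge> 1) \<noteq> 0}"
    then have k: "k \<ge> 1" "E_plus k P \<noteq> 0" by (auto simp: when_def split: if_splits)
    then have "(\<Sum>m\<in>keys P. const (lookup P m) * E_plus k (tmono m)) \<noteq> 0"
      using linear_op_expansion[OF linear_op_E(1), of k P] by simp
    then obtain m where m: "m \<in> keys P" "E_plus k (tmono m) \<noteq> 0"
      by (metis (mono_tags, lifting) mult_zero_right sum.neutral)
    then have "k < fst m" using k by (cases m) (auto simp: E_plus_mono split: if_splits)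
    then show "k \<in> (\<Union>m\<in>keys P. {1..fst m})"
      using m k by force
  qed
qed auto

lemma finite_E_minus: "finite {k. (c k * E_minus k P when k \<le> -1) \<noteq> 0}"
proof (rule finite_subset)
  show "{k. (c k * E_minus k P when k \<le> -1) \<noteq> 0} \<subseteq> (\<Union>m\<in>keys P. {fst m..-1})"
  proof
    fix k assume "k \<in> {k. (c k * E_minus k P when k \<le> -1) \<noteq> 0}"
    then have k: "k \<le> -1" "E_minus k P \<noteq> 0" by (auto simp: when_def split: if_splits)
    then have "(\<Sum>m\<in>keys P. const (lookup P m) * E_minus k (tmono m)) \<noteq> 0"
      using linear_op_expansion[OF linear_op_E(2), of k P] by simp
    then obtain m where m: "m \<in> keys P" "E_minus k (tmono m) \<noteq> 0"
      by (metis (mono_tags, lifting) mult_zero_right sum.neutral)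
    then have "fst m < k" using k by (cases m) (auto simp: E_minus_mono split: if_splits)
    then show "k \<in> (\<Union>m\<in>keys P. {fst m..-1})"
      using m k by force
  qed
qed auto

text \<open>The common shape of \<open>Y1_op\<close> and \<open>Z2_op\<close>. It commutes with
  multiplication by \<open>v k\<close> (\<open>uop_v_mult\<close>), so on \<open>trace_polys\<close>
  it is determined by its values on powers of \<open>u\<close>.\<close>

definition uop :: "(int \<Rightarrow> trace_poly) \<Rightarrow> trace_poly \<Rightarrow> trace_poly" where
  "uop c P = Sum_any (\<lambda>k. c k * E_plus k P when k \<ge> 1) - Sum_any (\<lambda>k. c k * E_minus k P when k \<le> -1)"

lemma linear_op_uop [linear_op_intros]: "linear_op (uop c)"
  unfolding uop_def
  by (intro linear_op_minus linear_op_Sum_any linear_op_when linear_op_times linear_op_E finite_E_plus finite_E_minus)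

lemma uop_v_mult: "k \<noteq> 0 \<Longrightarrow> uop c (v k * P) = v k * uop c P"
  unfolding uop_def
  by (simp add: right_diff_distrib Sum_any_right_distrib[OF finite_E_plus] Sum_any_right_distrib[OF finite_E_minus]
      E_v_mult mult_when mult.left_commute[of "v k"])

lemma uop_u_pow:
  "uop c (u_pow a) = (\<Sum>k\<in>{1..a - 1}. const (of_int (a - k)) * c k * u_pow (a - k - 1))
     - (\<Sum>k\<in>{a + 1..-1}. const (of_int (a - k)) * c k * u_pow (a - k - 1))"
proof -
  have 1: "Sum_any (\<lambda>k. c k * E_plus k (u_pow a) when k \<ge> 1) = (\<Sum>k\<in>{1..a - 1}. c k * E_plus k (u_pow a) when k \<ge> 1)"
    by (rule Sum_any.expand_superset) (auto simp: u_pow_mono when_def E_plus_mono split: if_splits)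
  have 2: "Sum_any (\<lambda>k. c k * E_minus k (u_pow a) when k \<le> -1) = (\<Sum>k\<in>{a + 1..-1}. c k * E_minus k (u_pow a) when k \<le> -1)"
    by (rule Sum_any.expand_superset) (auto simp: u_pow_mono when_def E_minus_mono split: if_splits)
  show ?thesis
    unfolding uop_def 1 2 unfolding u_pow_mono
    by (intro arg_cong2[where f = "(-)"] sum.cong) (auto simp: E_plus_mono E_minus_mono when_def mult_ac)
qed

section \<open>Evaluation of trace polynomials\<close>

definition tmono_eval :: "'m::finite cmat \<Rightarrow> monomial \<Rightarrow> 'm cmat" where
  "tmono_eval A m = cscale (\<Prod>k\<in>keys (snd m). ntrace (mat_powi A k) ^ lookup (snd m) k) (mat_powi A (fst m))"

lemma trace_eval_superset:
  assumes "finite S" "keys P \<subseteq> S"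
  shows "trace_eval P A = (\<Sum>m\<in>S. cscale (lookup P m) (tmono_eval A m))"
proof -
  have "trace_eval P A = (\<Sum>m\<in>keys P. cscale (lookup P m) (tmono_eval A m))"
    unfolding trace_eval_def tmono_eval_def by (intro sum.cong) (auto split: prod.split)
  also have "\<dots> = (\<Sum>m\<in>S. cscale (lookup P m) (tmono_eval A m))"
    using assms by (intro sum.mono_neutral_left) (auto simp: in_keys_iff)
  finally show ?thesis .
qed

lemma trace_eval_add: "trace_eval (P + Q) A = trace_eval P A + trace_eval Q A"
proof -
  let ?S = "keys P \<union> keys Q"
  show ?thesis
    using keys_add[of P Q]
    by (simp add: trace_eval_superset[of ?S] lookup_add cscale_add_left sum.distrib)
qed

lemma trace_eval_const_mult: "trace_eval (const c * P) A = cscale c (trace_eval P A)"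
proof -
  have "keys (const c * P) \<subseteq> keys P"
    by (auto simp: in_keys_iff lookup_const_mult)
  then show ?thesis
    by (simp add: trace_eval_superset[of "keys P"] lookup_const_mult cscale_sum_right)
qed

lemma trace_eval_0: "trace_eval 0 A = 0"
  by (simp add: trace_eval_def)

lemma trace_eval_uminus: "trace_eval (- P) A = - trace_eval P A"
  using trace_eval_const_mult[of "-1" P A] by (simp add: const_simps cscale_minus_left)

lemma trace_eval_diff: "trace_eval (P - Q) A = trace_eval P A - trace_eval Q A"
  using trace_eval_add[of P "- Q" A] by (simp add: trace_eval_uminus)

lemma trace_eval_sum: "trace_eval (sum f S) A = (\<Sum>i\<in>S. trace_eval (f i) A)"
  by (induction S rule: infinite_finite_induct) (simp_all add: trace_eval_0 trace_eval_add)

lemma trace_eval_tmono: "trace_eval (tmono m) A = tmono_eval A m"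
  using trace_eval_superset[of "{m}" "tmono m" A] by (simp add: tmono_def)

lemma tmono_eval_add:
  assumes "invertible A"
  shows "tmono_eval A (m + m') = tmono_eval A m ** tmono_eval A m'"
proof -
  define f where "f e k = ntrace (mat_powi A k) ^ lookup e k" for e :: "int \<Rightarrow>\<^sub>0 nat" and k
  let ?S = "keys (snd m) \<union> keys (snd m')"
  have *: "(\<Prod>k\<in>keys e. f e k) = (\<Prod>k\<in>?S. f e k)" if "keys e \<subseteq> ?S" for e
    using that by (intro prod.mono_neutral_left) (auto simp: f_def in_keys_iff)
  have "(\<Prod>k\<in>keys (snd (m + m')). f (snd (m + m')) k) = (\<Prod>k\<in>?S. f (snd (m + m')) k)"
    using keys_add[of "snd m" "snd m'"] by (intro *) simp
  also have "\<dots> = (\<Prod>k\<in>?S. f (snd m) k) * (\<Prod>k\<in>?S. f (snd m') k)"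
    by (simp add: f_def lookup_add power_add prod.distrib)
  also have "\<dots> = (\<Prod>k\<in>keys (snd m). f (snd m) k) * (\<Prod>k\<in>keys (snd m'). f (snd m') k)"
    by (subst (1 2) *) simp_all
  finally show ?thesis
    by (simp add: tmono_eval_def f_def mat_powi_add[OF assms] mult.commute)
qed

text \<open>The \<open>v\<close>-factors become scalars, which commute with everything, and
  invertibility of \<open>A\<close> makes its integer powers additive in the exponent.\<close>

lemma trace_eval_mult:
  assumes "invertible A"
  shows "trace_eval (P * Q) A = trace_eval P A ** trace_eval Q A"
proof -
  have 1: "trace_eval (tmono m * Q) A = tmono_eval A m ** trace_eval Q A" for m
  proof -
    have "tmono m * Q = (\<Sum>m'\<in>keys Q. const (lookup Q m') * tmono (m + m'))"
      by (subst poly_mono_expansion[of Q]) (simp add: sum_distrib_left mult.left_commute[of "tmono m"] mono_mult)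
    then show ?thesis
      by (simp add: trace_eval_sum trace_eval_const_mult trace_eval_tmono tmono_eval_add[OF assms]
        trace_eval_superset[of "keys Q" Q] matrix_mult_sum_right)
  qed
  have "P * Q = (\<Sum>m\<in>keys P. const (lookup P m) * (tmono m * Q))"
    by (subst poly_mono_expansion[of P]) (simp add: sum_distrib_right mult.assoc)
  then show ?thesis
    by (simp add: trace_eval_sum trace_eval_const_mult 1 trace_eval_superset[of "keys P" P] matrix_mult_sum_left)
qed

lemma trace_eval_u_pow: "trace_eval (u_pow a) A = mat_powi A a"
  by (simp add: u_pow_mono trace_eval_tmono tmono_eval_def)

lemma trace_eval_const: "trace_eval (const c) A = cscale c (mat 1)"
  using trace_eval_const_mult[of c "u_pow 0" A] by (simp add: trace_eval_u_pow) (simp add: u_pow_0)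

lemma trace_eval_v: "trace_eval (v k) A = cscale (ntrace (mat_powi A k)) (mat 1)"
proof (cases "k = 0")
  case True
  then show ?thesis using trace_eval_const[of 1 A] by (simp add: const_simps ntrace_simps)
next
  case False
  then show ?thesis by (simp add: v_mono trace_eval_tmono tmono_eval_def)
qed

section \<open>The intertwining operator\<close>

text \<open>The operators \<open>\<D>\<^sub>N\<close> of all three series are instances.\<close>

definition D_gen :: "complex \<Rightarrow> complex \<Rightarrow> complex \<Rightarrow> complex \<Rightarrow> trace_poly \<Rightarrow> trace_poly" where
  "D_gen al cp cm g P = L0_op P + const al * (N_op P + 2 * Z1_op P + 2 * Z2_op P)
     + const cp * (2 * K1_plus P + K2_plus P) - const cm * (2 * K1_minus P + K2_minus P) + const g * J_op P"

definition nz :: "int \<Rightarrow> bool" where "nz k \<longleftrightarrow> \<bar>k\<bar> \<ge> 1"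

text \<open>The value of \<open>Y2_op\<close> at \<open>v k\<close>, as \<open>z_coeff k\<close> is
  that of \<open>Z1_op\<close>. For each sign of \<open>k\<close> one of the two ranges is empty,
  and both are empty if \<open>\<bar>k\<bar> \<le> 1\<close>.\<close>

definition y_coeff :: "int \<Rightarrow> trace_poly" where
  "y_coeff k = (\<Sum>j = 1..k - 1. of_int j * v j * v (k - j)) - (\<Sum>j = k + 1..-1. of_int j * v j * v (k - j))"

definition z_coeff :: "int \<Rightarrow> trace_poly" where
  "z_coeff k = (\<Sum>j = 1..k - 1. of_int (k - j) * v (k - 2 * j)) - (\<Sum>j = k + 1..-1. of_int (k - j) * v (k - 2 * j))"

text \<open>The derivations that arise as commutators of the second-order operators with
  \<open>v k\<close>. Under evaluation, combinations of them give the derivative in the direction of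
  a Casimir sum of \<open>tr(A^k X) X\<close>, see \<open>grad_all\<close>.\<close>

definition grad :: "(int \<Rightarrow> trace_poly) \<Rightarrow> int \<Rightarrow> trace_poly \<Rightarrow> trace_poly" where
  "grad c b P = u_pow b * D_u P + vop (\<lambda>j. of_int j * c j) nz P"

lemma nz_iff: "nz k \<longleftrightarrow> k \<noteq> 0" by (auto simp: nz_def)

lemma ops_vop:
  "N_op P = vop (\<lambda>k. of_int \<bar>k\<bar> * v k) nz P + u_pow 1 * D_u (R_plus P - R_minus P)"
  "Y1_op P = uop (\<lambda>k. v k * u_pow 1) P"
  "Y2_op P = vop (\<lambda>k. \<Sum>j = 1..k - 1. of_int j * v j * v (k - j)) (\<lambda>k. k \<ge> 2) P
    - vop (\<lambda>k. \<Sum>j = k + 1..-1. of_int j * v j * v (k - j)) (\<lambda>k. k \<le> -2) P"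
  "Z1_op P = vop (\<lambda>k. \<Sum>j = 1..k - 1. of_int (k - j) * v (k - 2 * j)) (\<lambda>k. k \<ge> 2) P
    - vop (\<lambda>k. \<Sum>j = k + 1..-1. of_int (k - j) * v (k - 2 * j)) (\<lambda>k. k \<le> -2) P"
  "Z2_op P = uop (\<lambda>k. u_pow (- k + 1)) P"
  "K1_plus P = vop (\<lambda>k. of_int k * u_pow (- k + 1)) nz (D_u P)"
  "K1_minus P = vop (\<lambda>k. of_int k * u_pow (k + 1)) nz (D_u P)"
  "K2_plus P = vop2 (\<lambda>j k. of_int (j * k) * v (k - j)) nz P"
  "K2_minus P = vop2 (\<lambda>j k. of_int (j * k) * v (k + j)) nz P"
  "J_op P = 2 * vop (\<lambda>k. of_int k * u_pow 1 * v k) nz (D_u P) + vop2 (\<lambda>j k. of_int (j * k) * v j * v k) nz P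
     + vop (\<lambda>k. of_int (k\<^sup>2) * v k) nz P + u_pow 2 * D_u (D_u P) + u_pow 1 * D_u P"
  by (simp_all only: N_op_def Y1_op_def Y2_op_def Z1_op_def Z2_op_def K1_plus_def K1_minus_def K2_plus_def
      K2_minus_def J_op_def vop_def vop2_def uop_def E_plus_def E_minus_def nz_def D_u_D_v)

lemma linear_op_D_gen [linear_op_intros]: "linear_op (D_gen al cp cm g)"
  unfolding D_gen_def L0_op_def ops_vop
  by (intro linear_op_intros)

lemma vop_scale: "vop (\<lambda>j. R * c j) p P = R * vop c p P"
proof -
  have "{k. D_v k P \<noteq> 0} \<subseteq> {k. D_v k P \<noteq> 0}" by simp
  note * = vop_superset[OF finite_D_v[of P] this]
  show ?thesis unfolding * by (simp add: sum_distrib_left mult_when mult.assoc)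
qed

text \<open>All operators have order at most two in the \<open>v\<close>-variables. Multiplication
  by \<open>v k\<close> therefore adds the value at \<open>v k\<close> and, for the second-order
  ones, a derivation of type \<open>grad\<close>. The factor \<open>2\<close> in front of
  \<open>K1_plus\<close> and \<open>K1_minus\<close> lets the mixed
  \<open>u\<close>-\<open>v\<close> part and the pure \<open>v\<close> part combine into such
  derivations.\<close>

lemma ops_v_mult:
  assumes k: "k \<noteq> 0"
  shows "N_op (v k * P) = v k * N_op P + of_int \<bar>k\<bar> * v k * P"
    and "Y1_op (v k * P) = v k * Y1_op P"
    and "Y2_op (v k * P) = v k * Y2_op P + y_coeff k * P"
    and "Z1_op (v k * P) = v k * Z1_op P + z_coeff k * P"
    and "Z2_op (v k * P) = v k * Z2_op P"
    and "2 * K1_plus (v k * P) + K2_plus (v k * P) = v k * (2 * K1_plus P + K2_plus P)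
      + of_int k * (grad (\<lambda>j. v (k - j)) (1 - k) P + grad (\<lambda>j. v (j - k)) (1 - k) P)"
    and "2 * K1_minus (v k * P) + K2_minus (v k * P) = v k * (2 * K1_minus P + K2_minus P)
      + of_int k * (2 * grad (\<lambda>j. v (k + j)) (1 + k) P)"
    and "J_op (v k * P) = v k * J_op P + of_int (k\<^sup>2) * v k * P + of_int k * (2 * (v k * grad v 1 P))"
proof -
  note vm = vop_v_mult[OF k] vop2_v_mult[OF k] uop_v_mult[OF k] v_mult_commutes[OF k]
  have nzk: "nz k" using k by (simp add: nz_iff)
  show "N_op (v k * P) = v k * N_op P + of_int \<bar>k\<bar> * v k * P"
    by (simp add: ops_vop vm nzk linear_op_diff[OF linear_op_basic(1)] distrib_left right_diff_distrib mult.left_commute[of "v k"])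
  show "Y1_op (v k * P) = v k * Y1_op P" "Z2_op (v k * P) = v k * Z2_op P"
    by (simp_all add: ops_vop vm)
  \<comment> \<open>For \<open>k < 2\<close>, and for \<open>k > -2\<close> in \<open>w'\<close>,
    the coefficient sums are empty, so the range restrictions may be dropped.\<close>
  have w: "(c * P when k \<ge> 2) = c * P" if "k < 2 \<Longrightarrow> c = 0" for c :: trace_poly
    using that by (auto simp: when_def)
  have w': "(c * P when k \<le> -2) = c * P" if "k > -2 \<Longrightarrow> c = 0" for c :: trace_poly
    using that by (auto simp: when_def)
  show "Y2_op (v k * P) = v k * Y2_op P + y_coeff k * P"
    unfolding ops_vop vm by (subst w, simp, subst w', simp) (simp add: y_coeff_def algebra_simps)
  show "Z1_op (v k * P) = v k * Z1_op P + z_coeff k * P"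
    unfolding ops_vop vm by (subst w, simp, subst w', simp) (simp add: z_coeff_def algebra_simps)
  have s: "vop (\<lambda>j. of_int (j * k) * c j) nz P = of_int k * vop (\<lambda>j. of_int j * c j) nz P"
    "vop (\<lambda>j. of_int (k * j) * c j) nz P = of_int k * vop (\<lambda>j. of_int j * c j) nz P"
    "vop (\<lambda>j. of_int (j * k) * c j * v k) nz P = of_int k * v k * vop (\<lambda>j. of_int j * c j) nz P"
    "vop (\<lambda>j. of_int (k * j) * v k * c j) nz P = of_int k * v k * vop (\<lambda>j. of_int j * c j) nz P" for c
    by (simp_all add: vop_scale[symmetric] mult_ac)
  show "2 * K1_plus (v k * P) + K2_plus (v k * P) = v k * (2 * K1_plus P + K2_plus P)
      + of_int k * (grad (\<lambda>j. v (k - j)) (1 - k) P + grad (\<lambda>j. v (j - k)) (1 - k) P)"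
    unfolding ops_vop vm vop2_v_mult[where p = nz, OF k nzk] s grad_def
    by (simp add: nzk algebra_simps)
  show "2 * K1_minus (v k * P) + K2_minus (v k * P) = v k * (2 * K1_minus P + K2_minus P)
      + of_int k * (2 * grad (\<lambda>j. v (k + j)) (1 + k) P)"
    unfolding ops_vop vm vop2_v_mult[where p = nz, OF k nzk] s grad_def
    by (simp add: nzk algebra_simps)
  show "J_op (v k * P) = v k * J_op P + of_int (k\<^sup>2) * v k * P + of_int k * (2 * (v k * grad v 1 P))"
    unfolding ops_vop vm vop2_v_mult[where p = nz, OF k nzk] s grad_def
    by (simp add: nzk algebra_simps)
qed

lemma grad_v_mult:
  assumes "k \<noteq> 0"
  shows "grad c b (v k * P) = v k * grad c b P + of_int k * c k * P"
  unfolding grad_def vop_v_mult[OF assms] v_mult_commutes[OF assms] by (simp add: nz_iff assms algebra_simps)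

text \<open>The value of \<open>D_gen\<close> at \<open>v k\<close>; the constants \<open>cp\<close>
  and \<open>cm\<close> belong to second derivatives and are absent from it.\<close>

definition D_coeff :: "complex \<Rightarrow> complex \<Rightarrow> int \<Rightarrow> trace_poly" where
  "D_coeff al g k = const (al - 1) * (of_int \<bar>k\<bar> * v k) - 2 * y_coeff k + const al * (2 * z_coeff k) + const g * (of_int (k\<^sup>2) * v k)"

lemma D_gen_v_mult:
  assumes "k \<noteq> 0"
  shows "D_gen al cp cm g (v k * P) = v k * D_gen al cp cm g P + D_coeff al g k * P
    + of_int k * (const cp * (grad (\<lambda>j. v (k - j)) (1 - k) P + grad (\<lambda>j. v (j - k)) (1 - k) P)
        - const cm * (2 * grad (\<lambda>j. v (k + j)) (1 + k) P) + const g * (2 * (v k * grad v 1 P)))"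
  unfolding D_gen_def L0_op_def ops_v_mult[OF assms] D_coeff_def const_simps
  by (simp add: algebra_simps)

lemma grad_u_pow: "grad c b (u_pow a) = of_int a * u_pow (a + b - 1)"
  unfolding grad_def vop_u_pow by (simp add: u_pow_mono D_u_mono of_int_const mult.left_commute[of _ "const _"] mono_mult add.commute add_diff_eq)

text \<open>A power of \<open>u\<close> has no \<open>v\<close>-derivatives, so the operators
  \<open>K1\<close> and \<open>K2\<close> vanish on it; what remains of \<open>J_op\<close> is the
  square of \<open>u D_u\<close>, whence \<open>a\<^sup>2\<close>.\<close>

lemma D_gen_u_pow:
  "D_gen al cp cm g (u_pow a) = const (al - 1) * (of_int \<bar>a\<bar> * u_pow a)
     - 2 * uop (\<lambda>k. v k * u_pow 1) (u_pow a) + const al * (2 * uop (\<lambda>k. u_pow (- k + 1)) (u_pow a))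
     + const g * (of_int (a\<^sup>2) * u_pow a)"
proof -
  have D: "D_u (u_pow a) = const (of_int a) * u_pow (a - 1)" for a
    by (simp add: u_pow_mono D_u_mono)
  have N: "N_op (u_pow a) = of_int \<bar>a\<bar> * u_pow a"
    unfolding ops_vop vop_u_pow
    by (cases "a \<ge> 0")
       (simp_all add: u_pow_mono R_plus_mono R_minus_mono D_u_mono of_int_const
         linear_op_uminus[OF linear_op_basic(1)] mult.left_commute[of _ "const _"] mono_mult const_simps)
  have V: "vop c p (D_u (u_pow a)) = 0" for c p
    using linear_op_const[OF linear_op_vop[OF linear_op_id], of c p "of_int a" "u_pow (a - 1)"]
    by (simp add: D vop_u_pow)
  have "u_pow 2 * D_u (D_u (u_pow a)) + u_pow 1 * D_u (u_pow a)
      = const (of_int a) * const (of_int (a - 1)) * (u_pow 2 * u_pow (a - 1 - 1)) + const (of_int a) * (u_pow 1 * u_pow (a - 1))"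
    by (simp only: D linear_op_const[OF linear_op_basic(1)] mult_ac)
  also have "\<dots> = const (of_int a * of_int (a - 1) + of_int a) * u_pow a"
    by (simp add: u_pow_add const_simps(6) distrib_right const_simps(3))
  also have "of_int a * of_int (a - 1) + of_int a = (of_int (a\<^sup>2) :: complex)"
    by (simp add: power2_eq_square algebra_simps)
  finally have "u_pow 2 * D_u (D_u (u_pow a)) + u_pow 1 * D_u (u_pow a) = of_int (a\<^sup>2) * u_pow a"
    by (simp add: of_int_const(1)[of "a\<^sup>2"] del: of_int_power)
  then have J: "J_op (u_pow a) = of_int (a\<^sup>2) * u_pow a"
    by (simp add: ops_vop(10) V vop_u_pow)
  show ?thesis
    unfolding D_gen_def L0_op_def N J ops_vop(2-9) V vop_u_pow const_simps
    by (simp add: algebra_simps)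
qed

section \<open>The Laplacian of trace polynomials\<close>

text \<open>The form in which \<open>uop\<close> acts on a power of \<open>u\<close> after
  evaluation (\<open>trace_eval_uop\<close>). For negative \<open>a\<close> both sign and range are
  mirrored, which gives the reflection rule \<open>weighted_sum_uminus\<close>.\<close>

definition weighted_sum :: "int \<Rightarrow> (int \<Rightarrow> 'm::finite cmat) \<Rightarrow> 'm cmat" where
  "weighted_sum a f = (\<Sum>k\<in>{1..a - 1}. cscale (of_int (a - k)) (f k)) - (\<Sum>k\<in>{a + 1..-1}. cscale (of_int (a - k)) (f k))"

lemma weighted_sum_uminus: "weighted_sum (- a) f = weighted_sum a (\<lambda>k. f (- k))"
proof -
  have "(\<Sum>k\<in>{1..- a - 1}. cscale (of_int (- a - k)) (f k)) = - (\<Sum>k\<in>{a + 1..-1}. cscale (of_int (a - k)) (f (- k)))"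
    unfolding sum_negf[symmetric]
    by (rule sum.reindex_bij_witness[where i = uminus and j = uminus]) (auto simp: cscale_minus_left[symmetric])
  moreover have "(\<Sum>k\<in>{- a + 1..-1}. cscale (of_int (- a - k)) (f k)) = - (\<Sum>k\<in>{1..a - 1}. cscale (of_int (a - k)) (f (- k)))"
    unfolding sum_negf[symmetric]
    by (rule sum.reindex_bij_witness[where i = uminus and j = uminus]) (auto simp: cscale_minus_left[symmetric])
  ultimately show ?thesis by (simp add: weighted_sum_def)
qed

lemma weighted_sum_nat: "weighted_sum (int n) f = (\<Sum>i<n. cscale (of_nat (n - Suc i)) (f (int (Suc i))))"
proof -
  have "(\<Sum>i<n. cscale (of_nat (n - Suc i)) (f (int (Suc i)))) = (\<Sum>k\<in>{1..int n}. cscale (of_int (int n - k)) (f k))"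
  proof (rule sum.reindex_bij_witness[where i = "\<lambda>k. nat (k - 1)" and j = "\<lambda>i. int (Suc i)"])
    fix i assume "i \<in> {..<n}"
    then have "of_int (int n - int (Suc i)) = (of_nat (n - Suc i) :: complex)"
      by (simp add: of_nat_diff)
    then show "cscale (of_int (int n - int (Suc i))) (f (int (Suc i))) = cscale (of_nat (n - Suc i)) (f (int (Suc i)))"
      by simp
  qed auto
  \<comment> \<open>The index \<open>k = int n\<close> carries the weight \<open>0\<close>.\<close>
  also have "\<dots> = (\<Sum>k\<in>{1..int n - 1}. cscale (of_int (int n - k)) (f k))"
  proof (rule sum.mono_neutral_right)
    show "\<forall>k\<in>{1..int n} - {1..int n - 1}. cscale (of_int (int n - k)) (f k) = 0"
    proof
      fix k assume "k \<in> {1..int n} - {1..int n - 1}"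
      then have "k = int n" by auto
      then show "cscale (of_int (int n - k)) (f k) = 0" by simp
    qed
  qed auto
  finally show ?thesis by (simp add: weighted_sum_def)
qed

lemma conj_transpose_weighted_sum: "conj_transpose (weighted_sum a f) = weighted_sum a (\<lambda>k. conj_transpose (f k))"
  by (simp add: weighted_sum_def conj_transpose_diff conj_transpose_sum)

text \<open>\<open>sandwich\<close> governs second derivatives of powers, and \<open>pairing\<close>
  the cross terms between powers and traces. The powers \<open>mat_powi A (- k)\<close> on the right
  stand for the transpose or the symplectic adjoint of \<open>mat_powi A k\<close>. The basis is the
  one selected inside \<open>laplacian\<close>.\<close>

locale laplace_group =
  fixes K :: "'m::finite cmat set" and c al cp cm g :: real
  assumes unitary: "A \<in> K \<Longrightarrow> conj_transpose A ** A = mat 1"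
    and mat_1_in: "mat 1 \<in> K"
    and mult_in: "A \<in> K \<Longrightarrow> B \<in> K \<Longrightarrow> A ** B \<in> K"
    and inv_in: "A \<in> K \<Longrightarrow> conj_transpose A \<in> K"
    and closed_K: "closed K"
    and basis: "orthonormal_lie_basis c K (SOME B. orthonormal_lie_basis c K B)"
    and sandwich: "A \<in> K \<Longrightarrow> (\<Sum>X\<in>(SOME B. orthonormal_lie_basis c K B). X ** mat_powi A k ** X)
      = cscale (- ntrace (mat_powi A k)) (mat 1) + cscale al (mat_powi A (- k)) + cscale g (mat_powi A k)"
    and pairing: "A \<in> K \<Longrightarrow> (\<Sum>X\<in>(SOME B. orthonormal_lie_basis c K B). cscale (ntrace (mat_powi A k ** X)) X)
      = cscale cp (mat_powi A (- k)) - cscale cm (mat_powi A k) + cscale (g * ntrace (mat_powi A k)) (mat 1)"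
begin

definition Ba :: "'m cmat set" where "Ba = (SOME B. orthonormal_lie_basis c K B)"

lemma Ba_lie: "X \<in> Ba \<Longrightarrow> X \<in> lie_algebra K"
  using basis[folded Ba_def, unfolded orthonormal_lie_basis_def] by blast

lemma skew: "X \<in> lie_algebra K \<Longrightarrow> conj_transpose X = - X"
  using lie_algebra_skew[of K X] unitary by blast

lemma exp_in: "X \<in> lie_algebra K \<Longrightarrow> mat_exp (t *\<^sub>R X) \<in> K"
  by (simp add: lie_algebra_def)

lemma curve_in: "X \<in> lie_algebra K \<Longrightarrow> k \<in> K \<Longrightarrow> k ** mat_exp (t *\<^sub>R X) \<in> K"
  by (intro mult_in exp_in)

lemma K_invertible: "A \<in> K \<Longrightarrow> invertible A"
  using unitary[of A] matrix_left_right_inverse[of "conj_transpose A" A] by (auto simp: invertible_def)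

lemma unitary': "A \<in> K \<Longrightarrow> A ** conj_transpose A = mat 1"
  using unitary[of A] by (simp add: matrix_left_right_inverse)

text \<open>A relation rather than \<open>lie_deriv\<close> itself, so that differentiability and
  value are propagated together by the product rules. Only values on \<open>K\<close> matter,
  because the curve stays in \<open>K\<close> (\<open>deriv_along_cong\<close>).\<close>

definition deriv_along :: "'m cmat \<Rightarrow> ('m cmat \<Rightarrow> 'b::real_normed_vector) \<Rightarrow> ('m cmat \<Rightarrow> 'b) \<Rightarrow> bool" where
  "deriv_along X F F' \<longleftrightarrow> X \<in> lie_algebra K \<and>
     (\<forall>k\<in>K. ((\<lambda>t. F (k ** mat_exp (t *\<^sub>R X))) has_vector_derivative F' k) (at 0))"

lemma deriv_along_lie: "deriv_along X F F' \<Longrightarrow> X \<in> lie_algebra K"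
  by (simp add: deriv_along_def)

lemma deriv_alongD:
  "deriv_along X F F' \<Longrightarrow> k \<in> K \<Longrightarrow> ((\<lambda>t. F (k ** mat_exp (t *\<^sub>R X))) has_vector_derivative F' k) (at 0)"
  by (simp add: deriv_along_def)

lemma deriv_along_cong:
  assumes "deriv_along X F F'" "\<And>A. A \<in> K \<Longrightarrow> F A = G A" "\<And>A. A \<in> K \<Longrightarrow> F' A = G' A"
  shows "deriv_along X G G'"
  unfolding deriv_along_def
proof (intro conjI ballI)
  show X: "X \<in> lie_algebra K" by (rule deriv_along_lie[OF assms(1)])
  fix k assume k: "k \<in> K"
  have "(\<lambda>t. F (k ** mat_exp (t *\<^sub>R X))) = (\<lambda>t. G (k ** mat_exp (t *\<^sub>R X)))"
    using assms(2) curve_in[OF X k] by auto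
  then show "((\<lambda>t. G (k ** mat_exp (t *\<^sub>R X))) has_vector_derivative G' k) (at 0)"
    using deriv_alongD[OF assms(1) k] assms(3)[OF k] by simp
qed

lemma lie_deriv_eq: "deriv_along X F F' \<Longrightarrow> k \<in> K \<Longrightarrow> lie_deriv X F k = F' k"
  unfolding lie_deriv_def by (intro vector_derivative_at deriv_alongD)

lemma lie_deriv_lie_deriv_eq:
  assumes "deriv_along X F F'" "deriv_along X F' F''" "k \<in> K"
  shows "lie_deriv X (lie_deriv X F) k = F'' k"
  by (rule lie_deriv_eq[OF deriv_along_cong[OF assms(2)] assms(3)]) (simp_all add: lie_deriv_eq[OF assms(1)])

lemma deriv_along_const: "X \<in> lie_algebra K \<Longrightarrow> deriv_along X (\<lambda>A. z) (\<lambda>A. 0)"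
  by (simp add: deriv_along_def has_vector_derivative_const)

lemma deriv_along_id: "X \<in> lie_algebra K \<Longrightarrow> deriv_along X (\<lambda>A. A) (\<lambda>A. A ** X)"
  unfolding deriv_along_def
proof (intro conjI ballI)
  fix k assume "X \<in> lie_algebra K" "k \<in> K"
  have "((\<lambda>t. k ** mat_exp (t *\<^sub>R X)) has_vector_derivative k ** (X ** mat_exp (0 *\<^sub>R X))) (at 0)"
    by (rule bounded_linear.has_vector_derivative[OF bounded_bilinear.bounded_linear_right[OF bounded_bilinear_matrix_mult]])
       (rule mat_exp_has_vector_derivative)
  then show "((\<lambda>t. k ** mat_exp (t *\<^sub>R X)) has_vector_derivative k ** X) (at 0)" by simp
qed

lemma deriv_along_add:
  "deriv_along X F F' \<Longrightarrow> deriv_along X G G' \<Longrightarrow> deriv_along X (\<lambda>A. F A + G A) (\<lambda>A. F' A + G' A)"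
  by (auto simp: deriv_along_def intro!: has_vector_derivative_add)

lemma deriv_along_sum:
  "(\<And>i. i \<in> S \<Longrightarrow> deriv_along X (F i) (F' i)) \<Longrightarrow> X \<in> lie_algebra K \<Longrightarrow>
    deriv_along X (\<lambda>A. \<Sum>i\<in>S. F i A) (\<lambda>A. \<Sum>i\<in>S. F' i A)"
  by (auto simp: deriv_along_def intro!: has_vector_derivative_sum)

lemma deriv_along_linear:
  "bounded_linear h \<Longrightarrow> deriv_along X F F' \<Longrightarrow> deriv_along X (\<lambda>A. h (F A)) (\<lambda>A. h (F' A))"
  using bounded_linear.has_vector_derivative[of h] by (fastforce simp: deriv_along_def)

lemma deriv_along_bilinear:
  assumes "bounded_bilinear h" "deriv_along X F F'" "deriv_along X G G'"
  shows "deriv_along X (\<lambda>A. h (F A) (G A)) (\<lambda>A. h (F A) (G' A) + h (F' A) (G A))"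
proof -
  have "((\<lambda>t. h (F (k ** mat_exp (t *\<^sub>R X))) (G (k ** mat_exp (t *\<^sub>R X))))
      has_vector_derivative h (F k) (G' k) + h (F' k) (G k)) (at 0)" if "k \<in> K" for k
    using bounded_bilinear.has_vector_derivative[OF assms(1) deriv_alongD[OF assms(2) that] deriv_alongD[OF assms(3) that]]
    by simp
  then show ?thesis using deriv_along_lie[OF assms(2)] by (simp add: deriv_along_def)
qed

lemmas deriv_along_matrix_mult = deriv_along_bilinear[OF bounded_bilinear_matrix_mult]
lemmas deriv_along_cscale = deriv_along_bilinear[OF bounded_bilinear_cscale]
lemmas deriv_along_mult = deriv_along_bilinear[OF bounded_bilinear_mult]

text \<open>With \<open>ddpow\<close>, the first and second derivative of \<open>mat_pow A n\<close>
  along \<open>X\<close>: the product rule for \<open>A ** mat_pow A n\<close>, in which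
  \<open>A\<close> has the derivatives \<open>A ** X\<close> and \<open>A ** X ** X\<close>.\<close>

primrec dpow :: "'m cmat \<Rightarrow> nat \<Rightarrow> 'm cmat \<Rightarrow> 'm cmat" where
  "dpow X 0 A = 0"
| "dpow X (Suc n) A = A ** X ** mat_pow A n + A ** dpow X n A"

primrec ddpow :: "'m cmat \<Rightarrow> nat \<Rightarrow> 'm cmat \<Rightarrow> 'm cmat" where
  "ddpow X 0 A = 0"
| "ddpow X (Suc n) A = A ** X ** X ** mat_pow A n + 2 *\<^sub>R (A ** X ** dpow X n A) + A ** ddpow X n A"

lemma deriv_along_mat_pow: "X \<in> lie_algebra K \<Longrightarrow> deriv_along X (\<lambda>A. mat_pow A n) (dpow X n)"
proof (induction n)
  case (Suc n)
  show ?case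
    by (rule deriv_along_cong[OF deriv_along_matrix_mult[OF deriv_along_id[OF Suc.prems] Suc.IH[OF Suc.prems]]])
       (simp_all add: add.commute)
qed (simp add: deriv_along_def)

lemma deriv_along_dpow: "X \<in> lie_algebra K \<Longrightarrow> deriv_along X (dpow X n) (ddpow X n)"
proof (induction n)
  case (Suc n)
  note X = Suc.prems
  have AX: "deriv_along X (\<lambda>A. A ** X) (\<lambda>A. A ** X ** X)"
    by (rule deriv_along_cong[OF deriv_along_matrix_mult[OF deriv_along_id[OF X] deriv_along_const[OF X, of X]]])
       simp_all
  show ?case
    by (rule deriv_along_cong[OF deriv_along_add[OF deriv_along_matrix_mult[OF AX deriv_along_mat_pow[OF X, of n]]
          deriv_along_matrix_mult[OF deriv_along_id[OF X] Suc.IH[OF X]]]])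
       (simp_all add: scaleR_2)
qed (simp add: deriv_along_def)

text \<open>On \<open>K\<close> the power \<open>- n\<close> is the adjoint of the power
  \<open>n\<close>, so its derivative is the adjoint of \<open>dpow X n A\<close>.\<close>

definition dpowi :: "'m cmat \<Rightarrow> int \<Rightarrow> 'm cmat \<Rightarrow> 'm cmat" where
  "dpowi X k A = (if k \<ge> 0 then dpow X (nat k) A else conj_transpose (dpow X (nat (- k)) A))"

definition ddpowi :: "'m cmat \<Rightarrow> int \<Rightarrow> 'm cmat \<Rightarrow> 'm cmat" where
  "ddpowi X k A = (if k \<ge> 0 then ddpow X (nat k) A else conj_transpose (ddpow X (nat (- k)) A))"

lemma dpowi_nat [simp]: "dpowi X (int n) A = dpow X n A" "ddpowi X (int n) A = ddpow X n A"
  by (simp_all add: dpowi_def ddpowi_def)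

lemma dpowi_minus_nat [simp]: "dpowi X (- int n) A = conj_transpose (dpow X n A)"
  "ddpowi X (- int n) A = conj_transpose (ddpow X n A)"
  by (cases n; simp add: dpowi_def ddpowi_def nat_add_distrib)+

lemma powi_minus: "A \<in> K \<Longrightarrow> conj_transpose (mat_powi A k) = mat_powi A (- k)"
  using mat_powi_minus[OF unitary] by simp

lemma deriv_along_mat_powi:
  assumes X: "X \<in> lie_algebra K"
  shows "deriv_along X (\<lambda>A. mat_powi A k) (dpowi X k)" "deriv_along X (dpowi X k) (ddpowi X k)"
proof -
  show "deriv_along X (\<lambda>A. mat_powi A k) (dpowi X k)"
  proof (cases k rule: int_cases2)
    case (nonneg n)
    then show ?thesis using deriv_along_mat_pow[OF X, of n] by (auto intro: deriv_along_cong)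
  next
    case (nonpos n)
    show ?thesis unfolding nonpos
      by (rule deriv_along_cong[OF deriv_along_linear[OF bounded_linear_conj_transpose deriv_along_mat_pow[OF X, of n]]])
         (simp_all add: mat_powi_minus[OF unitary])
  qed
  show "deriv_along X (dpowi X k) (ddpowi X k)"
  proof (cases k rule: int_cases2)
    case (nonneg n)
    then show ?thesis using deriv_along_dpow[OF X, of n] by (auto intro: deriv_along_cong)
  next
    case (nonpos n)
    show ?thesis unfolding nonpos
      by (rule deriv_along_cong[OF deriv_along_linear[OF bounded_linear_conj_transpose deriv_along_dpow[OF X, of n]]])
         simp_all
  qed
qed

text \<open>There is one summand for each factor \<open>A\<close> after which \<open>X\<close> is
  inserted. In this form a sum over the basis isolates a single sandwich or pairing in each
  summand.\<close>

lemma dpow_sum: "dpow X n A = (\<Sum>i<n. mat_pow A (Suc i) ** X ** mat_pow A (n - Suc i))"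
proof (induction n)
  case (Suc n)
  have "(\<Sum>i<Suc n. mat_pow A (Suc i) ** X ** mat_pow A (Suc n - Suc i))
      = A ** X ** mat_pow A n + (\<Sum>i<n. mat_pow A (Suc (Suc i)) ** X ** mat_pow A (n - Suc i))"
    by (subst sum.lessThan_Suc_shift) simp
  then show ?case
    by (simp add: Suc.IH matrix_mult_sum_right matrix_mul_assoc)
qed simp

abbreviation w :: "'m cmat \<Rightarrow> int \<Rightarrow> complex" where "w A k \<equiv> ntrace (mat_powi A k)"

text \<open>The Laplacian of the power \<open>a\<close> (\<open>sum_ddpowi\<close>), arranged as the
  evaluation of \<open>D_gen_u_pow\<close>.\<close>

definition lap_pow :: "'m cmat \<Rightarrow> int \<Rightarrow> 'm cmat" where
  "lap_pow A a = cscale ((al - 1) * \<bar>a\<bar> + g * a\<^sup>2) (mat_powi A a)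
    - cscale 2 (weighted_sum a (\<lambda>k. cscale (w A k) (mat_powi A (a - k))))
    + cscale (2 * al) (weighted_sum a (\<lambda>k. mat_powi A (a - 2 * k)))"

lemma lap_pow_minus:
  assumes "A \<in> K"
  shows "lap_pow A (- a) = conj_transpose (lap_pow A a)"
proof -
  have cw: "cnj (w A k) = w A (- k)" for k
    using powi_minus[OF assms, of k] by (simp add: ntrace_simps[symmetric])
  show ?thesis
    unfolding lap_pow_def weighted_sum_uminus
    by (simp add: conj_transpose_add conj_transpose_diff conj_transpose_weighted_sum powi_minus[OF assms] cw)
qed

end

context laplace_group
begin

lemma powi_add: "A \<in> K \<Longrightarrow> mat_powi A i ** mat_powi A j = mat_powi A (i + j)"
  using mat_powi_add[OF K_invertible, of A i j] by simp

lemma sum_mult_dpow: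
  assumes A: "A \<in> K"
  shows "(\<Sum>X\<in>Ba. X ** dpow X n A) = (\<Sum>i<n. cscale (- w A (int (Suc i))) (mat_powi A (int n - int (Suc i)))
     + cscale al (mat_powi A (int n - 2 * int (Suc i))) + cscale g (mat_powi A (int n)))"
proof -
  have "(\<Sum>X\<in>Ba. X ** dpow X n A) = (\<Sum>i<n. (\<Sum>X\<in>Ba. X ** mat_powi A (int (Suc i)) ** X) ** mat_powi A (int (n - Suc i)))"
    unfolding dpow_sum matrix_mult_sum_right matrix_mult_sum_left mat_powi_nat
    by (subst sum.swap) (simp add: matrix_mul_assoc)
  also have "\<dots> = (\<Sum>i<n. cscale (- w A (int (Suc i))) (mat_powi A (int n - int (Suc i)))
     + cscale al (mat_powi A (int n - 2 * int (Suc i))) + cscale g (mat_powi A (int n)))"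
  proof (intro sum.cong refl)
    fix i assume "i \<in> {..<n}"
    then have n: "int (n - Suc i) = int n - int (Suc i)" by (simp add: of_nat_diff)
    show "(\<Sum>X\<in>Ba. X ** mat_powi A (int (Suc i)) ** X) ** mat_powi A (int (n - Suc i)) =
        cscale (- w A (int (Suc i))) (mat_powi A (int n - int (Suc i)))
        + cscale al (mat_powi A (int n - 2 * int (Suc i))) + cscale g (mat_powi A (int n))"
      unfolding sandwich[OF A, folded Ba_def] n matrix_add_rdistrib2 cscale_mult_left powi_add[OF A]
      by (simp add: algebra_simps)
  qed
  finally show ?thesis .
qed

text \<open>Induction along the recursion of \<open>ddpow\<close>. From \<open>n\<close> to
  \<open>n + 1\<close> all weights in the two sums grow by one, and
  \<open>(al - 1) * n + g * n\<^sup>2\<close> grows by \<open>al - 1 + g * (2 * n + 1)\<close>; the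
  doubled mixed term and the sum of all \<open>X ** X\<close> supply exactly these
  increments.\<close>

lemma sum_ddpow:
  assumes A: "A \<in> K"
  shows "(\<Sum>X\<in>Ba. ddpow X n A) = lap_pow A (int n)"
proof (induction n)
  case 0
  show ?case by (simp add: lap_pow_def weighted_sum_def)
next
  case (Suc n)
  define p where "p = mat_powi A (int (Suc n))"
  define x where "x i = cscale (w A (int (Suc i))) (mat_powi A (int (Suc n) - int (Suc i)))" for i
  define y where "y i = mat_powi A (int (Suc n) - 2 * int (Suc i))" for i
  define Xs Ys where "Xs = (\<Sum>i<n. x i)" and "Ys = (\<Sum>i<n. y i)"
  define U V where "U = (\<Sum>i<n. cscale (of_nat (n - Suc i)) (x i))" and "V = (\<Sum>i<n. cscale (of_nat (n - Suc i)) (y i))"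
  have mult: "A ** mat_powi A i = mat_powi A (1 + i)" for i
    using powi_add[OF A, of 1 i] by simp
  \<comment> \<open>The case of exponent \<open>0\<close> in \<open>sandwich\<close>, where all
    powers are the identity.\<close>
  have T0: "(\<Sum>X\<in>Ba. X ** X) = cscale (al - 1 + g) (mat 1)"
    using sandwich[OF A, of 0, folded Ba_def] by (simp add: ntrace_simps cscale_add_left[symmetric])
  have "A ** (cscale (- w A (int (Suc i))) (mat_powi A (int n - int (Suc i))) + cscale al (mat_powi A (int n - 2 * int (Suc i)))
      + cscale g (mat_powi A (int n))) = cscale al (y i) - x i + cscale g p" for i
  proof -
    have e: "1 + (int n - int (Suc i)) = int (Suc n) - int (Suc i)" "1 + (int n - 2 * int (Suc i)) = int (Suc n) - 2 * int (Suc i)"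
      "1 + int n = int (Suc n)" by simp_all
    show ?thesis
      unfolding matrix_add_ldistrib cscale_mult_right mult e x_def y_def p_def by (simp add: cscale_minus_left)
  qed
  then have S: "A ** (\<Sum>X\<in>Ba. X ** dpow X n A) = cscale al Ys - Xs + cscale (of_nat n * g) p"
    unfolding sum_mult_dpow[OF A] matrix_mult_sum_right
    by (simp add: sum.distrib sum_subtractf Xs_def Ys_def cscale_sum_right sum_constant_scaleR cscale_of_real[symmetric] del: of_nat_Suc sum_constant)
  have L: "A ** lap_pow A (int n) = cscale ((al - 1) * of_nat n + g * (of_nat n)\<^sup>2) p - cscale 2 U + cscale (2 * al) V"
    unfolding lap_pow_def weighted_sum_nat
    by (simp add: matrix_mult_diff matrix_add_ldistrib matrix_mult_sum_right mult U_def V_def x_def y_def p_def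
        add_diff_eq mult.commute del: mat_powi_nat)
  have shift: "(\<Sum>i<Suc n. cscale (of_nat (Suc n - Suc i)) (f i)) = (\<Sum>i<n. cscale (of_nat (n - Suc i)) (f i)) + (\<Sum>i<n. f i)"
    for f :: "nat \<Rightarrow> 'm cmat"
  proof -
    have "(\<Sum>i<Suc n. cscale (of_nat (Suc n - Suc i)) (f i)) = (\<Sum>i<n. cscale (of_nat (n - i)) (f i))"
      by simp
    also have "\<dots> = (\<Sum>i<n. cscale (of_nat (n - Suc i)) (f i) + f i)"
    proof (intro sum.cong refl)
      fix i assume "i \<in> {..<n}"
      then have "of_nat (n - i) = of_nat (n - Suc i) + (1 :: complex)"
        by (simp add: of_nat_diff)
      then show "cscale (of_nat (n - i)) (f i) = cscale (of_nat (n - Suc i)) (f i) + f i"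
        by (simp add: cscale_add_left)
    qed
    finally show ?thesis by (simp add: sum.distrib)
  qed
  have lapS: "lap_pow A (int (Suc n)) = cscale ((al - 1) * of_nat (Suc n) + g * (of_nat (Suc n))\<^sup>2) p
      - cscale 2 (U + Xs) + cscale (2 * al) (V + Ys)"
    unfolding lap_pow_def weighted_sum_nat x_def[symmetric] y_def[symmetric] p_def[symmetric] shift U_def V_def Xs_def Ys_def
    by (simp del: of_nat_Suc)
  have "(\<Sum>X\<in>Ba. ddpow X (Suc n) A) = A ** (\<Sum>X\<in>Ba. X ** X) ** mat_pow A n
      + 2 *\<^sub>R (A ** (\<Sum>X\<in>Ba. X ** dpow X n A)) + A ** (\<Sum>X\<in>Ba. ddpow X n A)"
    by (simp add: sum.distrib matrix_mult_sum_right matrix_mult_sum_left scaleR_sum_right matrix_mul_assoc)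
  also have "\<dots> = cscale (al - 1 + g) p + 2 *\<^sub>R (cscale al Ys - Xs + cscale (of_nat n * g) p) + A ** lap_pow A (int n)"
    unfolding T0 S Suc.IH using mat_powi_nat[of A "Suc n"] by (simp add: p_def del: mat_powi_nat)
  also have "\<dots> = lap_pow A (int (Suc n))"
    unfolding L lapS cscale_of_real[symmetric]
    by (simp add: vec_eq_iff algebra_simps power2_eq_square)
  finally show ?case .
qed

lemma sum_ddpowi:
  assumes A: "A \<in> K"
  shows "(\<Sum>X\<in>Ba. ddpowi X a A) = lap_pow A a"
proof (cases a rule: int_cases2)
  case (nonneg n)
  then show ?thesis by (simp add: sum_ddpow[OF A])
next
  case (nonpos n)
  then show ?thesis by (simp add: conj_transpose_sum[symmetric] sum_ddpow[OF A] lap_pow_minus[OF A])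
qed

lemma cnj_ntrace_powi_mult:
  assumes "A \<in> K" "X \<in> Ba"
  shows "cnj (ntrace (mat_powi A k ** X)) = - ntrace (mat_powi A (- k) ** X)"
proof -
  have "cnj (ntrace (mat_powi A k ** X)) = ntrace (conj_transpose X ** mat_powi A (- k))"
    by (simp add: ntrace_simps(7)[symmetric] powi_minus[OF assms(1)])
  then show ?thesis
    using skew[OF Ba_lie[OF assms(2)]] by (simp add: ntrace_simps ntrace_mult_commute[of X])
qed

text \<open>The Casimir sum is a combination of powers of \<open>A\<close> and so commutes with the
  powers around it: all \<open>n\<close> summands of \<open>dpow_sum\<close> contribute the same.
  Negative exponents follow by taking adjoints, with the sign from
  \<open>cnj_ntrace_powi_mult\<close>.\<close>

lemma pairing_dpowi:
  assumes A: "A \<in> K"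
  shows "(\<Sum>X\<in>Ba. cscale (ntrace (mat_powi A k ** X)) (dpowi X a A))
    = cscale (of_int a) (cscale cp (mat_powi A (a - k)) - cscale cm (mat_powi A (a + k)) + cscale (g * w A k) (mat_powi A a))"
proof -
  have nat: "(\<Sum>X\<in>Ba. cscale (ntrace (mat_powi A k ** X)) (dpow X n A))
    = cscale (of_nat n) (cscale cp (mat_powi A (int n - k)) - cscale cm (mat_powi A (int n + k)) + cscale (g * w A k) (mat_powi A (int n)))" for n k
  proof -
    have "(\<Sum>X\<in>Ba. cscale (ntrace (mat_powi A k ** X)) (dpow X n A)) = (\<Sum>i<n. mat_powi A (int (Suc i)) **
        (\<Sum>X\<in>Ba. cscale (ntrace (mat_powi A k ** X)) X) ** mat_powi A (int (n - Suc i)))"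
      unfolding dpow_sum cscale_sum_right matrix_mult_sum_right matrix_mult_sum_left mat_powi_nat
      by (subst sum.swap) simp
    also have "\<dots> = (\<Sum>i<n. cscale cp (mat_powi A (int n - k)) - cscale cm (mat_powi A (int n + k)) + cscale (g * w A k) (mat_powi A (int n)))"
    proof (intro sum.cong refl)
      fix i assume "i \<in> {..<n}"
      then have n: "int (n - Suc i) = int n - int (Suc i)" by (simp add: of_nat_diff)
      have [simp]: "mat_powi A (int (Suc i)) ** mat_powi A (int n - int (Suc i)) = mat_powi A (int n)"
        by (simp add: powi_add[OF A])
      show "mat_powi A (int (Suc i)) ** (\<Sum>X\<in>Ba. cscale (ntrace (mat_powi A k ** X)) X) ** mat_powi A (int (n - Suc i)) =
        cscale cp (mat_powi A (int n - k)) - cscale cm (mat_powi A (int n + k)) + cscale (g * w A k) (mat_powi A (int n))"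
        unfolding pairing[OF A, folded Ba_def] n matrix_add_rdistrib2 matrix_add_ldistrib matrix_mult_diff
          cscale_mult_left cscale_mult_right powi_add[OF A] matrix_mul_rid
        by (simp add: algebra_simps)
    qed
    also have "\<dots> = cscale (of_nat n) (cscale cp (mat_powi A (int n - k)) - cscale cm (mat_powi A (int n + k)) + cscale (g * w A k) (mat_powi A (int n)))"
      by (simp add: sum_constant_scaleR cscale_of_real[symmetric] del: sum_constant)
    finally show ?thesis .
  qed
  show ?thesis
  proof (cases a rule: int_cases2)
    case (nonneg n)
    then show ?thesis by (simp add: nat)
  next
    case (nonpos n)
    have "(\<Sum>X\<in>Ba. cscale (ntrace (mat_powi A k ** X)) (dpowi X a A))
        = conj_transpose (\<Sum>X\<in>Ba. cscale (- ntrace (mat_powi A (- k) ** X)) (dpow X n A))"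
      unfolding conj_transpose_sum nonpos
      by (intro sum.cong refl) (simp add: cnj_ntrace_powi_mult[OF A])
    moreover have "(\<Sum>X\<in>Ba. cscale (- ntrace (mat_powi A (- k) ** X)) (dpow X n A))
        = - (\<Sum>X\<in>Ba. cscale (ntrace (mat_powi A (- k) ** X)) (dpow X n A))"
      by (simp add: cscale_minus_left sum_negf)
    moreover have "mat_powi A (- k - int n) = mat_powi A (- int n - k)"
      by (rule arg_cong[of _ _ "mat_powi A"]) simp
    ultimately show ?thesis
      unfolding nat nonpos
      by (simp add: conj_transpose_add conj_transpose_diff powi_minus[OF A] ntrace_simps(7)[symmetric]
          cscale_minus_left algebra_simps del: mat_powi_nat)
  qed
qed

text \<open>By cyclicity, all summands of \<open>dpow_sum\<close> have the same trace.\<close>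

lemma ntrace_dpowi:
  assumes A: "A \<in> K" and X: "X \<in> Ba"
  shows "ntrace (dpowi X a A) = of_int a * ntrace (mat_powi A a ** X)"
proof -
  have nat: "ntrace (dpow X n A) = of_nat n * ntrace (mat_pow A n ** X)" for n
  proof -
    have "ntrace (mat_pow A (Suc i) ** X ** mat_pow A (n - Suc i)) = ntrace (mat_pow A n ** X)" if "i < n" for i
      using that by (subst ntrace_mult_commute) (simp add: matrix_mul_assoc mat_pow_add[symmetric] flip: mat_pow.simps(2))
    then show ?thesis by (simp add: dpow_sum ntrace_simps)
  qed
  show ?thesis
  proof (cases a rule: int_cases2)
    case (nonneg n)
    then show ?thesis by (simp add: nat)
  next
    case (nonpos n)
    then show ?thesis
      using cnj_ntrace_powi_mult[OF A X, of "int n"] by (simp add: nat ntrace_simps)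
  qed
qed

text \<open>By \<open>ntrace_dpowi\<close>, \<open>j * k\<close> times this sum is the sum over the
  basis of the products of the derivatives of \<open>v j\<close> and \<open>v k\<close>. This is
  where the coefficients of \<open>K2_plus\<close>, \<open>K2_minus\<close> and the second sum of
  \<open>J_op\<close> come from.\<close>

lemma pairing_pairing:
  assumes A: "A \<in> K"
  shows "(\<Sum>X\<in>Ba. ntrace (mat_powi A j ** X) * ntrace (mat_powi A k ** X))
    = cp * w A (k - j) - cm * w A (k + j) + g * w A j * w A k"
proof -
  have "(\<Sum>X\<in>Ba. ntrace (mat_powi A j ** X) * ntrace (mat_powi A k ** X))
      = ntrace (mat_powi A k ** (\<Sum>X\<in>Ba. cscale (ntrace (mat_powi A j ** X)) X))"
    by (simp add: matrix_mult_sum_right ntrace_simps)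
  also have "\<dots> = cp * w A (k - j) - cm * w A (k + j) + g * w A j * w A k"
    unfolding pairing[OF A, folded Ba_def] matrix_add_ldistrib matrix_mult_diff cscale_mult_right powi_add[OF A]
    by (simp add: ntrace_simps)
  finally show ?thesis .
qed

text \<open>For the unitary series \<open>cp = 0\<close>; for the other two, \<open>A\<close> is similar to the transpose of its inverse.\<close>

lemma cp_symmetric:
  assumes A: "A \<in> K"
  shows "cp * w A (- k) = cp * w A k"
  \<comment> \<open>The left-hand sides for the index pairs \<open>0, k\<close> and
    \<open>k, 0\<close> coincide, and the right-hand sides differ only in the \<open>cp\<close>
    term.\<close>
  using pairing_pairing[OF A, of 0 k] pairing_pairing[OF A, of k 0]
  by (auto simp: mult.commute ntrace_simps)

section \<open>Intertwining with the Laplacian, by induction over monomials\<close>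

abbreviation Dop :: "trace_poly \<Rightarrow> trace_poly" where "Dop \<equiv> D_gen al cp cm g"

text \<open>The sign \<open>e\<close> distinguishes the coefficients \<open>v (k - j)\<close> and
  \<open>v (j - k)\<close>, which both occur in \<open>D_gen_v_mult\<close> because
  \<open>K2_plus\<close> is not symmetric in its indices. They are different polynomials, but
  \<open>cp\<close> times their values on \<open>K\<close> agree by
  \<open>cp_symmetric\<close>.\<close>

definition grad_all :: "int \<Rightarrow> int \<Rightarrow> trace_poly \<Rightarrow> trace_poly" where
  "grad_all e k P = const cp * grad (\<lambda>j. v (e * (k - j))) (1 - k) P - const cm * grad (\<lambda>j. v (k + j)) (1 + k) P
     + const g * (v k * grad v 1 P)"

definition intertwines :: "trace_poly \<Rightarrow> bool" where
  "intertwines P \<longleftrightarrow> (\<exists>F1 F2.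
     (\<forall>X\<in>Ba. deriv_along X (trace_eval P) (F1 X) \<and> deriv_along X (F1 X) (F2 X)) \<and>
     (\<forall>A\<in>K. (\<Sum>X\<in>Ba. F2 X A) = trace_eval (Dop P) A))"

lemma trace_eval_of_int: "trace_eval (of_int k * P) A = cscale (of_int k) (trace_eval P A)"
  "trace_eval (2 * P) A = cscale 2 (trace_eval P A)"
  by (simp_all add: of_int_const(1)[of k] of_int_const(2)[of "Num.Bit0 Num.One"] trace_eval_const_mult)

lemma trace_eval_v_mult:
  assumes A: "A \<in> K"
  shows "trace_eval (v k * P) A = cscale (w A k) (trace_eval P A)"
  by (simp add: trace_eval_mult[OF K_invertible[OF A]] trace_eval_v)

lemmas trace_eval_simps = trace_eval_add trace_eval_diff trace_eval_uminus trace_eval_sum trace_eval_const_mult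
  trace_eval_of_int trace_eval_v trace_eval_u_pow

lemma trace_eval_uop:
  assumes A: "A \<in> K"
  shows "trace_eval (uop f (u_pow a)) A = weighted_sum a (\<lambda>k. trace_eval (f k * u_pow (a - k - 1)) A)"
  unfolding uop_u_pow weighted_sum_def trace_eval_diff trace_eval_sum
  by (simp add: mult.assoc trace_eval_const_mult)

lemma trace_eval_D_u_pow:
  assumes A: "A \<in> K"
  shows "trace_eval (Dop (u_pow a)) A = lap_pow A a"
proof -
  have 1: "trace_eval (uop (\<lambda>k. v k * u_pow 1) (u_pow a)) A = weighted_sum a (\<lambda>k. cscale (w A k) (mat_powi A (a - k)))"
    unfolding trace_eval_uop[OF A] by (simp add: mult.assoc u_pow_add trace_eval_v_mult[OF A] trace_eval_u_pow)
  have 2: "trace_eval (uop (\<lambda>k. u_pow (- k + 1)) (u_pow a)) A = weighted_sum a (\<lambda>k. mat_powi A (a - 2 * k))"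
    unfolding trace_eval_uop[OF A] by (simp add: u_pow_add trace_eval_u_pow)
  have "complex_of_real \<bar>real_of_int a\<bar> = of_int \<bar>a\<bar>"
    by (metis of_int_abs of_real_of_int_eq)
  then show ?thesis
    unfolding D_gen_u_pow trace_eval_simps 1 2 lap_pow_def
    by (simp add: cscale_add_left mult.commute)
qed

lemma sum_reflect: "(\<Sum>j = 1..k - 1. f j) = (\<Sum>j = 1..k - (1::int). f (k - j))"
  "(\<Sum>j = k + 1..-1. f j) = (\<Sum>j = k + 1..-(1::int). f (k - j))"
  by (rule sum.reindex_bij_witness[where i = "\<lambda>j. k - j" and j = "\<lambda>j. k - j"]; auto)+

text \<open>The normalized trace commutes with the Laplacian, so the operator at \<open>v k\<close>
  has to evaluate to the trace of the Laplacian of the power \<open>k\<close>.\<close>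

lemma trace_eval_D_coeff:
  assumes A: "A \<in> K"
  shows "trace_eval (D_coeff al g k) A = cscale (ntrace (lap_pow A k)) (mat 1)"
proof -
  have y: "trace_eval (y_coeff k) A = cscale (ntrace (weighted_sum k (\<lambda>j. cscale (w A j) (mat_powi A (k - j))))) (mat 1)"
  proof -
    \<comment> \<open>The reflection \<open>j \<mapsto> k - j\<close> replaces the weight
      \<open>j\<close> by the weight \<open>k - j\<close> of \<open>weighted_sum\<close>.\<close>
    have "y_coeff k = (\<Sum>j = 1..k - 1. of_int (k - j) * (v j * v (k - j))) - (\<Sum>j = k + 1..-1. of_int (k - j) * (v j * v (k - j)))"
      unfolding y_coeff_def sum_reflect[of "\<lambda>j. of_int j * v j * v (k - j)" k] by (simp add: mult_ac)
    then show ?thesis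
      unfolding weighted_sum_def
      by (simp add: trace_eval_sum trace_eval_diff trace_eval_of_int trace_eval_v trace_eval_v_mult[OF A] ntrace_simps
        cscale_diff_left cscale_sum_left mult.assoc del: of_int_diff)
  qed
  have z: "trace_eval (z_coeff k) A = cscale (ntrace (weighted_sum k (\<lambda>j. mat_powi A (k - 2 * j)))) (mat 1)"
    unfolding z_coeff_def weighted_sum_def
    by (simp add: trace_eval_simps ntrace_simps cscale_diff_left cscale_sum_left del: of_int_diff)
  have "complex_of_real \<bar>real_of_int k\<bar> = of_int \<bar>k\<bar>"
    by (metis of_int_abs of_real_of_int_eq)
  then show ?thesis
    unfolding D_coeff_def lap_pow_def trace_eval_simps y z
    by (simp add: ntrace_simps cscale_add_left cscale_diff_left mult_ac distrib_left right_diff_distrib)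
qed

lemma trace_eval_grad_u_pow:
  assumes A: "A \<in> K"
  shows "trace_eval (grad_all e k (u_pow a)) A
    = cscale (of_int a) (cscale cp (mat_powi A (a - k)) - cscale cm (mat_powi A (a + k)) + cscale (g * w A k) (mat_powi A a))"
  unfolding grad_all_def grad_u_pow
  by (simp only: trace_eval_simps trace_eval_v_mult[OF A]) (simp add: cscale_add_right cscale_diff_right mult_ac)

lemma trace_eval_grad_v_mult:
  assumes A: "A \<in> K" and l: "l \<noteq> 0"
  shows "trace_eval (grad_all e k (v l * P)) A = cscale (w A l) (trace_eval (grad_all e k P) A)
    + cscale (of_int l * (cp * w A (e * (k - l)) - cm * w A (k + l) + g * w A k * w A l)) (trace_eval P A)"
proof -
  have "grad_all e k (v l * P) = v l * grad_all e k P + of_int l * (const cp * (v (e * (k - l)) * P)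
      - const cm * (v (k + l) * P) + const g * (v k * (v l * P)))"
    unfolding grad_all_def grad_v_mult[OF l] by (simp add: algebra_simps)
  then show ?thesis
    by (simp only: trace_eval_simps trace_eval_v_mult[OF A])
       (simp add: cscale_add_left cscale_diff_left cscale_add_right cscale_diff_right mult_ac distrib_left right_diff_distrib)
qed

text \<open>A strengthening of \<open>intertwines\<close> for the induction: the Laplacian of
  \<open>v l * P\<close> contains the cross term of the first derivatives of \<open>v l\<close> and
  \<open>P\<close>, so the pairing of \<open>F1\<close> with powers of \<open>A\<close> has to be
  known as well, for both signs in \<open>grad_all\<close>.\<close>

definition good_mono :: "monomial \<Rightarrow> bool" where
  "good_mono m \<longleftrightarrow> (\<exists>F1 F2.
     (\<forall>X\<in>Ba. deriv_along X (trace_eval (tmono m)) (F1 X) \<and> deriv_along X (F1 X) (F2 X)) \<and>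
     (\<forall>A\<in>K. (\<Sum>X\<in>Ba. F2 X A) = trace_eval (Dop (tmono m)) A \<and>
       (\<forall>k. \<forall>e\<in>{1, -1}. (\<Sum>X\<in>Ba. cscale (ntrace (mat_powi A k ** X)) (F1 X A)) = trace_eval (grad_all e k (tmono m)) A)))"

lemma good_mono_u_pow: "good_mono (a, 0)"
  unfolding good_mono_def u_pow_mono[symmetric]
proof (rule exI[of _ "\<lambda>X. dpowi X a"], rule exI[of _ "\<lambda>X. ddpowi X a"], intro conjI ballI allI)
  fix X assume X: "X \<in> Ba"
  show "deriv_along X (trace_eval (u_pow a)) (dpowi X a)"
    by (rule deriv_along_cong[OF deriv_along_mat_powi(1)[OF Ba_lie[OF X], of a]]) (simp_all add: trace_eval_u_pow)
  show "deriv_along X (dpowi X a) (ddpowi X a)"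
    by (rule deriv_along_mat_powi(2)[OF Ba_lie[OF X]])
next
  fix A assume A: "A \<in> K"
  show "(\<Sum>X\<in>Ba. ddpowi X a A) = trace_eval (Dop (u_pow a)) A"
    by (simp add: sum_ddpowi[OF A] trace_eval_D_u_pow[OF A])
  fix k and e :: int assume "e \<in> {1, -1}"
  show "(\<Sum>X\<in>Ba. cscale (ntrace (mat_powi A k ** X)) (dpowi X a A)) = trace_eval (grad_all e k (u_pow a)) A"
    by (simp add: pairing_dpowi[OF A] trace_eval_grad_u_pow[OF A])
qed

lemma good_mono_v_mult:
  assumes "good_mono (a, e)" and l: "l \<noteq> 0"
  shows "good_mono (a, single l 1 + e)"
proof -
  let ?P = "tmono (a, e)"
  have vP: "tmono (a, single l 1 + e) = v l * ?P" using l by (simp add: v_mult_mono)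
  obtain F1 F2 where F: "\<And>X. X \<in> Ba \<Longrightarrow> deriv_along X (trace_eval ?P) (F1 X)" "\<And>X. X \<in> Ba \<Longrightarrow> deriv_along X (F1 X) (F2 X)"
    and lap: "\<And>A. A \<in> K \<Longrightarrow> (\<Sum>X\<in>Ba. F2 X A) = trace_eval (Dop ?P) A"
    and gr: "\<And>A k e. A \<in> K \<Longrightarrow> e \<in> {1, -1} \<Longrightarrow>
      (\<Sum>X\<in>Ba. cscale (ntrace (mat_powi A k ** X)) (F1 X A)) = trace_eval (grad_all e k ?P) A"
    using assms(1) unfolding good_mono_def by blast
  define G1 where "G1 X A = cscale (w A l) (F1 X A) + cscale (ntrace (dpowi X l A)) (trace_eval ?P A)" for X A
  define G2 where "G2 X A = (cscale (w A l) (F2 X A) + cscale (ntrace (dpowi X l A)) (F1 X A))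
    + (cscale (ntrace (dpowi X l A)) (F1 X A) + cscale (ntrace (ddpowi X l A)) (trace_eval ?P A))" for X A
  show ?thesis
    unfolding good_mono_def vP
  proof (rule exI[of _ G1], rule exI[of _ G2], intro conjI ballI allI)
    fix X assume X: "X \<in> Ba"
    note L = Ba_lie[OF X]
    have w1: "deriv_along X (\<lambda>A. w A l) (\<lambda>A. ntrace (dpowi X l A))"
      "deriv_along X (\<lambda>A. ntrace (dpowi X l A)) (\<lambda>A. ntrace (ddpowi X l A))"
      by (rule deriv_along_linear[OF bounded_linear_ntrace] deriv_along_mat_powi[OF L])+
    show "deriv_along X (trace_eval (v l * ?P)) (G1 X)"
      by (rule deriv_along_cong[OF deriv_along_cscale[OF w1(1) F(1)[OF X]]]) (simp_all add: trace_eval_v_mult G1_def)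
    show "deriv_along X (G1 X) (G2 X)"
      by (rule deriv_along_cong[OF deriv_along_add[OF deriv_along_cscale[OF w1(1) F(2)[OF X]] deriv_along_cscale[OF w1(2) F(1)[OF X]]]])
         (simp_all add: G1_def G2_def)
  next
    fix A assume A: "A \<in> K"
    define q where "q k = (\<Sum>X\<in>Ba. cscale (ntrace (mat_powi A k ** X)) (F1 X A))" for k
    have nd: "(\<Sum>X\<in>Ba. cscale (ntrace (dpowi X l A)) (F1 X A)) = cscale (of_int l) (q l)"
      unfolding q_def cscale_sum_right by (intro sum.cong refl) (simp add: ntrace_dpowi[OF A])
    have ndd: "(\<Sum>X\<in>Ba. ntrace (ddpowi X l A)) = ntrace (lap_pow A l)"
      by (simp add: ntrace_simps(5)[symmetric] sum_ddpowi[OF A])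
    \<comment> \<open>The cross term occurs twice; one copy is written with \<open>e = 1\<close> and
      the other with \<open>e = - 1\<close>, to match the two gradients in
      \<open>D_gen_v_mult\<close>.\<close>
    have q: "q l + q l = trace_eval (grad_all 1 l ?P) A + trace_eval (grad_all (-1) l ?P) A"
      using gr[OF A, of 1 l] gr[OF A, of "-1" l] by (simp add: q_def)
    have "(\<Sum>X\<in>Ba. G2 X A) = cscale (w A l) (trace_eval (Dop ?P) A) + cscale (ntrace (lap_pow A l)) (trace_eval ?P A)
        + cscale (of_int l) (q l + q l)"
      unfolding G2_def sum.distrib nd cscale_sum_right[symmetric] cscale_sum_left[symmetric] ndd lap[OF A]
      by (simp only: cscale_add_right add_ac)
    also have "\<dots> = trace_eval (Dop (v l * ?P)) A"
    proof -
      have "Dop (v l * ?P) = v l * Dop ?P + D_coeff al g l * ?P + of_int l * (grad_all 1 l ?P + grad_all (-1) l ?P)"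
        unfolding D_gen_v_mult[OF l] grad_all_def by (simp add: algebra_simps)
      then show ?thesis
        unfolding q by (simp add: trace_eval_add trace_eval_of_int trace_eval_v_mult[OF A]
            trace_eval_mult[OF K_invertible[OF A], of "D_coeff al g l"] trace_eval_D_coeff[OF A])
    qed
    finally show "(\<Sum>X\<in>Ba. G2 X A) = trace_eval (Dop (v l * ?P)) A" .
    fix k and e :: int assume e: "e \<in> {1, -1}"
    have "(\<Sum>X\<in>Ba. cscale (ntrace (mat_powi A k ** X)) (G1 X A)) = cscale (w A l) (q k)
        + cscale (of_int l * (\<Sum>X\<in>Ba. ntrace (mat_powi A k ** X) * ntrace (mat_powi A l ** X))) (trace_eval ?P A)"
      unfolding G1_def q_def cscale_sum_right sum_distrib_left cscale_sum_left sum.distrib[symmetric]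
      by (intro sum.cong refl) (simp add: ntrace_dpowi[OF A] cscale_add_right mult_ac)
    \<comment> \<open>The pairing yields the index \<open>l - k\<close>, which is that of
      \<open>grad_all\<close> for \<open>e = - 1\<close>; \<open>cp_symmetric\<close> covers
      \<open>e = 1\<close>.\<close>
    moreover have "cp * w A (l - k) = cp * w A (e * (k - l))"
      using e cp_symmetric[OF A, of "k - l"] by auto
    ultimately show "(\<Sum>X\<in>Ba. cscale (ntrace (mat_powi A k ** X)) (G1 X A)) = trace_eval (grad_all e k (v l * ?P)) A"
      unfolding trace_eval_grad_v_mult[OF A l] pairing_pairing[OF A] gr[OF A e, of k, symmetric] q_def
      by (simp add: add.commute)
  qed
qed

text \<open>Induction on the total number of \<open>v\<close>-factors. The condition on the exponent
  at \<open>0\<close> ensures that the factor split off is a genuine variable.\<close>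

lemma good_mono: "lookup e 0 = 0 \<Longrightarrow> good_mono (a, e)"
proof (induction e rule: measure_induct_rule[where f = "\<lambda>e. \<Sum>k\<in>keys e. lookup e k"])
  case (less e)
  show ?case
  proof (cases "e = 0")
    case True
    then show ?thesis by (simp add: good_mono_u_pow)
  next
    case False
    then obtain l where l: "l \<in> keys e" by (metis ex_in_conv keys_eq_empty)
    define e' where "e' = e - single l 1"
    have e: "e = single l 1 + e'"
      using l by (intro poly_mapping_eqI) (auto simp: e'_def lookup_add lookup_minus lookup_single when_def in_keys_iff)
    have l0: "l \<noteq> 0" using l less.prems by (auto simp: in_keys_iff)
    have sub: "keys e' \<subseteq> keys e" by (auto simp: e'_def in_keys_iff lookup_minus)
    have "(\<Sum>k\<in>keys e'. lookup e' k) = (\<Sum>k\<in>keys e. lookup e' k)"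
      using sub by (intro sum.mono_neutral_left) (auto simp: in_keys_iff)
    also have "\<dots> < (\<Sum>k\<in>keys e. lookup e k)"
      using l by (intro sum_strict_mono_ex1 bexI[of _ l]) (auto simp: e'_def lookup_minus lookup_single in_keys_iff when_def)
    finally have "good_mono (a, e')"
      using less.prems by (intro less.IH) (simp_all add: e'_def lookup_minus)
    then show ?thesis
      using good_mono_v_mult[OF _ l0] e by metis
  qed
qed

lemma intertwines_trace_polys:
  assumes "P \<in> trace_polys"
  shows "intertwines P"
proof -
  have good: "good_mono m" if "m \<in> keys P" for m
    using assms that by (cases m) (auto simp: trace_polys_def intro!: good_mono)
  define R where "R m F1 F2 \<longleftrightarrow> (\<forall>X\<in>Ba. deriv_along X (trace_eval (tmono m)) (F1 X) \<and> deriv_along X (F1 X) (F2 X)) \<and>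
     (\<forall>A\<in>K. (\<Sum>X\<in>Ba. F2 X A) = trace_eval (Dop (tmono m)) A)" for m F1 F2
  have "\<forall>m\<in>keys P. \<exists>F1. \<exists>F2. R m F1 F2"
    using good unfolding good_mono_def R_def by blast
  from bchoice[OF this] obtain F1 where "\<forall>m\<in>keys P. \<exists>F2. R m (F1 m) F2" ..
  from bchoice[OF this] obtain F2 where R: "\<forall>m\<in>keys P. R m (F1 m) (F2 m)" ..
  have F: "\<And>m X. m \<in> keys P \<Longrightarrow> X \<in> Ba \<Longrightarrow> deriv_along X (trace_eval (tmono m)) (F1 m X)"
    "\<And>m X. m \<in> keys P \<Longrightarrow> X \<in> Ba \<Longrightarrow> deriv_along X (F1 m X) (F2 m X)"
    "\<And>m A. m \<in> keys P \<Longrightarrow> A \<in> K \<Longrightarrow> (\<Sum>X\<in>Ba. F2 m X A) = trace_eval (Dop (tmono m)) A"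
    using R unfolding R_def by blast+
  have cs: "deriv_along X (\<lambda>A. cscale z (G A)) (\<lambda>A. cscale z (G' A))" if "deriv_along X G G'" for X z G G'
    by (rule deriv_along_linear[OF bounded_bilinear.bounded_linear_right[OF bounded_bilinear_cscale] that])
  have te: "trace_eval P A = (\<Sum>m\<in>keys P. cscale (lookup P m) (trace_eval (tmono m) A))" for A
    by (subst poly_mono_expansion[of P]) (simp add: trace_eval_sum trace_eval_const_mult)
  show ?thesis
    unfolding intertwines_def
  proof (rule exI[of _ "\<lambda>X A. \<Sum>m\<in>keys P. cscale (lookup P m) (F1 m X A)"], rule exI[of _ "\<lambda>X A. \<Sum>m\<in>keys P. cscale (lookup P m) (F2 m X A)"], intro conjI ballI)
    fix X assume X: "X \<in> Ba"
    show "deriv_along X (trace_eval P) (\<lambda>A. \<Sum>m\<in>keys P. cscale (lookup P m) (F1 m X A))"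
      unfolding te by (intro deriv_along_sum cs F X Ba_lie)
    show "deriv_along X (\<lambda>A. \<Sum>m\<in>keys P. cscale (lookup P m) (F1 m X A)) (\<lambda>A. \<Sum>m\<in>keys P. cscale (lookup P m) (F2 m X A))"
      by (intro deriv_along_sum cs F X Ba_lie)
  next
    fix A assume A: "A \<in> K"
    have "(\<Sum>X\<in>Ba. \<Sum>m\<in>keys P. cscale (lookup P m) (F2 m X A)) = (\<Sum>m\<in>keys P. cscale (lookup P m) (trace_eval (Dop (tmono m)) A))"
      by (subst sum.swap) (simp add: cscale_sum_right[symmetric] F(3)[OF _ A])
    also have "\<dots> = trace_eval (Dop P) A"
      by (subst linear_op_expansion[OF linear_op_D_gen, of _ _ _ _ P]) (simp add: trace_eval_sum trace_eval_const_mult)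
    finally show "(\<Sum>X\<in>Ba. \<Sum>m\<in>keys P. cscale (lookup P m) (F2 m X A)) = trace_eval (Dop P) A" .
  qed
qed

end

section \<open>Regular functions and Haar integration\<close>

lemma has_vector_derivative_imp_quotient_tendsto:
  assumes "(f has_vector_derivative f') (at (0::real))"
  shows "((\<lambda>t. (f t - f 0) /\<^sub>R t) \<longlongrightarrow> f') (at 0)"
proof -
  have "((\<lambda>t. norm (f (0 + t) - f 0 - t *\<^sub>R f') / norm t) \<longlongrightarrow> 0) (at 0)"
    using assms unfolding has_vector_derivative_def has_derivative_at by blast
  moreover have "\<forall>\<^sub>F t in at 0. norm ((f t - f 0) /\<^sub>R t - f') \<le> norm (f (0 + t) - f 0 - t *\<^sub>R f') / norm t"
  proof (rule eventually_at_filter[THEN iffD2], intro always_eventually allI impI)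
    fix t :: real assume "t \<noteq> 0"
    then have "(f t - f 0) /\<^sub>R t - f' = (f (0 + t) - f 0 - t *\<^sub>R f') /\<^sub>R t"
      by (simp add: scaleR_diff_right)
    then show "norm ((f t - f 0) /\<^sub>R t - f') \<le> norm (f (0 + t) - f 0 - t *\<^sub>R f') / norm t"
      by (simp add: divide_inverse mult.commute)
  qed
  ultimately have "((\<lambda>t. (f t - f 0) /\<^sub>R t - f') \<longlongrightarrow> 0) (at 0)"
    by (rule Lim_null_comparison[rotated])
  then show ?thesis by (simp add: LIM_zero_iff)
qed

context laplace_group
begin

text \<open>Polynomials in the entries and their conjugates, up to equality on \<open>K\<close>. The
  class contains the entries of trace polynomials, since inverse powers are adjoints, and is stable
  under derivatives and left translations. The rule \<open>regular_cong\<close> is there because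
  \<open>lie_deriv\<close> is controlled only on \<open>K\<close>.\<close>

inductive regular :: "('m cmat \<Rightarrow> complex) \<Rightarrow> bool" where
  regular_const: "regular (\<lambda>A. z)"
| regular_entry: "regular (\<lambda>A. A $ i $ j)"
| regular_cnj_entry: "regular (\<lambda>A. cnj (A $ i $ j))"
| regular_add: "regular f \<Longrightarrow> regular u \<Longrightarrow> regular (\<lambda>A. f A + u A)"
| regular_mult: "regular f \<Longrightarrow> regular u \<Longrightarrow> regular (\<lambda>A. f A * u A)"
| regular_cong: "regular f \<Longrightarrow> (\<And>A. A \<in> K \<Longrightarrow> f A = u A) \<Longrightarrow> regular u"

lemma regular_sum: "(\<And>i. i \<in> S \<Longrightarrow> regular (f i)) \<Longrightarrow> regular (\<lambda>A. \<Sum>i\<in>S. f i A)"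
  by (induction S rule: infinite_finite_induct) (auto intro: regular_const regular_add)

lemma regular_power: "regular f \<Longrightarrow> regular (\<lambda>A. f A ^ n)"
  by (induction n) (auto intro: regular_const regular_mult)

lemma regular_prod: "(\<And>i. i \<in> S \<Longrightarrow> regular (f i)) \<Longrightarrow> regular (\<lambda>A. \<Prod>i\<in>S. f i A)"
  by (induction S rule: infinite_finite_induct) (auto intro: regular_const regular_mult)

lemma regular_cnj: "regular f \<Longrightarrow> regular (\<lambda>A. cnj (f A))"
proof (induction rule: regular.induct)
  case (regular_cong f u)
  then show ?case by (auto intro: regular.regular_cong[of "\<lambda>A. cnj (f A)"])
qed (auto intro: regular.intros)

lemma regular_mat_pow: "regular (\<lambda>A. mat_pow A n $ i $ j)"
proof (induction n arbitrary: i)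
  case 0
  show ?case by (simp add: regular_const)
next
  case (Suc n)
  then show ?case
    by (simp add: matrix_mult_nth) (intro regular_sum regular_mult regular_entry)
qed

lemma regular_mat_powi: "regular (\<lambda>A. mat_powi A k $ i $ j)"
proof (cases k rule: int_cases2)
  case (nonneg n)
  then show ?thesis by (simp add: regular_mat_pow)
next
  case (nonpos n)
  show ?thesis
    by (rule regular_cong[OF regular_cnj[OF regular_mat_pow[of n j i]]])
       (simp add: nonpos mat_powi_minus[OF unitary])
qed

lemma regular_trace_eval: "regular (\<lambda>A. trace_eval P A $ i $ j)"
proof -
  have "regular (\<lambda>A. ntrace (mat_powi A k))" for k
    unfolding ntrace_def trace_def divide_inverse
    by (intro regular_mult regular_sum regular_mat_powi regular_const)
  then have "regular (\<lambda>A. \<Sum>m\<in>keys P. lookup P m * ((\<Prod>k\<in>keys (snd m). ntrace (mat_powi A k) ^ lookup (snd m) k) * mat_powi A (fst m) $ i $ j))"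
    by (intro regular_sum regular_mult regular_const regular_prod regular_power regular_mat_powi)
  then show ?thesis
    by (simp add: trace_eval_superset[of "keys P"] tmono_eval_def mult.assoc)
qed

lemma regular_deriv_along:
  assumes "regular f" and X: "X \<in> lie_algebra K"
  shows "\<exists>f'. regular f' \<and> deriv_along X f f'"
  using assms(1)
proof induction
  case (regular_const z)
  show ?case using deriv_along_const[OF X] regular.regular_const by blast
next
  case (regular_entry i j)
  have "deriv_along X (\<lambda>A. A $ i $ j) (\<lambda>A. (A ** X) $ i $ j)"
    by (rule deriv_along_linear[OF bounded_linear_compose[OF bounded_linear_vec_nth bounded_linear_vec_nth] deriv_along_id[OF X]])
  moreover have "regular (\<lambda>A. (A ** X) $ i $ j)"
    unfolding matrix_mult_nth by (intro regular_sum regular_mult regular.regular_entry regular.regular_const)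
  ultimately show ?case by blast
next
  case (regular_cnj_entry i j)
  have "deriv_along X (\<lambda>A. cnj (A $ i $ j)) (\<lambda>A. cnj ((A ** X) $ i $ j))"
    by (rule deriv_along_linear[OF bounded_linear_compose[OF bounded_linear_cnj bounded_linear_compose[OF bounded_linear_vec_nth bounded_linear_vec_nth]] deriv_along_id[OF X]])
  moreover have "regular (\<lambda>A. cnj ((A ** X) $ i $ j))"
    unfolding matrix_mult_nth by (intro regular_cnj regular_sum regular_mult regular.regular_entry regular.regular_const)
  ultimately show ?case by blast
next
  case (regular_add f u)
  then obtain f' u' where "regular f'" "deriv_along X f f'" "regular u'" "deriv_along X u u'" by blast
  then show ?case
    by (intro exI[of _ "\<lambda>A. f' A + u' A"] conjI regular.regular_add deriv_along_add)
next
  case (regular_mult f u)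
  then obtain f' u' where "regular f'" "deriv_along X f f'" "regular u'" "deriv_along X u u'" by blast
  then show ?case
    by (intro exI[of _ "\<lambda>A. f A * u' A + f' A * u A"] conjI regular.regular_add regular.regular_mult deriv_along_mult regular_mult.hyps)
next
  case (regular_cong f u)
  then obtain f' where "regular f'" "deriv_along X f f'" by blast
  then show ?case
    using deriv_along_cong[of X f f' u f'] regular_cong.hyps by blast
qed

lemma regular_lie_deriv:
  assumes "regular f" and X: "X \<in> lie_algebra K"
  shows "regular (lie_deriv X f)" "deriv_along X f (lie_deriv X f)"
proof -
  obtain f' where f': "regular f'" "deriv_along X f f'"
    using regular_deriv_along[OF assms] by blast
  then have eq: "lie_deriv X f A = f' A" if "A \<in> K" for A
    using lie_deriv_eq that by blast
  show "regular (lie_deriv X f)"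
    by (rule regular_cong[OF f'(1)]) (simp add: eq)
  show "deriv_along X f (lie_deriv X f)"
    by (rule deriv_along_cong[OF f'(2)]) (simp_all add: eq)
qed

lemma regular_continuous: "regular f \<Longrightarrow> continuous_on K f"
proof (induction rule: regular.induct)
  case (regular_cong f u)
  then show ?case using continuous_on_cong by blast
qed (auto intro!: continuous_intros)

lemma regular_smooth:
  assumes "regular f"
  shows "smooth_on_group K f"
proof -
  have "Cn_on n K f" if "regular f" for n f
    using that
  proof (induction n arbitrary: f)
    case 0
    then show ?case by (simp add: regular_continuous)
  next
    case (Suc n)
    show ?case
      unfolding Cn_on.simps
    proof (intro conjI ballI)
      show "continuous_on K f" by (rule regular_continuous[OF Suc.prems])
      fix X assume X: "X \<in> lie_algebra K"
      show "Cn_on n K (lie_deriv X f)" by (rule Suc.IH[OF regular_lie_deriv(1)[OF Suc.prems X]])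
      fix k assume "k \<in> K"
      then show "(\<lambda>t. f (k ** mat_exp (t *\<^sub>R X))) differentiable (at 0)"
        by (rule differentiableI_vector[OF deriv_alongD[OF regular_lie_deriv(2)[OF Suc.prems X]]])
    qed
  qed
  then show ?thesis using assms by (simp add: smooth_on_group_def)
qed

lemma regular_translate:
  assumes "h \<in> K" "regular f"
  shows "regular (\<lambda>A. f (h ** A))"
  using assms(2)
proof induction
  case (regular_cong f u)
  show ?case
    by (rule regular.regular_cong[OF regular_cong.IH]) (use assms(1) regular_cong.hyps mult_in in blast)
next
  case (regular_entry i j)
  show ?case unfolding matrix_mult_nth by (intro regular_sum regular_mult regular.regular_entry regular.regular_const)
next
  case (regular_cnj_entry i j)
  show ?case unfolding matrix_mult_nth
    by (intro regular_cnj regular_sum regular_mult regular.regular_entry regular.regular_const)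
qed (auto intro: regular.intros)

text \<open>\<open>deriv_along\<close> speaks about \<open>t = 0\<close> at all points of
  \<open>K\<close>; the group law of the exponential carries this along the curve.\<close>

lemma curve_has_vector_derivative:
  assumes "deriv_along X f f'" "k \<in> K"
  shows "((\<lambda>t. f (k ** mat_exp (t *\<^sub>R X))) has_vector_derivative f' (k ** mat_exp (t *\<^sub>R X))) (at t)"
proof -
  have X: "X \<in> lie_algebra K" by (rule deriv_along_lie[OF assms(1)])
  let ?k = "k ** mat_exp (t *\<^sub>R X)"
  have "((\<lambda>s. s - t) has_vector_derivative 1) (at t)"
    by (auto intro!: derivative_eq_intros simp: has_vector_derivative_def)
  moreover have "((\<lambda>s. f (?k ** mat_exp (s *\<^sub>R X))) has_vector_derivative f' ?k) (at (t - t))"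
    using deriv_alongD[OF assms(1) curve_in[OF X assms(2)]] by simp
  ultimately have "((\<lambda>s. f (?k ** mat_exp (s *\<^sub>R X))) \<circ> (\<lambda>s. s - t) has_vector_derivative 1 *\<^sub>R f' ?k) (at t)"
    by (rule vector_diff_chain_at)
  moreover have "?k ** mat_exp ((s - t) *\<^sub>R X) = k ** mat_exp (s *\<^sub>R X)" for s
    using mat_exp_add[of t "s - t" X] by (simp add: matrix_mul_assoc[symmetric])
  ultimately show ?thesis by (simp add: o_def)
qed

lemma compact_K: "compact K"
proof -
  have "norm A = sqrt (real CARD('m))" if "A \<in> K" for A
  proof -
    have "of_real ((norm A)\<^sup>2) = (of_real (real CARD('m)) :: complex)"
      using trace_mult_conj_transpose[of A] unitary'[OF that] by (simp add: trace_I)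
    then have "(norm A)\<^sup>2 = real CARD('m)" by (simp only: of_real_eq_iff)
    then show ?thesis by (metis norm_ge_zero real_sqrt_abs abs_of_nonneg)
  qed
  then have "bounded K" by (auto simp: bounded_iff intro!: exI[of _ "sqrt (real CARD('m))"])
  then show ?thesis using closed_K by (simp add: compact_eq_bounded_closed)
qed

end

section \<open>Haar integration and symmetry of the Laplacian\<close>

locale haar_group = laplace_group K c al cp cm g
  for K :: "'m::finite cmat set" and c al cp cm g +
  fixes \<mu> :: "'m cmat measure"
  assumes haar: "haar_measure K \<mu>"
begin

lemma space_mu [simp]: "space \<mu> = K" and sets_mu: "sets \<mu> = sets (restrict_space borel K)"
  and emeasure_K: "emeasure \<mu> K = 1"
  using haar by (auto simp: haar_measure_def)

sublocale finite_measure \<mu>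
  by (rule finite_measureI) (simp add: emeasure_K)

lemma measurable_continuous:
  fixes f :: "'m cmat \<Rightarrow> 'b::{second_countable_topology, real_normed_vector}"
  shows "continuous_on K f \<Longrightarrow> f \<in> borel_measurable \<mu>"
  using borel_measurable_continuous_on_restrict[of K f] measurable_cong_sets[OF sets_mu refl] by blast

lemma integrable_continuous:
  fixes f :: "'m cmat \<Rightarrow> 'b::{second_countable_topology, banach}"
  assumes "continuous_on K f"
  shows "integrable \<mu> f"
proof -
  have "bounded (f ` K)"
    using compact_continuous_image[OF assms compact_K] by (rule compact_imp_bounded)
  then obtain C where C: "\<And>k. k \<in> K \<Longrightarrow> norm (f k) \<le> C"
    by (auto simp: bounded_iff)
  show ?thesis
    by (rule integrable_const_bound[of _ C]) (auto intro!: AE_I2 C measurable_continuous assms)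
qed

lemma measurable_translate:
  assumes "h \<in> K"
  shows "(\<lambda>k. h ** k) \<in> measurable \<mu> \<mu>" "(\<lambda>k. k ** h) \<in> measurable \<mu> \<mu>"
proof -
  have "continuous_on K (\<lambda>k. h ** k)" "continuous_on K (\<lambda>k. k ** h)"
    by (intro bounded_linear.continuous_on[OF bounded_bilinear.bounded_linear_right[OF bounded_bilinear_matrix_mult]]
        bounded_linear.continuous_on[OF bounded_bilinear.bounded_linear_left[OF bounded_bilinear_matrix_mult]] continuous_on_id)+
  then have "(\<lambda>k. h ** k) \<in> borel_measurable \<mu>" "(\<lambda>k. k ** h) \<in> borel_measurable \<mu>"
    by (simp_all add: measurable_continuous)
  then show "(\<lambda>k. h ** k) \<in> measurable \<mu> \<mu>" "(\<lambda>k. k ** h) \<in> measurable \<mu> \<mu>"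
    using assms mult_in
    by (subst measurable_cong_sets[OF refl sets_mu], intro measurable_restrict_space2, auto)+
qed

lemma integral_translate:
  fixes f :: "'m cmat \<Rightarrow> complex"
  assumes "h \<in> K" "f \<in> borel_measurable \<mu>"
  shows "(LINT k|\<mu>. f (h ** k)) = (LINT k|\<mu>. f k)" "(LINT k|\<mu>. f (k ** h)) = (LINT k|\<mu>. f k)"
proof -
  have d: "distr \<mu> \<mu> (\<lambda>k. h ** k) = \<mu>" "distr \<mu> \<mu> (\<lambda>k. k ** h) = \<mu>"
    using haar assms(1) by (auto simp: haar_measure_def)
  show "(LINT k|\<mu>. f (h ** k)) = (LINT k|\<mu>. f k)"
    using integral_distr[OF measurable_translate(1)[OF assms(1)] assms(2)] d(1) by simp
  show "(LINT k|\<mu>. f (k ** h)) = (LINT k|\<mu>. f k)"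
    using integral_distr[OF measurable_translate(2)[OF assms(1)] assms(2)] d(2) by simp
qed

lemma continuous_translate:
  assumes "continuous_on K f" "h \<in> K"
  shows "continuous_on K (\<lambda>k. f (h ** k))" "continuous_on K (\<lambda>k. f (k ** h))"
proof -
  have c: "continuous_on K (\<lambda>k. h ** k)" "continuous_on K (\<lambda>k. k ** h)"
    by (intro bounded_linear.continuous_on[OF bounded_bilinear.bounded_linear_right[OF bounded_bilinear_matrix_mult]]
        bounded_linear.continuous_on[OF bounded_bilinear.bounded_linear_left[OF bounded_bilinear_matrix_mult]] continuous_on_id)+
  show "continuous_on K (\<lambda>k. f (h ** k))" "continuous_on K (\<lambda>k. f (k ** h))"
    using assms(2) mult_in by (auto intro!: continuous_on_compose2[OF assms(1)] c)
qed

lemma null_translate: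
  assumes "U \<in> sets \<mu>" "emeasure \<mu> U = 0" "h \<in> K"
  shows "{k \<in> K. h ** k \<in> U} \<in> null_sets \<mu>"
proof -
  have "emeasure (distr \<mu> \<mu> (\<lambda>k. h ** k)) U = emeasure \<mu> {k \<in> K. h ** k \<in> U}"
    using emeasure_distr[OF measurable_translate(1)[OF assms(3)] assms(1)]
    by (simp add: vimage_def Int_def conj_commute)
  moreover have "distr \<mu> \<mu> (\<lambda>k. h ** k) = \<mu>"
    using haar assms(3) by (auto simp: haar_measure_def)
  moreover have "{k \<in> K. h ** k \<in> U} \<in> sets \<mu>"
    using measurable_sets[OF measurable_translate(1)[OF assms(3)] assms(1)]
    by (simp add: vimage_def Int_def conj_commute)
  ultimately show ?thesis using assms(2) by auto
qed

text \<open>Haar measure charges every nonempty relatively open subset of \<open>K\<close>: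
  otherwise finitely many translates of a null set would cover the compact \<open>K\<close>, which
  has measure \<open>1\<close>.\<close>

lemma integral_eq_0_imp_0:
  fixes f :: "'m cmat \<Rightarrow> real"
  assumes cont: "continuous_on K f" and nonneg: "\<And>k. k \<in> K \<Longrightarrow> f k \<ge> 0"
    and int: "(LINT k|\<mu>. f k) = 0" and k0: "k0 \<in> K"
  shows "f k0 = 0"
proof (rule ccontr)
  assume "f k0 \<noteq> 0"
  define U where "U = {k \<in> K. f k > 0}"
  have U: "U \<in> sets \<mu>"
    using borel_measurable_less[OF borel_measurable_const measurable_continuous[OF cont], of 0] by (simp add: U_def)
  have "AE k in \<mu>. 0 \<le> f k"
    by (rule AE_I2) (simp add: nonneg)
  then have "AE k in \<mu>. f k = 0"
    using integral_nonneg_eq_0_iff_AE[OF integrable_continuous[OF cont]] int by auto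
  then have "AE k in \<mu>. k \<notin> U"
    by (rule AE_mp) (auto simp: U_def)
  then have U0: "emeasure \<mu> U = 0"
    using U by (subst (asm) AE_iff_measurable[of U]) (auto simp: U_def)
  define T where "T h = {k \<in> K. f (conj_transpose h ** k) > 0}" for h
  have T0: "T h \<in> null_sets \<mu>" if "h \<in> K" for h
  proof -
    have "T h = {k \<in> K. conj_transpose h ** k \<in> U}"
      using mult_in[OF inv_in[OF that]] by (auto simp: T_def U_def)
    then show ?thesis using null_translate[OF U U0 inv_in[OF that]] by simp
  qed
  have "\<exists>V. open V \<and> V \<inter> K = T h" if "h \<in> K" for h
  proof -
    have "openin (top_of_set K) (K \<inter> (\<lambda>k. f (conj_transpose h ** k)) -` {0<..})"
      using continuous_openin_preimage_gen[OF continuous_translate(1)[OF cont inv_in[OF that]], of "{0<..}"] by simp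
    then show ?thesis
      unfolding openin_open by (auto simp: T_def vimage_def Int_def conj_commute)
  qed
  then obtain V where V: "\<And>h. h \<in> K \<Longrightarrow> open (V h)" "\<And>h. h \<in> K \<Longrightarrow> V h \<inter> K = T h"
    by metis
  have cover: "K \<subseteq> (\<Union>h\<in>K. V h)"
  proof
    fix k assume k: "k \<in> K"
    \<comment> \<open>Left multiplication by \<open>?h\<close> carries \<open>k0\<close> to
      \<open>k\<close>.\<close>
    let ?h = "k ** conj_transpose k0"
    have "conj_transpose ?h ** k = k0 ** (conj_transpose k ** k)"
      by (simp add: matrix_mul_assoc)
    then have "k \<in> T ?h"
      using \<open>f k0 \<noteq> 0\<close> nonneg[OF k0] k unitary[OF k] by (simp add: T_def)
    moreover have "?h \<in> K" using mult_in[OF k inv_in[OF k0]] .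
    ultimately show "k \<in> (\<Union>h\<in>K. V h)" using V(2) by blast
  qed
  obtain D where D: "D \<subseteq> K" "finite D" "K \<subseteq> (\<Union>h\<in>D. V h)"
    using compactE_image[OF compact_K, of K V] V(1) cover by metis
  have "K \<subseteq> (\<Union>h\<in>D. T h)"
    using D(1,3) V(2) by blast
  moreover have "(\<Union>h\<in>D. T h) \<in> null_sets \<mu>"
    using D(1,2) T0 by (intro null_sets.finite_UN) auto
  moreover have "K \<in> sets \<mu>" using sets.top[of \<mu>] by simp
  ultimately have "K \<in> null_sets \<mu>"
    by (meson null_sets_subset)
  then show False using emeasure_K by auto
qed

text \<open>By right invariance the difference quotients along the one-parameter group of
  \<open>X\<close> have integral zero. They converge to the derivative and are bounded by a bound
  for it through the mean value inequality, so dominated convergence applies.\<close>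

lemma integral_lie_deriv:
  assumes f: "regular f" and X: "X \<in> lie_algebra K"
  shows "(LINT k|\<mu>. lie_deriv X f k) = 0"
proof -
  let ?f' = "lie_deriv X f"
  have cf: "continuous_on K f" and cf': "continuous_on K ?f'"
    using regular_continuous f regular_lie_deriv(1)[OF f X] by blast+
  obtain C where C: "\<And>k. k \<in> K \<Longrightarrow> norm (?f' k) \<le> C"
    using compact_imp_bounded[OF compact_continuous_image[OF cf' compact_K]] by (auto simp: bounded_iff)
  define h where "h n = inverse (real (Suc n))" for n
  have h: "h n > 0" for n by (simp add: h_def)
  have h0: "h \<longlonglongrightarrow> 0" unfolding h_def by (rule LIMSEQ_inverse_real_of_nat)
  define q where "q n k = (f (k ** mat_exp (h n *\<^sub>R X)) - f k) /\<^sub>R h n" for n k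
  have cq: "continuous_on K (q n)" for n
    unfolding q_def by (intro continuous_intros continuous_translate cf exp_in[OF X])
  have int0: "(LINT k|\<mu>. q n k) = 0" for n
  proof -
    have "(LINT k|\<mu>. f (k ** mat_exp (h n *\<^sub>R X)) - f k) = 0"
      using integral_translate(2)[OF exp_in[OF X] measurable_continuous[OF cf], of "h n"]
      by (subst Bochner_Integration.integral_diff)
         (auto intro!: integrable_continuous continuous_translate cf exp_in[OF X])
    then show ?thesis
      unfolding q_def by simp
  qed
  have "(\<lambda>n. LINT k|\<mu>. q n k) \<longlonglongrightarrow> (LINT k|\<mu>. ?f' k)"
  proof (rule integral_dominated_convergence[where w = "\<lambda>_. C"])
    show "?f' \<in> borel_measurable \<mu>" "q n \<in> borel_measurable \<mu>" for n
      by (intro measurable_continuous cf' cq)+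
    show "AE k in \<mu>. (\<lambda>n. q n k) \<longlonglongrightarrow> ?f' k"
    proof (rule AE_I2)
      fix k assume "k \<in> space \<mu>"
      then have k: "k \<in> K" by simp
      have "((\<lambda>t. (f (k ** mat_exp (t *\<^sub>R X)) - f k) /\<^sub>R t) \<longlongrightarrow> ?f' k) (at 0)"
        using has_vector_derivative_imp_quotient_tendsto[OF deriv_alongD[OF regular_lie_deriv(2)[OF f X] k]] by simp
      then show "(\<lambda>n. q n k) \<longlonglongrightarrow> ?f' k"
        unfolding q_def by (rule filterlim_compose) (use h h0 in \<open>auto simp: filterlim_at less_imp_neq[symmetric] eventually_sequentially\<close>)
    qed
    show "AE k in \<mu>. norm (q n k) \<le> C" for n
    proof (rule AE_I2)
      fix k assume "k \<in> space \<mu>"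
      then have k: "k \<in> K" by simp
      have "norm (f (k ** mat_exp (h n *\<^sub>R X)) - f (k ** mat_exp (0 *\<^sub>R X))) \<le> C * norm (h n - 0)"
      proof (rule differentiable_bound[of UNIV "\<lambda>t. f (k ** mat_exp (t *\<^sub>R X))" "\<lambda>t s. s *\<^sub>R ?f' (k ** mat_exp (t *\<^sub>R X))"])
        fix t :: real
        show "((\<lambda>t. f (k ** mat_exp (t *\<^sub>R X))) has_derivative (\<lambda>s. s *\<^sub>R ?f' (k ** mat_exp (t *\<^sub>R X)))) (at t within UNIV)"
          using curve_has_vector_derivative[OF regular_lie_deriv(2)[OF f X] k, of t] by (simp add: has_vector_derivative_def)
        show "onorm (\<lambda>s. s *\<^sub>R ?f' (k ** mat_exp (t *\<^sub>R X))) \<le> C"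
          by (rule onorm_le) (use mult_left_mono[OF C[OF curve_in[OF X k]] abs_ge_zero] in \<open>simp add: mult.commute\<close>)
      qed auto
      moreover have "norm (q n k) = norm (f (k ** mat_exp (h n *\<^sub>R X)) - f k) / h n"
        using h[of n] by (simp add: q_def divide_inverse mult.commute)
      ultimately show "norm (q n k) \<le> C"
        using h[of n] by (simp add: pos_divide_le_eq)
    qed
  qed simp
  then show ?thesis by (simp add: int0 LIMSEQ_const_iff)
qed

text \<open>Integration by parts: the derivative of \<open>f * cnj u\<close> has integral zero, and
  the product rule splits it. Applied twice, it makes the Laplacian symmetric.\<close>

lemma integral_lie_deriv_swap:
  assumes f: "regular f" and u: "regular u" and X: "X \<in> lie_algebra K"
  shows "(LINT k|\<mu>. lie_deriv X f k * cnj (u k)) = - (LINT k|\<mu>. f k * cnj (lie_deriv X u k))"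
proof -
  have "deriv_along X (\<lambda>k. f k * cnj (u k)) (\<lambda>k. f k * cnj (lie_deriv X u k) + lie_deriv X f k * cnj (u k))"
    by (rule deriv_along_mult[OF regular_lie_deriv(2)[OF f X] deriv_along_linear[OF bounded_linear_cnj regular_lie_deriv(2)[OF u X]]])
  then have "(LINT k|\<mu>. f k * cnj (lie_deriv X u k) + lie_deriv X f k * cnj (u k)) = (LINT k|\<mu>. lie_deriv X (\<lambda>k. f k * cnj (u k)) k)"
    by (intro Bochner_Integration.integral_cong) (simp_all add: lie_deriv_eq)
  also have "\<dots> = 0"
    by (intro integral_lie_deriv regular_mult f regular_cnj u X)
  finally have "(LINT k|\<mu>. f k * cnj (lie_deriv X u k)) + (LINT k|\<mu>. lie_deriv X f k * cnj (u k)) = 0"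
    by (subst (asm) Bochner_Integration.integral_add)
       (auto intro!: integrable_continuous regular_continuous regular_mult regular_cnj f u regular_lie_deriv X)
  then show ?thesis by (simp add: add_eq_0_iff)
qed

lemma integral_laplacian_swap:
  assumes f: "regular f" and u: "regular u"
  shows "(LINT k|\<mu>. laplacian c K f k * cnj (u k)) = (LINT k|\<mu>. f k * cnj (laplacian c K u k))"
proof -
  have i: "integrable \<mu> (\<lambda>k. a k * cnj (b k))" if "regular a" "regular b" for a b
    using that by (intro integrable_continuous regular_continuous regular_mult regular_cnj)
  note rl = regular_lie_deriv(1)
  have "(LINT k|\<mu>. laplacian c K f k * cnj (u k)) = (\<Sum>X\<in>Ba. LINT k|\<mu>. lie_deriv X (lie_deriv X f) k * cnj (u k))"
    unfolding laplacian_def Ba_def[symmetric] sum_distrib_right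
    by (rule Bochner_Integration.integral_sum) (intro i rl f u Ba_lie; assumption)
  also have "\<dots> = (\<Sum>X\<in>Ba. LINT k|\<mu>. f k * cnj (lie_deriv X (lie_deriv X u) k))"
    by (intro sum.cong refl) (simp add: integral_lie_deriv_swap rl f u Ba_lie)
  also have "\<dots> = (LINT k|\<mu>. f k * cnj (laplacian c K u k))"
    unfolding laplacian_def Ba_def[symmetric] cnj_sum sum_distrib_left
    by (rule Bochner_Integration.integral_sum[symmetric]) (intro i rl f u Ba_lie; assumption)
  finally show ?thesis .
qed

end

section \<open>Spectral decomposition for a positive semidefinite form\<close>

text \<open>The subspace \<open>V\<close> is separate from the ambient type because the type
  \<open>trace_poly\<close> also contains exponents at the index \<open>0\<close>, while the link
  with the Laplacian is established on \<open>trace_polys\<close>. A second instance, with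
  \<open>V = UNIV\<close>, is left multiplication by a Hermitian matrix.\<close>

locale semi_inner = vector_space scale
  for scale :: "complex \<Rightarrow> 'v::ab_group_add \<Rightarrow> 'v" +
  fixes ip :: "'v \<Rightarrow> 'v \<Rightarrow> complex" and T :: "'v \<Rightarrow> 'v" and V :: "'v set"
  assumes subspace_V: "subspace V"
    and T_V: "x \<in> V \<Longrightarrow> T x \<in> V"
    and T_add: "T (x + y) = T x + T y"
    and T_scale: "T (scale c x) = scale c (T x)"
    and ip_add: "ip (x + y) z = ip x z + ip y z"
    and ip_scale: "ip (scale c x) y = c * ip x y"
    and ip_cnj: "ip y x = cnj (ip x y)"
    and ip_nonneg: "0 \<le> Re (ip x x)"
    and T_sym: "x \<in> V \<Longrightarrow> y \<in> V \<Longrightarrow> ip (T x) y = ip x (T y)"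
begin

definition null :: "'v \<Rightarrow> bool" where "null x \<longleftrightarrow> ip x x = 0"

lemma ip_add_right: "ip z (x + y) = ip z x + ip z y"
  using ip_cnj ip_add by (metis complex_cnj_add)

lemma ip_scale_right: "ip x (scale c y) = cnj c * ip x y"
  using ip_cnj ip_scale by (metis complex_cnj_mult)

text \<open>Adding multiples of a null vector to \<open>y\<close> changes \<open>ip y y\<close>
  affinely, so a nonzero \<open>ip x y\<close> would drive it below zero.\<close>

lemma ip_null: assumes "null x" shows "ip x y = 0"
proof (rule ccontr)
  assume a: "ip x y \<noteq> 0"
  define a where "a = ip x y"
  have "0 \<le> Re (ip y y) - 2 * t * (norm a)\<^sup>2" for t :: real
  proof -
    define c where "c = - of_real t * cnj a"
    have "ip (scale c x + y) (scale c x + y) = c * a + cnj (c * a) + ip y y"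
      using assms ip_cnj[where x = x and y = y]
      by (simp add: ip_add ip_add_right ip_scale ip_scale_right null_def a_def)
    moreover have "c * a = - of_real (t * (norm a)\<^sup>2)"
      by (simp add: c_def mult.assoc mult.commute[of "cnj a"] complex_norm_square[symmetric] del: of_real_power)
    ultimately show ?thesis using ip_nonneg[of "scale c x + y"] by simp
  qed
  \<comment> \<open>For this \<open>t\<close> the supposedly nonnegative expression equals
    \<open>- 1\<close>.\<close>
  from this[of "(Re (ip y y) + 1) / (2 * (norm a)\<^sup>2)"] show False
    using a by (simp add: a_def)
qed

lemma ip_null': "null x \<Longrightarrow> ip y x = 0"
  using ip_null[of x y] ip_cnj[of y x] by simp

lemma null_add: "null x \<Longrightarrow> null y \<Longrightarrow> null (x + y)"
  unfolding null_def[of "x + y"] by (simp add: ip_add ip_null)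

lemma null_scale: "null x \<Longrightarrow> null (scale c x)"
  unfolding null_def[of "scale c x"] by (simp add: ip_scale ip_null)

lemma null_0: "null 0"
  using ip_scale[of 0 0 0] by (simp add: null_def)

lemma null_uminus: "null x \<Longrightarrow> null (- x)"
  using null_scale[of x "-1"] by simp

lemma null_diff: "null x \<Longrightarrow> null y \<Longrightarrow> null (x - y)"
  using null_add[of x "- y"] null_uminus[of y] by simp

lemma null_sum: "(\<And>i. i \<in> S \<Longrightarrow> null (f i)) \<Longrightarrow> null (sum f S)"
  by (induction S rule: infinite_finite_induct) (auto intro: null_0 null_add)

lemma T_0: "T 0 = 0"
  using T_scale[of 0 0] by simp

lemma T_diff: "T (x - y) = T x - T y"
  by (metis T_add add_diff_cancel diff_add_cancel)

lemma T_sum: "T (sum f S) = (\<Sum>i\<in>S. T (f i))"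
  by (induction S rule: infinite_finite_induct) (auto simp: T_0 T_add)

lemma null_T: "x \<in> V \<Longrightarrow> null x \<Longrightarrow> null (T x)"
  unfolding null_def[of "T x"] by (simp add: T_sym T_V ip_null)

definition shift :: "complex \<Rightarrow> 'v \<Rightarrow> 'v" where "shift r x = T x - scale r x"

lemma shift_V: "x \<in> V \<Longrightarrow> shift r x \<in> V"
  unfolding shift_def by (intro subspace_diff subspace_scale subspace_V T_V)

lemma shift_simps:
  "shift r (x + y) = shift r x + shift r y" "shift r (x - y) = shift r x - shift r y"
  "shift r (scale c x) = scale c (shift r x)" "shift r (sum f S) = (\<Sum>i\<in>S. shift r (f i))"
  by (simp_all add: shift_def T_add T_diff T_scale T_sum scale_right_distrib scale_right_diff_distrib
      scale_sum_right sum_subtractf mult.commute)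

lemma null_shift: "x \<in> V \<Longrightarrow> null x \<Longrightarrow> null (shift r x)"
  unfolding shift_def by (intro null_diff null_T null_scale)

lemma ip_uminus: "ip (- x) y = - ip x y"
  using ip_scale[of "-1" x y] by simp

lemma ip_diff: "ip (x - y) z = ip x z - ip y z"
  using ip_add[of x "- y" z] by (simp add: ip_uminus)

lemma ip_diff_right: "ip z (x - y) = ip z x - ip z y"
  using ip_cnj[of z "x - y"] ip_cnj[of z x] ip_cnj[of z y] by (simp add: ip_diff)

text \<open>By symmetry \<open>ip x x\<close> is multiplied by \<open>r\<close> and by its conjugate
  with the same result; for nonreal \<open>r\<close> it must vanish.\<close>

lemma null_eigenvector:
  assumes "x \<in> V" "null (shift r x)" "r \<notin> \<real>"
  shows "null x"
proof -
  have "ip (T x) x = r * ip x x" "ip x (T x) = cnj r * ip x x"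
    using ip_null[OF assms(2), of x] ip_null'[OF assms(2), of x]
    by (simp_all add: shift_def ip_diff ip_diff_right ip_scale ip_scale_right)
  then have "r * ip x x = cnj r * ip x x"
    using T_sym[OF assms(1,1)] by metis
  then have "(r - cnj r) * ip x x = 0"
    by (simp only: left_diff_distrib right_minus_eq)
  moreover have "r - cnj r \<noteq> 0"
    using assms(3) by (metis Reals_cnj_iff eq_iff_diff_eq_0)
  ultimately show ?thesis
    by (simp add: null_def)
qed

text \<open>Absence of Jordan blocks: by symmetry, the product of \<open>shift r x\<close> with
  itself equals that of \<open>x\<close> with \<open>shift r (shift r x)\<close>.\<close>

lemma null_shift_shift:
  assumes x: "x \<in> V" and "null (shift (of_real r) (shift (of_real r) x))"
  shows "null (shift (of_real r) x)"
proof -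
  have "ip (shift (of_real r) x) z = ip x (shift (of_real r) z)" if "z \<in> V" for z
    using T_sym[OF x that] by (simp add: shift_def ip_diff ip_diff_right ip_scale ip_scale_right)
  from this[OF shift_V[OF x]] show ?thesis
    using ip_null'[OF assms(2)] by (simp add: null_def)
qed

definition decomposable :: "'v \<Rightarrow> bool" where
  "decomposable x \<longleftrightarrow> (\<exists>\<Lambda> y. finite (\<Lambda> :: real set) \<and> (\<forall>\<nu>\<in>\<Lambda>. y \<nu> \<in> V \<and> null (shift (of_real \<nu>) (y \<nu>))) \<and> null (x - sum y \<Lambda>))"

text \<open>Dividing the component of \<open>shift r x\<close> for \<open>\<nu> \<noteq> r\<close>
  by \<open>\<nu> - r\<close> gives a preimage under \<open>shift r\<close>, modulo null vectors.
  For the rest \<open>w\<close> of \<open>x\<close>, the vector \<open>shift r w\<close> is, modulo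
  null vectors, the component for \<open>r\<close> or zero. So \<open>w\<close> is null for nonreal
  \<open>r\<close>, and an eigenvector for real \<open>r\<close> by
  \<open>null_shift_shift\<close>.\<close>

lemma decomposable_shift:
  assumes x: "x \<in> V" and "decomposable (shift r x)"
  shows "decomposable x"
proof -
  obtain \<Lambda> y where L: "finite \<Lambda>" "\<And>\<nu>. \<nu> \<in> \<Lambda> \<Longrightarrow> y \<nu> \<in> V" "\<And>\<nu>. \<nu> \<in> \<Lambda> \<Longrightarrow> null (shift (of_real \<nu>) (y \<nu>))"
    "null (shift r x - sum y \<Lambda>)"
    using assms(2) unfolding decomposable_def by blast
  define M where "M = {\<nu> \<in> \<Lambda>. of_real \<nu> \<noteq> r}"
  define h where "h \<nu> = scale (1 / (of_real \<nu> - r)) (y \<nu>)" for \<nu>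
  define w where "w = x - sum h M"
  have fM: "finite M" using L(1) by (simp add: M_def)
  have hV: "h \<nu> \<in> V" and hn: "null (shift (of_real \<nu>) (h \<nu>))" if "\<nu> \<in> M" for \<nu>
    using L(2,3)[of \<nu>] that by (auto simp: M_def h_def shift_simps intro: subspace_scale[OF subspace_V] null_scale)
  have wV: "w \<in> V"
    unfolding w_def by (intro subspace_diff subspace_sum subspace_V x hV)
  have diff: "null (shift r (h \<nu>) - y \<nu>)" if "\<nu> \<in> M" for \<nu>
  proof -
    have "y \<nu> = scale (of_real \<nu> - r) (h \<nu>)"
      using that by (simp add: h_def M_def)
    then have "shift r (h \<nu>) - y \<nu> = shift (of_real \<nu>) (h \<nu>)"
      by (simp add: shift_def scale_left_diff_distrib)
    then show ?thesis using hn[OF that] by simp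
  qed
  have "shift r w - (sum y \<Lambda> - sum y M) = (shift r x - sum y \<Lambda>) - (\<Sum>\<nu>\<in>M. shift r (h \<nu>) - y \<nu>)"
    by (simp add: w_def shift_simps sum_subtractf)
  also have "null \<dots>"
    by (intro null_diff L(4) null_sum diff)
  finally have sw: "null (shift r w - (sum y \<Lambda> - sum y M))" .
  show ?thesis
  proof (cases "r \<in> \<real>")
    case False
    then have "M = \<Lambda>" by (auto simp: M_def)
    then have "null (shift r w)" using sw by simp
    then have "null w" using null_eigenvector[OF wV _ False] by simp
    then show ?thesis
      unfolding decomposable_def w_def using fM hV hn by blast
  next
    case True
    then obtain \<rho> where r: "r = of_real \<rho>" by (auto elim: Reals_cases)
    \<comment> \<open>The component for the eigenvalue \<open>\<rho>\<close>, or zero if there is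
      none.\<close>
    define u where "u = sum y \<Lambda> - sum y M"
    have u: "u \<in> V \<and> null (shift r u)"
    proof (cases "\<rho> \<in> \<Lambda>")
      case True
      then have "\<Lambda> = insert \<rho> M" "\<rho> \<notin> M" by (auto simp: M_def r)
      then have "u = y \<rho>" using fM by (simp add: u_def)
      then show ?thesis using L(2,3)[OF True] by (simp add: r)
    next
      case False
      then have "M = \<Lambda>" by (auto simp: M_def r)
      then show ?thesis using subspace_0[OF subspace_V] null_shift[OF _ null_0, of r] by (simp add: u_def)
    qed
    have "shift r (shift r w) = shift r (shift r w - u) + shift r u"
      by (simp add: shift_simps)
    moreover have "null (shift r (shift r w - u))"
      by (rule null_shift) (use u sw shift_V[OF wV] subspace_diff[OF subspace_V] in \<open>auto simp: u_def\<close>)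
    ultimately have "null (shift r (shift r w))" using u by (simp add: null_add)
    then have wn: "null (shift (of_real \<rho>) w)" using null_shift_shift[OF wV] r by simp
    have \<rho>: "\<rho> \<notin> M" by (simp add: M_def r)
    have "sum (h(\<rho> := w)) M = sum h M"
      by (rule sum.cong) (use \<rho> in auto)
    then have "x - sum (h(\<rho> := w)) (insert \<rho> M) = 0"
      using fM \<rho> by (simp add: w_def)
    then show ?thesis
      unfolding decomposable_def
      using fM hV hn wn wV \<rho> null_0
      by (intro exI[of _ "insert \<rho> M"] exI[of _ "h(\<rho> := w)"]) auto
  qed
qed

definition peval :: "complex poly \<Rightarrow> 'v \<Rightarrow> 'v" where
  "peval q x = (\<Sum>i\<le>degree q. scale (coeff q i) ((T ^^ i) x))"

lemma peval_bound: "degree q \<le> n \<Longrightarrow> peval q x = (\<Sum>i\<le>n. scale (coeff q i) ((T ^^ i) x))"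
  unfolding peval_def by (rule sum.mono_neutral_left) (auto simp: coeff_eq_0)

lemma T_pow_simps: "(T ^^ i) (x - y) = (T ^^ i) x - (T ^^ i) y" "(T ^^ i) (scale r x) = scale r ((T ^^ i) x)"
  by (induction i) (simp_all add: T_diff T_scale)

lemma peval_mult_linear: "peval ([:- r, 1:] * q) x = peval q (shift r x)"
proof -
  let ?n = "degree q"
  have "degree ([:- r, 1:] * q) \<le> Suc ?n"
    using degree_mult_le[of "[:- r, 1:]" q] by simp
  then have "peval ([:- r, 1:] * q) x = (\<Sum>i\<le>Suc ?n. scale (coeff (pCons 0 q) i) ((T ^^ i) x)) - (\<Sum>i\<le>Suc ?n. scale (r * coeff q i) ((T ^^ i) x))"
    by (simp only: peval_bound sum_subtractf[symmetric] scale_left_diff_distrib[symmetric])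
       (simp add: scale_minus_left[symmetric] del: scale_minus_left)
  also have "(\<Sum>i\<le>Suc ?n. scale (coeff (pCons 0 q) i) ((T ^^ i) x)) = (\<Sum>i\<le>?n. scale (coeff q i) ((T ^^ i) (T x)))"
    by (subst sum.atMost_Suc_shift) (simp add: funpow_swap1)
  also have "(\<Sum>i\<le>Suc ?n. scale (r * coeff q i) ((T ^^ i) x)) = (\<Sum>i\<le>?n. scale (coeff q i) ((T ^^ i) (scale r x)))"
    by (simp add: coeff_eq_0 T_pow_simps mult.commute)
  finally show ?thesis
    by (simp add: peval_def shift_def T_pow_simps sum_subtractf scale_right_diff_distrib)
qed

text \<open>Complex polynomials split into linear factors. Each factor is removed by
  \<open>decomposable_shift\<close>, until a nonzero constant is left and the vector is
  null.\<close>

lemma decomposable_peval: "q \<noteq> 0 \<Longrightarrow> x \<in> V \<Longrightarrow> null (peval q x) \<Longrightarrow> decomposable x"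
proof (induction "degree q" arbitrary: q x)
  case 0
  then have "degree q = 0" by simp
  then obtain a where a: "q = [:a:]" by (rule degree_eq_zeroE)
  have "a \<noteq> 0" using "0.prems"(1) a by simp
  have "null (scale (1 / a) (peval q x))" by (rule null_scale[OF "0.prems"(3)])
  then have "null x" using \<open>a \<noteq> 0\<close> by (simp add: a peval_def)
  then show ?case
    unfolding decomposable_def by (intro exI[of _ "{}"]) simp
next
  case (Suc n)
  have "degree q > 0" using Suc.hyps(2) by simp
  then obtain r where "poly q r = 0" using alg_closed_imp_poly_has_root by blast
  then have "[:- r, 1:] dvd q" by (simp only: poly_eq_0_iff_dvd)
  then obtain p where p: "q = [:- r, 1:] * p" by (rule dvdE)
  have "p \<noteq> 0" using Suc.prems(1) unfolding p by (metis mult_zero_right)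
  then have "degree q = Suc (degree p)" unfolding p by (subst degree_mult_eq) simp_all
  then have n: "n = degree p" using Suc.hyps(2) by simp
  have "null (peval p (shift r x))"
    using Suc.prems(3) unfolding p peval_mult_linear .
  from Suc.hyps(1)[OF n \<open>p \<noteq> 0\<close> shift_V[OF Suc.prems(2)] this] have "decomposable (shift r x)" .
  then show ?case by (rule decomposable_shift[OF Suc.prems(2)])
qed

lemma annihilating_poly:
  assumes S: "finite S" "\<And>n. (T ^^ n) x \<in> span S"
  shows "\<exists>q. q \<noteq> 0 \<and> peval q x = 0"
\<comment> \<open>Linear dependence is a property of sets, so coinciding iterates have to be treated
  apart; they give a difference of two monomials.\<close>
proof (cases "inj_on (\<lambda>i. (T ^^ i) x) {..card S}")
  case False
  then obtain a b where ab: "a \<noteq> b" "(T ^^ a) x = (T ^^ b) x"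
    unfolding inj_on_def by blast
  define i j where "i = min a b" and "j = max a b"
  have ij: "i < j" "(T ^^ i) x = (T ^^ j) x"
    using ab by (auto simp: i_def j_def min_def max_def)
  define q where "q = monom 1 j - monom (1::complex) i"
  have "coeff q j = 1" using ij by (simp add: q_def)
  then have q0: "q \<noteq> 0" by (metis coeff_0 zero_neq_one)
  have "degree q \<le> j"
    unfolding q_def using ij by (intro degree_diff_le) (auto simp: degree_monom_eq)
  then have "peval q x = (\<Sum>k\<le>j. scale (coeff q k) ((T ^^ k) x))" by (rule peval_bound)
  also have "\<dots> = (\<Sum>k\<le>j. (if k = j then (T ^^ k) x else 0) - (if k = i then (T ^^ k) x else 0))"
    using ij by (intro sum.cong) (auto simp: q_def)
  also have "\<dots> = (T ^^ j) x - (T ^^ i) x"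
    using ij(1) by (simp add: sum_subtractf)
  finally have "peval q x = 0" using ij by simp
  then show ?thesis using q0 by blast
next
  case True
  let ?f = "\<lambda>i. (T ^^ i) x" and ?n = "card S"
  have "card (?f ` {..?n}) > ?n" using True by (simp add: card_image)
  moreover have "?f ` {..?n} \<subseteq> span S" using S(2) by blast
  ultimately have "dependent (?f ` {..?n})"
    using independent_span_bound[OF S(1), of "?f ` {..?n}"] by linarith
  then have "\<exists>u. (\<exists>z\<in>?f ` {..?n}. u z \<noteq> 0) \<and> (\<Sum>z\<in>?f ` {..?n}. scale (u z) z) = 0"
    by (subst (asm) dependent_finite) simp_all
  then obtain u where u: "\<exists>z\<in>?f ` {..?n}. u z \<noteq> 0" "(\<Sum>z\<in>?f ` {..?n}. scale (u z) z) = 0"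
    by blast
  define q where "q = (\<Sum>i\<le>?n. monom (u (?f i)) i)"
  have co: "coeff q i = (if i \<le> ?n then u (?f i) else 0)" for i
    by (simp add: q_def coeff_sum)
  from u(1) obtain i where "i \<le> ?n" "u (?f i) \<noteq> 0" by blast
  then have "coeff q i \<noteq> 0" by (simp add: co)
  then have "q \<noteq> 0" by (metis coeff_0)
  moreover have "degree q \<le> ?n" by (rule degree_le) (simp add: co)
  then have "peval q x = (\<Sum>i\<le>?n. scale (coeff q i) (?f i))" by (rule peval_bound)
  then have "peval q x = (\<Sum>i\<le>?n. scale (u (?f i)) (?f i))" by (simp add: co)
  then have "peval q x = 0" using u(2) True by (simp add: sum.reindex)
  ultimately show ?thesis by blast
qed

theorem spectral_decomposition:
  assumes "finite S" "x \<in> V" "\<And>n. (T ^^ n) x \<in> span S"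
  obtains \<Lambda> y where "finite (\<Lambda> :: real set)" "\<And>\<nu>. \<nu> \<in> \<Lambda> \<Longrightarrow> y \<nu> \<in> V"
    "\<And>\<nu>. \<nu> \<in> \<Lambda> \<Longrightarrow> null (T (y \<nu>) - scale (of_real \<nu>) (y \<nu>))" "null (x - sum y \<Lambda>)"
proof -
  obtain q where "q \<noteq> 0" "peval q x = 0" using annihilating_poly[OF assms(1,3)] by blast
  then have "decomposable x" using decomposable_peval[OF _ assms(2)] null_0 by metis
  then show ?thesis using that unfolding decomposable_def shift_def by blast
qed

end

section \<open>Trace degree and the exponential\<close>

definition weight :: "(int \<Rightarrow>\<^sub>0 nat) \<Rightarrow> int" where
  "weight e = (\<Sum>k\<in>keys e. \<bar>k\<bar> * int (lookup e k))"

definition monomials_upto :: "int \<Rightarrow> monomial set" where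
  "monomials_upto n = {m. \<bar>fst m\<bar> + weight (snd m) \<le> n \<and> lookup (snd m) 0 = 0}"

definition polys_upto :: "int \<Rightarrow> trace_poly set" where
  "polys_upto n = {P. keys P \<subseteq> monomials_upto n}"

lemma weight_superset: "finite S \<Longrightarrow> keys e \<subseteq> S \<Longrightarrow> weight e = (\<Sum>k\<in>S. \<bar>k\<bar> * int (lookup e k))"
  unfolding weight_def by (rule sum.mono_neutral_left) (auto simp: in_keys_iff)

lemma weight_add: "weight (e + e') = weight e + weight e'"
  using keys_add[of e e']
  by (simp add: weight_superset[of "keys e \<union> keys e'"] lookup_add distrib_left sum.distrib)

lemma weight_single: "weight (single k 1) = \<bar>k\<bar>"
  by (simp add: weight_def)

lemma weight_nonneg: "weight e \<ge> 0"
  unfolding weight_def by (intro sum_nonneg) simp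

lemma weight_0 [simp]: "weight 0 = 0"
  by (simp add: weight_def)

lemma polys_upto_0: "0 \<in> polys_upto n"
  by (simp add: polys_upto_def)

lemma polys_upto_add: "P \<in> polys_upto n \<Longrightarrow> Q \<in> polys_upto n \<Longrightarrow> P + Q \<in> polys_upto n"
  using keys_add[of P Q] by (auto simp: polys_upto_def)

lemma polys_upto_const: "P \<in> polys_upto n \<Longrightarrow> const c * P \<in> polys_upto n"
  by (auto simp: polys_upto_def in_keys_iff lookup_const_mult subset_iff)

lemma polys_upto_uminus: "P \<in> polys_upto n \<Longrightarrow> - P \<in> polys_upto n"
  using polys_upto_const[of P n "-1"] by (simp add: const_simps)

lemma polys_upto_diff: "P \<in> polys_upto n \<Longrightarrow> Q \<in> polys_upto n \<Longrightarrow> P - Q \<in> polys_upto n"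
  using polys_upto_add[of P n "- Q"] polys_upto_uminus by simp

lemma polys_upto_sum: "(\<And>i. i \<in> S \<Longrightarrow> f i \<in> polys_upto n) \<Longrightarrow> sum f S \<in> polys_upto n"
  by (induction S rule: infinite_finite_induct) (auto intro: polys_upto_0 polys_upto_add)

lemma polys_upto_of_int: "P \<in> polys_upto n \<Longrightarrow> of_int j * P \<in> polys_upto n" "P \<in> polys_upto n \<Longrightarrow> 2 * P \<in> polys_upto n"
  using polys_upto_const[of P n "of_int j"] polys_upto_const[of P n 2]
  by (simp_all only: of_int_const(1)[of j, symmetric] of_int_const(2)[symmetric])

lemma polys_upto_mono: "P \<in> polys_upto m \<Longrightarrow> m \<le> n \<Longrightarrow> P \<in> polys_upto n"
  by (force simp: polys_upto_def monomials_upto_def)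

lemma polys_upto_mult:
  assumes "P \<in> polys_upto m" "Q \<in> polys_upto n"
  shows "P * Q \<in> polys_upto (m + n)"
proof -
  have "a + b \<in> monomials_upto (m + n)" if "a \<in> monomials_upto m" "b \<in> monomials_upto n" for a b
    using that abs_triangle_ineq[of "fst a" "fst b"]
    by (auto simp: monomials_upto_def weight_add lookup_add)
  then show ?thesis
    using keys_mult[of P Q] assms unfolding polys_upto_def by blast
qed

lemma tmono_polys_upto: "tmono m \<in> polys_upto n \<longleftrightarrow> m \<in> monomials_upto n"
  by (simp add: polys_upto_def tmono_def)

lemma u_pow_polys_upto: "\<bar>a\<bar> \<le> n \<Longrightarrow> u_pow a \<in> polys_upto n"
  by (simp add: u_pow_mono tmono_polys_upto monomials_upto_def)

lemma v_polys_upto: "v k \<in> polys_upto \<bar>k\<bar>"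
proof (cases "k = 0")
  case True
  then show ?thesis using u_pow_polys_upto[of 0 0] by (simp add: u_pow_0)
next
  case False
  then show ?thesis
    by (simp add: v_mono tmono_polys_upto monomials_upto_def weight_single lookup_single del: One_nat_def)
qed

lemma linear_op_polys_upto:
  assumes L: "linear_op L" and P: "P \<in> polys_upto n"
    and "\<And>a e. (a, e) \<in> monomials_upto n \<Longrightarrow> L (tmono (a, e)) \<in> polys_upto n'"
  shows "L P \<in> polys_upto n'"
  unfolding linear_op_expansion[OF L, of P]
proof (rule polys_upto_sum)
  fix m assume "m \<in> keys P"
  then have "m \<in> monomials_upto n" using P by (auto simp: polys_upto_def)
  then show "const (lookup P m) * L (tmono m) \<in> polys_upto n'"
    using assms(3)[of "fst m" "snd m"] by (intro polys_upto_const) simp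
qed

lemma D_v_polys_upto:
  assumes "P \<in> polys_upto n"
  shows "D_v k P \<in> polys_upto (n - \<bar>k\<bar>)"
proof (rule linear_op_polys_upto[OF linear_op_basic(2) assms])
  fix a e assume m: "(a, e) \<in> monomials_upto n"
  show "D_v k (tmono (a, e)) \<in> polys_upto (n - \<bar>k\<bar>)"
  proof (cases "lookup e k = 0")
    case True
    then show ?thesis by (simp add: D_v_mono const_simps polys_upto_0)
  next
    case False
    then have "e = (e - single k 1) + single k 1"
      by (intro poly_mapping_eqI) (auto simp: lookup_add lookup_minus lookup_single when_def)
    then have "weight e = weight (e - single k 1) + \<bar>k\<bar>"
      using weight_add[of "e - single k 1" "single k 1"] weight_single[of k] by simp
    then show ?thesis
      using m unfolding D_v_mono
      by (intro polys_upto_const) (auto simp: tmono_polys_upto monomials_upto_def lookup_minus)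
  qed
qed

text \<open>On negative powers of \<open>u\<close> the operator \<open>D_u\<close> raises the trace
  degree. It is therefore always taken together with factors \<open>u\<close> that restore the
  exponent.\<close>

lemma u_D_u_polys_upto:
  assumes "P \<in> polys_upto n"
  shows "u_pow 1 * D_u P \<in> polys_upto n" "u_pow 2 * D_u (D_u P) \<in> polys_upto n"
    "u_pow 1 * D_u (R_plus P - R_minus P) \<in> polys_upto n"
proof -
  have lin: "linear_op (\<lambda>P. u_pow 1 * D_u P)" "linear_op (\<lambda>P. u_pow 2 * D_u (D_u P))"
    "linear_op (\<lambda>P. u_pow 1 * D_u (R_plus P - R_minus P))"
    by (intro linear_op_intros)+
  have m: "u_pow 1 * D_u (tmono (a, e)) = const (of_int a) * tmono (a, e)" for a e
    by (simp add: D_u_mono mult.left_commute[of _ "const (of_int a)"] u_pow_mult_mono)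
  have m2: "u_pow 2 * D_u (D_u (tmono (a, e))) = const (of_int a) * (const (of_int (a - 1)) * tmono (a, e))" for a e
    by (simp add: D_u_mono linear_op_const[OF linear_op_basic(1)] mult.left_commute[of "u_pow 2"] u_pow_mult_mono del: of_int_diff)
  show "u_pow 1 * D_u P \<in> polys_upto n"
    by (rule linear_op_polys_upto[OF lin(1) assms]) (simp add: m polys_upto_const tmono_polys_upto)
  show "u_pow 2 * D_u (D_u P) \<in> polys_upto n"
    by (rule linear_op_polys_upto[OF lin(2) assms]) (simp add: m2 polys_upto_const tmono_polys_upto del: of_int_diff)
  show "u_pow 1 * D_u (R_plus P - R_minus P) \<in> polys_upto n"
  proof (rule linear_op_polys_upto[OF lin(3) assms])
    fix a e assume "(a, e) \<in> monomials_upto n"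
    then show "u_pow 1 * D_u (R_plus (tmono (a, e)) - R_minus (tmono (a, e))) \<in> polys_upto n"
      by (cases "a \<ge> 0") (auto simp: R_plus_mono R_minus_mono m polys_upto_const tmono_polys_upto
          linear_op_uminus[OF linear_op_basic(1)] polys_upto_uminus)
  qed
qed

lemma polys_upto_when: "(b \<Longrightarrow> P \<in> polys_upto n) \<Longrightarrow> (P when b) \<in> polys_upto n"
  by (simp add: when_def polys_upto_0)

lemma polys_upto_Sum_any: "(\<And>k. f k \<in> polys_upto n) \<Longrightarrow> Sum_any f \<in> polys_upto n"
  unfolding Sum_any.expand_set by (rule polys_upto_sum)

lemma vop_polys_upto:
  assumes "P \<in> polys_upto n" "\<And>k. p k \<Longrightarrow> c k \<in> polys_upto \<bar>k\<bar>"
  shows "vop c p P \<in> polys_upto n"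
  unfolding vop_def
proof (intro polys_upto_Sum_any polys_upto_when)
  fix k assume "p k"
  then have "c k * D_v k P \<in> polys_upto (\<bar>k\<bar> + (n - \<bar>k\<bar>))"
    by (intro polys_upto_mult assms D_v_polys_upto)
  then show "c k * D_v k P \<in> polys_upto n" by simp
qed

lemma vop2_polys_upto:
  assumes "P \<in> polys_upto n" "\<And>j k. c j k \<in> polys_upto (\<bar>j\<bar> + \<bar>k\<bar>)"
  shows "vop2 c p P \<in> polys_upto n"
  unfolding vop2_def
proof (rule polys_upto_Sum_any)
  fix jk :: "int \<times> int"
  obtain j k where jk: "jk = (j, k)" by (cases jk)
  have "c j k * D_v j (D_v k P) \<in> polys_upto (\<bar>j\<bar> + \<bar>k\<bar> + (n - \<bar>k\<bar> - \<bar>j\<bar>))"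
    by (intro polys_upto_mult assms D_v_polys_upto)
  then show "(case jk of (j, k) \<Rightarrow> c j k * D_v j (D_v k P) when p j \<and> p k) \<in> polys_upto n"
    by (simp add: jk when_def polys_upto_0)
qed

lemma vop_D_u_polys_upto:
  assumes P: "P \<in> polys_upto n" and c: "\<And>k. c k \<in> polys_upto \<bar>k\<bar>"
  shows "vop (\<lambda>k. c k * u_pow 1) p (D_u P) \<in> polys_upto n"
  unfolding vop_def
proof (intro polys_upto_Sum_any polys_upto_when)
  fix k
  have "c k * (u_pow 1 * D_u (D_v k P)) \<in> polys_upto (\<bar>k\<bar> + (n - \<bar>k\<bar>))"
    by (intro polys_upto_mult c u_D_u_polys_upto(1) D_v_polys_upto P)
  then show "c k * u_pow 1 * D_v k (D_u P) \<in> polys_upto n"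
    by (simp add: D_u_D_v mult.assoc)
qed

lemma uop_polys_upto:
  assumes P: "P \<in> polys_upto n" and c: "\<And>k. c k \<in> polys_upto \<bar>k\<bar>"
  shows "uop (\<lambda>k. c k * u_pow 1) P \<in> polys_upto n"
proof -
  have E: "u_pow 1 * E_plus k P \<in> polys_upto (n - \<bar>k\<bar>)" if "k \<ge> 1" for k
  proof (rule linear_op_polys_upto[OF _ P])
    show "linear_op (\<lambda>P. u_pow 1 * E_plus k P)" by (intro linear_op_times linear_op_E)
    fix a e assume "(a, e) \<in> monomials_upto n"
    then show "u_pow 1 * E_plus k (tmono (a, e)) \<in> polys_upto (n - \<bar>k\<bar>)"
      using that by (auto simp: E_plus_mono mult.left_commute[of "u_pow 1"] u_pow_mult_mono polys_upto_0
          tmono_polys_upto monomials_upto_def simp del: of_int_diff intro!: polys_upto_const)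
  qed
  have E': "u_pow 1 * E_minus k P \<in> polys_upto (n - \<bar>k\<bar>)" if "k \<le> -1" for k
  proof (rule linear_op_polys_upto[OF _ P])
    show "linear_op (\<lambda>P. u_pow 1 * E_minus k P)" by (intro linear_op_times linear_op_E)
    fix a e assume "(a, e) \<in> monomials_upto n"
    then show "u_pow 1 * E_minus k (tmono (a, e)) \<in> polys_upto (n - \<bar>k\<bar>)"
      using that by (auto simp: E_minus_mono mult.left_commute[of "u_pow 1"] u_pow_mult_mono polys_upto_0
          tmono_polys_upto monomials_upto_def simp del: of_int_diff intro!: polys_upto_const)
  qed
  have cu: "c k * u_pow 1 * Q \<in> polys_upto n" if "u_pow 1 * Q \<in> polys_upto (n - \<bar>k\<bar>)" for k Q
    using polys_upto_mult[OF c[of k] that] by (simp add: mult.assoc)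
  show ?thesis
    unfolding uop_def by (intro polys_upto_diff polys_upto_Sum_any polys_upto_when cu E E')
qed

lemma D_gen_polys_upto:
  assumes P: "P \<in> polys_upto n"
  shows "D_gen al cp cm g P \<in> polys_upto n"
proof -
  have vv: "v j * v k \<in> polys_upto (\<bar>j\<bar> + \<bar>k\<bar>)" for j k
    by (intro polys_upto_mult v_polys_upto)
  have vle: "\<bar>j\<bar> \<le> m \<Longrightarrow> v j \<in> polys_upto m" for j m
    using polys_upto_mono[OF v_polys_upto] .
  \<comment> \<open>One factor \<open>u\<close> is split off to accompany \<open>D_u\<close>; the
    rest has trace degree \<open>\<bar>k\<bar>\<close>, exactly what \<open>D_v k\<close>,
    \<open>E_plus k\<close> or \<open>E_minus k\<close> takes away.\<close>
  have u1: "u_pow (- k + 1) = u_pow (- k) * u_pow 1" "u_pow (k + 1) = u_pow k * u_pow 1" for k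
    by (simp_all add: u_pow_add)
  have N: "N_op P \<in> polys_upto n"
    unfolding ops_vop by (intro polys_upto_add vop_polys_upto P polys_upto_of_int v_polys_upto u_D_u_polys_upto)
  have Y1: "Y1_op P \<in> polys_upto n"
    unfolding ops_vop by (intro uop_polys_upto P v_polys_upto)
  have Z2: "Z2_op P \<in> polys_upto n"
    unfolding ops_vop u1 by (intro uop_polys_upto P u_pow_polys_upto) simp
  have Y2: "Y2_op P \<in> polys_upto n"
    unfolding ops_vop
    by (intro polys_upto_diff vop_polys_upto P polys_upto_sum;
        simp only: mult.assoc; intro polys_upto_of_int(1) polys_upto_mono[OF vv]) auto
  have Z1: "Z1_op P \<in> polys_upto n"
    unfolding ops_vop
    by (intro polys_upto_diff vop_polys_upto P polys_upto_sum polys_upto_of_int vle) auto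
  have K1: "K1_plus P \<in> polys_upto n" "K1_minus P \<in> polys_upto n"
    unfolding ops_vop u1 mult.assoc[symmetric]
    by (intro vop_D_u_polys_upto P polys_upto_of_int u_pow_polys_upto; simp)+
  have K2: "K2_plus P \<in> polys_upto n" "K2_minus P \<in> polys_upto n"
    unfolding ops_vop by (intro vop2_polys_upto P polys_upto_of_int vle; simp)+
  have J1: "vop (\<lambda>k. of_int k * u_pow 1 * v k) nz (D_u P) \<in> polys_upto n"
    using vop_D_u_polys_upto[OF P, of "\<lambda>k. of_int k * v k" nz] polys_upto_of_int(1)[OF v_polys_upto]
    by (simp add: mult.assoc mult.commute[of "u_pow 1"])
  have J: "J_op P \<in> polys_upto n"
    unfolding ops_vop
    by (intro polys_upto_add polys_upto_of_int(2) J1 vop2_polys_upto vop_polys_upto P u_D_u_polys_upto)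
       (simp_all add: mult.assoc polys_upto_of_int vv v_polys_upto del: of_int_mult of_int_power)
  show ?thesis
    unfolding D_gen_def L0_op_def
    by (intro polys_upto_add polys_upto_diff polys_upto_uminus polys_upto_const polys_upto_of_int N Y1 Y2 Z1 Z2 K1 K2 J)
qed

text \<open>A factor with index \<open>0\<close> would have weight zero and could occur to any
  power; it is excluded in \<open>monomials_upto\<close>, and every other exponent is bounded by the
  trace degree.\<close>

lemma finite_monomials_upto: "finite (monomials_upto n)"
proof -
  define F where "F = {f. \<forall>k. (k \<in> {-n..n} \<longrightarrow> f k \<in> {0..nat n}) \<and> (k \<notin> {-n..n} \<longrightarrow> f k = (0::nat))}"
  have "finite F"
    unfolding F_def by (rule finite_set_of_finite_funs) auto
  moreover have "monomials_upto n \<subseteq> {-n..n} \<times> (Abs_poly_mapping ` F)"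
  proof
    fix m assume m: "m \<in> monomials_upto n"
    obtain a e where ae: "m = (a, e)" by (cases m)
    have we: "\<bar>a\<bar> + weight e \<le> n" "lookup e 0 = 0" using m by (auto simp: monomials_upto_def ae)
    have k: "\<bar>k\<bar> * int (lookup e k) \<le> n" for k
    proof (cases "k \<in> keys e")
      case True
      then have "\<bar>k\<bar> * int (lookup e k) \<le> weight e"
        unfolding weight_def by (intro member_le_sum) auto
      then show ?thesis using we(1) by linarith
    next
      case False
      then show ?thesis using we weight_nonneg[of e] by (simp add: in_keys_iff)
    qed
    have "lookup e \<in> F"
      unfolding F_def
    proof (intro CollectI allI conjI impI)
      fix j
      have bound: "int (lookup e j) \<le> n"
      proof (cases "j = 0")
        case True
        then show ?thesis using we weight_nonneg[of e] by simp
      next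
        case False
        then have "1 * int (lookup e j) \<le> \<bar>j\<bar> * int (lookup e j)"
          by (intro mult_right_mono) auto
        then show ?thesis using k[of j] by simp
      qed
      then show "lookup e j \<in> {0..nat n}" by auto
      assume "j \<notin> {-n..n}"
      then have "\<bar>j\<bar> > n" by auto
      show "lookup e j = 0"
      proof (rule ccontr)
        assume "lookup e j \<noteq> 0"
        then have "\<bar>j\<bar> * 1 \<le> \<bar>j\<bar> * int (lookup e j)" by (intro mult_left_mono) auto
        then show False using k[of j] \<open>\<bar>j\<bar> > n\<close> by simp
      qed
    qed
    then have "e \<in> Abs_poly_mapping ` F"
      using lookup_inverse[of e] by (metis imageI)
    then show "m \<in> {-n..n} \<times> (Abs_poly_mapping ` F)"
      using we(1) weight_nonneg[of e] by (auto simp: ae)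
  qed
  ultimately show ?thesis by (meson finite_SigmaI finite_atLeastAtMost_int finite_imageI finite_subset)
qed

lemma trace_polys_upto: "P \<in> polys_upto n \<Longrightarrow> P \<in> trace_polys"
  by (force simp: polys_upto_def monomials_upto_def trace_polys_def)

lemma trace_polys_upto_exists:
  assumes "P \<in> trace_polys"
  shows "\<exists>n. P \<in> polys_upto n"
proof -
  define n where "n = (\<Sum>m\<in>keys P. \<bar>fst m\<bar> + weight (snd m))"
  have "m \<in> monomials_upto n" if m: "m \<in> keys P" for m
  proof -
    have "\<bar>fst m\<bar> + weight (snd m) \<le> n"
      unfolding n_def using m weight_nonneg by (intro member_le_sum) (auto intro: add_nonneg_nonneg)
    moreover have "lookup (snd m) 0 = 0"
      using assms m by (cases m) (auto simp: trace_polys_def)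
    ultimately show ?thesis by (simp add: monomials_upto_def)
  qed
  then show ?thesis unfolding polys_upto_def by blast
qed

text \<open>On the finite-dimensional space \<open>polys_upto n\<close> the operator is bounded for
  the sum norm of the coefficients, so the exponential series converges in each coefficient. The
  limit is supported in \<open>monomials_upto n\<close>, hence \<open>Abs_poly_mapping\<close> in
  \<open>exp_op\<close> yields the intended polynomial.\<close>

lemma exp_op_sums:
  assumes L: "linear_op D" and pres: "\<And>Q. Q \<in> polys_upto n \<Longrightarrow> D Q \<in> polys_upto n" and P: "P \<in> polys_upto n"
  shows "(\<lambda>i. z ^ i / fact i * trace_eval ((D ^^ i) P) A $ a $ b) sums (trace_eval (exp_op z D P) A $ a $ b)"
proof -
  let ?S = "monomials_upto n"
  have fin: "finite ?S" by (rule finite_monomials_upto)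
  have iter: "(D ^^ i) P \<in> polys_upto n" for i
    by (induction i) (auto intro: P pres)
  then have keysi: "keys ((D ^^ i) P) \<subseteq> ?S" for i by (simp add: polys_upto_def)
  \<comment> \<open>A crude bound for the operator norm: the sum of the absolute values of all
    matrix entries of \<open>D\<close>.\<close>
  define M where "M = (\<Sum>m\<in>?S. \<Sum>m'\<in>?S. norm (lookup (D (tmono m)) m'))"
  define s where "s i = (\<Sum>m\<in>?S. norm (lookup ((D ^^ i) P) m))" for i
  have M0: "M \<ge> 0" unfolding M_def by (intro sum_nonneg) auto
  have step: "s (Suc i) \<le> M * s i" for i
  proof -
    let ?Q = "(D ^^ i) P"
    have "D ?Q = (\<Sum>m\<in>?S. const (lookup ?Q m) * D (tmono m))"
      unfolding linear_op_expansion[OF L, of ?Q]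
      by (rule sum.mono_neutral_left) (use keysi[of i] fin in \<open>auto simp: in_keys_iff const_simps\<close>)
    then have "lookup (D ?Q) m' = (\<Sum>m\<in>?S. lookup ?Q m * lookup (D (tmono m)) m')" for m'
      by (simp add: lookup_sum lookup_const_mult)
    then have "s (Suc i) \<le> (\<Sum>m'\<in>?S. \<Sum>m\<in>?S. norm (lookup ?Q m) * norm (lookup (D (tmono m)) m'))"
      unfolding s_def by (auto intro!: sum_mono order_trans[OF norm_sum] simp: norm_mult)
    also have "\<dots> = (\<Sum>m\<in>?S. norm (lookup ?Q m) * (\<Sum>m'\<in>?S. norm (lookup (D (tmono m)) m')))"
      by (subst sum.swap) (simp add: sum_distrib_left)
    also have "\<dots> \<le> (\<Sum>m\<in>?S. norm (lookup ?Q m) * M)"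
      unfolding M_def using fin
      by (intro sum_mono mult_left_mono member_le_sum) (auto intro: sum_nonneg)
    finally show ?thesis by (simp add: s_def sum_distrib_left mult.commute)
  qed
  have s_bound: "s i \<le> M ^ i * s 0" for i
  proof (induction i)
    case (Suc i)
    have "s (Suc i) \<le> M * (M ^ i * s 0)"
      using step[of i] mult_left_mono[OF Suc.IH M0] by linarith
    then show ?case by (simp add: mult.assoc)
  qed simp
  have summ: "summable (\<lambda>i. z ^ i / fact i * lookup ((D ^^ i) P) m)" for m
  proof (cases "m \<in> ?S")
    case True
    show ?thesis
    proof (rule summable_comparison_test)
      show "summable (\<lambda>i. inverse (fact i) * (norm z * M) ^ i * s 0)"
        using summable_exp[of "norm z * M"] by (intro summable_mult2) simp
      have "norm (z ^ i / fact i * lookup ((D ^^ i) P) m) \<le> inverse (fact i) * (norm z * M) ^ i * s 0" for i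
      proof -
        have "norm (lookup ((D ^^ i) P) m) \<le> s i"
          unfolding s_def using True fin by (intro member_le_sum) auto
        then have le: "norm (lookup ((D ^^ i) P) m) \<le> M ^ i * s 0"
          using s_bound[of i] by linarith
        have "norm (z ^ i / fact i * lookup ((D ^^ i) P) m) = norm z ^ i / fact i * norm (lookup ((D ^^ i) P) m)"
          by (simp add: norm_mult norm_divide norm_power)
        also have "\<dots> \<le> norm z ^ i / fact i * (M ^ i * s 0)"
          by (intro mult_left_mono le) simp
        also have "\<dots> = inverse (fact i) * (norm z * M) ^ i * s 0"
          by (simp add: power_mult_distrib divide_inverse mult_ac)
        finally show ?thesis .
      qed
      then show "\<exists>N. \<forall>i\<ge>N. norm (z ^ i / fact i * lookup ((D ^^ i) P) m) \<le> inverse (fact i) * (norm z * M) ^ i * s 0"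
        by blast
    qed
  next
    case False
    then have "lookup ((D ^^ i) P) m = 0" for i using keysi[of i] by (auto simp: in_keys_iff)
    then show ?thesis by simp
  qed
  have zero: "suminf (\<lambda>i. z ^ i / fact i * lookup ((D ^^ i) P) m) = 0" if "m \<notin> ?S" for m
  proof -
    have "lookup ((D ^^ i) P) m = 0" for i using keysi[of i] that by (auto simp: in_keys_iff)
    then show ?thesis by simp
  qed
  have "finite {m. suminf (\<lambda>i. z ^ i / fact i * lookup ((D ^^ i) P) m) \<noteq> 0}"
    by (rule finite_subset[OF _ fin]) (use zero in blast)
  then have look: "lookup (exp_op z D P) m = suminf (\<lambda>i. z ^ i / fact i * lookup ((D ^^ i) P) m)" for m
    by (simp add: exp_op_def)
  have keyse: "keys (exp_op z D P) \<subseteq> ?S"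
    using zero unfolding subset_iff in_keys_iff look by blast
  have "(\<lambda>i. \<Sum>m\<in>?S. z ^ i / fact i * lookup ((D ^^ i) P) m * tmono_eval A m $ a $ b) sums
      (\<Sum>m\<in>?S. lookup (exp_op z D P) m * tmono_eval A m $ a $ b)"
    unfolding look by (intro sums_sum sums_mult2 summable_sums summ)
  then show ?thesis
    by (simp add: trace_eval_superset[OF fin keysi] trace_eval_superset[OF fin keyse] sum_distrib_left mult.assoc)
qed

section \<open>Eigenfunctions and the heat kernel\<close>

lemma mat_powi_conjugate:
  fixes A h :: "'m::finite cmat"
  assumes "invertible A" "invertible h"
  shows "mat_powi (matrix_inv h ** A ** h) k = matrix_inv h ** mat_powi A k ** h"
proof -
  have nat: "mat_pow (matrix_inv h ** A ** h) n = matrix_inv h ** mat_pow A n ** h" for n and A :: "'m cmat"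
  proof (induction n)
    case (Suc n)
    have "matrix_inv h ** A ** h ** (matrix_inv h ** mat_pow A n ** h) = matrix_inv h ** A ** (h ** matrix_inv h) ** mat_pow A n ** h"
      by (simp only: matrix_mul_assoc)
    then show ?case using Suc assms(2) by (simp add: matrix_mul_assoc)
  qed (simp add: assms(2))
  have "matrix_inv h ** A ** h ** (matrix_inv h ** matrix_inv A ** h) = matrix_inv h ** (A ** (h ** matrix_inv h) ** matrix_inv A) ** h"
    by (simp only: matrix_mul_assoc)
  then have "matrix_inv (matrix_inv h ** A ** h) = matrix_inv h ** matrix_inv A ** h"
    using assms by (intro matrix_inv_eqI) simp
  then show ?thesis by (simp add: mat_powi_def nat)
qed

text \<open>Normalized traces of powers are invariant under conjugation, so only the power of
  \<open>A\<close> coming from \<open>u\<close> is conjugated.\<close>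

lemma trace_eval_conjugate:
  fixes A h :: "'m::finite cmat"
  assumes "invertible A" "invertible h"
  shows "trace_eval P (matrix_inv h ** A ** h) = matrix_inv h ** trace_eval P A ** h"
proof -
  have "ntrace (matrix_inv h ** B ** h) = ntrace B" for B
    using assms(2) by (subst ntrace_mult_commute) (simp add: matrix_mul_assoc)
  then show ?thesis
    by (simp add: trace_eval_superset[of "keys P"] tmono_eval_def mat_powi_conjugate[OF assms]
        matrix_mult_sum_left matrix_mult_sum_right)
qed

context haar_group
begin

lemma laplacian_trace_eval:
  assumes P: "P \<in> trace_polys" and A: "A \<in> K"
  shows "laplacian c K (\<lambda>A. trace_eval P A $ i $ j) A = trace_eval (Dop P) A $ i $ j"
proof -
  obtain F1 F2 where F: "\<And>X. X \<in> Ba \<Longrightarrow> deriv_along X (trace_eval P) (F1 X)" "\<And>X. X \<in> Ba \<Longrightarrow> deriv_along X (F1 X) (F2 X)"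
    "\<And>A. A \<in> K \<Longrightarrow> (\<Sum>X\<in>Ba. F2 X A) = trace_eval (Dop P) A"
    using intertwines_trace_polys[OF P] unfolding intertwines_def by blast
  have bl: "bounded_linear (\<lambda>B :: 'm cmat. B $ i $ j)"
    by (intro bounded_linear_compose[OF bounded_linear_vec_nth bounded_linear_vec_nth])
  have "laplacian c K (\<lambda>A. trace_eval P A $ i $ j) A = (\<Sum>X\<in>Ba. F2 X A $ i $ j)"
    unfolding laplacian_def Ba_def[symmetric]
    by (intro sum.cong refl lie_deriv_lie_deriv_eq[OF deriv_along_linear[OF bl F(1)] deriv_along_linear[OF bl F(2)] A])
  then show ?thesis by (simp add: F(3)[OF A, symmetric])
qed

text \<open>The \<open>L\<^sup>2\<close> product of matrix-valued functions on \<open>K\<close>,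
  pulled back to polynomials; its null vectors vanish on \<open>K\<close>
  (\<open>form_self_eq_0\<close>).\<close>

definition form :: "trace_poly \<Rightarrow> trace_poly \<Rightarrow> complex" where
  "form P Q = (\<Sum>i\<in>UNIV. \<Sum>j\<in>UNIV. LINT k|\<mu>. trace_eval P k $ i $ j * cnj (trace_eval Q k $ i $ j))"

lemma integrable_form: "integrable \<mu> (\<lambda>k. trace_eval P k $ i $ j * cnj (trace_eval Q k $ i $ j))"
  by (intro integrable_continuous regular_continuous regular_mult regular_cnj regular_trace_eval)

lemma form_self: "form P P = of_real (\<Sum>i\<in>UNIV. \<Sum>j\<in>UNIV. LINT k|\<mu>. (norm (trace_eval P k $ i $ j))\<^sup>2)"
  unfolding form_def of_real_sum integral_complex_of_real[symmetric]
  by (simp add: complex_norm_square[symmetric])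

lemma semi_inner_form: "semi_inner (\<lambda>z P. const z * P) form Dop trace_polys"
proof -
  interpret vector_space "\<lambda>z P. const z * (P :: trace_poly)"
    by (unfold_locales; simp add: distrib_left distrib_right const_simps mult.assoc[symmetric])
  show ?thesis
  proof
    show "subspace trace_polys"
      unfolding subspace_def
    proof (intro conjI ballI allI)
      show "0 \<in> trace_polys" by (simp add: trace_polys_def)
      fix x y assume x: "x \<in> trace_polys" and y: "y \<in> trace_polys"
      then show "x + y \<in> trace_polys"
        using keys_add[of x y] unfolding trace_polys_def by blast
    next
      fix z x assume "x \<in> trace_polys"
      moreover have "keys (const z * x) \<subseteq> keys x" by (auto simp: in_keys_iff lookup_const_mult)
      ultimately show "const z * x \<in> trace_polys" unfolding trace_polys_def by blast
    qed
    fix x y z :: trace_poly and a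
    show "Dop (x + y) = Dop x + Dop y" "Dop (const a * x) = const a * Dop x"
      by (simp_all add: linear_op_add[OF linear_op_D_gen] linear_op_const[OF linear_op_D_gen])
    show "form (x + y) z = form x z + form y z"
      unfolding form_def by (simp add: trace_eval_add distrib_right integrable_form sum.distrib)
    show "form (const a * x) y = a * form x y"
      unfolding form_def by (simp add: trace_eval_const_mult sum_distrib_left mult.assoc)
    have "cnj (LINT k|\<mu>. trace_eval x k $ i $ j * cnj (trace_eval y k $ i $ j))
        = (LINT k|\<mu>. trace_eval y k $ i $ j * cnj (trace_eval x k $ i $ j))" for i j
      using integral_bounded_linear[OF bounded_linear_cnj integrable_form[of x i j y]]
      by (simp add: mult.commute)
    then show "form y x = cnj (form x y)"
      unfolding form_def by simp
    show "0 \<le> Re (form x x)"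
      unfolding form_self by (simp add: sum_nonneg)
    assume x: "x \<in> trace_polys"
    then show "Dop x \<in> trace_polys"
      using trace_polys_upto_exists[OF x] D_gen_polys_upto trace_polys_upto by blast
    assume y: "y \<in> trace_polys"
    have "(LINT k|\<mu>. trace_eval (Dop x) k $ i $ j * cnj (trace_eval y k $ i $ j))
        = (LINT k|\<mu>. trace_eval x k $ i $ j * cnj (trace_eval (Dop y) k $ i $ j))" for i j
    proof -
      have "(LINT k|\<mu>. trace_eval (Dop x) k $ i $ j * cnj (trace_eval y k $ i $ j))
          = (LINT k|\<mu>. laplacian c K (\<lambda>A. trace_eval x A $ i $ j) k * cnj (trace_eval y k $ i $ j))"
        by (intro Bochner_Integration.integral_cong refl) (simp add: laplacian_trace_eval[OF x])
      also have "\<dots> = (LINT k|\<mu>. trace_eval x k $ i $ j * cnj (laplacian c K (\<lambda>A. trace_eval y A $ i $ j) k))"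
        by (rule integral_laplacian_swap) (rule regular_trace_eval)+
      also have "\<dots> = (LINT k|\<mu>. trace_eval x k $ i $ j * cnj (trace_eval (Dop y) k $ i $ j))"
        by (intro Bochner_Integration.integral_cong refl) (simp add: laplacian_trace_eval[OF y])
      finally show ?thesis .
    qed
    then show "form (Dop x) y = form x (Dop y)"
      unfolding form_def by simp
  qed
qed

lemma form_self_eq_0:
  assumes "form P P = 0" "A \<in> K"
  shows "trace_eval P A = 0"
proof (rule matrix_eqI)
  fix i j
  have cont: "continuous_on K (\<lambda>k. (norm (trace_eval P k $ i $ j))\<^sup>2)" for i j
    by (intro continuous_intros regular_continuous regular_trace_eval)
  have "(\<Sum>i\<in>UNIV. \<Sum>j\<in>UNIV. LINT k|\<mu>. (norm (trace_eval P k $ i $ j))\<^sup>2) = 0"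
    using assms(1) unfolding form_self by (simp only: of_real_eq_0_iff)
  then have "(LINT k|\<mu>. (norm (trace_eval P k $ i $ j))\<^sup>2) = 0"
    by (simp add: sum_nonneg_eq_0_iff sum_nonneg)
  from integral_eq_0_imp_0[OF cont zero_le_power2 this assms(2)]
  have "(norm (trace_eval P A $ i $ j))\<^sup>2 = 0" .
  then show "trace_eval P A $ i $ j = 0 $ i $ j" by simp
qed

text \<open>The iterates of \<open>P\<close> stay in the finite-dimensional
  \<open>polys_upto n\<close>, so the abstract decomposition applies; nullity of the remainders
  becomes pointwise equality on \<open>K\<close> by \<open>form_self_eq_0\<close>.\<close>

lemma eigen_decomposition:
  assumes P: "P \<in> trace_polys"
  obtains \<Lambda> y where "finite (\<Lambda> :: real set)" "\<And>\<nu>. \<nu> \<in> \<Lambda> \<Longrightarrow> y \<nu> \<in> trace_polys"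
    "\<And>\<nu> A. \<nu> \<in> \<Lambda> \<Longrightarrow> A \<in> K \<Longrightarrow> trace_eval (Dop (y \<nu>)) A = cscale \<nu> (trace_eval (y \<nu>) A)"
    "\<And>A. A \<in> K \<Longrightarrow> trace_eval P A = (\<Sum>\<nu>\<in>\<Lambda>. trace_eval (y \<nu>) A)"
proof -
  interpret S: semi_inner "\<lambda>z P. const z * (P :: trace_poly)" form Dop trace_polys
    by (rule semi_inner_form)
  obtain n where n: "P \<in> polys_upto n" using trace_polys_upto_exists[OF P] by blast
  have it: "(Dop ^^ i) P \<in> polys_upto n" for i
    by (induction i) (auto intro: n D_gen_polys_upto)
  have sp: "Q \<in> S.span (tmono ` monomials_upto n)" if "Q \<in> polys_upto n" for Q
  proof -
    have "(\<Sum>m\<in>keys Q. const (lookup Q m) * tmono m) \<in> S.span (tmono ` monomials_upto n)"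
      using that by (intro S.span_sum S.span_scale S.span_base) (auto simp: polys_upto_def)
    then show ?thesis using poly_mono_expansion[of Q] by simp
  qed
  obtain \<Lambda> y where L: "finite (\<Lambda> :: real set)" "\<And>\<nu>. \<nu> \<in> \<Lambda> \<Longrightarrow> y \<nu> \<in> trace_polys"
    "\<And>\<nu>. \<nu> \<in> \<Lambda> \<Longrightarrow> S.null (Dop (y \<nu>) - const (of_real \<nu>) * y \<nu>)" "S.null (P - sum y \<Lambda>)"
    using S.spectral_decomposition[OF finite_imageI[OF finite_monomials_upto] P sp[OF it]] by blast
  show ?thesis
  proof (rule that[OF L(1,2)])
    fix \<nu> A assume "\<nu> \<in> \<Lambda>" "A \<in> K"
    then have "trace_eval (Dop (y \<nu>) - const (of_real \<nu>) * y \<nu>) A = 0"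
      using L(3) form_self_eq_0 by (simp add: S.null_def)
    then show "trace_eval (Dop (y \<nu>)) A = cscale \<nu> (trace_eval (y \<nu>) A)"
      by (simp add: trace_eval_diff trace_eval_const_mult)
  next
    fix A assume "A \<in> K"
    then have "trace_eval (P - sum y \<Lambda>) A = 0"
      using L(4) form_self_eq_0 by (simp add: S.null_def)
    then show "trace_eval P A = (\<Sum>\<nu>\<in>\<Lambda>. trace_eval (y \<nu>) A)"
      by (simp add: trace_eval_diff trace_eval_sum)
  qed
qed

text \<open>A convergent sequence together with its limit is compact, and so is its product with
  \<open>K\<close>; this provides a constant dominating function.\<close>

lemma continuous_on_integral:
  fixes G :: "'x::heine_borel \<Rightarrow> 'm cmat \<Rightarrow> complex"
  assumes G: "continuous_on (S \<times> K) (\<lambda>(y, k). G y k)"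
  shows "continuous_on S (\<lambda>y. LINT k|\<mu>. G y k)"
  unfolding continuous_on_sequentially
proof (intro allI ballI impI)
  fix x a assume a: "a \<in> S" and xa: "(\<forall>n. x n \<in> S) \<and> x \<longlonglongrightarrow> a"
  have cG: "continuous_on K (G y)" if "y \<in> S" for y
    by (rule continuous_on_compose2[OF G, of K "\<lambda>k. (y, k)", simplified]) (use that in \<open>auto intro!: continuous_intros\<close>)
  have comp: "compact ((insert a (range x)) \<times> K)"
    using compact_sequence_with_limit[of x a] xa by (intro compact_Times compact_K) auto
  have sub: "(insert a (range x)) \<times> K \<subseteq> S \<times> K" using a xa by auto
  obtain C where C: "\<And>y k. y \<in> insert a (range x) \<Longrightarrow> k \<in> K \<Longrightarrow> norm (G y k) \<le> C"
    using compact_imp_bounded[OF compact_continuous_image[OF continuous_on_subset[OF G sub] comp]]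
    by (auto simp: bounded_iff)
  have "(\<lambda>n. LINT k|\<mu>. G (x n) k) \<longlonglongrightarrow> (LINT k|\<mu>. G a k)"
  proof (rule integral_dominated_convergence[where w = "\<lambda>_. C"])
    show "G a \<in> borel_measurable \<mu>" "G (x n) \<in> borel_measurable \<mu>" for n
      using a xa by (auto intro!: measurable_continuous cG)
    show "AE k in \<mu>. (\<lambda>n. G (x n) k) \<longlonglongrightarrow> G a k"
    proof (rule AE_I2)
      fix k assume "k \<in> space \<mu>"
      then have "continuous_on S (\<lambda>y. G y k)"
        by (intro continuous_on_compose2[OF G, of S "\<lambda>y. (y, k)", simplified]) (auto intro!: continuous_intros)
      then show "(\<lambda>n. G (x n) k) \<longlonglongrightarrow> G a k"
        using a xa unfolding continuous_on_sequentially by (auto simp: o_def)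
    qed
    show "AE k in \<mu>. norm (G (x n) k) \<le> C" for n by (rule AE_I2) (auto intro: C)
  qed simp
  then show "((\<lambda>y. LINT k|\<mu>. G y k) \<circ> x) \<longlonglongrightarrow> (LINT k|\<mu>. G a k)" by (simp add: o_def)
qed

lemma integral_swap:
  fixes G :: "'m cmat \<Rightarrow> 'm cmat \<Rightarrow> complex"
  assumes G: "continuous_on (K \<times> K) (\<lambda>(x, k). G x k)"
  shows "(LINT x|\<mu>. LINT k|\<mu>. G x k) = (LINT k|\<mu>. LINT x|\<mu>. G x k)"
proof -
  interpret pair_sigma_finite \<mu> \<mu> by unfold_locales
  interpret P: finite_measure "\<mu> \<Otimes>\<^sub>M \<mu>" by (rule finite_measure_pair_measure) unfold_locales
  have id: "(\<lambda>x. x) \<in> borel_measurable \<mu>" by (intro measurable_continuous continuous_on_id)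
  \<comment> \<open>Continuity gives measurability for the Borel sets of
    \<open>K \<times> K\<close>; the identity transfers it to the product sigma-algebra.\<close>
  have "(\<lambda>p. (fst p, snd p)) \<in> borel_measurable (\<mu> \<Otimes>\<^sub>M \<mu>)"
    by (intro borel_measurable_Pair measurable_compose[OF measurable_fst id] measurable_compose[OF measurable_snd id])
  then have "(\<lambda>p. p) \<in> measurable (\<mu> \<Otimes>\<^sub>M \<mu>) (restrict_space borel (K \<times> K))"
    by (intro measurable_restrict_space2) (auto simp: space_pair_measure)
  from measurable_compose[OF this borel_measurable_continuous_on_restrict[OF G]]
  have meas: "(\<lambda>(x, k). G x k) \<in> borel_measurable (\<mu> \<Otimes>\<^sub>M \<mu>)" .
  obtain C where C: "\<And>x k. x \<in> K \<Longrightarrow> k \<in> K \<Longrightarrow> norm (G x k) \<le> C"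
    using compact_imp_bounded[OF compact_continuous_image[OF G compact_Times[OF compact_K compact_K]]]
    by (auto simp: bounded_iff)
  have "integrable (\<mu> \<Otimes>\<^sub>M \<mu>) (\<lambda>(x, k). G x k)"
    by (rule P.integrable_const_bound[of _ C]) (auto intro!: AE_I2 C meas simp: space_pair_measure)
  from Fubini_integral[OF this] show ?thesis by simp
qed

lemma continuous_on_matrix_mult [continuous_intros]:
  fixes f h :: "'x::topological_space \<Rightarrow> 'm cmat"
  assumes "continuous_on S f" "continuous_on S h"
  shows "continuous_on S (\<lambda>x. f x ** h x)"
  by (rule bounded_bilinear.continuous_on[OF bounded_bilinear_matrix_mult assms])

lemma continuous_on_conj_transpose [continuous_intros]:
  fixes f :: "'x::topological_space \<Rightarrow> 'm cmat"
  assumes "continuous_on S f"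
  shows "continuous_on S (\<lambda>x. conj_transpose (f x))"
  by (rule bounded_linear.continuous_on[OF bounded_linear_conj_transpose assms])

lemma measure_K [simp]: "measure \<mu> K = 1"
  using emeasure_K by (simp add: measure_def)

text \<open>Averaging over a second variable \<open>h\<close>: translating \<open>k\<close> by the
  inverse of \<open>h\<close> turns \<open>f (conj_transpose k)\<close> into
  \<open>f (conj_transpose k ** h)\<close>, and after exchanging the integrals the integration over
  \<open>h\<close> absorbs \<open>conj_transpose k\<close>.\<close>

lemma integral_inverse:
  fixes f :: "'m cmat \<Rightarrow> complex"
  assumes f: "continuous_on K f"
  shows "(LINT k|\<mu>. f (conj_transpose k)) = (LINT k|\<mu>. f k)"
proof -
  have ci: "continuous_on K (\<lambda>k. f (conj_transpose k))"
    by (rule continuous_on_compose2[OF f]) (auto intro!: continuous_intros inv_in)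
  have "(LINT k|\<mu>. f (conj_transpose k)) = (LINT h|\<mu>. LINT k|\<mu>. f (conj_transpose k))"
    by simp
  also have "\<dots> = (LINT h|\<mu>. LINT k|\<mu>. f (conj_transpose k ** h))"
  proof (rule Bochner_Integration.integral_cong[OF refl])
    fix h assume "h \<in> space \<mu>"
    then have h: "conj_transpose h \<in> K" using inv_in by simp
    show "(LINT k|\<mu>. f (conj_transpose k)) = (LINT k|\<mu>. f (conj_transpose k ** h))"
      using integral_translate(1)[OF h measurable_continuous[OF ci]] by simp
  qed
  also have "\<dots> = (LINT k|\<mu>. LINT h|\<mu>. f (conj_transpose k ** h))"
  proof -
    have "continuous_on (K \<times> K) (\<lambda>p. f (conj_transpose (snd p) ** fst p))"
      by (rule continuous_on_compose2[OF f]) (auto intro!: continuous_intros mult_in inv_in)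
    then have "continuous_on (K \<times> K) (\<lambda>(h, k). f (conj_transpose k ** h))"
      by (simp add: case_prod_beta)
    then show ?thesis
      by (rule integral_swap[where G = "\<lambda>h k. f (conj_transpose k ** h)"])
  qed
  also have "\<dots> = (LINT k|\<mu>. LINT h|\<mu>. f h)"
    by (rule Bochner_Integration.integral_cong[OF refl])
       (simp add: integral_translate(1)[OF inv_in measurable_continuous[OF f]])
  also have "\<dots> = (LINT h|\<mu>. f h)" by simp
  finally show ?thesis .
qed

lemma L2_continuous:
  fixes f :: "'m cmat \<Rightarrow> complex" and r :: "'m cmat \<Rightarrow> real"
  assumes "continuous_on K f" "continuous_on K r"
  shows "L2 \<mu> r f"
  unfolding L2_def by (intro conjI measurable_continuous integrable_continuous continuous_intros assms)

end

locale heat_group = haar_group K c al cp cm g \<mu>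
  for K :: "'m::finite cmat set" and c al cp cm g \<mu> +
  fixes \<rho> :: "real \<Rightarrow> 'm cmat \<Rightarrow> real"
  assumes heat: "heat_kernel c K \<mu> \<rho>"
begin

lemma continuous_rho: "s > 0 \<Longrightarrow> continuous_on K (\<rho> s)"
  using heat unfolding heat_kernel_def smooth_on_group_def by (metis Cn_on.simps(1))

text \<open>Testing the heat operator against arbitrary \<open>f\<close> yields the adjoint convolution identity for
  eigenfunctions, so that completeness of the eigenfunctions is not needed.\<close>

lemma heat_kernel_dual:
  fixes f :: "'m cmat \<Rightarrow> complex"
  assumes s: "s > 0" and reg: "regular f" and eig: "laplace_eigenfunction c K \<nu> f" and y: "y \<in> K"
  shows "(LINT k|\<mu>. \<rho> s k * f (y ** conj_transpose k)) = of_real (exp (s * \<nu> / 2)) * f y"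
proof -
  let ?e = "of_real (exp (s * \<nu> / 2)) :: complex"
  note cr = continuous_rho[OF s] and cf = regular_continuous[OF reg]
  \<comment> \<open>The conjugate appears because eigenfunctions enter
    \<open>heat_operator_graph\<close> through \<open>cnj\<close>; the claim amounts to
    \<open>h y = 0\<close>.\<close>
  define p where "p x = (LINT k|\<mu>. \<rho> s k * cnj (f (x ** conj_transpose k)))" for x
  define h where "h x = p x - ?e * cnj (f x)" for x
  have cp: "continuous_on K p"
    unfolding p_def
    by (rule continuous_on_integral)
       (auto intro!: continuous_intros continuous_on_compose2[OF cf] continuous_on_compose2[OF cr] mult_in inv_in simp: case_prod_beta)
  have ch: "continuous_on K h"
    unfolding h_def by (intro continuous_intros cp cf)
  have test: "(LINT x|\<mu>. b x * h x) = 0" if cb: "continuous_on K b" for b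
  proof -
    have "heat_operator_graph c K \<mu> s b (\<lambda>x. LINT k|\<mu>. b (x ** k) * of_real (\<rho> s k))"
      using heat s L2_continuous[OF cb continuous_on_const] unfolding heat_kernel_def by blast
    then have op: "(LINT x|\<mu>. (LINT k|\<mu>. b (x ** k) * of_real (\<rho> s k)) * cnj (f x)) = ?e * (LINT x|\<mu>. b x * cnj (f x))"
      using eig unfolding heat_operator_graph_def by blast
    have "(LINT x|\<mu>. (LINT k|\<mu>. b (x ** k) * of_real (\<rho> s k)) * cnj (f x))
        = (LINT x|\<mu>. LINT k|\<mu>. b (x ** k) * of_real (\<rho> s k) * cnj (f x))"
      by simp
    also have "\<dots> = (LINT k|\<mu>. LINT x|\<mu>. b (x ** k) * of_real (\<rho> s k) * cnj (f x))"
      by (rule integral_swap)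
         (auto intro!: continuous_intros continuous_on_compose2[OF cf] continuous_on_compose2[OF cr] continuous_on_compose2[OF cb] mult_in simp: case_prod_beta)
    \<comment> \<open>Right invariance moves \<open>k\<close> from the test function
      \<open>b\<close> to the eigenfunction.\<close>
    also have "\<dots> = (LINT k|\<mu>. LINT x|\<mu>. b x * of_real (\<rho> s k) * cnj (f (x ** conj_transpose k)))"
    proof (rule Bochner_Integration.integral_cong[OF refl])
      fix k assume "k \<in> space \<mu>"
      then have k: "k \<in> K" by simp
      have "continuous_on K (\<lambda>x. b x * of_real (\<rho> s k) * cnj (f (x ** conj_transpose k)))"
        by (intro continuous_intros cb continuous_translate(2)[OF cf] inv_in k)
      from integral_translate(2)[OF k measurable_continuous[OF this]]
      show "(LINT x|\<mu>. b (x ** k) * of_real (\<rho> s k) * cnj (f x))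
          = (LINT x|\<mu>. b x * of_real (\<rho> s k) * cnj (f (x ** conj_transpose k)))"
        by (simp add: matrix_mul_assoc[symmetric] unitary'[OF k])
    qed
    also have "\<dots> = (LINT x|\<mu>. LINT k|\<mu>. b x * of_real (\<rho> s k) * cnj (f (x ** conj_transpose k)))"
      by (rule integral_swap[symmetric])
         (auto intro!: continuous_intros continuous_on_compose2[OF cf] continuous_on_compose2[OF cr] continuous_on_compose2[OF cb] mult_in inv_in simp: case_prod_beta)
    also have "\<dots> = (LINT x|\<mu>. b x * p x)"
      by (simp add: p_def mult.assoc)
    finally have "(LINT x|\<mu>. b x * p x) = ?e * (LINT x|\<mu>. b x * cnj (f x))" using op by simp
    moreover have "(LINT x|\<mu>. b x * h x) = (LINT x|\<mu>. b x * p x) - (LINT x|\<mu>. ?e * (b x * cnj (f x)))"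
      unfolding h_def right_diff_distrib
      by (subst Bochner_Integration.integral_diff[symmetric])
         (auto intro!: integrable_continuous continuous_intros cb cp cf simp: mult_ac)
    ultimately show ?thesis by simp
  qed
  \<comment> \<open>The test function is now the conjugate of \<open>h\<close> itself.\<close>
  have "(LINT x|\<mu>. of_real ((norm (h x))\<^sup>2)) = (0 :: complex)"
    using test[OF continuous_on_cnj[OF ch]] by (simp only: complex_norm_square mult.commute)
  then have "(LINT x|\<mu>. (norm (h x))\<^sup>2) = 0"
    by (simp only: integral_complex_of_real of_real_eq_0_iff)
  then have "(norm (h y))\<^sup>2 = 0"
    by (rule integral_eq_0_imp_0[rotated 2, OF _ y]) (auto intro!: continuous_intros ch)
  then have "cnj (p y) = cnj (?e * cnj (f y))" by (simp add: h_def)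
  moreover have "cnj (p y) = (LINT k|\<mu>. \<rho> s k * f (y ** conj_transpose k))"
  proof -
    have "integrable \<mu> (\<lambda>k. \<rho> s k * cnj (f (y ** conj_transpose k)))"
      by (rule integrable_continuous)
         (auto intro!: continuous_intros continuous_on_compose2[OF cf] continuous_on_compose2[OF cr] mult_in inv_in y)
    from integral_bounded_linear[OF bounded_linear_cnj this] show ?thesis
      by (simp add: p_def)
  qed
  ultimately show ?thesis by simp
qed

text \<open>Conjugation equivariance turns the right translate of an eigenfunction into a combination of
  left translates, with which the left-invariant Laplacian commutes.\<close>

lemma right_translate_eigenfunction:
  assumes P: "P \<in> trace_polys" and eig: "\<And>A. A \<in> K \<Longrightarrow> trace_eval (Dop P) A = cscale (of_real \<nu>) (trace_eval P A)"
    and x: "x \<in> K"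
  shows "regular (\<lambda>y. trace_eval P (y ** x) $ i $ j)" "laplace_eigenfunction c K \<nu> (\<lambda>y. trace_eval P (y ** x) $ i $ j)"
proof -
  obtain F1 F2 where F: "\<And>X. X \<in> Ba \<Longrightarrow> deriv_along X (trace_eval P) (F1 X)" "\<And>X. X \<in> Ba \<Longrightarrow> deriv_along X (F1 X) (F2 X)"
    "\<And>A. A \<in> K \<Longrightarrow> (\<Sum>X\<in>Ba. F2 X A) = trace_eval (Dop P) A"
    using intertwines_trace_polys[OF P] unfolding intertwines_def by blast
  \<comment> \<open>\<open>y ** x\<close> is the conjugate of \<open>x ** y\<close> by
    \<open>x\<close>, so \<open>l\<close>, an entry after conjugation by \<open>x\<close>, expresses
    the right translate through the left translate.\<close>
  define l where "l B = (conj_transpose x ** B ** x) $ i $ j" for B :: "'m cmat"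
  have bl: "bounded_linear l"
    unfolding l_def
    by (intro bounded_linear_compose[OF bounded_linear_vec_nth] bounded_linear_compose[OF bounded_linear_vec_nth]
        bounded_linear_compose[OF bounded_bilinear.bounded_linear_left[OF bounded_bilinear_matrix_mult]]
        bounded_bilinear.bounded_linear_right[OF bounded_bilinear_matrix_mult])
  have eq: "trace_eval P (y ** x) $ i $ j = l (trace_eval P (x ** y))" if y: "y \<in> K" for y
  proof -
    have "conj_transpose x ** (x ** y) ** x = y ** x"
      by (simp add: matrix_mul_assoc unitary[OF x])
    then show ?thesis
      using trace_eval_conjugate[OF K_invertible[OF mult_in[OF x y]] K_invertible[OF x], of P]
      by (simp add: l_def matrix_inv_unitary[OF unitary[OF x]])
  qed
  have "regular (\<lambda>y. l (trace_eval P (x ** y)))"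
    unfolding l_def matrix_mult_nth[of "_ ** _"] matrix_mult_nth[of "conj_transpose x"]
    by (intro regular_sum regular_mult regular_const regular_translate[OF x regular_trace_eval])
  then show reg: "regular (\<lambda>y. trace_eval P (y ** x) $ i $ j)"
    by (rule regular_cong) (simp add: eq)
  have tr: "deriv_along X (\<lambda>y. l (G (x ** y))) (\<lambda>y. l (G' (x ** y)))" if "deriv_along X G G'" for X G G'
  proof (rule deriv_along_linear[OF bl])
    show "deriv_along X (\<lambda>y. G (x ** y)) (\<lambda>y. G' (x ** y))"
      using that mult_in[OF x] unfolding deriv_along_def by (simp add: matrix_mul_assoc)
  qed
  show "laplace_eigenfunction c K \<nu> (\<lambda>y. trace_eval P (y ** x) $ i $ j)"
    unfolding laplace_eigenfunction_def
  proof (intro conjI ballI regular_smooth reg)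
    fix y assume y: "y \<in> K"
    have "laplacian c K (\<lambda>y. trace_eval P (y ** x) $ i $ j) y = (\<Sum>X\<in>Ba. l (F2 X (x ** y)))"
      unfolding laplacian_def Ba_def[symmetric]
    proof (intro sum.cong refl)
      fix X assume X: "X \<in> Ba"
      have "deriv_along X (\<lambda>y. trace_eval P (y ** x) $ i $ j) (\<lambda>y. l (F1 X (x ** y)))"
        by (rule deriv_along_cong[OF tr[OF F(1)[OF X]]]) (simp_all add: eq)
      then show "lie_deriv X (lie_deriv X (\<lambda>y. trace_eval P (y ** x) $ i $ j)) y = l (F2 X (x ** y))"
        by (rule lie_deriv_lie_deriv_eq[OF _ tr[OF F(2)[OF X]] y])
    qed
    also have "\<dots> = l (\<Sum>X\<in>Ba. F2 X (x ** y))"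
      by (rule linear_sum[symmetric]) (rule bounded_linear.linear[OF bl])
    also have "\<dots> = of_real \<nu> * trace_eval P (y ** x) $ i $ j"
      unfolding F(3)[OF mult_in[OF x y]] eig[OF mult_in[OF x y]] eq[OF y] l_def by simp
    finally show "laplacian c K (\<lambda>y. trace_eval P (y ** x) $ i $ j) y = of_real \<nu> * trace_eval P (y ** x) $ i $ j" .
  qed
qed

text \<open>Right translation of \<open>k\<close> by \<open>x\<close> and inversion bring the
  integral into the form of \<open>heat_kernel_dual\<close> at the identity, with the right
  translate of \<open>trace_eval P\<close> by \<open>x\<close> as eigenfunction.\<close>

lemma heat_kernel_eigen:
  assumes P: "P \<in> trace_polys" and eig: "\<And>A. A \<in> K \<Longrightarrow> trace_eval (Dop P) A = cscale (of_real \<nu>) (trace_eval P A)"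
    and s: "s > 0" and x: "x \<in> K"
  shows "(LINT k|\<mu>. \<rho> s (x ** conj_transpose k) * trace_eval P k $ i $ j) = of_real (exp (s * \<nu> / 2)) * trace_eval P x $ i $ j"
proof -
  have re: "regular (\<lambda>y. trace_eval P (y ** x) $ i $ j)" "laplace_eigenfunction c K \<nu> (\<lambda>y. trace_eval P (y ** x) $ i $ j)"
    by (rule right_translate_eigenfunction[OF P _ x]; simp add: eig)+
  have cP: "continuous_on K (\<lambda>k. trace_eval P k $ i $ j)"
    by (intro regular_continuous regular_trace_eval)
  have c1: "continuous_on K (\<lambda>k. \<rho> s (x ** conj_transpose k) * trace_eval P k $ i $ j)"
    by (auto intro!: continuous_intros continuous_on_compose2[OF continuous_rho[OF s]] cP mult_in inv_in x)
  have c2: "continuous_on K (\<lambda>k. \<rho> s k * trace_eval P (conj_transpose k ** x) $ i $ j)"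
  proof -
    have "continuous_on K (\<lambda>k. trace_eval P (conj_transpose k ** x) $ i $ j)"
      by (rule continuous_on_compose2[OF cP]) (auto intro!: continuous_intros mult_in inv_in x)
    then show ?thesis
      by (intro continuous_on_mult continuous_on_of_real continuous_rho[OF s])
  qed
  have "(LINT k|\<mu>. \<rho> s (x ** conj_transpose k) * trace_eval P k $ i $ j)
      = (LINT k|\<mu>. \<rho> s (conj_transpose k) * trace_eval P (conj_transpose (conj_transpose k) ** x) $ i $ j)"
    using integral_translate(2)[OF x measurable_continuous[OF c1]] unitary'[OF x]
    by (simp add: matrix_mul_assoc)
  also have "\<dots> = (LINT k|\<mu>. \<rho> s k * trace_eval P (conj_transpose k ** x) $ i $ j)"
    by (rule integral_inverse[OF c2])
  also have "\<dots> = of_real (exp (s * \<nu> / 2)) * trace_eval P x $ i $ j"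
    using heat_kernel_dual[OF s re mat_1_in] by (simp only: matrix_mul_lid)
  finally show ?thesis .
qed

end

section \<open>Polar decomposition\<close>

lemma norm_trace_zero: "trace (X ** conj_transpose X) = 0 \<longleftrightarrow> X = 0"
  by (simp add: trace_mult_conj_transpose)

text \<open>Left multiplication by a Hermitian matrix is symmetric for the Hilbert-Schmidt product,
  so the abstract decomposition also yields the spectral theorem for matrices.\<close>

lemma semi_inner_matrix:
  fixes H :: "'m::finite cmat"
  assumes "conj_transpose H = H"
  shows "semi_inner cscale (\<lambda>A B. trace (A ** conj_transpose B)) ((**) H) UNIV"
proof -
  interpret vector_space "cscale :: complex \<Rightarrow> 'm cmat \<Rightarrow> 'm cmat"
    by unfold_locales (simp_all add: cscale_add_right cscale_add_left)
  show ?thesis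
  proof
    fix A B :: "'m cmat"
    show "trace (B ** conj_transpose A) = cnj (trace (A ** conj_transpose B))"
      by (simp add: trace_conj_transpose[symmetric])
    show "0 \<le> Re (trace (A ** conj_transpose A))"
      by (simp add: trace_mult_conj_transpose del: of_real_power)
    show "trace (H ** A ** conj_transpose B) = trace (A ** conj_transpose (H ** B))"
      using trace_mul_sym[of H "A ** conj_transpose B"] by (simp add: assms matrix_mul_assoc)
  qed (auto simp: subspace_UNIV matrix_add_ldistrib matrix_add_rdistrib2 trace_add trace_cscale)
qed

text \<open>Decomposing the identity matrix into eigenvectors of left multiplication produces the
  spectral projections. Components for different eigenvalues are orthogonal; multiplying the adjoint
  of the decomposition by \<open>E \<nu>\<close> then gives
  \<open>E \<nu> = conj_transpose (E \<nu>) ** E \<nu>\<close>, which makes \<open>E \<nu>\<close>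
  Hermitian and idempotent.\<close>

lemma hermitian_spectral:
  fixes H :: "'m::finite cmat"
  assumes H: "conj_transpose H = H"
  obtains \<Lambda> E where "finite (\<Lambda> :: real set)" "\<And>\<nu>. \<nu> \<in> \<Lambda> \<Longrightarrow> E \<nu> \<noteq> 0"
    "\<And>\<nu>. \<nu> \<in> \<Lambda> \<Longrightarrow> H ** E \<nu> = cscale (of_real \<nu>) (E \<nu>)" "(\<Sum>\<nu>\<in>\<Lambda>. E \<nu>) = mat 1"
    "\<And>\<nu> \<nu>'. \<nu> \<in> \<Lambda> \<Longrightarrow> \<nu>' \<in> \<Lambda> \<Longrightarrow> E \<nu> ** E \<nu>' = (if \<nu> = \<nu>' then E \<nu> else 0)"
    "\<And>\<nu>. \<nu> \<in> \<Lambda> \<Longrightarrow> conj_transpose (E \<nu>) = E \<nu>"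
proof -
  interpret S: semi_inner cscale "\<lambda>A B. trace (A ** conj_transpose B)" "(**) H" UNIV
    by (rule semi_inner_matrix[OF H])
  define U where "U = (\<lambda>(a, b). mat_unit a b :: 'm cmat) ` UNIV"
  have span: "A \<in> S.span U" for A :: "'m cmat"
  proof -
    have "A $ i $ j = (\<Sum>a\<in>UNIV. \<Sum>b\<in>UNIV. cscale (A $ a $ b) (mat_unit a b)) $ i $ j" for i j
    proof -
      have "(\<Sum>a\<in>UNIV. \<Sum>b\<in>UNIV. cscale (A $ a $ b) (mat_unit a b)) $ i $ j
          = (\<Sum>a\<in>UNIV. \<Sum>b\<in>UNIV. if b = j then if a = i then A $ a $ b else 0 else 0)"
        unfolding sum_component cscale_nth by (intro sum.cong refl) (auto simp: mat_unit_def)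
      then show ?thesis by simp
    qed
    then have "A = (\<Sum>a\<in>UNIV. \<Sum>b\<in>UNIV. cscale (A $ a $ b) (mat_unit a b))" by (rule matrix_eqI)
    moreover have "(\<Sum>a\<in>UNIV. \<Sum>b\<in>UNIV. cscale (A $ a $ b) (mat_unit a b)) \<in> S.span U"
      by (intro S.span_sum S.span_scale S.span_base) (auto simp: U_def)
    ultimately show ?thesis by simp
  qed
  have fU: "finite U" by (simp add: U_def)
  obtain \<Lambda>0 E where L: "finite (\<Lambda>0 :: real set)"
    "\<And>\<nu>. \<nu> \<in> \<Lambda>0 \<Longrightarrow> S.null (H ** E \<nu> - cscale (of_real \<nu>) (E \<nu>))" "S.null (mat 1 - sum E \<Lambda>0)"
    by (rule S.spectral_decomposition[where S = U and x = "mat 1", OF fU UNIV_I span]) metis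
  \<comment> \<open>Zero components are dropped, since positivity of the eigenvalues in
    \<open>polar_curve\<close> is read off from nonzero projections.\<close>
  define \<Lambda> where "\<Lambda> = {\<nu> \<in> \<Lambda>0. E \<nu> \<noteq> 0}"
  have f: "finite \<Lambda>" using L(1) by (simp add: \<Lambda>_def)
  have eig: "H ** E \<nu> = cscale (of_real \<nu>) (E \<nu>)" if "\<nu> \<in> \<Lambda>" for \<nu>
    using L(2)[of \<nu>] that norm_trace_zero[of "H ** E \<nu> - cscale (of_real \<nu>) (E \<nu>)"] by (simp add: \<Lambda>_def S.null_def)
  have "mat 1 = sum E \<Lambda>0"
    using L(3) norm_trace_zero[of "mat 1 - sum E \<Lambda>0"] by (simp add: S.null_def)
  also have "\<dots> = sum E \<Lambda>"
    using L(1) by (intro sum.mono_neutral_right) (auto simp: \<Lambda>_def)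
  finally have one: "sum E \<Lambda> = mat 1" by simp
  have orth: "conj_transpose (E \<nu>) ** E \<nu>' = 0" if "\<nu> \<in> \<Lambda>" "\<nu>' \<in> \<Lambda>" "\<nu> \<noteq> \<nu>'" for \<nu> \<nu>'
  proof -
    have "cscale (of_real \<nu>) (conj_transpose (E \<nu>)) = conj_transpose (E \<nu>) ** H"
      using arg_cong[OF eig[OF that(1)], of conj_transpose] by (simp add: H)
    then have "cscale (of_real \<nu>) (conj_transpose (E \<nu>)) ** E \<nu>' = conj_transpose (E \<nu>) ** H ** E \<nu>'"
      by (rule arg_cong)
    then have "cscale (of_real \<nu>) (conj_transpose (E \<nu>) ** E \<nu>') = conj_transpose (E \<nu>) ** (H ** E \<nu>')"
      by (simp only: cscale_mult_left matrix_mul_assoc)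
    then have "cscale (of_real \<nu> - of_real \<nu>') (conj_transpose (E \<nu>) ** E \<nu>') = 0"
      by (simp add: eig[OF that(2)] cscale_diff_left)
    then show ?thesis using that(3) by (simp add: vec_eq_iff)
  qed
  have self: "conj_transpose (E \<nu>) ** E \<nu> = E \<nu>" if "\<nu> \<in> \<Lambda>" for \<nu>
  proof -
    have "E \<nu> = conj_transpose (sum E \<Lambda>) ** E \<nu>" by (simp add: one)
    also have "\<dots> = (\<Sum>\<nu>'\<in>\<Lambda>. if \<nu>' = \<nu> then conj_transpose (E \<nu>) ** E \<nu> else 0)"
      unfolding conj_transpose_sum matrix_mult_sum_left by (intro sum.cong) (auto simp: orth that)
    finally show ?thesis using f that by simp
  qed
  have herm: "conj_transpose (E \<nu>) = E \<nu>" if "\<nu> \<in> \<Lambda>" for \<nu>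
  proof -
    have "conj_transpose (conj_transpose (E \<nu>) ** E \<nu>) = conj_transpose (E \<nu>) ** E \<nu>"
      by (simp only: conj_transpose_simps)
    then show ?thesis by (simp only: self[OF that])
  qed
  have mult: "E \<nu> ** E \<nu>' = (if \<nu> = \<nu>' then E \<nu> else 0)" if "\<nu> \<in> \<Lambda>" "\<nu>' \<in> \<Lambda>" for \<nu> \<nu>'
  proof (cases "\<nu> = \<nu>'")
    case True
    then show ?thesis using self[OF that(1)] unfolding herm[OF that(1)] by simp
  next
    case False
    then show ?thesis using orth[OF that False] unfolding herm[OF that(1)] by simp
  qed
  have ne: "E \<nu> \<noteq> 0" if "\<nu> \<in> \<Lambda>" for \<nu>
    using that unfolding \<Lambda>_def by blast
  show ?thesis
    by (rule that[of \<Lambda> E]) (rule f ne eig one mult herm; assumption)+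
qed

text \<open>Complex powers are defined on the spectral projections of
  \<open>conj_transpose z ** z\<close>. The last two properties keep the curve inside a group given
  by invariant forms and determinant one.\<close>

lemma polar_curve:
  fixes z :: "'m::finite cmat"
  assumes z: "invertible z"
  obtains Hp :: "complex \<Rightarrow> 'm cmat" where
    "\<And>i j. (\<lambda>w. Hp w $ i $ j) holomorphic_on UNIV"
    "\<And>w w'. Hp w ** Hp w' = Hp (w + w')" "Hp 0 = mat 1" "\<And>w. conj_transpose (Hp w) = Hp (cnj w)"
    "Hp 1 = conj_transpose z ** z"
    "\<And>J w. transpose (Hp 1) ** J ** Hp 1 = J \<Longrightarrow> transpose (Hp w) ** J ** Hp w = J"
    "\<And>w. det (Hp 1) = 1 \<Longrightarrow> det (Hp w) = 1"
proof -
  define H where "H = conj_transpose z ** z"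
  have "conj_transpose H = H" by (simp add: H_def)
  then obtain \<Lambda> E where f: "finite (\<Lambda> :: real set)" and ne: "\<And>\<nu>. \<nu> \<in> \<Lambda> \<Longrightarrow> E \<nu> \<noteq> 0"
    and eig: "\<And>\<nu>. \<nu> \<in> \<Lambda> \<Longrightarrow> H ** E \<nu> = cscale (of_real \<nu>) (E \<nu>)" and one: "(\<Sum>\<nu>\<in>\<Lambda>. E \<nu>) = mat 1"
    and orth: "\<And>\<nu> \<nu>'. \<nu> \<in> \<Lambda> \<Longrightarrow> \<nu>' \<in> \<Lambda> \<Longrightarrow> E \<nu> ** E \<nu>' = (if \<nu> = \<nu>' then E \<nu> else 0)"
    and herm: "\<And>\<nu>. \<nu> \<in> \<Lambda> \<Longrightarrow> conj_transpose (E \<nu>) = E \<nu>"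
    using hermitian_spectral[of H] by blast
  \<comment> \<open>The factor \<open>\<nu>\<close> relates the squared norms of
    \<open>E \<nu>\<close> and \<open>z ** E \<nu>\<close>, both nonzero as \<open>z\<close> is
    invertible.\<close>
  have pos: "\<nu> > 0" if n: "\<nu> \<in> \<Lambda>" for \<nu>
  proof -
    have "conj_transpose (z ** E \<nu>) ** (z ** E \<nu>) = E \<nu> ** (H ** E \<nu>)"
      by (simp add: H_def herm[OF n] matrix_mul_assoc)
    also have "\<dots> = cscale (of_real \<nu>) (E \<nu> ** conj_transpose (E \<nu>))"
      by (simp add: eig[OF n] herm[OF n])
    finally have "trace ((z ** E \<nu>) ** conj_transpose (z ** E \<nu>)) = of_real \<nu> * trace (E \<nu> ** conj_transpose (E \<nu>))"
      by (subst trace_mul_sym) (simp add: trace_cscale)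
    then have "of_real ((norm (z ** E \<nu>))\<^sup>2) = (of_real (\<nu> * (norm (E \<nu>))\<^sup>2) :: complex)"
      by (simp only: trace_mult_conj_transpose of_real_mult)
    then have eq: "(norm (z ** E \<nu>))\<^sup>2 = \<nu> * (norm (E \<nu>))\<^sup>2" by (simp only: of_real_eq_iff)
    have "z ** E \<nu> \<noteq> 0"
    proof
      assume "z ** E \<nu> = 0"
      then have "matrix_inv z ** (z ** E \<nu>) = 0" by simp
      then show False using ne[OF n] z by (simp add: matrix_mul_assoc)
    qed
    then have "0 < \<nu> * (norm (E \<nu>))\<^sup>2" unfolding eq[symmetric] by simp
    then show ?thesis by (simp add: zero_less_mult_iff)
  qed
  define Hp where "Hp w = (\<Sum>\<nu>\<in>\<Lambda>. cscale (exp (w * of_real (ln \<nu>))) (E \<nu>))" for w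
  have mult: "Hp w ** Hp w' = Hp (w + w')" for w w'
  proof -
    have "Hp w ** Hp w' = (\<Sum>\<nu>\<in>\<Lambda>. \<Sum>\<nu>'\<in>\<Lambda>. if \<nu>' = \<nu> then cscale (exp (w * of_real (ln \<nu>)) * exp (w' * of_real (ln \<nu>))) (E \<nu>) else 0)"
      unfolding Hp_def matrix_mult_sum_left matrix_mult_sum_right
      by (intro sum.cong refl) (auto simp: orth mult.commute)
    then show ?thesis using f by (simp add: Hp_def exp_add[symmetric] distrib_right)
  qed
  have Hp0: "Hp 0 = mat 1" by (simp add: Hp_def one)
  have Hp1: "Hp 1 = H"
  proof -
    have "H = H ** (\<Sum>\<nu>\<in>\<Lambda>. E \<nu>)" by (simp add: one)
    then show ?thesis
      by (simp add: Hp_def matrix_mult_sum_right eig exp_of_real pos)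
  qed
  have conj: "conj_transpose (Hp w) = Hp (cnj w)" for w
    by (simp add: Hp_def conj_transpose_sum herm exp_cnj)
  have hol: "(\<lambda>w. Hp w $ i $ j) holomorphic_on UNIV" for i j
    unfolding Hp_def sum_component cscale_nth by (intro holomorphic_intros)
  have J: "transpose (Hp w) ** J ** Hp w = J" if J: "transpose (Hp 1) ** J ** Hp 1 = J" for J w
  proof -
    have tsum: "transpose (sum F S) = (\<Sum>i\<in>S. transpose (F i))" for F :: "real \<Rightarrow> 'm cmat" and S
      by (induction S rule: infinite_finite_induct) (simp_all add: transpose_simps, simp_all add: transpose_def vec_eq_iff)
    have form: "transpose (Hp w) ** J ** Hp w = (\<Sum>\<nu>\<in>\<Lambda>. \<Sum>\<nu>'\<in>\<Lambda>. cscale (exp (w * of_real (ln \<nu>)) * exp (w * of_real (ln \<nu>'))) (transpose (E \<nu>) ** J ** E \<nu>'))" for w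
      unfolding Hp_def tsum matrix_mult_sum_left matrix_mult_sum_right
      by (subst sum.swap, intro sum.cong refl) (simp add: transpose_simps mult.commute)
    \<comment> \<open>Invariance under \<open>H\<close> forces the block of \<open>J\<close> between
      two eigenspaces to vanish unless \<open>\<nu> * \<nu>' = 1\<close>; in that case the
      logarithms cancel for every \<open>w\<close>.\<close>
    have "cscale (exp (w * of_real (ln \<nu>)) * exp (w * of_real (ln \<nu>'))) (transpose (E \<nu>) ** J ** E \<nu>') = transpose (E \<nu>) ** J ** E \<nu>'"
      if n: "\<nu> \<in> \<Lambda>" "\<nu>' \<in> \<Lambda>" for \<nu> \<nu>'
    proof -
      have "transpose (H ** E \<nu>) ** J ** (H ** E \<nu>') = transpose (E \<nu>) ** (transpose H ** J ** H) ** E \<nu>'"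
        by (simp add: matrix_transpose_mul matrix_mul_assoc)
      then have "cscale (of_real \<nu> * of_real \<nu>') (transpose (E \<nu>) ** J ** E \<nu>') = transpose (E \<nu>) ** J ** E \<nu>'"
        using J by (simp add: eig n transpose_simps Hp1 mult.commute)
      then have c: "cscale (of_real \<nu> * of_real \<nu>' - 1) (transpose (E \<nu>) ** J ** E \<nu>') = 0"
        by (simp add: cscale_diff_left)
      show ?thesis
      proof (cases "transpose (E \<nu>) ** J ** E \<nu>' = 0")
        case False
        then have "of_real \<nu> * of_real \<nu>' = (1 :: complex)"
          using c by (auto simp: vec_eq_iff)
        then have "\<nu> * \<nu>' = 1" by (metis of_real_eq_1_iff of_real_mult)
        then have "\<nu>' = inverse \<nu>" by (metis inverse_unique)
        then have "ln \<nu> + ln \<nu>' = 0" using pos[OF n(1)] by (simp add: ln_inverse)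
        then have "w * of_real (ln \<nu>) + w * of_real (ln \<nu>') = 0"
          by (metis distrib_left mult_zero_right of_real_0 of_real_add)
        then show ?thesis by (simp add: exp_add[symmetric])
      qed simp
    qed
    then have "transpose (Hp w) ** J ** Hp w = (\<Sum>\<nu>\<in>\<Lambda>. \<Sum>\<nu>'\<in>\<Lambda>. transpose (E \<nu>) ** J ** E \<nu>')"
      unfolding form by simp
    also have "\<dots> = transpose (sum E \<Lambda>) ** J ** sum E \<Lambda>"
      unfolding tsum matrix_mult_sum_left matrix_mult_sum_right by (rule sum.swap)
    finally show ?thesis by (simp add: one transpose_mat)
  qed
  have det: "det (Hp w) = 1" if d1: "det (Hp 1) = 1" for w
  proof -
    \<comment> \<open>The trace of the logarithm of \<open>H\<close>, since the squared norm of an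
      orthogonal projection is its trace.\<close>
    define a where "a = (\<Sum>\<nu>\<in>\<Lambda>. ln \<nu> * (norm (E \<nu>))\<^sup>2)"
    have der0: "((\<lambda>t. det (Hp (of_real t * w))) has_vector_derivative w * of_real a) (at 0)" for w
    proof -
      have "((\<lambda>t. Hp (of_real t * w)) has_vector_derivative (\<Sum>\<nu>\<in>\<Lambda>. cscale (w * of_real (ln \<nu>)) (E \<nu>))) (at 0)"
        unfolding Hp_def
      proof (intro has_vector_derivative_sum)
        fix \<nu> assume "\<nu> \<in> \<Lambda>"
        have "((\<lambda>t. exp (t * w * of_real (ln \<nu>))) has_field_derivative (w * of_real (ln \<nu>))) (at (of_real 0))"
          by (auto intro!: derivative_eq_intros)
        from bounded_linear.has_vector_derivative[OF bounded_bilinear.bounded_linear_left[OF bounded_bilinear_cscale]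
          has_vector_derivative_real_field[OF this]]
        show "((\<lambda>t. cscale (exp (of_real t * w * of_real (ln \<nu>))) (E \<nu>)) has_vector_derivative cscale (w * of_real (ln \<nu>)) (E \<nu>)) (at 0)" .
      qed
      then have "((\<lambda>t. det (Hp (of_real t * w))) has_vector_derivative trace (\<Sum>\<nu>\<in>\<Lambda>. cscale (w * of_real (ln \<nu>)) (E \<nu>))) (at 0)"
        by (rule det_has_vector_derivative) (simp add: Hp0)
      moreover have "trace (E \<nu>) = of_real ((norm (E \<nu>))\<^sup>2)" if "\<nu> \<in> \<Lambda>" for \<nu>
        using trace_mult_conj_transpose[of "E \<nu>"] by (simp add: herm[OF that] orth[OF that that])
      ultimately show ?thesis
        by (simp add: trace_sum trace_cscale a_def sum_distrib_left mult.assoc)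
    qed
    have der: "((\<lambda>t. det (Hp (of_real t * w))) has_vector_derivative w * of_real a * det (Hp (of_real t * w))) (at t)" for t w
    proof -
      have "((\<lambda>h. det (Hp (of_real h * w))) \<circ> (\<lambda>h. h - t) has_vector_derivative 1 *\<^sub>R (w * of_real a)) (at t)"
        by (rule vector_diff_chain_at) (use der0 in \<open>auto intro!: derivative_eq_intros simp: has_vector_derivative_def\<close>)
      then have "((\<lambda>h. det (Hp (of_real t * w)) * det (Hp (of_real (h - t) * w))) has_vector_derivative det (Hp (of_real t * w)) * (w * of_real a)) (at t)"
        by (intro has_vector_derivative_mult_right) (simp add: o_def)
      moreover have "det (Hp (of_real t * w)) * det (Hp (of_real (h - t) * w)) = det (Hp (of_real h * w))" for h
        by (simp add: det_mul[symmetric] mult algebra_simps)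
      ultimately show ?thesis by (simp add: mult.commute)
    qed
    have "((\<lambda>t. exp (- (of_real t * of_real a)) * det (Hp (of_real t * 1))) has_vector_derivative 0) (at t)" for t
    proof -
      have "((\<lambda>t. exp (- (t * of_real a))) has_field_derivative - of_real a * exp (- (of_real t * of_real a))) (at (of_real t :: complex))"
        by (auto intro!: derivative_eq_intros)
      from has_vector_derivative_mult[OF has_vector_derivative_real_field[OF this] der[of 1 t]]
      show ?thesis by (simp add: mult_ac)
    qed
    \<comment> \<open>Comparison of \<open>t = 1\<close> with \<open>t = 0\<close>. As
      \<open>a\<close> is real, \<open>exp (- a) = 1\<close> leaves only
      \<open>a = 0\<close>.\<close>
    from vector_derivative_zero_constant[OF this, of 1 0] have "exp (- of_real a) = (1 :: complex)"
      by (simp add: d1 Hp0)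
    then have "of_real (exp (- a)) = (1 :: complex)" by (simp add: exp_of_real[symmetric])
    then have "exp (- a) = 1" by (metis of_real_eq_1_iff)
    then have "a = 0" by simp
    then have "((\<lambda>t. det (Hp (of_real t * w))) has_vector_derivative 0) (at t)" for t
      using der[of w t] by simp
    from vector_derivative_zero_constant[OF this, of 1 0] show ?thesis by (simp add: Hp0)
  qed
  show ?thesis
    by (rule that[OF hol mult Hp0 conj _ J det]) (simp_all add: Hp1 H_def)
qed

section \<open>Analytic continuation\<close>

lemma holomorphic_on_submanifold_continuous:
  assumes "holomorphic_on_submanifold S F"
  shows "continuous_on S F"
  unfolding continuous_on_eq_continuous_within
proof
  fix p assume p: "p \<in> S"
  then obtain U G G' where U: "open U" "p \<in> U" "\<forall>q\<in>U \<inter> S. G q = F q" and G: "(G has_derivative G') (at p)"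
    using assms unfolding holomorphic_on_submanifold_def by meson
  have "continuous (at p within S) G"
    using has_derivative_continuous[OF G] continuous_at_imp_continuous_at_within by blast
  moreover have "\<forall>\<^sub>F q in at p within S. G q = F q"
    using U eventually_at_topological by fastforce
  moreover have "G p = F p" using U p by blast
  ultimately show "continuous (at p within S) F"
    unfolding continuous_within by (simp add: tendsto_cong)
qed

text \<open>Near each point of the curve \<open>F\<close> may be replaced by its ambient extension
  \<open>G\<close>, to which the chain rule applies.\<close>

lemma holomorphic_on_submanifold_curve:
  fixes Z :: "complex \<Rightarrow> 'm::finite cmat"
  assumes F: "holomorphic_on_submanifold S F" and W: "open W"
    and \<phi>: "\<phi> holomorphic_on W" and Z: "\<And>i j. (\<lambda>w. Z w $ i $ j) holomorphic_on W"
    and in_S: "\<And>w. w \<in> W \<Longrightarrow> (\<phi> w, Z w) \<in> S"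
  shows "(\<lambda>w. F (\<phi> w, Z w)) holomorphic_on W"
proof (rule holomorphic_onI)
  fix w assume w: "w \<in> W"
  let ?p = "(\<phi> w, Z w)" and ?c = "\<lambda>w. (\<phi> w, Z w)"
  have "\<exists>U G. open U \<and> ?p \<in> U \<and> (\<forall>q\<in>U \<inter> S. G q = F q) \<and>
        (\<forall>q\<in>U. \<exists>G'. (G has_derivative G') (at q) \<and> (\<forall>t Z. G' (\<i> * t, cscale \<i> Z) = \<i> * G' (t, Z)))"
    using F[unfolded holomorphic_on_submanifold_def] in_S[OF w] by (rule bspec)
  then obtain U G where U: "open U" "?p \<in> U" "\<forall>q\<in>U \<inter> S. G q = F q"
    and der: "\<forall>q\<in>U. \<exists>G'. (G has_derivative G') (at q) \<and> (\<forall>t Z. G' (\<i> * t, cscale \<i> Z) = \<i> * G' (t, Z))"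
    by (elim exE conjE)
  obtain G' where G: "(G has_derivative G') (at ?p)" and cl: "\<And>t Z. G' (\<i> * t, cscale \<i> Z) = \<i> * G' (t, Z)"
    using der U(2) by blast
  define Z' where "Z' = (\<chi> i j. deriv (\<lambda>w. Z w $ i $ j) w)"
  have d\<phi>: "(\<phi> has_derivative (\<lambda>h. deriv \<phi> w * h)) (at w)"
    using holomorphic_derivI[OF \<phi> W w] by (simp add: has_field_derivative_def)
  have dZ: "(Z has_derivative (\<lambda>h. cscale h Z')) (at w)"
  proof -
    have "((\<lambda>w. Z w $ i $ j) has_derivative (\<lambda>h. cscale h Z' $ i $ j)) (at w)" for i j
    proof -
      have "(\<lambda>h. cscale h Z' $ i $ j) = (*) (deriv (\<lambda>w. Z w $ i $ j) w)"
        by (auto simp: Z'_def mult.commute)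
      then show ?thesis
        using holomorphic_derivI[OF Z W w, of i j] by (simp add: has_field_derivative_def)
    qed
    then show ?thesis
      unfolding has_derivative_def
      by (auto intro!: vec_tendstoI bounded_bilinear.bounded_linear_left[OF bounded_bilinear_cscale])
  qed
  have comp: "((\<lambda>w. G (?c w)) has_derivative (\<lambda>h. G' (deriv \<phi> w * h, cscale h Z'))) (at w)"
    using has_derivative_compose[OF has_derivative_Pair[OF d\<phi> dZ] G] .
  have lin: "linear G'" using has_derivative_linear[OF G] .
  \<comment> \<open>As a Frechet derivative \<open>G'\<close> is real linear; compatibility with
    \<open>\<i>\<close> upgrades this to complex linearity.\<close>
  have "G' (deriv \<phi> w * h, cscale h Z') = G' (deriv \<phi> w, Z') * h" for h
  proof -
    let ?v = "(deriv \<phi> w, Z')"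
    have "(deriv \<phi> w * h, cscale h Z') = Re h *\<^sub>R ?v + Im h *\<^sub>R (\<i> * deriv \<phi> w, cscale \<i> Z')"
    proof -
      have h: "h = of_real (Re h) + of_real (Im h) * \<i>" by (simp add: complex_eq_iff)
      show ?thesis
        by (subst (1 2) h) (simp add: cscale_add_left cscale_of_real[symmetric] scaleR_conv_of_real algebra_simps)
    qed
    then have "G' (deriv \<phi> w * h, cscale h Z') = Re h *\<^sub>R G' ?v + Im h *\<^sub>R (\<i> * G' ?v)"
      by (simp only: linear_add[OF lin] linear_scale[OF lin] cl)
    also have "\<dots> = G' ?v * h"
      by (simp add: complex_eq_iff)
    finally show ?thesis .
  qed
  then have fd: "((\<lambda>w. G (?c w)) has_field_derivative G' (deriv \<phi> w, Z')) (at w)"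
    using comp by (simp add: has_field_derivative_def)
  have cont: "isCont ?c w"
    using has_derivative_continuous[OF has_derivative_Pair[OF d\<phi> dZ]] .
  have "\<forall>\<^sub>F x in at w. ?c x \<in> U"
    by (rule topological_tendstoD[OF cont[unfolded isCont_def] U(1,2)])
  then have "\<forall>\<^sub>F x in nhds w. ?c x \<in> U"
    using U(2) by (simp add: eventually_nhds_conv_at)
  moreover have "\<forall>\<^sub>F x in nhds w. x \<in> W"
    using W w by (rule eventually_nhds_in_open)
  ultimately have "\<forall>\<^sub>F x in nhds w. G (?c x) = F (?c x)"
    by eventually_elim (use U(3) in_S in blast)
  then have "((\<lambda>w. F (?c w)) has_field_derivative G' (deriv \<phi> w, Z')) (at w)"
    using fd DERIV_cong_ev[OF refl _ refl, of "\<lambda>w. G (?c w)" "\<lambda>w. F (?c w)" w] by blast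
  then show "(\<lambda>w. F (?c w)) field_differentiable at w within W"
    using field_differentiable_at_within field_differentiable_def by blast
qed

text \<open>The Cauchy estimate bounds the difference quotients in \<open>w\<close> uniformly in
  \<open>k\<close>, so dominated convergence allows differentiation under the integral.\<close>

lemma (in haar_group) holomorphic_integral:
  fixes G :: "complex \<Rightarrow> 'm cmat \<Rightarrow> complex"
  assumes W: "open W" and cont: "continuous_on (W \<times> K) (\<lambda>(w, k). G w k)"
    and hol: "\<And>k. k \<in> K \<Longrightarrow> (\<lambda>w. G w k) holomorphic_on W"
  shows "(\<lambda>w. LINT k|\<mu>. G w k) holomorphic_on W"
proof (rule holomorphic_onI)
  fix w0 assume w0: "w0 \<in> W"
  obtain e where e: "e > 0" "cball w0 e \<subseteq> W" using W w0 open_contains_cball by blast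
  \<comment> \<open>Half the radius, so that a circle of radius \<open>r\<close> around any point of
    \<open>ball w0 r\<close> stays in \<open>cball w0 e\<close>, where \<open>G\<close> is bounded
    by \<open>C\<close>.\<close>
  define r where "r = e / 2"
  have r: "r > 0" using e by (simp add: r_def)
  have sub0: "ball w0 r \<subseteq> W"
  proof
    fix x assume "x \<in> ball w0 r"
    then have "x \<in> cball w0 e" using e(1) by (simp add: r_def)
    then show "x \<in> W" using e(2) by blast
  qed
  have cG: "continuous_on K (G w)" if "w \<in> W" for w
    by (rule continuous_on_compose2[OF cont, of K "\<lambda>k. (w, k)", simplified]) (use that in \<open>auto intro!: continuous_intros\<close>)
  have "cball w0 e \<times> K \<subseteq> W \<times> K" using e by auto
  from compact_imp_bounded[OF compact_continuous_image[OF continuous_on_subset[OF cont this] compact_Times[OF compact_cball compact_K]]]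
  obtain C where C0: "\<forall>x\<in>(\<lambda>(w, k). G w k) ` (cball w0 e \<times> K). norm x \<le> C"
    unfolding bounded_iff by blast
  have C: "norm (G w k) \<le> C" if "w \<in> cball w0 e" "k \<in> K" for w k
    using bspec[OF C0, of "G w k"] that by force
  have lip: "norm ((G w k - G w0 k) / (w - w0)) \<le> C / r" if w: "w \<in> ball w0 r" "w \<noteq> w0" and k: "k \<in> K" for w k
  proof -
    have "norm (deriv (\<lambda>w. G w k) x) \<le> C / r" if x: "x \<in> ball w0 r" for x
    proof -
      have sub: "cball x r \<subseteq> cball w0 e"
      proof
        fix u assume "u \<in> cball x r"
        then show "u \<in> cball w0 e"
          using x dist_triangle[of w0 u x] by (simp add: r_def)
      qed
      have "norm ((deriv ^^ 1) (\<lambda>w. G w k) x) \<le> fact 1 * C / r ^ 1"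
      proof (rule Cauchy_inequality)
        show "(\<lambda>w. G w k) holomorphic_on ball x r"
          using holomorphic_on_subset[OF hol[OF k]] sub e(2) ball_subset_cball by blast
        show "continuous_on (cball x r) (\<lambda>w. G w k)"
          using holomorphic_on_imp_continuous_on[OF holomorphic_on_subset[OF hol[OF k]]] sub e(2) by blast
        show "norm (G u k) \<le> C" if "norm (x - u) = r" for u
          using C[OF _ k, of u] sub that by (auto simp: dist_norm)
      qed (use r in auto)
      then show ?thesis by simp
    qed
    then have "norm (G w k - G w0 k) \<le> (C / r) * norm (w - w0)"
    proof (intro field_differentiable_bound[of "ball w0 r" "\<lambda>w. G w k" "deriv (\<lambda>w. G w k)"])
      fix x assume x: "x \<in> ball w0 r"
      then have "x \<in> W" using sub0 by blast
      then show "((\<lambda>w. G w k) has_field_derivative deriv (\<lambda>w. G w k) x) (at x within ball w0 r)"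
        using holomorphic_derivI[OF hol[OF k] W] has_field_derivative_at_within by blast
    qed (use w r in auto)
    then show ?thesis using w(2) by (simp add: norm_divide pos_divide_le_eq)
  qed
  define d where "d k = deriv (\<lambda>w. G w k) w0" for k
  have "((\<lambda>w. ((LINT k|\<mu>. G w k) - (LINT k|\<mu>. G w0 k)) / (w - w0)) \<longlongrightarrow> (LINT k|\<mu>. d k)) (at w0 within ball w0 r)"
    unfolding tendsto_at_iff_sequentially
  proof (intro allI impI)
    fix X assume X: "\<forall>i. X i \<in> ball w0 r - {w0}" and lim: "X \<longlonglongrightarrow> w0"
    define q where "q i k = (G (X i) k - G w0 k) / (X i - w0)" for i k
    have XW: "X i \<in> W" for i using X sub0 by blast
    have cq: "continuous_on K (q i)" for i
      unfolding q_def using X by (intro continuous_intros cG XW w0) auto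
    have ptw: "(\<lambda>i. q i k) \<longlonglongrightarrow> d k" if k: "k \<in> K" for k
    proof -
      have "((\<lambda>w. (G w k - G w0 k) / (w - w0)) \<longlongrightarrow> d k) (at w0)"
        using holomorphic_derivI[OF hol[OF k] W w0] by (simp add: has_field_derivative_iff d_def)
      then show ?thesis
        unfolding q_def
        by (rule filterlim_compose) (use X lim in \<open>auto simp: filterlim_at\<close>)
    qed
    have "(\<lambda>i. LINT k|\<mu>. q i k) \<longlonglongrightarrow> (LINT k|\<mu>. d k)"
    proof (rule integral_dominated_convergence[where w = "\<lambda>_. C / r"])
      show "q i \<in> borel_measurable \<mu>" for i by (rule measurable_continuous[OF cq])
      show "d \<in> borel_measurable \<mu>"
        by (rule borel_measurable_LIMSEQ_metric[of q]) (simp_all add: ptw measurable_continuous[OF cq])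
      show "AE k in \<mu>. (\<lambda>i. q i k) \<longlonglongrightarrow> d k" by (rule AE_I2) (simp add: ptw)
      show "AE k in \<mu>. norm (q i k) \<le> C / r" for i
        by (rule AE_I2) (use X in \<open>auto simp: q_def intro!: lip\<close>)
    qed simp
    moreover have "(LINT k|\<mu>. q i k) = ((LINT k|\<mu>. G (X i) k) - (LINT k|\<mu>. G w0 k)) / (X i - w0)" for i
      unfolding q_def by (simp add: integrable_continuous cG XW w0)
    ultimately show "((\<lambda>w. ((LINT k|\<mu>. G w k) - (LINT k|\<mu>. G w0 k)) / (w - w0)) \<circ> X) \<longlonglongrightarrow> (LINT k|\<mu>. d k)"
      by (simp add: o_def)
  qed
  then have "((\<lambda>w. LINT k|\<mu>. G w k) has_field_derivative (LINT k|\<mu>. d k)) (at w0)"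
    using r by (simp add: has_field_derivative_iff at_within_open[of w0 "ball w0 r"])
  then show "(\<lambda>w. LINT k|\<mu>. G w k) field_differentiable at w0 within W"
    using field_differentiable_at_within field_differentiable_def by blast
qed

section \<open>The Segal-Bargmann transform of trace polynomials\<close>

lemma holomorphic_mat_pow:
  fixes Z :: "complex \<Rightarrow> 'm::finite cmat"
  assumes "\<And>i j. (\<lambda>w. Z w $ i $ j) holomorphic_on W"
  shows "(\<lambda>w. mat_pow (Z w) n $ i $ j) holomorphic_on W"
proof (induction n arbitrary: i)
  case (Suc n)
  then show ?case by (simp add: matrix_mult_nth) (intro holomorphic_intros assms)
qed simp

text \<open>\<open>matrix_inv\<close> is a choice and carries no analytic information; the
  holomorphic inverse \<open>Z'\<close> is supplied for the negative powers.\<close>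

lemma holomorphic_trace_eval:
  fixes Z :: "complex \<Rightarrow> 'm::finite cmat"
  assumes Z: "\<And>i j. (\<lambda>w. Z w $ i $ j) holomorphic_on W" and Z': "\<And>i j. (\<lambda>w. Z' w $ i $ j) holomorphic_on W"
    and inv: "\<And>w. Z w ** Z' w = mat 1"
  shows "(\<lambda>w. trace_eval P (Z w) $ i $ j) holomorphic_on W"
proof -
  have "matrix_inv (Z w) = Z' w" for w by (rule matrix_inv_eqI[OF inv])
  then have powi: "(\<lambda>w. mat_powi (Z w) k $ i $ j) holomorphic_on W" for k i j
    using holomorphic_mat_pow[OF Z] holomorphic_mat_pow[OF Z'] by (cases "k \<ge> 0") (simp_all add: mat_powi_def)
  have "(\<lambda>w. ntrace (mat_powi (Z w) k)) holomorphic_on W" for k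
    unfolding ntrace_def trace_def by (intro holomorphic_intros powi) simp
  then have "(\<lambda>w. \<Sum>m\<in>keys P. lookup P m * ((\<Prod>k\<in>keys (snd m). ntrace (mat_powi (Z w) k) ^ lookup (snd m) k) * mat_powi (Z w) (fst m) $ i $ j)) holomorphic_on W"
    by (intro holomorphic_intros powi)
  then show ?thesis by (simp add: trace_eval_superset[of "keys P"] tmono_eval_def mult.assoc)
qed

text \<open>\<open>KC_form\<close> says that \<open>KC\<close> is cut out by invariant forms and the
  determinant, in the shape in which \<open>polar_curve\<close> delivers it: whatever
  \<open>H\<close> preserves, \<open>B\<close> preserves.\<close>

locale segal_group = heat_group K c al cp cm g \<mu> \<rho>
  for K :: "'m::finite cmat set" and c al cp cm g \<mu> \<rho> +
  fixes KC :: "'m cmat set" and \<rho>C :: "complex \<Rightarrow> 'm cmat \<Rightarrow> complex"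
  assumes continuation: "heat_kernel_continuation K KC \<rho> \<rho>C"
    and KC_mult: "A \<in> KC \<Longrightarrow> B \<in> KC \<Longrightarrow> A ** B \<in> KC"
    and KC_invertible: "A \<in> KC \<Longrightarrow> invertible A"
    and KC_conj_transpose: "A \<in> KC \<Longrightarrow> conj_transpose A \<in> KC"
    and K_iff: "A \<in> K \<longleftrightarrow> A \<in> KC \<and> conj_transpose A ** A = mat 1"
    and KC_form: "H \<in> KC \<Longrightarrow> (\<And>J. transpose H ** J ** H = J \<Longrightarrow> transpose B ** J ** B = J) \<Longrightarrow>
      (det H = 1 \<Longrightarrow> det B = 1) \<Longrightarrow> B \<in> KC"
begin

lemma KC_polar:
  assumes z: "z \<in> KC"
  obtains k and Hp :: "complex \<Rightarrow> 'm cmat" where "k \<in> K" "z = k ** Hp (1 / 2)" "\<And>w. Hp w \<in> KC"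
    "\<And>r :: real. Hp (\<i> * of_real r) \<in> K" "\<And>w. Hp w ** Hp (- w) = mat 1"
    "\<And>i j. (\<lambda>w. Hp w $ i $ j) holomorphic_on UNIV"
proof -
  obtain Hp where hol: "\<And>i j. (\<lambda>w. Hp w $ i $ j) holomorphic_on UNIV"
    and mult: "\<And>w w'. Hp w ** Hp w' = Hp (w + w')" and Hp0: "Hp 0 = mat 1" and conj: "\<And>w. conj_transpose (Hp w) = Hp (cnj w)"
    and Hp1: "Hp 1 = conj_transpose z ** z"
    and J: "\<And>J w. transpose (Hp 1) ** J ** Hp 1 = J \<Longrightarrow> transpose (Hp w) ** J ** Hp w = J"
    and det: "\<And>w. det (Hp 1) = 1 \<Longrightarrow> det (Hp w) = 1"
    by (rule polar_curve[OF KC_invertible[OF z]]) blast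
  have H1: "Hp 1 \<in> KC" unfolding Hp1 by (intro KC_mult KC_conj_transpose z)
  have KC: "Hp w \<in> KC" for w
    by (rule KC_form[OF H1 J det])
  \<comment> \<open>The unitary factor of the polar decomposition of \<open>z\<close>.\<close>
  define k where "k = z ** Hp (- (1 / 2))"
  have "conj_transpose k ** k = Hp (- (1 / 2)) ** Hp 1 ** Hp (- (1 / 2))"
    by (simp add: k_def conj Hp1 matrix_mul_assoc)
  also have "\<dots> = mat 1" by (simp add: mult Hp0)
  finally have k: "k \<in> K"
    unfolding K_iff k_def using KC_mult[OF z KC] by simp
  have zk: "z = k ** Hp (1 / 2)"
    by (simp add: k_def matrix_mul_assoc[symmetric] mult Hp0)
  \<comment> \<open>Conjugation reverses an imaginary exponent, so the adjoint is the
    inverse.\<close>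
  have im: "Hp (\<i> * of_real r) \<in> K" for r
    unfolding K_iff using KC by (simp add: conj mult Hp0)
  have inv: "Hp w ** Hp (- w) = mat 1" for w by (simp add: mult Hp0)
  show ?thesis by (rule that[OF k zk KC im inv hol])
qed

text \<open>The iterate and the combination \<open>Q\<close> of the \<open>y \<nu>\<close> agree as
  functions on \<open>K\<close> but may differ as polynomials, so \<open>Dop\<close> cannot be
  applied to the equality. The Laplacian can, since derivatives along \<open>K\<close> depend on
  values on \<open>K\<close> alone, and \<open>laplacian_trace_eval\<close> translates back.\<close>

lemma trace_eval_D_iterate:
  assumes L: "finite (\<Lambda> :: real set)" "\<And>\<nu>. \<nu> \<in> \<Lambda> \<Longrightarrow> y \<nu> \<in> trace_polys"
    and eig: "\<And>\<nu> A. \<nu> \<in> \<Lambda> \<Longrightarrow> A \<in> K \<Longrightarrow> trace_eval (Dop (y \<nu>)) A = cscale \<nu> (trace_eval (y \<nu>) A)"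
    and sum: "\<And>A. A \<in> K \<Longrightarrow> trace_eval P A = (\<Sum>\<nu>\<in>\<Lambda>. trace_eval (y \<nu>) A)"
    and P: "P \<in> trace_polys" and A: "A \<in> K"
  shows "trace_eval ((Dop ^^ n) P) A = (\<Sum>\<nu>\<in>\<Lambda>. cscale (of_real \<nu> ^ n) (trace_eval (y \<nu>) A))"
  using A
proof (induction n arbitrary: A)
  case 0
  then show ?case by (simp add: sum)
next
  case (Suc n)
  interpret S: semi_inner "\<lambda>z P. const z * (P :: trace_poly)" form Dop trace_polys
    by (rule semi_inner_form)
  define Q where "Q = (\<Sum>\<nu>\<in>\<Lambda>. const (of_real \<nu> ^ n) * y \<nu>)"
  have Q: "Q \<in> trace_polys"
    unfolding Q_def by (intro S.subspace_sum S.subspace_scale S.subspace_V L)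
  have Pn: "(Dop ^^ n) P \<in> trace_polys"
    by (induction n) (auto intro: P S.T_V)
  have eq: "trace_eval ((Dop ^^ n) P) A = trace_eval Q A" if "A \<in> K" for A
    using Suc.IH[OF that] by (simp add: Q_def trace_eval_sum trace_eval_const_mult)
  have "trace_eval (Dop ((Dop ^^ n) P)) A = trace_eval (Dop Q) A"
  proof (rule matrix_eqI)
    fix i j
    have reg: "regular (\<lambda>A. trace_eval P A $ i $ j)" for P by (rule regular_trace_eval)
    have "laplacian c K (\<lambda>A. trace_eval ((Dop ^^ n) P) A $ i $ j) A = laplacian c K (\<lambda>A. trace_eval Q A $ i $ j) A"
      unfolding laplacian_def Ba_def[symmetric]
    proof (intro sum.cong refl)
      fix X assume "X \<in> Ba"
      note X = Ba_lie[OF this]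
      have 1: "deriv_along X (\<lambda>A. trace_eval ((Dop ^^ n) P) A $ i $ j) (lie_deriv X (\<lambda>A. trace_eval Q A $ i $ j))"
        by (rule deriv_along_cong[OF regular_lie_deriv(2)[OF reg X, of Q]]) (simp_all add: eq)
      show "lie_deriv X (lie_deriv X (\<lambda>A. trace_eval ((Dop ^^ n) P) A $ i $ j)) A = lie_deriv X (lie_deriv X (\<lambda>A. trace_eval Q A $ i $ j)) A"
        by (rule lie_deriv_lie_deriv_eq[OF 1 regular_lie_deriv(2)[OF regular_lie_deriv(1)[OF reg X] X] Suc.prems])
    qed
    then show "trace_eval (Dop ((Dop ^^ n) P)) A $ i $ j = trace_eval (Dop Q) A $ i $ j"
      by (simp add: laplacian_trace_eval Pn Q Suc.prems)
  qed
  also have "\<dots> = (\<Sum>\<nu>\<in>\<Lambda>. cscale (of_real \<nu> ^ Suc n) (trace_eval (y \<nu>) A))"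
    unfolding Q_def linear_op_sum[OF linear_op_D_gen] linear_op_const[OF linear_op_D_gen] trace_eval_sum trace_eval_const_mult
    by (intro sum.cong refl) (simp add: eig Suc.prems mult.commute)
  finally show ?case by simp
qed

lemma trace_eval_exp_op:
  assumes L: "finite (\<Lambda> :: real set)" "\<And>\<nu>. \<nu> \<in> \<Lambda> \<Longrightarrow> y \<nu> \<in> trace_polys"
    and eig: "\<And>\<nu> A. \<nu> \<in> \<Lambda> \<Longrightarrow> A \<in> K \<Longrightarrow> trace_eval (Dop (y \<nu>)) A = cscale \<nu> (trace_eval (y \<nu>) A)"
    and sum: "\<And>A. A \<in> K \<Longrightarrow> trace_eval P A = (\<Sum>\<nu>\<in>\<Lambda>. trace_eval (y \<nu>) A)"
    and P: "P \<in> trace_polys" and A: "A \<in> K"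
  shows "trace_eval (exp_op z Dop P) A $ i $ j = (\<Sum>\<nu>\<in>\<Lambda>. exp (z * of_real \<nu>) * trace_eval (y \<nu>) A $ i $ j)"
proof -
  obtain n where n: "P \<in> polys_upto n" using trace_polys_upto_exists[OF P] by blast
  have 1: "(\<lambda>k. z ^ k / fact k * trace_eval ((Dop ^^ k) P) A $ i $ j) sums (trace_eval (exp_op z Dop P) A $ i $ j)"
    by (rule exp_op_sums[OF linear_op_D_gen D_gen_polys_upto n])
  have "(\<lambda>k. \<Sum>\<nu>\<in>\<Lambda>. (z * of_real \<nu>) ^ k /\<^sub>R fact k * trace_eval (y \<nu>) A $ i $ j) sums (\<Sum>\<nu>\<in>\<Lambda>. exp (z * of_real \<nu>) * trace_eval (y \<nu>) A $ i $ j)"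
    by (intro sums_sum sums_mult2 exp_converges)
  moreover have "(\<Sum>\<nu>\<in>\<Lambda>. (z * of_real \<nu>) ^ k /\<^sub>R fact k * trace_eval (y \<nu>) A $ i $ j) = z ^ k / fact k * trace_eval ((Dop ^^ k) P) A $ i $ j" for k
  proof -
    have "trace_eval ((Dop ^^ k) P) A = (\<Sum>\<nu>\<in>\<Lambda>. cscale (of_real \<nu> ^ k) (trace_eval (y \<nu>) A))"
      by (rule trace_eval_D_iterate[where \<Lambda> = \<Lambda> and y = y]) (fact L eig sum P A)+
    then show ?thesis
    unfolding sum_component sum_distrib_left
    by (simp only: sum_component sum_distrib_left) (intro sum.cong refl, simp add: power_mult_distrib scaleR_conv_of_real divide_inverse mult_ac)
  qed
  ultimately show ?thesis using 1 by (simp add: sums_iff)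
qed

lemma segal_bargmann_trace_eval:
  assumes P: "P \<in> trace_polys" and \<tau>: "Re \<tau> > 0" and z: "z \<in> KC"
  shows "(LINT k|\<mu>. \<rho>C \<tau> (z ** conj_transpose k) * trace_eval P k $ i $ j) = trace_eval (exp_op (\<tau> / 2) Dop P) z $ i $ j"
proof -
  define S where "S = {\<tau>. Re \<tau> > 0} \<times> KC"
  have hol: "holomorphic_on_submanifold S (\<lambda>(\<tau>, z). \<rho>C \<tau> z)" and real: "\<And>s x. s > 0 \<Longrightarrow> x \<in> K \<Longrightarrow> \<rho>C (of_real s) x = of_real (\<rho> s x)"
    using continuation unfolding heat_kernel_continuation_def S_def by blast+
  note contS = holomorphic_on_submanifold_continuous[OF hol]
  have KKC: "x \<in> K \<Longrightarrow> x \<in> KC" for x by (simp add: K_iff)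
  have cP: "continuous_on K (\<lambda>k. trace_eval P k $ i $ j)"
    by (intro regular_continuous regular_trace_eval)
  have opn: "open {\<tau>. Re \<tau> > 0}" by (rule open_halfspace_Re_gt)
  obtain \<Lambda> y where L: "finite (\<Lambda> :: real set)" "\<And>\<nu>. \<nu> \<in> \<Lambda> \<Longrightarrow> y \<nu> \<in> trace_polys"
    "\<And>\<nu> A. \<nu> \<in> \<Lambda> \<Longrightarrow> A \<in> K \<Longrightarrow> trace_eval (Dop (y \<nu>)) A = cscale \<nu> (trace_eval (y \<nu>) A)"
    "\<And>A. A \<in> K \<Longrightarrow> trace_eval P A = (\<Sum>\<nu>\<in>\<Lambda>. trace_eval (y \<nu>) A)"
    using eigen_decomposition[OF P] by metis
  define \<Phi> where "\<Phi> \<tau> z = (LINT k|\<mu>. \<rho>C \<tau> (z ** conj_transpose k) * trace_eval P k $ i $ j)" for \<tau> z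
  \<comment> \<open>Used twice: with \<open>\<phi>\<close> the identity and \<open>Z\<close>
    constant for the continuation in \<open>\<tau>\<close>, and with \<open>\<phi>\<close> constant
    for the continuation along a curve in \<open>KC\<close>.\<close>
  have holG: "(\<lambda>w. \<Phi> (\<phi> w) (Z w)) holomorphic_on W"
    if W: "open W" and \<phi>: "\<phi> holomorphic_on W" and Z: "\<And>i j. (\<lambda>w. Z w $ i $ j) holomorphic_on W"
      and inS: "\<And>w. w \<in> W \<Longrightarrow> Re (\<phi> w) > 0 \<and> Z w \<in> KC" for W \<phi> Z
    unfolding \<Phi>_def
  proof (rule holomorphic_integral[OF W])
    have cZ: "continuous_on W Z"
    proof -
      have "continuous_on W (\<lambda>w. \<chi> i j. Z w $ i $ j)"
        by (intro continuous_on_vec_lambda holomorphic_on_imp_continuous_on Z)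
      then show ?thesis by simp
    qed
    have cZ2: "continuous_on (W \<times> K) (\<lambda>p. (\<phi> (fst p), Z (fst p) ** conj_transpose (snd p)))"
      by (intro continuous_intros continuous_on_compose2[OF cZ] continuous_on_compose2[OF holomorphic_on_imp_continuous_on[OF \<phi>]]) auto
    have "continuous_on (W \<times> K) (\<lambda>p. (\<lambda>(\<tau>, z). \<rho>C \<tau> z) (\<phi> (fst p), Z (fst p) ** conj_transpose (snd p)))"
      by (rule continuous_on_compose2[OF contS cZ2]) (use inS inv_in KKC KC_mult in \<open>auto simp: S_def\<close>)
    moreover have "continuous_on (W \<times> K) (\<lambda>p. trace_eval P (snd p) $ i $ j)"
      by (rule continuous_on_compose2[OF cP]) (auto intro!: continuous_intros)
    ultimately have "continuous_on (W \<times> K) (\<lambda>p. \<rho>C (\<phi> (fst p)) (Z (fst p) ** conj_transpose (snd p)) * trace_eval P (snd p) $ i $ j)"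
      using continuous_on_mult by fastforce
    then show "continuous_on (W \<times> K) (\<lambda>(w, k). \<rho>C (\<phi> w) (Z w ** conj_transpose k) * trace_eval P k $ i $ j)"
      by (simp add: case_prod_beta)
    fix k assume k: "k \<in> K"
    have "(\<lambda>w. (\<lambda>(\<tau>, z). \<rho>C \<tau> z) (\<phi> w, Z w ** conj_transpose k)) holomorphic_on W"
    proof (rule holomorphic_on_submanifold_curve[OF hol W \<phi>])
      show "(\<lambda>w. (Z w ** conj_transpose k) $ i $ j) holomorphic_on W" for i j
        unfolding matrix_mult_nth by (intro holomorphic_intros Z)
      show "(\<phi> w, Z w ** conj_transpose k) \<in> S" if "w \<in> W" for w
        using inS[OF that] KC_mult[OF _ KKC[OF inv_in[OF k]]] by (simp add: S_def)
    qed
    then show "(\<lambda>w. \<rho>C (\<phi> w) (Z w ** conj_transpose k) * trace_eval P k $ i $ j) holomorphic_on W"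
      by (intro holomorphic_on_mult holomorphic_on_const) simp
  qed
  have real_eq: "\<Phi> (of_real s) x = (\<Sum>\<nu>\<in>\<Lambda>. exp (of_real s / 2 * of_real \<nu>) * trace_eval (y \<nu>) x $ i $ j)"
    if s: "s > 0" and x: "x \<in> K" for s x
  proof -
    have "\<Phi> (of_real s) x = (LINT k|\<mu>. (\<Sum>\<nu>\<in>\<Lambda>. \<rho> s (x ** conj_transpose k) * trace_eval (y \<nu>) k $ i $ j))"
      unfolding \<Phi>_def
    proof (rule Bochner_Integration.integral_cong[OF refl])
      fix k assume "k \<in> space \<mu>"
      then have k: "k \<in> K" by simp
      show "\<rho>C (of_real s) (x ** conj_transpose k) * trace_eval P k $ i $ j = (\<Sum>\<nu>\<in>\<Lambda>. \<rho> s (x ** conj_transpose k) * trace_eval (y \<nu>) k $ i $ j)"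
        using real[OF s mult_in[OF x inv_in[OF k]]] L(4)[OF k] by (simp add: sum_distrib_left)
    qed
    also have "\<dots> = (\<Sum>\<nu>\<in>\<Lambda>. (LINT k|\<mu>. \<rho> s (x ** conj_transpose k) * trace_eval (y \<nu>) k $ i $ j))"
    proof (rule Bochner_Integration.integral_sum)
      fix \<nu>
      have "continuous_on K (\<lambda>k. \<rho> s (x ** conj_transpose k))"
        by (rule continuous_on_compose2[OF continuous_rho[OF s]]) (auto intro!: continuous_intros mult_in inv_in x)
      then show "integrable \<mu> (\<lambda>k. \<rho> s (x ** conj_transpose k) * trace_eval (y \<nu>) k $ i $ j)"
        by (intro integrable_continuous continuous_on_mult continuous_on_of_real regular_continuous regular_trace_eval)
    qed
    also have "\<dots> = (\<Sum>\<nu>\<in>\<Lambda>. of_real (exp (s * \<nu> / 2)) * trace_eval (y \<nu>) x $ i $ j)"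
      by (intro sum.cong refl, rule heat_kernel_eigen[OF L(2) _ s x]) (simp_all add: L(3))
    finally show ?thesis by (simp add: exp_of_real[symmetric])
  qed
  have K_eq: "\<Phi> \<tau> x = trace_eval (exp_op (\<tau> / 2) Dop P) x $ i $ j" if x: "x \<in> K" for x
  proof -
    have ex: "trace_eval (exp_op (\<tau> / 2) Dop P) x $ i $ j = (\<Sum>\<nu>\<in>\<Lambda>. exp (\<tau> / 2 * of_real \<nu>) * trace_eval (y \<nu>) x $ i $ j)"
      by (rule trace_eval_exp_op[where \<Lambda> = \<Lambda> and y = y]) (fact L P x)+
    let ?d = "\<lambda>t. \<Phi> t x - (\<Sum>\<nu>\<in>\<Lambda>. exp (t / 2 * of_real \<nu>) * trace_eval (y \<nu>) x $ i $ j)"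
    have "(\<lambda>t. \<Phi> t x) holomorphic_on {\<tau>. Re \<tau> > 0}"
      by (rule holG[of _ "\<lambda>w. w" "\<lambda>_. x", OF opn holomorphic_on_ident holomorphic_on_const])
         (simp add: KKC[OF x])
    then have h: "?d holomorphic_on {\<tau>. Re \<tau> > 0}"
      by (intro holomorphic_intros) auto
    \<comment> \<open>\<open>?d\<close> vanishes for positive real arguments by
      \<open>real_eq\<close>; these accumulate at \<open>1\<close> inside the connected
      half-plane.\<close>
    have "?d \<tau> = 0"
    proof (rule analytic_continuation[OF h opn, of "of_real ` {0<..}" 1])
      show "connected {\<tau>. 0 < Re \<tau>}" by (intro convex_connected convex_halfspace_Re_gt)
      show "(1 :: complex) islimpt of_real ` {0<..}"
        unfolding islimpt_sequential
      proof (intro exI[of _ "\<lambda>n. of_real (1 + inverse (real (Suc n)))"] conjI allI)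
        have "(\<lambda>n. 1 + inverse (real (Suc n))) \<longlonglongrightarrow> 1 + 0"
          by (intro tendsto_add tendsto_const LIMSEQ_inverse_real_of_nat)
        from tendsto_of_real[OF this] show "(\<lambda>n. of_real (1 + inverse (real (Suc n)))) \<longlonglongrightarrow> (1 :: complex)"
          by (simp only: add_0_right of_real_1)
        fix n
        have pos: "inverse (real (Suc n)) > 0" by simp
        then have neq: "of_real (1 + inverse (real (Suc n))) \<noteq> (of_real 1 :: complex)"
          unfolding of_real_eq_iff by linarith
        show "of_real (1 + inverse (real (Suc n))) \<in> complex_of_real ` {0<..} - {1}"
          unfolding Diff_iff singleton_iff
        proof (intro conjI imageI)
          show "1 + inverse (real (Suc n)) \<in> {0<..}"
            unfolding greaterThan_iff using pos by (rule add_pos_pos[OF zero_less_one])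
        qed (use neq in \<open>simp only: of_real_1 not_False_eq_True\<close>)
      qed
    qed (use \<tau> real_eq[OF _ x] in auto)
    then show ?thesis
      using ex by simp
  qed
  obtain k and Hp :: "complex \<Rightarrow> 'm cmat" where k: "k \<in> K" and zk: "z = k ** Hp (1 / 2)" and HKC: "\<And>w. Hp w \<in> KC"
    and HK: "\<And>r :: real. Hp (\<i> * of_real r) \<in> K" and Hinv: "\<And>w. Hp w ** Hp (- w) = mat 1"
    and Hhol: "\<And>i j. (\<lambda>w. Hp w $ i $ j) holomorphic_on UNIV"
    by (rule KC_polar[OF z]) blast
  let ?E = "exp_op (\<tau> / 2) Dop P"
  \<comment> \<open>The comparison is now with the trace polynomial \<open>?E\<close> itself,
    because the decomposition into eigenfunctions is known on \<open>K\<close> only.\<close>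
  let ?d = "\<lambda>w. \<Phi> \<tau> (k ** Hp w) - trace_eval ?E (k ** Hp w) $ i $ j"
  have hZ: "(\<lambda>w. (k ** Hp w) $ i $ j) holomorphic_on UNIV" for i j
    unfolding matrix_mult_nth by (intro holomorphic_intros Hhol)
  have hneg: "(\<lambda>w. Hp (- w) $ i $ j) holomorphic_on UNIV" for i j
  proof -
    have "((\<lambda>w. Hp w $ i $ j) \<circ> uminus) holomorphic_on UNIV"
      by (rule holomorphic_on_compose_gen[OF _ Hhol]) (auto intro!: holomorphic_intros)
    then show ?thesis by (simp add: o_def)
  qed
  have hZ': "(\<lambda>w. (Hp (- w) ** conj_transpose k) $ i $ j) holomorphic_on UNIV" for i j
    unfolding matrix_mult_nth by (intro holomorphic_intros hneg)
  have inv: "k ** Hp w ** (Hp (- w) ** conj_transpose k) = mat 1" for w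
  proof -
    have "k ** Hp w ** (Hp (- w) ** conj_transpose k) = k ** (Hp w ** Hp (- w)) ** conj_transpose k"
      by (simp only: matrix_mul_assoc)
    then show ?thesis by (simp add: Hinv unitary'[OF k])
  qed
  have "(\<lambda>w. \<Phi> \<tau> (k ** Hp w)) holomorphic_on UNIV"
    by (rule holG[of _ "\<lambda>_. \<tau>" "\<lambda>w. k ** Hp w", OF open_UNIV holomorphic_on_const hZ])
       (simp add: \<tau> KC_mult[OF KKC[OF k] HKC])
  then have h: "?d holomorphic_on UNIV"
    by (intro holomorphic_on_diff holomorphic_trace_eval[OF hZ hZ' inv])
  \<comment> \<open>At \<open>w = 1 / 2\<close> the curve reaches \<open>z\<close>; on the imaginary
    axis, which accumulates at \<open>0\<close>, it stays in \<open>K\<close>, where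
    \<open>K_eq\<close> holds.\<close>
  have "?d (1 / 2) = 0"
  proof (rule analytic_continuation[OF h open_UNIV connected_UNIV, of "(\<lambda>r. \<i> * of_real r) ` UNIV" 0])
    show "0 islimpt (\<lambda>r. \<i> * complex_of_real r) ` UNIV"
      unfolding islimpt_sequential
    proof (intro exI[of _ "\<lambda>n. \<i> * of_real (inverse (real (Suc n)))"] conjI allI)
      have "(\<lambda>n. \<i> * of_real (inverse (real (Suc n)))) \<longlonglongrightarrow> \<i> * of_real 0"
        by (intro tendsto_mult tendsto_const tendsto_of_real LIMSEQ_inverse_real_of_nat)
      then show "(\<lambda>n. \<i> * of_real (inverse (real (Suc n)))) \<longlonglongrightarrow> 0"
        by (simp only: of_real_0 mult_zero_right)
      show "\<i> * of_real (inverse (real (Suc n))) \<in> (\<lambda>r. \<i> * complex_of_real r) ` UNIV - {0}" for n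
        unfolding Diff_iff singleton_iff
        by (intro conjI image_eqI[OF refl] UNIV_I) (simp del: of_nat_Suc of_real_inverse)
    qed
    show "?d w = 0" if "w \<in> (\<lambda>r. \<i> * of_real r) ` UNIV" for w
      using that K_eq[OF mult_in[OF k HK]] by auto
  qed auto
  then show ?thesis by (simp add: \<Phi>_def zk)
qed

theorem boosted_segal_bargmann_trace_eval:
  assumes P: "P \<in> trace_polys" and s: "s > 0" and \<tau>: "norm (\<tau> - of_real s) < s" and A: "A \<in> KC"
  shows "boosted_segal_bargmann \<mu> \<rho> \<rho>C s \<tau> (trace_eval P) A = trace_eval (exp_op (\<tau> / 2) Dop P) A"
proof (rule matrix_eqI)
  fix i j
  \<comment> \<open>The open disc of radius \<open>s\<close> about \<open>s\<close> lies in the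
    right half-plane.\<close>
  have "\<bar>Re (\<tau> - of_real s)\<bar> < s" using abs_Re_le_cmod \<tau> by (rule le_less_trans)
  then have Re: "Re \<tau> > 0" by simp
  have L2: "L2 \<mu> (\<rho> s) (\<lambda>k. trace_eval P k $ i $ j)"
    by (intro L2_continuous regular_continuous regular_trace_eval continuous_rho s)
  have "(LINT k|\<mu>. \<rho>C \<tau> (A ** matrix_inv k) * trace_eval P k $ i $ j) = (LINT k|\<mu>. \<rho>C \<tau> (A ** conj_transpose k) * trace_eval P k $ i $ j)"
    by (rule Bochner_Integration.integral_cong[OF refl]) (simp add: matrix_inv_unitary unitary)
  then show "boosted_segal_bargmann \<mu> \<rho> \<rho>C s \<tau> (trace_eval P) A $ i $ j = trace_eval (exp_op (\<tau> / 2) Dop P) A $ i $ j"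
    using L2 by (simp add: boosted_segal_bargmann_def segal_bargmann_def segal_bargmann_trace_eval[OF P Re A])
qed

end

section \<open>The classical groups\<close>

text \<open>With \<open>f\<close> the transpose or the symplectic adjoint, this turns the adjoint
  terms of the Casimir formulas into the inverse powers required by
  \<open>laplace_group\<close>.\<close>

lemma mat_powi_anti:
  fixes f :: "'m::finite cmat \<Rightarrow> 'm cmat"
  assumes f_mult: "\<And>A B. f (A ** B) = f B ** f A" and f_1: "f (mat 1) = mat 1"
    and inv: "f A ** A = mat 1" and ff: "f (f A) = A"
  shows "f (mat_powi A k) = mat_powi A (- k)"
proof -
  have pow: "f (mat_pow B n) = mat_pow (f B) n" for B n
    by (induction n) (simp_all add: f_1 f_mult mat_pow_Suc2[symmetric])
  have "A ** f A = mat 1"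
    using inv matrix_left_right_inverse by blast
  then have "matrix_inv A = f A" by (rule matrix_inv_eqI)
  then show ?thesis
    by (auto simp: mat_powi_def pow ff f_1)
qed

lemma anti_unit_mult:
  fixes f :: "'m::finite cmat \<Rightarrow> 'm cmat"
  assumes f_mult: "\<And>A B. f (A ** B) = f B ** f A" and A: "f A ** A = mat 1" and B: "f B ** B = mat 1"
  shows "f (A ** B) ** (A ** B) = mat 1"
proof -
  have "f (A ** B) ** (A ** B) = f B ** (f A ** A) ** B"
    by (simp only: f_mult matrix_mul_assoc)
  then show ?thesis by (simp add: A B)
qed

lemma anti_unit_conj_transpose:
  fixes f :: "'m::finite cmat \<Rightarrow> 'm cmat"
  assumes "f (conj_transpose A) = conj_transpose (f A)" and "f A ** A = mat 1"
  shows "f (conj_transpose A) ** conj_transpose A = mat 1"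
proof -
  have "A ** f A = mat 1"
    using assms(2) matrix_left_right_inverse by blast
  then have "conj_transpose (A ** f A) = mat 1" by simp
  then show ?thesis by (simp add: assms(1))
qed

lemma closed_anti_unit:
  fixes f :: "'m::finite cmat \<Rightarrow> 'm cmat"
  assumes "bounded_linear f"
  shows "closed {A. f A ** A = mat 1}"
  by (intro closed_Collect_eq bounded_bilinear.continuous_on[OF bounded_bilinear_matrix_mult]
      bounded_linear.continuous_on[OF assms] continuous_on_id continuous_on_const)

lemma closed_det_1: "closed {A :: 'm::finite cmat. det A = 1}"
  unfolding det_def by (intro closed_Collect_eq continuous_intros)

lemma det_conj_transpose: "det (conj_transpose A) = cnj (det A)"
proof -
  have "conj_transpose A = transpose (\<chi> i j. cnj (A $ i $ j))"
    by (simp add: vec_eq_iff transpose_def)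
  then have "det (conj_transpose A) = det (\<chi> i j. cnj (A $ i $ j))"
    by (simp only: det_transpose)
  then show ?thesis by (simp add: det_def)
qed

lemma symplectic_adjoint_1: "symplectic_adjoint (mat 1) = mat 1"
  by (simp add: symplectic_adjoint_def Omega_simps transpose_mat)

lemma bounded_linear_symplectic_adjoint:
  "bounded_linear (symplectic_adjoint :: ('n::finite \<times> bool) cmat \<Rightarrow> _)"
  by (intro linear_conv_bounded_linear[THEN iffD1] linearI)
     (simp_all add: symplectic_adjoint_simps cscale_of_real[symmetric])

lemma preserves_Omega_iff: "transpose A ** Omega ** A = Omega \<longleftrightarrow> symplectic_adjoint A ** A = mat 1"
proof -
  have eq: "symplectic_adjoint A ** A = - (Omega ** (transpose A ** Omega ** A))"
    by (simp add: symplectic_adjoint_def matrix_mul_assoc)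
  have OO: "Omega ** (Omega ** B) = - B" for B :: "('n::finite \<times> bool) cmat"
    by (simp add: matrix_mul_assoc Omega_simps)
  show ?thesis
  proof
    assume "transpose A ** Omega ** A = Omega"
    then show "symplectic_adjoint A ** A = mat 1"
      by (simp only: eq Omega_simps minus_minus)
  next
    assume "symplectic_adjoint A ** A = mat 1"
    then have "- Omega ** (Omega ** (transpose A ** Omega ** A)) = Omega"
      unfolding eq by (metis matrix_mul_rid matrix_mult_minus)
    then show "transpose A ** Omega ** A = Omega"
      by (simp only: matrix_mult_minus(1) OO minus_minus)
  qed
qed

lemma Sp_complex_altdef: "Sp_complex = {A. symplectic_adjoint A ** A = mat 1}"
  by (simp add: Sp_complex_def preserves_Omega_iff)

lemma Sp_compact_altdef: "Sp_compact = {A. symplectic_adjoint A ** A = mat 1} \<inter> {A. conj_transpose A ** A = mat 1}"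
  by (auto simp: Sp_compact_def preserves_Omega_iff)

lemma pairing_casimir:
  fixes M :: "'m::finite cmat"
  shows "(\<Sum>X\<in>B. cscale (ntrace (M ** X)) X) = cscale (1 / of_nat CARD('m)) (\<Sum>X\<in>B. cscale (trace (M ** X)) X)"
  by (simp add: cscale_sum_right ntrace_def)

text \<open>\<open>al = 1 / N\<close> is read off from \<open>SO_sandwich\<close>; in
  \<open>pairing\<close> the factor \<open>1 / N\<close> of \<open>SO_casimir\<close> meets a second
  one from the normalized trace, which gives \<open>cp = cm = 1 / N\<^sup>2\<close>.\<close>

lemma laplace_group_SO:
  "laplace_group (SO_real :: 'n::finite cmat set) (real CARD('n) / 2) (1 / real CARD('n))
     (1 / (real CARD('n))\<^sup>2) (1 / (real CARD('n))\<^sup>2) 0"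
proof -
  have "subspace (lie_algebra (SO_real :: 'n cmat set))"
    unfolding lie_algebra_SO_real by (auto simp: subspace_def transpose_simps conj_transpose_add
        linear_0[OF bounded_linear.linear[OF bounded_linear_transpose]])
  then have basis: "orthonormal_lie_basis (real CARD('n) / 2) (SO_real :: 'n cmat set) (SOME B. orthonormal_lie_basis (real CARD('n) / 2) SO_real B)"
    by (rule orthonormal_lie_basis_exists) (simp_all add: lie_algebra_SO_real)
  have SO: "(SO_real :: 'n cmat set) = {A. transpose A ** A = mat 1} \<inter> {A. conj_transpose A ** A = mat 1} \<inter> {A. det A = 1}"
    by (auto simp: SO_real_altdef)
  have powi: "transpose (mat_powi A k) = mat_powi A (- k)" if "A \<in> SO_real" for A :: "'n cmat" and k
    using that by (intro mat_powi_anti) (simp_all add: SO matrix_transpose_mul)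
  show ?thesis
  proof
    show "mat 1 \<in> (SO_real :: 'n cmat set)" by (simp add: SO transpose_mat)
    show "closed (SO_real :: 'n cmat set)"
      unfolding SO by (intro closed_Int closed_anti_unit closed_det_1 bounded_linear_transpose bounded_linear_conj_transpose)
    fix A :: "'n cmat" assume A: "A \<in> SO_real"
    then show "conj_transpose A ** A = mat 1" by (simp add: SO)
    show "conj_transpose A \<in> SO_real"
      using A anti_unit_conj_transpose[of transpose A] anti_unit_conj_transpose[of conj_transpose A]
      by (simp add: SO det_conj_transpose transpose_simps)
    show "A ** B \<in> SO_real" if "B \<in> SO_real" for B
      using A that anti_unit_mult[of transpose A B] anti_unit_mult[of conj_transpose A B]
      by (simp add: SO det_mul matrix_transpose_mul)
    show "(\<Sum>X\<in>(SOME B. orthonormal_lie_basis (real CARD('n) / 2) SO_real B). X ** mat_powi A k ** X)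
        = cscale (- ntrace (mat_powi A k)) (mat 1) + cscale (of_real (1 / real CARD('n))) (mat_powi A (- k)) + cscale (of_real 0) (mat_powi A k)" for k
      by (simp add: SO_sandwich[OF basis] powi[OF A])
    show "(\<Sum>X\<in>(SOME B. orthonormal_lie_basis (real CARD('n) / 2) SO_real B). cscale (ntrace (mat_powi A k ** X)) X)
        = cscale (of_real (1 / (real CARD('n))\<^sup>2)) (mat_powi A (- k)) - cscale (of_real (1 / (real CARD('n))\<^sup>2)) (mat_powi A k)
          + cscale (of_real 0 * ntrace (mat_powi A k)) (mat 1)" for k
      by (simp add: pairing_casimir SO_casimir[OF basis] powi[OF A] cscale_diff_right cscale_minus_left power2_eq_square)
  qed (fact basis)
qed

text \<open>The Casimir formulas contain no adjoint term, so \<open>al = cp = 0\<close>; removing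
  the trace contributes \<open>g\<close>, which equals \<open>cm\<close>.\<close>

lemma laplace_group_SU:
  "laplace_group (SU :: 'n::finite cmat set) (real CARD('n)) 0
     0 (1 / (real CARD('n))\<^sup>2) (1 / (real CARD('n))\<^sup>2)"
proof -
  have "subspace (lie_algebra (SU :: 'n cmat set))"
    unfolding lie_algebra_SU
    by (auto simp: subspace_def conj_transpose_add trace_add trace_0[unfolded mat_0] cscale_of_real[symmetric] trace_cscale cscale_minus_right)
  then have basis: "orthonormal_lie_basis (real CARD('n)) (SU :: 'n cmat set) (SOME B. orthonormal_lie_basis (real CARD('n)) SU B)"
    by (rule orthonormal_lie_basis_exists) (simp_all add: lie_algebra_SU)
  have SU: "(SU :: 'n cmat set) = {A. conj_transpose A ** A = mat 1} \<inter> {A. det A = 1}"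
    by (auto simp: SU_def)
  show ?thesis
  proof
    show "mat 1 \<in> (SU :: 'n cmat set)" by (simp add: SU)
    show "closed (SU :: 'n cmat set)"
      unfolding SU by (intro closed_Int closed_anti_unit closed_det_1 bounded_linear_conj_transpose)
    fix A :: "'n cmat" assume A: "A \<in> SU"
    then show "conj_transpose A ** A = mat 1" by (simp add: SU)
    show "conj_transpose A \<in> SU"
      using A anti_unit_conj_transpose[of conj_transpose A] by (auto simp: SU det_conj_transpose)
    show "A ** B \<in> SU" if "B \<in> SU" for B
      using A that anti_unit_mult[of conj_transpose A B] by (auto simp: SU det_mul)
    show "(\<Sum>X\<in>(SOME B. orthonormal_lie_basis (real CARD('n)) SU B). X ** mat_powi A k ** X)
        = cscale (- ntrace (mat_powi A k)) (mat 1) + cscale (of_real 0) (mat_powi A (- k)) + cscale (of_real (1 / (real CARD('n))\<^sup>2)) (mat_powi A k)" for k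
      by (simp add: SU_sandwich[OF basis])
    show "(\<Sum>X\<in>(SOME B. orthonormal_lie_basis (real CARD('n)) SU B). cscale (ntrace (mat_powi A k ** X)) X)
        = cscale (of_real 0) (mat_powi A (- k)) - cscale (of_real (1 / (real CARD('n))\<^sup>2)) (mat_powi A k)
          + cscale (of_real (1 / (real CARD('n))\<^sup>2) * ntrace (mat_powi A k)) (mat 1)" for k
      by (simp add: pairing_casimir SU_casimir[OF basis] cscale_diff_right cscale_minus_left power2_eq_square)
  qed (fact basis)
qed

text \<open>The matrix size \<open>2 * N\<close> replaces \<open>N\<close>, and the antisymmetry of
  \<open>Omega\<close> reverses the sign of \<open>al\<close>.\<close>

lemma laplace_group_Sp:
  "laplace_group (Sp_compact :: ('n::finite \<times> bool) cmat set) (real CARD('n)) (- 1 / (2 * real CARD('n)))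
     (1 / (2 * real CARD('n))\<^sup>2) (1 / (2 * real CARD('n))\<^sup>2) 0"
proof -
  have "subspace (lie_algebra (Sp_compact :: ('n \<times> bool) cmat set))"
    unfolding lie_algebra_Sp_compact symplectic_adjoint_eq_iff[symmetric]
    by (auto simp: subspace_def symplectic_adjoint_simps conj_transpose_add cscale_of_real[symmetric] cscale_minus_right
        linear_0[OF bounded_linear.linear[OF bounded_linear_symplectic_adjoint]])
  then have basis: "orthonormal_lie_basis (real CARD('n)) (Sp_compact :: ('n \<times> bool) cmat set) (SOME B. orthonormal_lie_basis (real CARD('n)) Sp_compact B)"
    by (rule orthonormal_lie_basis_exists) (simp_all add: lie_algebra_Sp_compact)
  note Sp = Sp_compact_altdef
  have powi: "symplectic_adjoint (mat_powi A k) = mat_powi A (- k)" if "A \<in> Sp_compact" for A :: "('n \<times> bool) cmat" and k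
    using that by (intro mat_powi_anti) (simp_all add: Sp symplectic_adjoint_simps symplectic_adjoint_1)
  show ?thesis
  proof
    show "mat 1 \<in> (Sp_compact :: ('n \<times> bool) cmat set)" by (simp add: Sp symplectic_adjoint_1)
    show "closed (Sp_compact :: ('n \<times> bool) cmat set)"
      unfolding Sp by (intro closed_Int closed_anti_unit bounded_linear_symplectic_adjoint bounded_linear_conj_transpose)
    fix A :: "('n \<times> bool) cmat" assume A: "A \<in> Sp_compact"
    then show "conj_transpose A ** A = mat 1" by (simp add: Sp)
    show "conj_transpose A \<in> Sp_compact"
      using A anti_unit_conj_transpose[of conj_transpose A] anti_unit_conj_transpose[of symplectic_adjoint A]
      by (auto simp: Sp symplectic_adjoint_simps)
    show "A ** B \<in> Sp_compact" if "B \<in> Sp_compact" for B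
      using A that anti_unit_mult[of conj_transpose A B] anti_unit_mult[of symplectic_adjoint A B]
      by (auto simp: Sp symplectic_adjoint_simps)
    show "(\<Sum>X\<in>(SOME B. orthonormal_lie_basis (real CARD('n)) Sp_compact B). X ** mat_powi A k ** X)
        = cscale (- ntrace (mat_powi A k)) (mat 1) + cscale (of_real (- 1 / (2 * real CARD('n)))) (mat_powi A (- k)) + cscale (of_real 0) (mat_powi A k)" for k
      by (simp add: Sp_sandwich[OF basis] powi[OF A])
    show "(\<Sum>X\<in>(SOME B. orthonormal_lie_basis (real CARD('n)) Sp_compact B). cscale (ntrace (mat_powi A k ** X)) X)
        = cscale (of_real (1 / (2 * real CARD('n))\<^sup>2)) (mat_powi A (- k)) - cscale (of_real (1 / (2 * real CARD('n))\<^sup>2)) (mat_powi A k)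
          + cscale (of_real 0 * ntrace (mat_powi A k)) (mat 1)" for k
      by (simp add: pairing_casimir Sp_casimir[OF basis] powi[OF A] cscale_diff_right cscale_minus_left power2_eq_square)
  qed (fact basis)
qed

text \<open>The factors \<open>- 1 / 2\<close> and \<open>1 / 4\<close> in the symplectic case turn
  \<open>1 / N\<close> and \<open>1 / N\<^sup>2\<close> into the constants
  \<open>- 1 / (2 * N)\<close> and \<open>1 / (2 * N)\<^sup>2\<close> that belong to the matrix size
  \<open>2 * N\<close>.\<close>

lemma D_op_eq_D_gen:
  "D_op 1 N = D_gen (of_real (1 / real N)) (of_real (1 / (real N)\<^sup>2)) (of_real (1 / (real N)\<^sup>2)) (of_real 0)"
  "D_op 2 N = D_gen (of_real 0) (of_real 0) (of_real (1 / (real N)\<^sup>2)) (of_real (1 / (real N)\<^sup>2))"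
  "D_op 4 N = D_gen (of_real (- 1 / (2 * real N))) (of_real (1 / (2 * real N)\<^sup>2)) (of_real (1 / (2 * real N)\<^sup>2)) (of_real 0)"
proof -
  note defs = D_op_def D_gen_def L1_op_def L2_op_def K1_op_def K2_op_def
  show "D_op 1 N = D_gen (of_real (1 / real N)) (of_real (1 / (real N)\<^sup>2)) (of_real (1 / (real N)\<^sup>2)) (of_real 0)"
    by (rule ext) (simp add: defs const_simps algebra_simps)
  show "D_op 2 N = D_gen (of_real 0) (of_real 0) (of_real (1 / (real N)\<^sup>2)) (of_real (1 / (real N)\<^sup>2))"
    by (rule ext) (simp add: defs const_simps algebra_simps)
  have "1 / of_nat N * (- (1 / 2)) = (of_real (- 1 / (2 * real N)) :: complex)"
    "1 / (of_nat N)\<^sup>2 * (1 / 4) = (of_real (1 / (2 * real N)\<^sup>2) :: complex)"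
    by (simp_all add: power2_eq_square mult_ac)
  then have eq: "const (1 / of_nat N) * (const (- (1 / 2)) * Q) = const (of_real (- 1 / (2 * real N))) * Q"
    "const (1 / (of_nat N)\<^sup>2) * (const (1 / 4) * Q) = const (of_real (1 / (2 * real N)\<^sup>2)) * Q" for Q
    by (simp_all only: mult.assoc[symmetric] const_simps(6))
  have L: "L1_op 4 P = const (- (1 / 2)) * (N_op P + 2 * Z1_op P + 2 * Z2_op P)"
    "L2_op 4 P = const (1 / 4) * (2 * K1_op P + K2_op P)" for P
    by (simp_all add: L1_op_def L2_op_def)
  have "x * (2 * (a - b) + (d - e)) = x * (2 * a + d) - x * (2 * b + e)" for x a b d e :: trace_poly
    by (simp add: algebra_simps)
  then show "D_op 4 N = D_gen (of_real (- 1 / (2 * real N))) (of_real (1 / (2 * real N)\<^sup>2)) (of_real (1 / (2 * real N)\<^sup>2)) (of_real 0)"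
    unfolding fun_eq_iff D_op_def D_gen_def L eq K1_op_def K2_op_def of_real_0 const_simps(1) mult_zero_left add_0_right
    by (simp only: add_diff_eq simp_thms)
qed

theorem theorem1p5:
  fixes P :: trace_poly and s :: real and \<tau> :: complex
  assumes "P \<in> trace_polys"
    and "s > 0"
    and "norm (\<tau> - of_real s) < s"
  shows
    "(\<forall>(\<mu> :: 'n::finite cmat measure) \<rho> \<rho>C.
        haar_measure SO_real \<mu> \<and>
        heat_kernel (real CARD('n) / 2) SO_real \<mu> \<rho> \<and>
        heat_kernel_continuation SO_real SO_complex \<rho> \<rho>C \<longrightarrow>
        (\<forall>A\<in>SO_complex.
           boosted_segal_bargmann \<mu> \<rho> \<rho>C s \<tau> (trace_eval P) A
             = trace_eval (exp_op (\<tau> / 2) (D_op 1 CARD('n)) P) A)) \<and>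
     (\<forall>(\<mu> :: 'n cmat measure) \<rho> \<rho>C.
        haar_measure SU \<mu> \<and>
        heat_kernel (real CARD('n)) SU \<mu> \<rho> \<and>
        heat_kernel_continuation SU SL \<rho> \<rho>C \<longrightarrow>
        (\<forall>A\<in>SL.
           boosted_segal_bargmann \<mu> \<rho> \<rho>C s \<tau> (trace_eval P) A
             = trace_eval (exp_op (\<tau> / 2) (D_op 2 CARD('n)) P) A)) \<and>
     (\<forall>(\<mu> :: ('n \<times> bool) cmat measure) \<rho> \<rho>C.
        haar_measure Sp_compact \<mu> \<and>
        heat_kernel (real CARD('n)) Sp_compact \<mu> \<rho> \<and>
        heat_kernel_continuation Sp_compact Sp_complex \<rho> \<rho>C \<longrightarrow>
        (\<forall>A\<in>Sp_complex.
           boosted_segal_bargmann \<mu> \<rho> \<rho>C s \<tau> (trace_eval P) A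
             = trace_eval (exp_op (\<tau> / 2) (D_op 4 CARD('n)) P) A))"
proof (intro conjI allI impI ballI; elim conjE)
  fix \<mu> :: "'n cmat measure" and \<rho> \<rho>C and A :: "'n cmat"
  assume haar: "haar_measure SO_real \<mu>" and heat: "heat_kernel (real CARD('n) / 2) SO_real \<mu> \<rho>"
    and cont: "heat_kernel_continuation SO_real SO_complex \<rho> \<rho>C" and A: "A \<in> SO_complex"
  have SO: "(SO_complex :: 'n cmat set) = {A. transpose A ** A = mat 1 \<and> det A = 1}"
    by (simp add: SO_complex_def)
  interpret laplace_group "SO_real :: 'n cmat set" "real CARD('n) / 2" "1 / real CARD('n)"
    "1 / (real CARD('n))\<^sup>2" "1 / (real CARD('n))\<^sup>2" 0
    by (rule laplace_group_SO)
  interpret segal_group SO_real "real CARD('n) / 2" "1 / real CARD('n)"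
    "1 / (real CARD('n))\<^sup>2" "1 / (real CARD('n))\<^sup>2" 0 \<mu> \<rho> SO_complex \<rho>C
  proof
    fix A B H :: "'n cmat"
    show "A ** B \<in> SO_complex" if "A \<in> SO_complex" "B \<in> SO_complex"
      using that anti_unit_mult[of transpose A B] by (simp add: SO matrix_transpose_mul det_mul)
    show "invertible A" if "A \<in> SO_complex"
      using that by (simp add: SO invertible_det_nz)
    show "conj_transpose A \<in> SO_complex" if "A \<in> SO_complex"
      using that anti_unit_conj_transpose[of transpose A] by (simp add: SO transpose_simps det_conj_transpose)
    show "A \<in> SO_real \<longleftrightarrow> A \<in> SO_complex \<and> conj_transpose A ** A = mat 1"
      by (auto simp: SO SO_real_altdef)
    assume "H \<in> SO_complex" "\<And>J. transpose H ** J ** H = J \<Longrightarrow> transpose B ** J ** B = J" "det H = 1 \<Longrightarrow> det B = 1"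
    \<comment> \<open>The complex orthogonal group is cut out by the form \<open>mat 1\<close> and
      the determinant.\<close>
    from this(1) this(2)[of "mat 1"] this(3) show "B \<in> SO_complex"
      by (simp add: SO)
  qed (fact haar heat cont)+
  show "boosted_segal_bargmann \<mu> \<rho> \<rho>C s \<tau> (trace_eval P) A = trace_eval (exp_op (\<tau> / 2) (D_op 1 CARD('n)) P) A"
    unfolding D_op_eq_D_gen using boosted_segal_bargmann_trace_eval[OF assms A] .
next
  fix \<mu> :: "'n cmat measure" and \<rho> \<rho>C and A :: "'n cmat"
  assume haar: "haar_measure SU \<mu>" and heat: "heat_kernel (real CARD('n)) SU \<mu> \<rho>"
    and cont: "heat_kernel_continuation SU SL \<rho> \<rho>C" and A: "A \<in> SL"
  interpret laplace_group "SU :: 'n cmat set" "real CARD('n)" 0 0 "1 / (real CARD('n))\<^sup>2" "1 / (real CARD('n))\<^sup>2"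
    by (rule laplace_group_SU)
  interpret segal_group SU "real CARD('n)" 0 0 "1 / (real CARD('n))\<^sup>2" "1 / (real CARD('n))\<^sup>2" \<mu> \<rho> SL \<rho>C
  proof
    fix A B H :: "'n cmat"
    show "A ** B \<in> SL" if "A \<in> SL" "B \<in> SL"
      using that by (simp add: SL_def det_mul)
    show "invertible A" if "A \<in> SL"
      using that by (simp add: SL_def invertible_det_nz)
    show "conj_transpose A \<in> SL" if "A \<in> SL"
      using that by (simp add: SL_def det_conj_transpose)
    show "A \<in> SU \<longleftrightarrow> A \<in> SL \<and> conj_transpose A ** A = mat 1"
      by (auto simp: SL_def SU_def)
    show "B \<in> SL" if "H \<in> SL" "det H = 1 \<Longrightarrow> det B = 1"
      using that by (simp add: SL_def)
  qed (fact haar heat cont)+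
  show "boosted_segal_bargmann \<mu> \<rho> \<rho>C s \<tau> (trace_eval P) A = trace_eval (exp_op (\<tau> / 2) (D_op 2 CARD('n)) P) A"
    unfolding D_op_eq_D_gen using boosted_segal_bargmann_trace_eval[OF assms A] .
next
  fix \<mu> :: "('n \<times> bool) cmat measure" and \<rho> \<rho>C and A :: "('n \<times> bool) cmat"
  assume haar: "haar_measure Sp_compact \<mu>" and heat: "heat_kernel (real CARD('n)) Sp_compact \<mu> \<rho>"
    and cont: "heat_kernel_continuation Sp_compact Sp_complex \<rho> \<rho>C" and A: "A \<in> Sp_complex"
  note Sp = Sp_complex_altdef
  interpret laplace_group "Sp_compact :: ('n \<times> bool) cmat set" "real CARD('n)" "- 1 / (2 * real CARD('n))"
    "1 / (2 * real CARD('n))\<^sup>2" "1 / (2 * real CARD('n))\<^sup>2" 0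
    by (rule laplace_group_Sp)
  interpret segal_group Sp_compact "real CARD('n)" "- 1 / (2 * real CARD('n))"
    "1 / (2 * real CARD('n))\<^sup>2" "1 / (2 * real CARD('n))\<^sup>2" 0 \<mu> \<rho> Sp_complex \<rho>C
  proof
    fix A B H :: "('n \<times> bool) cmat"
    show "A ** B \<in> Sp_complex" if "A \<in> Sp_complex" "B \<in> Sp_complex"
      using that anti_unit_mult[of symplectic_adjoint A B] by (simp add: Sp symplectic_adjoint_simps)
    show "invertible A" if "A \<in> Sp_complex"
      using that invertible_left_inverse by (auto simp: Sp)
    show "conj_transpose A \<in> Sp_complex" if "A \<in> Sp_complex"
      using that anti_unit_conj_transpose[of symplectic_adjoint A] by (simp add: Sp symplectic_adjoint_simps)
    show "A \<in> Sp_compact \<longleftrightarrow> A \<in> Sp_complex \<and> conj_transpose A ** A = mat 1"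
      by (auto simp: Sp Sp_compact_altdef)
    assume "H \<in> Sp_complex" "\<And>J. transpose H ** J ** H = J \<Longrightarrow> transpose B ** J ** B = J"
    \<comment> \<open>The complex symplectic group is cut out by the form
      \<open>Omega\<close>.\<close>
    from this(1) this(2)[of Omega] show "B \<in> Sp_complex"
      unfolding Sp_complex_def mem_Collect_eq by iprover
  qed (fact haar heat cont)+
  show "boosted_segal_bargmann \<mu> \<rho> \<rho>C s \<tau> (trace_eval P) A = trace_eval (exp_op (\<tau> / 2) (D_op 4 CARD('n)) P) A"
    unfolding D_op_eq_D_gen using boosted_segal_bargmann_trace_eval[OF assms A] .
qed

end
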